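(* Let $m,n\ge0$ be integers, let $u_0,\dots,u_{2m+5}\in\mathbb C^*$ be (generic) parameters with $q^{2n-2}\prod_{0\le r<2m+6}u_r=(pq)^{m+1}$, and let $v,w\in\mathbb C^*\uplus\mathbb C^*$ be such that $\mathrm{II}_n(u_0,\dots,u_{2m+5})F^+_n(v,w)\neq0$. Then the matrix $M_n(z;v,w)=M_n(z;v,w;u_0,\dots,u_{2m+5})$ is a meromorphic fundamental matrix for a $p$-theta $q$-difference equation $y(qz)=A(z)y(z)$ with multiplier $q^{-2n}$ (so $A(z)=A_n(z;v,w;u_0,\dots,u_{2m+5})=M_n(qz;v,w)M_n(z;v,w)^{-1}$). The isomonodromy class of the equation is independent of $v$ and $w$, and invariant under all permutations of the parameters $u_0,\dots,u_{2m+5}$ and all shifts $$(u_0,\dots,u_{2m+5})\mapsto(q^{k_0}u_0,\dots,q^{k_{2m+5}}u_{2m+5})$$ with $k_r\in\mathbb Z$ such that $\sum_{0\le r<2m+6}k_r=0$; and invariant under simultaneous negation of all parameters. The theta-isomonodromy class is further invariant under all shifts $$(u_0,\dots,u_{2m+5},z,n)\mapsto(q^{k_0}u_0,\dots,q^{k_{2m+5}}u_{2m+5},q^lz,n+\nu)$$ with $l\in\frac12\mathbb Z$, $k_r\in l+\mathbb Z$, $\nu\in\mathbb Z$ such that $2\nu+\sum_{0\le r<2m+6}k_r=0$. In addition, the associated shift matrix $A(z)$ satisfies the symmetry $A(1/(qz))A(z)=1$.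
   Context: $p,q$ are fixed nonzero complex numbers with $|p|,|q|<1$ and $p^{\mathbb Z}\cap q^{\mathbb Z}=\{1\}$; $q^{1/2}$ is a fixed square root; $\mathbb C^*=\mathbb C\setminus\{0\}$. Difference equations. A nonsingular meromorphic matrix is a square matrix with entries meromorphic on $\mathbb C^*$ and determinant not identically $0$. A $p$-theta $q$-difference equation of multiplier $\mu(z)=\alpha z^k$ ($\alpha\in\mathbb C^*$, $k\in\mathbb Z$) is an equation $y(qz)=A(z)y(z)$ with $A$ (the shift matrix) nonsingular meromorphic and $A(pz)=\mu(z)A(z)$; a meromorphic fundamental matrix for it is a nonsingular meromorphic $M$ with $M(qz)=A(z)M(z)$. Exchanging $p,q$ gives $q$-theta $p$-difference equations. The equations $y(pz)=C(z)y(z)$ with $C(z)=M(pz)^tM(z)^{-t}$, as $M$ runs over the meromorphic fundamental matrices of a given $p$-theta $q$-difference equation, are $q$-theta $p$-difference equations and form one class for the equivalence relation "$C\cong C'$ iff $C'(z)D(z)=D(pz)C(z)$ for some nonsingular meromorphic matrix $D$ with $D(qz)=D(z)$"; this class is the weak monodromy of the given equation. Two $p$-theta $q$-difference equations are isomonodromic if they have the same weak monodromy; they are theta-isomonodromic if there is a nonsingular meromorphic matrix $B$ with $B(pz)=az^kB(z)$ for some $a\in\mathbb C^*$, $k\in\mathbb Z$, such that their shift matrices satisfy $A'(z)B(z)=B(qz)A(z)$. Invariance of a class under a transformation means that the equation whose shift matrix is obtained from $A_n(z;v,w;u_0,\dots,u_{2m+5})$ by substituting the new values of the quantities transformed (among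 the $u_r$, $z$, $n$) lies in the same class, whenever both equations are defined (in particular $n+\nu\ge0$). Functions. $(x;p)=\prod_{i\ge0}(1-p^ix)$ (the symbols $(p;p)$ and $(q;q)$ below denote $\prod_{i\ge1}(1-p^i)$ and $\prod_{i\ge1}(1-q^i)$), $\theta_p(z)=\prod_{i\ge0}(1-p^{i+1}/z)(1-p^iz)$, $\Gamma_{p,q}(z)=\prod_{i,j\ge0}\frac{1-p^{i+1}q^{j+1}/z}{1-p^iq^jz}$. Multiple arguments and $\pm$ exponents denote products. $\psi_p(x,z)=x^{-1}\theta_p(xz^{\pm1})$. For $2M+6$ parameters, $\Delta(z;a_0,\dots,a_{2M+5})=\prod_{r}\Gamma_{p,q}(a_rz^{\pm1})/\Gamma_{p,q}(z^{\pm2})$, and, when $q^{2N-2}\prod_ra_r=(pq)^{M+1}$, $$\mathrm{II}_N(a_0,\dots,a_{2M+5})=\frac{(p;p)^N(q;q)^N\Gamma_{p,q}(q)^N}{2^NN!}\int_{C^N}\prod_{1\le i<j\le N}\frac{\Gamma_{p,q}(qz_i^{\pm1}z_j^{\pm1})}{\Gamma_{p,q}(z_i^{\pm1}z_j^{\pm1})}\prod_{1\le i\le N}\Delta(z_i;a_0,\dots,a_{2M+5})\frac{dz_i}{2\pi\sqrt{-1}\,z_i},$$ where $C=C^{-1}$ is a (possibly disconnected) closed contour whose interior contains every point $p^iq^ja_r$, $i,j\ge0$ (points that are not poles of the integrand may be ignored); this is meromorphic in the parameters; $\mathrm{II}_0=1$, $\mathrm{II}_{-1}=0$. For $x,v\in\mathbb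 C^*$ (suppressing $u_0,\dots,u_{2m+5}$ from the notation): $F_n(x;v)=x^{-n}v^n\,\mathrm{II}_n(u_0,\dots,u_{2m+5},qx,pq/x,v,p/v)$, $F^+_n(x,v)=v^{n+1}x^{n+1}\psi_p(v,x)\,\mathrm{II}_{n+1}(u_0,\dots,u_{2m+5},x,p/x,v,p/v)$, $F^-_n(x,v)=\psi_p(v,x)\,x^{1-n}v^{1-n}\,\mathrm{II}_{n-1}(u_0,\dots,u_{2m+5},qx,pq/x,qv,pq/v)$. $\mathbb C^*\uplus\mathbb C^*$ is the disjoint union of two copies of $\mathbb C^*$; $v\in\mathbb C^*$ gives two elements, written $v$ and $\hat v$. The functions are extended by $F^+_n(\hat v,w)=F_n(v;w)$, $F^+_n(v,\hat w)=-F_n(w;v)$, $F^+_n(\hat v,\hat w)=F^-_n(v,w)$, $F_n(x;\hat v)=F^-_n(x,v)$. Finally $$M_n(z;v,w)=\begin{pmatrix}F_n(z;v)&z^{-1}\theta_p(z^2)F^+_n(z,v)/\Delta(z;u_0,\dots,u_{2m+5})\\ F_n(z;w)&z^{-1}\theta_p(z^2)F^+_n(z,w)/\Delta(z;u_0,\dots,u_{2m+5})\end{pmatrix}.$$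
   Formalization: F^-_n carries ψ_p(x,v) instead of ψ_p(v,x) (as written, the claim fails for n≥1 when exactly one of v,w is hatted), and simultaneous negation of the parameters also sends z to −z (with z fixed it fails for generic u). *)

theory Defs
  imports "HOL-Complex_Analysis.Complex_Analysis" "HOL-Combinatorics.Permutations"
begin

section \<open>Difference equations\<close>

text \<open>
  Meromorphic functions on \<open>\<complex>\<^sup>*\<close> are represented by total functions that are
  \<open>meromorphic_on (-{0})\<close>. The values of such a function on a closed discrete subset carry no
  information, so identities between them are stated with the filter \<open>cosparse (-{0})\<close>, i.e.
  outside a subset of \<open>\<complex>\<^sup>*\<close> without limit points in \<open>\<complex>\<^sup>*\<close>.
\<close>

definition nonsingular_meromorphic :: "(complex \<Rightarrow> complex^'n^'n) \<Rightarrow> bool" where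
  "nonsingular_meromorphic A \<longleftrightarrow>
     (\<forall>i j. (\<lambda>z. A z $ i $ j) meromorphic_on (-{0})) \<and>
     \<not> (\<forall>\<^sub>\<approx>z\<in>-{0}. det (A z) = 0)"

text \<open>
  \<open>theta_multiplier p A \<alpha> k\<close>: \<open>A(pz) = \<alpha> z\<^sup>k A(z)\<close>. A nonsingular meromorphic \<open>A\<close> with this
  property is the shift matrix of a \<open>p\<close>-theta \<open>q\<close>-difference equation \<open>y(qz) = A(z)y(z)\<close>; the
  condition on \<open>A\<close> does not involve \<open>q\<close>. Equations are represented by their shift matrices.
\<close>

definition theta_multiplier ::
  "complex \<Rightarrow> (complex \<Rightarrow> complex^'n^'n) \<Rightarrow> complex \<Rightarrow> int \<Rightarrow> bool" where
  "theta_multiplier p A \<alpha> k \<longleftrightarrow>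
     \<alpha> \<noteq> 0 \<and> (\<forall>\<^sub>\<approx>z\<in>-{0}. A (p * z) = (\<chi> i j. \<alpha> * z powi k * A z $ i $ j))"

definition theta_equation :: "complex \<Rightarrow> (complex \<Rightarrow> complex^'n^'n) \<Rightarrow> bool" where
  "theta_equation p A \<longleftrightarrow> nonsingular_meromorphic A \<and> (\<exists>\<alpha> k. theta_multiplier p A \<alpha> k)"

definition fundamental_matrix ::
  "complex \<Rightarrow> (complex \<Rightarrow> complex^'n^'n) \<Rightarrow> (complex \<Rightarrow> complex^'n^'n) \<Rightarrow> bool" where
  "fundamental_matrix q A M \<longleftrightarrow>
     nonsingular_meromorphic M \<and> (\<forall>\<^sub>\<approx>z\<in>-{0}. M (q * z) = A z ** M z)"

definition monodromy_equiv ::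
  "complex \<Rightarrow> complex \<Rightarrow> (complex \<Rightarrow> complex^'n^'n) \<Rightarrow> (complex \<Rightarrow> complex^'n^'n) \<Rightarrow> bool" where
  "monodromy_equiv p q C C' \<longleftrightarrow>
     (\<exists>D. nonsingular_meromorphic D \<and> (\<forall>\<^sub>\<approx>z\<in>-{0}. D (q * z) = D z) \<and>
          (\<forall>\<^sub>\<approx>z\<in>-{0}. C' z ** D z = D (p * z) ** C z))"

definition monodromy_matrix ::
  "complex \<Rightarrow> (complex \<Rightarrow> complex^'n^'n) \<Rightarrow> complex \<Rightarrow> complex^'n^'n" where
  "monodromy_matrix p M z = transpose (M (p * z)) ** matrix_inv (transpose (M z))"

text \<open>The weak monodromy of \<open>y(qz) = A(z)y(z)\<close>, as a class of \<open>q\<close>-theta \<open>p\<close>-difference equations.\<close>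

definition weak_monodromy ::
  "complex \<Rightarrow> complex \<Rightarrow> (complex \<Rightarrow> complex^'n^'n) \<Rightarrow> (complex \<Rightarrow> complex^'n^'n) set" where
  "weak_monodromy p q A =
     {C. theta_equation q C \<and>
         (\<exists>M. fundamental_matrix q A M \<and> monodromy_equiv p q (monodromy_matrix p M) C)}"

definition isomonodromic ::
  "complex \<Rightarrow> complex \<Rightarrow> (complex \<Rightarrow> complex^'n^'n) \<Rightarrow> (complex \<Rightarrow> complex^'n^'n) \<Rightarrow> bool" where
  "isomonodromic p q A A' \<longleftrightarrow>
     theta_equation p A \<and> theta_equation p A' \<and> weak_monodromy p q A = weak_monodromy p q A'"

definition theta_isomonodromic ::
  "complex \<Rightarrow> complex \<Rightarrow> (complex \<Rightarrow> complex^'n^'n) \<Rightarrow> (complex \<Rightarrow> complex^'n^'n) \<Rightarrow> bool" where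
  "theta_isomonodromic p q A A' \<longleftrightarrow>
     theta_equation p A \<and> theta_equation p A' \<and>
     (\<exists>B. nonsingular_meromorphic B \<and> (\<exists>a k. theta_multiplier p B a k) \<and>
          (\<forall>\<^sub>\<approx>z\<in>-{0}. A' z ** B z = B (q * z) ** A z))"


section \<open>Theta and elliptic Gamma functions\<close>

definition poch_inf :: "complex \<Rightarrow> complex \<Rightarrow> complex" where
  "poch_inf p x = (\<Prod>i. 1 - p ^ i * x)"

definition theta :: "complex \<Rightarrow> complex \<Rightarrow> complex" where
  "theta p z = (\<Prod>i. (1 - p ^ (i + 1) / z) * (1 - p ^ i * z))"

definition egamma :: "complex \<Rightarrow> complex \<Rightarrow> complex \<Rightarrow> complex" where
  "egamma p q z =
     (\<Prod>i. \<Prod>j. (1 - p ^ (i + 1) * q ^ (j + 1) / z) / (1 - p ^ i * q ^ j * z))"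

text \<open>\<open>\<Gamma>(c z\<^sup>\<plusminus>\<^sup>1)\<close> and \<open>\<Gamma>(c x\<^sup>\<plusminus>\<^sup>1 y\<^sup>\<plusminus>\<^sup>1)\<close>\<close>

definition egamma2 :: "complex \<Rightarrow> complex \<Rightarrow> complex \<Rightarrow> complex \<Rightarrow> complex" where
  "egamma2 p q c z = egamma p q (c * z) * egamma p q (c / z)"

definition egamma4 :: "complex \<Rightarrow> complex \<Rightarrow> complex \<Rightarrow> complex \<Rightarrow> complex \<Rightarrow> complex" where
  "egamma4 p q c x y = egamma2 p q (c * x) y * egamma2 p q (c / x) y"

definition psi :: "complex \<Rightarrow> complex \<Rightarrow> complex \<Rightarrow> complex" where
  "psi p x z = inverse x * (theta p (x * z) * theta p (x / z))"

definition Delta :: "complex \<Rightarrow> complex \<Rightarrow> complex \<Rightarrow> complex list \<Rightarrow> complex" where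
  "Delta p q z as = (\<Prod>a\<leftarrow>as. egamma2 p q a z) / egamma2 p q 1 (z\<^sup>2)"


section \<open>The integrals\<close>

text \<open>
  A (possibly disconnected) closed contour is a finite list of closed paths in \<open>\<complex>\<^sup>*\<close>; its
  interior is the set of points of winding number 1.
\<close>

definition contour_image :: "(real \<Rightarrow> complex) list \<Rightarrow> complex set" where
  "contour_image Cs = (\<Union>\<gamma>\<in>set Cs. path_image \<gamma>)"

definition contour_winding :: "(real \<Rightarrow> complex) list \<Rightarrow> complex \<Rightarrow> complex" where
  "contour_winding Cs z = (\<Sum>\<gamma>\<leftarrow>Cs. winding_number \<gamma> z)"

definition contour_interior :: "(real \<Rightarrow> complex) list \<Rightarrow> complex set" where
  "contour_interior Cs = {z. z \<notin> contour_image Cs \<and> contour_winding Cs z = 1}"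

definition closed_contour :: "(real \<Rightarrow> complex) list \<Rightarrow> bool" where
  "closed_contour Cs \<longleftrightarrow>
     (\<forall>\<gamma>\<in>set Cs. valid_path \<gamma> \<and> pathfinish \<gamma> = pathstart \<gamma> \<and> 0 \<notin> path_image \<gamma>) \<and>
     (\<forall>z. z \<notin> contour_image Cs \<longrightarrow> contour_winding Cs z \<in> {0, 1})"

text \<open>
  \<open>C = C\<^sup>-\<^sup>1\<close>. Inversion exchanges the two sides of the contour, so taking orientation into account
  the condition says that it maps interior points to exterior points and vice versa. For
  \<open>z\<close> near \<open>0\<close> this forces winding number 1 around \<open>0\<close>.
\<close>

definition inversion_invariant :: "(real \<Rightarrow> complex) list \<Rightarrow> bool" where
  "inversion_invariant Cs \<longleftrightarrow>
     inverse ` contour_image Cs = contour_image Cs \<and>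
     (\<forall>z. z \<noteq> 0 \<longrightarrow> z \<notin> contour_image Cs \<longrightarrow>
          contour_winding Cs (inverse z) = 1 - contour_winding Cs z)"

text \<open>
  The factors \<open>\<Gamma>(q z\<^sub>i\<^sup>\<plusminus>\<^sup>1 z\<^sub>j\<^sup>\<plusminus>\<^sup>1) / \<Gamma>(z\<^sub>i\<^sup>\<plusminus>\<^sup>1 z\<^sub>j\<^sup>\<plusminus>\<^sup>1)\<close> of the integrand are products of theta functions
  and have no poles in \<open>\<complex>\<^sup>*\<close>; the poles of the integrand are those of \<open>\<Delta>\<close>.
\<close>

definition is_contour_for ::
  "complex \<Rightarrow> complex \<Rightarrow> complex list \<Rightarrow> (real \<Rightarrow> complex) list \<Rightarrow> bool" where
  "is_contour_for p q as Cs \<longleftrightarrow>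
     closed_contour Cs \<and> inversion_invariant Cs \<and>
     (\<forall>a\<in>set as. \<forall>i j. is_pole (\<lambda>z. Delta p q z as) (p ^ i * q ^ j * a) \<longrightarrow>
        p ^ i * q ^ j * a \<in> contour_interior Cs)"

definition contour_exists :: "complex \<Rightarrow> complex \<Rightarrow> complex list \<Rightarrow> bool" where
  "contour_exists p q as \<longleftrightarrow> (\<exists>Cs. is_contour_for p q as Cs)"

text \<open>The integral over \<open>C\<^sup>N\<close> as an iterated contour integral.\<close>

primrec iterated_integral ::
  "nat \<Rightarrow> (real \<Rightarrow> complex) list \<Rightarrow> (complex list \<Rightarrow> complex) \<Rightarrow> complex" where
  "iterated_integral 0 Cs f = f []"
| "iterated_integral (Suc N) Cs f =
     (\<Sum>\<gamma>\<leftarrow>Cs. contour_integral \<gamma> (\<lambda>z. iterated_integral N Cs (\<lambda>zs. f (z # zs))))"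

definition II_integrand ::
  "complex \<Rightarrow> complex \<Rightarrow> complex list \<Rightarrow> complex list \<Rightarrow> complex" where
  "II_integrand p q as zs =
     (\<Prod>j<length zs. \<Prod>i<j. egamma4 p q q (zs ! i) (zs ! j) / egamma4 p q 1 (zs ! i) (zs ! j)) *
     (\<Prod>i<length zs. Delta p q (zs ! i) as / (2 * of_real pi * \<i> * (zs ! i)))"

text \<open>
  Meaningful if \<open>N \<le> 0\<close> or \<open>contour_exists p q as\<close>; by Cauchy's theorem the integral does not
  depend on the contour chosen. It is only used under the balancing condition
  \<open>q\<^sup>2\<^sup>N\<^sup>-\<^sup>2 \<Prod>a\<^sub>r = (pq)\<^sup>M\<^sup>+\<^sup>1\<close>, where \<open>2M + 6\<close> is the number of parameters.
\<close>

definition II :: "complex \<Rightarrow> complex \<Rightarrow> int \<Rightarrow> complex list \<Rightarrow> complex" where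
  "II p q N as =
     (if N < 0 then 0 else if N = 0 then 1
      else (poch_inf p p * poch_inf q q * egamma p q q) ^ nat N / (2 ^ nat N * fact (nat N)) *
           iterated_integral (nat N) (SOME Cs. is_contour_for p q as Cs) (II_integrand p q as))"


section \<open>The functions \<open>F\<close> and the matrices \<open>M\<close> and \<open>A\<close>\<close>

text \<open>
  The functions \<open>F\<close> are meromorphic in their parameters, but the contours defining them fail to
  exist on certain hypersurfaces which need not be polar (e.g. \<open>F\<^sup>+\<close> at \<open>v = p w\<close>, where a pole of
  \<open>II\<close> cancels a zero of \<open>\<psi>\<close>). \<open>extend S f a\<close> is the value at \<open>a\<close> of the function \<open>f\<close>, given on
  \<open>S\<close>, extended by continuity; it is \<open>None\<close> if there is no such value.
\<close>

definition extend ::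
  "'a::topological_space set \<Rightarrow> ('a \<Rightarrow> complex) \<Rightarrow> 'a \<Rightarrow> complex option" where
  "extend S f a =
     (if a \<in> S then Some (f a)
      else if a islimpt S \<and> (\<exists>L. (f \<longlongrightarrow> L) (at a within S)) then Some (Lim (at a within S) f)
      else None)"

definition F_fun ::
  "complex \<Rightarrow> complex \<Rightarrow> nat \<Rightarrow> complex list \<Rightarrow> complex \<Rightarrow> complex \<Rightarrow> complex option" where
  "F_fun p q n us x v =
     extend {(x, v). x \<noteq> 0 \<and> v \<noteq> 0 \<and> contour_exists p q (us @ [q * x, p * q / x, v, p / v])}
       (\<lambda>(x, v). x powi (- int n) * v ^ n * II p q (int n) (us @ [q * x, p * q / x, v, p / v]))
       (x, v)"

definition Fplus ::
  "complex \<Rightarrow> complex \<Rightarrow> nat \<Rightarrow> complex list \<Rightarrow> complex \<Rightarrow> complex \<Rightarrow> complex option" where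
  "Fplus p q n us x v =
     extend {(x, v). x \<noteq> 0 \<and> v \<noteq> 0 \<and> contour_exists p q (us @ [x, p / x, v, p / v])}
       (\<lambda>(x, v). v ^ (n + 1) * x ^ (n + 1) * psi p v x *
                 II p q (int n + 1) (us @ [x, p / x, v, p / v]))
       (x, v)"

text \<open>
  Sign convention: \<open>F\<^sup>-\<^sub>n(x,v)\<close> carries the factor \<open>\<psi>\<^sub>p(x,v) = -\<psi>\<^sub>p(v,x)\<close>, whereas \<open>F\<^sup>+\<^sub>n(x,v)\<close> carries
  \<open>\<psi>\<^sub>p(v,x)\<close>. The signs have to be opposite for
  \<open>F\<^sub>n(z;v) F\<^sup>+\<^sub>n(z,w) - F\<^sub>n(z;w) F\<^sup>+\<^sub>n(z,v) = II\<^sub>n(u) F\<^sup>+\<^sub>n(v,w)\<close> to hold when exactly one of \<open>v\<close>, \<open>w\<close>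
  is hatted; with \<open>\<psi>\<^sub>p(v,x)\<close> in both, \<open>A\<close> is not theta-periodic in that case (if \<open>n > 0\<close>). If both or
  none are hatted, the sign only affects \<open>M\<close> by a constant diagonal factor on the right, not \<open>A\<close>.
\<close>

definition Fminus ::
  "complex \<Rightarrow> complex \<Rightarrow> nat \<Rightarrow> complex list \<Rightarrow> complex \<Rightarrow> complex \<Rightarrow> complex option" where
  "Fminus p q n us x v =
     extend {(x, v). x \<noteq> 0 \<and> v \<noteq> 0 \<and> contour_exists p q (us @ [q * x, p * q / x, q * v, p * q / v])}
       (\<lambda>(x, v). psi p x v * x powi (1 - int n) * v powi (1 - int n) *
                 II p q (int n - 1) (us @ [q * x, p * q / x, q * v, p * q / v]))
       (x, v)"

text \<open>In \<open>\<complex>\<^sup>* \<uplus> \<complex>\<^sup>*\<close>, \<open>Inl v\<close> is the element \<open>v\<close> and \<open>Inr v\<close> is \<open>v\<close> with a hat.\<close>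

type_synonym point2 = "complex + complex"

definition cstar2 :: "point2 set" where
  "cstar2 = (-{0}) <+> (-{0})"

fun F_ext ::
  "complex \<Rightarrow> complex \<Rightarrow> nat \<Rightarrow> complex list \<Rightarrow> complex \<Rightarrow> point2 \<Rightarrow> complex option" where
  "F_ext p q n us x (Inl v) = F_fun p q n us x v"
| "F_ext p q n us x (Inr v) = Fminus p q n us x v"

fun Fplus_ext ::
  "complex \<Rightarrow> complex \<Rightarrow> nat \<Rightarrow> complex list \<Rightarrow> point2 \<Rightarrow> point2 \<Rightarrow> complex option" where
  "Fplus_ext p q n us (Inl v) (Inl w) = Fplus p q n us v w"
| "Fplus_ext p q n us (Inr v) (Inl w) = F_fun p q n us v w"
| "Fplus_ext p q n us (Inl v) (Inr w) = map_option uminus (F_fun p q n us w v)"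
| "Fplus_ext p q n us (Inr v) (Inr w) = Fminus p q n us v w"

definition params :: "nat \<Rightarrow> (nat \<Rightarrow> complex) \<Rightarrow> complex list" where
  "params m u = map u [0..<2 * m + 6]"

definition M_mat ::
  "complex \<Rightarrow> complex \<Rightarrow> nat \<Rightarrow> nat \<Rightarrow> point2 \<Rightarrow> point2 \<Rightarrow> (nat \<Rightarrow> complex) \<Rightarrow>
   complex \<Rightarrow> complex^2^2" where
  "M_mat p q m n v w u z =
     (let us = params m u;
          c = inverse z * theta p (z\<^sup>2);
          row = (\<lambda>s. vector [the (F_ext p q n us z s),
                             c * the (Fplus_ext p q n us (Inl z) s) / Delta p q z us])
      in vector [row v, row w])"

definition A_mat ::
  "complex \<Rightarrow> complex \<Rightarrow> nat \<Rightarrow> nat \<Rightarrow> point2 \<Rightarrow> point2 \<Rightarrow> (nat \<Rightarrow> complex) \<Rightarrow>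
   complex \<Rightarrow> complex^2^2" where
  "A_mat p q m n v w u z = M_mat p q m n v w u (q * z) ** matrix_inv (M_mat p q m n v w u z)"

text \<open>
  The standing conditions under which the equation with shift matrix \<open>A_mat p q m n v w u\<close> is
  defined. Genericity of \<open>u\<^sub>0, \<dots>, u\<^sub>2\<^sub>m\<^sub>+\<^sub>5\<close> means that the contour defining \<open>II\<^sub>n(u)\<close> exists, for
  which it suffices that no product \<open>u\<^sub>r u\<^sub>s\<close> is of the form \<open>p\<^sup>-\<^sup>i q\<^sup>-\<^sup>j\<close> with \<open>i, j \<ge> 0\<close>.
  The last conjunct says that the entries of \<open>M_mat\<close> are defined, i.e. that the hypersurfaces
  \<open>v = const\<close>, \<open>w = const\<close> are not polar for them.
\<close>

definition equation_defined ::
  "complex \<Rightarrow> complex \<Rightarrow> nat \<Rightarrow> nat \<Rightarrow> point2 \<Rightarrow> point2 \<Rightarrow> (nat \<Rightarrow> complex) \<Rightarrow> bool" where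
  "equation_defined p q m n v w u \<longleftrightarrow>
     (\<forall>r<2 * m + 6. u r \<noteq> 0) \<and>
     q powi (2 * int n - 2) * (\<Prod>r<2 * m + 6. u r) = (p * q) ^ (m + 1) \<and>
     contour_exists p q (params m u) \<and>
     v \<in> cstar2 \<and> w \<in> cstar2 \<and>
     (\<exists>y. Fplus_ext p q n (params m u) v w = Some y \<and> II p q (int n) (params m u) * y \<noteq> 0) \<and>
     (\<forall>s\<in>{v, w}. \<forall>\<^sub>\<approx>z\<in>-{0}. F_ext p q n (params m u) z s \<noteq> None \<and>
        Fplus_ext p q n (params m u) (Inl z) s \<noteq> None)"

text \<open>
  Negation of all parameters is understood to include \<open>z\<close>: it takes \<open>A_mat p q m n v w u z\<close> to
  \<open>A_mat p q m n v w (- u) (- z)\<close>. It relates the half-integral shifts for the two choices of the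
  square root of \<open>q\<close>. (Negating the \<open>u\<^sub>r\<close> alone changes the divisor of
  \<open>det (monodromy_matrix p M)\<close> modulo \<open>p\<^sup>\<int> q\<^sup>\<int>\<close>, hence the weak monodromy.)
\<close>

text \<open>\<open>q\<^sup>l\<close> for \<open>l \<in> \<onehalf>\<int>\<close>, where \<open>h\<close> is the chosen square root of \<open>q\<close>.\<close>

definition half_powi :: "complex \<Rightarrow> real \<Rightarrow> complex" where
  "half_powi h l = h powi \<lfloor>2 * l\<rfloor>"

end

theory Submission
  imports Defs "Jordan_Normal_Form.Determinant"
begin

text \<open>By the Andreief identity, an integral \<open>II\<^sub>N\<close> with a pair of additional parameters is a Hankel
  determinant of moments of the weight \<open>\<Delta>\<close> against products of theta functions. The inverse of a
  Hankel matrix has displacement rank 2; therefore \<open>F\<^sub>n(x; v)\<close>, \<open>F\<^sub>n\<^sup>+(x, v)\<close> and \<open>F\<^sub>n\<^sup>-(x, v)\<close> equal \<open>II\<^sub>n\<close>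
  times the determinants of the pairs \<open>P(x), R(v)\<close>, of \<open>R(x), R(v)\<close> and of \<open>P(x), P(v)\<close>, where the
  vector \<open>P\<close> consists of theta functions and \<open>R\<close> of Cauchy transforms. So \<open>M\<^sub>n(z; v, w)\<close> is a constant
  matrix, which alone depends on \<open>v\<close> and \<open>w\<close>, times the matrix \<open>Q(z)\<close> with columns \<open>P(z)\<close> and
  \<open>c(z) R(z)\<close>, where \<open>c(z) = z\<^sup>-\<^sup>1 \<theta>\<^sub>p(z\<^sup>2) / \<Delta>(z)\<close>. Moving \<open>z\<close> to \<open>1 / z\<close> crosses two poles of the Cauchy
  kernel and adds a multiple of \<open>P / c\<close> to \<open>R\<close>. It follows that \<open>Q(p z) = Q(z) U(z)\<close> with a triangular
  \<open>U\<close> that depends only on \<open>n\<close> and on the theta quotient \<open>c(p z) / c(z)\<close>, and \<open>U\<close> is unchanged, or changed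
  by a scalar factor, under the transformations in question. Where no contour exists, the
  functions \<open>F\<close> are reached as limits from generic arguments.\<close>

section \<open>Theta functions\<close>

text \<open>Determinants appear because the coupling constant of the integrand is q itself:
  \<Gamma>(q x) = \<theta>_p(x) \<Gamma>(x) makes the interaction of two variables the square of
  \<open>psi\<close>, and \<open>psi p x y\<close> is a determinant B(x) A(y) - A(x) B(y). In the
  coordinate t = B / A the additional parameter pairs multiply or divide the weight by linear
  factors, so that classical Hankel algebra applies. The obstacle is the contour. It moves with the
  parameters, may cease to exist, and is tied to actual poles only. It is replaced by cycles that
  are specified by winding numbers alone; the residues at the finitely many points that change sides
  give meromorphy in the parameters and the limits at special arguments. The matrix U(z) is not
  affected by the constant left factor of M, and its transpose is the monodromy matrix of M. So
  equality of two such U implies isomonodromy, and a monomial as their ratio implies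
  theta-isomonodromy. All shifts follow from one identity for c(p z) / c(z), whose exponents are
  settled by the balancing condition.\<close>

abbreviation (input) ae_punctured :: "(complex \<Rightarrow> bool) \<Rightarrow> bool" (binder "\<forall>\<^sup>*" 10) where
  "ae_punctured P \<equiv> eventually P (cosparse (-{0}))"

lemma some_contour: "contour_exists p q as \<Longrightarrow> is_contour_for p q as (SOME Cs. is_contour_for p q as Cs)"
  unfolding contour_exists_def by (rule someI_ex)

text \<open>Weierstrass argument: a summable bound of \<open>f i z - 1\<close> on every disc makes
  the partial products converge uniformly there. It serves twice: for \<open>poch_inf\<close>, and
  for \<open>dpoch\<close>, whose factors are themselves infinite products.\<close>

lemma entire_prodinf:
  fixes f :: "nat \<Rightarrow> complex \<Rightarrow> complex"
  assumes hol: "\<And>i. f i holomorphic_on UNIV"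
    and bd: "\<And>R. R > 0 \<Longrightarrow> \<exists>M. summable M \<and> (\<forall>i z. norm z \<le> R \<longrightarrow> norm (f i z - 1) \<le> M i)"
  shows "convergent_prod (\<lambda>i. f i z)" "(\<lambda>z. \<Prod>i. f i z) holomorphic_on UNIV"
proof -
  have norm_plus_1: "norm z + 1 > 0" for z :: complex using norm_ge_zero[of z] by linarith
  have conv: "convergent_prod (\<lambda>i. f i z)" for z
  proof -
    obtain M where M: "summable M" "\<And>i w. norm w \<le> norm z + 1 \<Longrightarrow> norm (f i w - 1) \<le> M i"
      using bd[OF norm_plus_1] by blast
    have "summable (\<lambda>i. norm (f i z - 1))"
      by (rule summable_comparison_test[OF _ M(1)]) (use M(2)[of z] in auto)
    then show ?thesis
      by (intro abs_convergent_prod_imp_convergent_prod) (simp add: abs_convergent_prod_conv_summable)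
  qed
  then show "convergent_prod (\<lambda>i. f i z)" .
  have ul: "uniform_limit (cball 0 R) (\<lambda>N z. \<Prod>i<N. f i z) (\<lambda>z. \<Prod>i. f i z) sequentially"
    if R: "R > 0" for R :: real
  proof -
    obtain M where M: "summable M" "\<And>i z. norm z \<le> R \<Longrightarrow> norm (f i z - 1) \<le> M i"
      using bd[OF R] by blast
    have "uniformly_convergent_on (cball 0 R) (\<lambda>N z. \<Prod>i<N. f i z)"
    proof (rule uniformly_convergent_on_prod')
      show "continuous_on (cball 0 R) (f n)" for n
        using hol[of n] holomorphic_on_imp_continuous_on continuous_on_subset by blast
      show "uniformly_convergent_on (cball 0 R) (\<lambda>N x. \<Sum>n<N. norm (f n x - 1))"
        by (rule Weierstrass_m_test'[OF _ M(1)]) (use M(2) in auto)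
    qed auto
    then obtain g where g: "uniform_limit (cball 0 R) (\<lambda>N z. \<Prod>i<N. f i z) g sequentially"
      by (auto simp: uniformly_convergent_on_def)
    have "g z = (\<Prod>i. f i z)" if "z \<in> cball 0 R" for z
    proof -
      have "(\<lambda>N. \<Prod>i<N. f i z) \<longlonglongrightarrow> g z" using tendsto_uniform_limitI[OF g that] .
      moreover have "(\<lambda>N. \<Prod>i<N. f i z) \<longlonglongrightarrow> (\<Prod>i. f i z)"
        using convergent_prod_LIMSEQ[OF conv[of z]] LIMSEQ_lessThan_iff_atMost by blast
      ultimately show ?thesis using LIMSEQ_unique by blast
    qed
    then show ?thesis using g by (metis (mono_tags, lifting) uniform_limit_cong')
  qed
  show "(\<lambda>z. \<Prod>i. f i z) holomorphic_on UNIV"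
  proof (rule holomorphic_uniform_sequence[where f = "\<lambda>N z. \<Prod>i<N. f i z"])
    show "(\<lambda>z. \<Prod>i<n. f i z) holomorphic_on UNIV" for n
      by (intro holomorphic_intros hol)
    fix x :: complex
    have "cball x 1 \<subseteq> cball 0 (norm x + 1)"
      by (auto simp: dist_norm) (metis norm_minus_commute norm_triangle_sub add.commute add_left_mono order_trans)
    then show "\<exists>d>0. cball x d \<subseteq> UNIV \<and>
        uniform_limit (cball x d) (\<lambda>N z. \<Prod>i<N. f i z) (\<lambda>z. \<Prod>i. f i z) sequentially"
      using uniform_limit_on_subset[OF ul[OF norm_plus_1]]
      by (intro exI[of _ 1]) auto
  qed auto
qed

lemma poch_inf_entire:
  assumes "norm p < 1"
  shows "convergent_prod (\<lambda>i. 1 - p ^ i * x)" "poch_inf p holomorphic_on UNIV"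
proof -
  have bd: "\<exists>M. summable M \<and> (\<forall>i z. norm z \<le> R \<longrightarrow> norm ((1 - p ^ i * z) - 1) \<le> M i)"
    if "R > 0" for R :: real
  proof (intro exI[of _ "\<lambda>i. norm p ^ i * R"] conjI allI impI)
    show "summable (\<lambda>i. norm p ^ i * R)"
      using assms by (intro summable_mult2 summable_geometric) auto
  qed (auto simp: norm_mult norm_power intro!: mult_left_mono)
  show "convergent_prod (\<lambda>i. 1 - p ^ i * x)"
    by (rule entire_prodinf(1)[where f = "\<lambda>i x. 1 - p ^ i * x", OF _ bd]) (auto intro!: holomorphic_intros)
  have "(\<lambda>z. \<Prod>i. 1 - p ^ i * z) holomorphic_on UNIV"
    by (rule entire_prodinf(2)[where f = "\<lambda>i x. 1 - p ^ i * x", OF _ bd]) (auto intro!: holomorphic_intros)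
  then show "poch_inf p holomorphic_on UNIV"
    by (simp add: poch_inf_def[abs_def])
qed

lemma prodinf_Suc:
  fixes f :: "nat \<Rightarrow> complex"
  assumes "convergent_prod f"
  shows "prodinf f = f 0 * (\<Prod>i. f (Suc i))"
proof -
  have "convergent_prod (\<lambda>i. f (Suc i))" using assms by simp
  then have "(\<lambda>n. f 0 * (\<Prod>i\<le>n. f (Suc i))) \<longlonglongrightarrow> f 0 * (\<Prod>i. f (Suc i))"
    by (intro tendsto_intros convergent_prod_LIMSEQ)
  moreover have "f 0 * (\<Prod>i\<le>n. f (Suc i)) = (\<Prod>i\<le>Suc n. f i)" for n
    by (rule prod.atMost_Suc_shift[symmetric])
  ultimately have "(\<lambda>n. \<Prod>i\<le>Suc n. f i) \<longlonglongrightarrow> f 0 * (\<Prod>i. f (Suc i))" by simp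
  moreover have "(\<lambda>n. \<Prod>i\<le>Suc n. f i) \<longlonglongrightarrow> prodinf f"
    using LIMSEQ_Suc[OF convergent_prod_LIMSEQ[OF assms]] by simp
  ultimately show ?thesis using LIMSEQ_unique by blast
qed

lemma prodinf_eq_0_iff:
  fixes f :: "nat \<Rightarrow> complex"
  assumes "convergent_prod f"
  shows "prodinf f = 0 \<longleftrightarrow> (\<exists>i. f i = 0)"
  using has_prod_eq_0_iff[OF convergent_prod_has_prod[OF assms]] by auto

lemma poch_inf_rec: "norm p < 1 \<Longrightarrow> poch_inf p x = (1 - x) * poch_inf p (p * x)"
  using prodinf_Suc[OF poch_inf_entire(1)[of p x]] by (simp add: poch_inf_def mult_ac)

lemma poch_inf_eq_0_iff: "norm p < 1 \<Longrightarrow> poch_inf p x = 0 \<longleftrightarrow> (\<exists>i. p ^ i * x = 1)"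
  using prodinf_eq_0_iff[OF poch_inf_entire(1)[of p x]] unfolding poch_inf_def by (metis right_minus_eq)

lemma poch_inf_0 [simp]: "poch_inf p 0 = 1"
  by (simp add: poch_inf_def)

lemma holomorphic_poch_inf [holomorphic_intros]:
  "norm p < 1 \<Longrightarrow> f holomorphic_on A \<Longrightarrow> (\<lambda>z. poch_inf p (f z)) holomorphic_on A"
  using holomorphic_on_compose_gen[OF _ poch_inf_entire(2), of f A p] by (simp add: o_def)

lemma poch_inf_nonzero: "norm p < 1 \<Longrightarrow> norm x < 1 \<Longrightarrow> poch_inf p x \<noteq> 0"
proof
  assume p: "norm p < 1" and x: "norm x < 1" and "poch_inf p x = 0"
  then obtain i where "p ^ i * x = 1" using poch_inf_eq_0_iff by blast
  then have "norm p ^ i * norm x = 1" by (metis norm_mult norm_one norm_power)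
  moreover have "norm p ^ i * norm x \<le> 1 * norm x"
    using p by (intro mult_right_mono power_le_one) auto
  ultimately show False using x by simp
qed

lemma theta_eq:
  assumes "norm p < 1"
  shows "theta p z = poch_inf p (p / z) * poch_inf p z"
proof -
  have *: "convergent_prod (\<lambda>i. 1 - p ^ i * (p / z))" "convergent_prod (\<lambda>i. 1 - p ^ i * z)"
    using poch_inf_entire(1)[OF assms] by blast+
  show ?thesis
    using prodinf_mult[OF *] by (simp add: theta_def poch_inf_def mult_ac)
qed

lemma theta_pmult:
  assumes "norm p < 1" "p \<noteq> 0" "z \<noteq> 0"
  shows "theta p (p * z) = - theta p z / z"
proof -
  have 1: "poch_inf p (p / (p * z)) = (1 - 1 / z) * poch_inf p (p / z)"
    using poch_inf_rec[OF assms(1), of "1 / z"] assms by simp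
  have 2: "poch_inf p z = (1 - z) * poch_inf p (p * z)" by (rule poch_inf_rec) fact
  show ?thesis
    unfolding theta_eq[OF assms(1)] 1 2 using assms by (simp add: field_simps)
qed

lemma theta_inverse:
  assumes "norm p < 1" "z \<noteq> 0"
  shows "theta p (1 / z) = - theta p z / z"
proof -
  have 1: "poch_inf p (1 / z) = (1 - 1 / z) * poch_inf p (p / z)"
    using poch_inf_rec[OF assms(1), of "1 / z"] by simp
  have 2: "poch_inf p z = (1 - z) * poch_inf p (p * z)" by (rule poch_inf_rec) fact
  have 3: "p / (1 / z) = p * z" by simp
  show ?thesis
    unfolding theta_eq[OF assms(1)] 1 2 3 using assms by (simp add: field_simps)
qed

lemma holomorphic_theta:
  "norm p < 1 \<Longrightarrow> f holomorphic_on A \<Longrightarrow> (\<And>z. z \<in> A \<Longrightarrow> f z \<noteq> 0) \<Longrightarrow>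
    (\<lambda>z. theta p (f z)) holomorphic_on A"
  by (auto simp: theta_eq intro!: holomorphic_intros)

lemma theta_eq_0_iff:
  assumes "norm p < 1" "p \<noteq> 0" "z \<noteq> 0"
  shows "theta p z = 0 \<longleftrightarrow> (\<exists>i::int. z = p powi i)"
proof
  assume "theta p z = 0"
  \<comment> \<open>The two kinds of factors account for the positive and for the nonpositive
    exponents.\<close>
  then consider i where "p ^ i * (p / z) = 1" | i where "p ^ i * z = 1"
    using assms by (auto simp: theta_eq poch_inf_eq_0_iff)
  then show "\<exists>i::int. z = p powi i"
  proof cases
    case 1
    then have "z = p powi (int i + 1)"
      using assms by (simp add: power_int_add field_simps)
    then show ?thesis by blast
  next
    case 2
    then have "z = p powi (- int i)"
      using assms by (simp add: power_int_minus field_simps)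
    then show ?thesis by blast
  qed
next
  assume "\<exists>i::int. z = p powi i"
  then obtain i :: int where i: "z = p powi i" by blast
  show "theta p z = 0"
  proof (cases "i > 0")
    case True
    then obtain k where k: "i = int (Suc k)" by (metis zero_less_imp_eq_int Suc_diff_1)
    then have "p ^ k * (p / z) = 1"
      using assms i by (simp add: power_int_add)
    then show ?thesis using assms by (auto simp: theta_eq poch_inf_eq_0_iff)
  next
    case False
    then have "p ^ nat (- i) * z = 1"
      using assms i by (simp add: power_int_def power_mult_distrib[symmetric])
    then show ?thesis using assms by (auto simp: theta_eq poch_inf_eq_0_iff)
  qed
qed

text \<open>Only the shape of the factor matters here, a monomial without zeros on the punctured
  plane: it carries the simple zero at 1 to all powers of \<open>p\<close>. Where the exact factor
  is needed, \<open>theta_powi\<close> supplies it.\<close>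

lemma theta_pow:
  assumes "norm p < 1" "p \<noteq> 0"
  obtains c k where "c \<noteq> 0" "\<And>z. z \<noteq> 0 \<Longrightarrow> theta p (p powi i * z) = c * z powi k * theta p z"
proof -
  have "\<exists>c k. c \<noteq> 0 \<and> (\<forall>z. z \<noteq> 0 \<longrightarrow> theta p (p ^ i * z) = c * z powi k * theta p z)" for i :: nat
  proof (induction i)
    case 0
    show ?case by (rule exI[of _ 1], rule exI[of _ 0]) auto
  next
    case (Suc i)
    then obtain c k where ck: "c \<noteq> 0" "\<And>z. z \<noteq> 0 \<Longrightarrow> theta p (p ^ i * z) = c * z powi k * theta p z" by blast
    show ?case
    proof (intro exI[of _ "- c / p ^ i"] exI[of _ "k - 1"] conjI allI impI)
      show "theta p (p ^ Suc i * z) = - c / p ^ i * z powi (k - 1) * theta p z" if "z \<noteq> 0" for z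
        using that assms ck theta_pmult[OF assms(1,2), of "p ^ i * z"]
        by (simp add: power_int_diff mult_ac)
    qed (use ck assms in auto)
  qed
  note pos = this
  have "\<exists>c k. c \<noteq> 0 \<and> (\<forall>z. z \<noteq> 0 \<longrightarrow> theta p (p powi i * z) = c * z powi k * theta p z)"
  proof (cases "i \<ge> 0")
    case True
    then show ?thesis using pos[of "nat i"] by (simp add: power_int_def)
  next
    case False
    obtain c k where ck: "c \<noteq> 0" "\<And>z. z \<noteq> 0 \<Longrightarrow> theta p (p ^ nat (-i) * z) = c * z powi k * theta p z"
      using pos by blast
    show ?thesis
    proof (intro exI[of _ "(p ^ nat (-i)) powi k / c"] exI[of _ "-k"] conjI allI impI)
      fix z :: complex assume "z \<noteq> 0"
      then show "theta p (p powi i * z) = (p ^ nat (-i)) powi k / c * z powi - k * theta p z"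
        using ck(1) ck(2)[of "p powi i * z"] assms False
        by (simp add: power_int_def[of p] power_int_mult_distrib power_int_minus power_int_divide_distrib field_simps)
    qed (use ck assms in auto)
  qed
  then show ?thesis using that by blast
qed

text \<open>The double product (z; p, q). Off its zeros \<open>egamma p q z\<close> is
  \<open>dpoch p q (p * q / z) / dpoch p q z\<close>, a quotient of functions that are holomorphic
  on the punctured plane.\<close>

definition dpoch :: "complex \<Rightarrow> complex \<Rightarrow> complex \<Rightarrow> complex" where
  "dpoch p q z = (\<Prod>i. poch_inf q (p ^ i * z))"

text \<open>A bound linear in \<open>norm y\<close> is what gives a summable majorant for the outer
  product, where y is p^i z. It comes from the bounded derivative on a disc.\<close>

lemma poch_inf_minus_1_bound:
  assumes "norm q < 1" "R > 0"
  shows "\<exists>K\<ge>0. \<forall>y. norm y \<le> R \<longrightarrow> norm (poch_inf q y - 1) \<le> K * norm y"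
proof -
  have hol: "poch_inf q holomorphic_on UNIV" by (rule poch_inf_entire) fact
  have "continuous_on (cball 0 R) (deriv (poch_inf q))"
    using holomorphic_deriv[OF hol] holomorphic_on_imp_continuous_on continuous_on_subset by blast
  then have "bounded (deriv (poch_inf q) ` cball 0 R)"
    by (intro compact_imp_bounded compact_continuous_image) auto
  then obtain K where K: "K > 0" "\<And>y. y \<in> cball 0 R \<Longrightarrow> norm (deriv (poch_inf q) y) \<le> K"
    by (auto simp: bounded_pos)
  have "norm (poch_inf q y - poch_inf q 0) \<le> K * norm (y - 0)" if "norm y \<le> R" for y
  proof (rule field_differentiable_bound[of "cball 0 R" _ "deriv (poch_inf q)"])
    fix z
    show "(poch_inf q has_field_derivative deriv (poch_inf q) z) (at z within cball 0 R)"
      using hol holomorphic_derivI[of "poch_inf q" UNIV z] has_field_derivative_at_within by blast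
  qed (use K that assms in auto)
  then show ?thesis using K(1) by (intro exI[of _ K]) auto
qed

lemma dpoch_entire:
  assumes "norm p < 1" "norm q < 1"
  shows "convergent_prod (\<lambda>i. poch_inf q (p ^ i * z))" "dpoch p q holomorphic_on UNIV"
proof -
  have bd: "\<exists>M. summable M \<and> (\<forall>i z. norm z \<le> R \<longrightarrow> norm (poch_inf q (p ^ i * z) - 1) \<le> M i)"
    if R: "R > 0" for R
  proof -
    obtain K where K: "K \<ge> 0" "\<And>y. norm y \<le> R \<Longrightarrow> norm (poch_inf q y - 1) \<le> K * norm y"
      using poch_inf_minus_1_bound[OF assms(2) R] by blast
    show ?thesis
    proof (intro exI[of _ "\<lambda>i. K * (norm p ^ i * R)"] conjI allI impI)
      show "summable (\<lambda>i. K * (norm p ^ i * R))"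
        using assms by (intro summable_mult summable_mult2 summable_geometric) auto
      fix i and z :: complex assume z: "norm z \<le> R"
      have 1: "norm (p ^ i * z) \<le> norm p ^ i * R"
        using z by (auto simp: norm_mult norm_power intro!: mult_left_mono)
      moreover have "norm p ^ i * R \<le> R"
        using assms R by (simp add: power_le_one mult_le_cancel_right1)
      ultimately show "norm (poch_inf q (p ^ i * z) - 1) \<le> K * (norm p ^ i * R)"
        using K(2)[of "p ^ i * z"] K(1) mult_left_mono[OF 1 K(1)] by linarith
    qed
  qed
  have hol: "(\<lambda>z. poch_inf q (p ^ i * z)) holomorphic_on UNIV" for i
    using assms by (intro holomorphic_intros)
  show "convergent_prod (\<lambda>i. poch_inf q (p ^ i * z))"
    by (rule entire_prodinf(1)[where f = "\<lambda>i z. poch_inf q (p ^ i * z)", OF hol bd])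
  show "dpoch p q holomorphic_on UNIV"
    unfolding dpoch_def[abs_def]
    by (rule entire_prodinf(2)[where f = "\<lambda>i z. poch_inf q (p ^ i * z)", OF hol bd])
qed

context
  fixes p q :: complex
  assumes pq: "norm p < 1" "norm q < 1"
begin

lemma holomorphic_dpoch [holomorphic_intros]:
  "f holomorphic_on A \<Longrightarrow> (\<lambda>z. dpoch p q (f z)) holomorphic_on A"
  using holomorphic_on_compose_gen[OF _ dpoch_entire(2)[OF pq], of f A] by (simp add: o_def)

lemma dpoch_p: "dpoch p q z = poch_inf q z * dpoch p q (p * z)"
  using prodinf_Suc[OF dpoch_entire(1)[OF pq, of z]] by (simp add: dpoch_def mult_ac)

text \<open>\<open>dpoch\<close> has the product over \<open>q\<close> inside the one over
  \<open>p\<close>. A shift by \<open>p\<close> removes one outer factor, whereas a shift by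
  \<open>q\<close> removes one factor from each inner product; these assemble to
  \<open>poch_inf p z\<close>.\<close>

lemma dpoch_q: "dpoch p q z = poch_inf p z * dpoch p q (q * z)"
proof -
  have "dpoch p q z = (\<Prod>i. (1 - p ^ i * z) * poch_inf q (p ^ i * (q * z)))"
    unfolding dpoch_def using poch_inf_rec[OF pq(2), of "p ^ _ * z"]
    by (intro prodinf_cong) (simp add: mult_ac)
  also have "\<dots> = poch_inf p z * dpoch p q (q * z)"
    unfolding dpoch_def poch_inf_def[of p]
    using prodinf_mult[OF poch_inf_entire(1)[OF pq(1), of z] dpoch_entire(1)[OF pq, of "q * z"]] by simp
  finally show ?thesis .
qed

lemma dpoch_eq_0_iff: "dpoch p q z = 0 \<longleftrightarrow> (\<exists>i j. p ^ i * q ^ j * z = 1)"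
  using prodinf_eq_0_iff[OF dpoch_entire(1)[OF pq, of z]] poch_inf_eq_0_iff[OF pq(2)]
  by (auto simp: dpoch_def mult_ac)

lemma egamma_eq:
  assumes "dpoch p q z \<noteq> 0"
  shows "egamma p q z = dpoch p q (p * q / z) / dpoch p q z"
proof -
  have "(\<Prod>j. (1 - p ^ (i + 1) * q ^ (j + 1) / z) / (1 - p ^ i * q ^ j * z)) =
      poch_inf q (p ^ i * (p * q / z)) / poch_inf q (p ^ i * z)" for i
    using prodinf_divide[OF poch_inf_entire(1)[OF pq(2), of "p ^ i * (p * q / z)"]
         poch_inf_entire(1)[OF pq(2), of "p ^ i * z"]] assms
      dpoch_eq_0_iff[of z]
    by (simp add: poch_inf_def mult_ac)
  then show ?thesis
    using prodinf_divide[OF dpoch_entire(1)[OF pq, of "p * q / z"] dpoch_entire(1)[OF pq, of z]] assms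
      prodinf_eq_0_iff[OF dpoch_entire(1)[OF pq, of z]]
    by (simp add: egamma_def dpoch_def)
qed

end

text \<open>Provides points where \<open>theta p\<close> does not vanish: its zeros are the powers
  of \<open>p\<close>, and none of them lies strictly between the circles of radius
  \<open>norm p\<close> and 1.\<close>

lemma power_int_eq_1_imp:
  assumes "norm (p::complex) < 1" "p \<noteq> 0" "norm p < norm z" "norm z < 1"
  shows "z \<noteq> p powi i"
proof
  assume z: "z = p powi i"
  show False
  proof (cases "i \<le> 0")
    case True
    have "norm z = (norm (1 / p)) ^ nat (- i)"
      using z True assms by (simp add: power_int_def norm_power norm_divide norm_inverse field_simps)
    moreover have "norm (1 / p) \<ge> 1" using assms by (simp add: norm_divide field_simps)
    ultimately have "norm z \<ge> 1" by (simp add: one_le_power)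
    then show False using assms by simp
  next
    case False
    then obtain k where k: "i = int (Suc k)" by (metis zero_less_imp_eq_int Suc_diff_1 not_le)
    have "norm z = norm p * norm p ^ k"
      using z k assms by (simp add: power_int_add norm_mult norm_power)
    also have "\<dots> \<le> norm p * 1"
      using assms by (intro mult_left_mono power_le_one) auto
    finally show False using assms by simp
  qed
qed

lemma isCont_eventually_eq:
  fixes f g :: "complex \<Rightarrow> complex"
  assumes "isCont f a" "isCont g a" "eventually (\<lambda>w. f w = g w) (at a)"
  shows "f a = g a"
proof (rule tendsto_unique)
  show "f \<midarrow>a\<rightarrow> f a" using assms(1) by (simp add: isCont_def)
  have "g \<midarrow>a\<rightarrow> g a" using assms(2) by (simp add: isCont_def)
  then show "f \<midarrow>a\<rightarrow> g a"
    by (rule Lim_transform_eventually) (use assms(3) in \<open>auto elim: eventually_mono\<close>)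
qed simp

lemma holomorphic_isCont:
  "f holomorphic_on A \<Longrightarrow> open A \<Longrightarrow> z \<in> A \<Longrightarrow> isCont f z"
  using holomorphic_on_imp_continuous_on continuous_on_eq_continuous_at by blast

lemma exp_image_nonzero: "f holomorphic_on -{0} \<Longrightarrow> (\<lambda>w. f (exp w)) holomorphic_on UNIV"
  using holomorphic_on_compose_gen[OF holomorphic_on_exp, of f "-{0}" UNIV]
  by (auto simp: o_def image_def)

locale nome =
  fixes p :: complex
  assumes p: "norm p < 1" "p \<noteq> 0"
begin

lemma theta_1 [simp]: "theta p 1 = 0"
  using theta_eq_0_iff[OF p, of 1] by (auto intro: exI[of _ 0])

text \<open>Splitting off the factor 1 - z of the product exhibits the zero as simple; what remains
  at 1 is the square of (p; p). This square is the origin of the denominator of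
  \<open>\<omega>\<close>.\<close>

lemma deriv_theta_1: "(theta p has_field_derivative - (poch_inf p p)\<^sup>2) (at 1)"
proof -
  define g where "g = (\<lambda>z. - (poch_inf p (p / z) * poch_inf p (p * z)))"
  have hol: "g holomorphic_on -{0}"
    unfolding g_def using p by (auto intro!: holomorphic_intros)
  have "((\<lambda>z. (z - 1) * g z) has_field_derivative (1 - 1) * deriv g 1 + 1 * g 1) (at 1)"
    using holomorphic_derivI[OF hol, of 1] by (auto intro!: derivative_eq_intros)
  moreover have "(z - 1) * g z = theta p z" for z
    unfolding theta_eq[OF p(1)] g_def poch_inf_rec[OF p(1), of z] by (simp add: algebra_simps)
  ultimately show ?thesis by (simp add: g_def power2_eq_square)
qed

lemma poch_pp_nonzero: "poch_inf p p \<noteq> 0"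
  using poch_inf_nonzero p by blast

lemma theta_field_differentiable: "z \<noteq> 0 \<Longrightarrow> (theta p has_field_derivative deriv (theta p) z) (at z)"
  using holomorphic_theta[OF p(1), of "\<lambda>z. z" "-{0}"]
  by (intro holomorphic_derivI[of _ "-{0}"]) (auto simp: open_delete)

text \<open>Quasi-periodicity moves the simple zero at 1 to every power of \<open>p\<close>.\<close>

lemma deriv_theta_nonzero: "deriv (theta p) (p powi i) \<noteq> 0"
proof -
  obtain c k where ck: "c \<noteq> 0" "\<And>z. z \<noteq> 0 \<Longrightarrow> theta p (p powi i * z) = c * z powi k * theta p z"
    using theta_pow[OF p, of i] by metis
  have "((\<lambda>z. c * z powi k * theta p z) has_field_derivative
      c * (of_int k * 1 powi (k - 1)) * theta p 1 + (- (poch_inf p p)\<^sup>2) * (c * 1 powi k)) (at 1)"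
    by (rule derivative_eq_intros deriv_theta_1 refl | simp)+
  then have "((\<lambda>z. c * z powi k * theta p z) has_field_derivative - (poch_inf p p)\<^sup>2 * c) (at 1)"
    by simp
  then have "((\<lambda>z. theta p (p powi i * z)) has_field_derivative - (poch_inf p p)\<^sup>2 * c) (at 1)"
    by (rule has_field_derivative_transform_within_open[where S = "-{0}"]) (use ck in auto)
  moreover have "((\<lambda>z. theta p (p powi i * z)) has_field_derivative deriv (theta p) (p powi i) * p powi i) (at 1)"
    using DERIV_chain2[where g = "\<lambda>z. p powi i * z" and f = "theta p" and x = 1] p
      theta_field_differentiable[of "p powi i"]
    by (metis (no_types, lifting) DERIV_cmult_Id mult.right_neutral power_int_eq_0_iff)
  ultimately have "deriv (theta p) (p powi i) * p powi i = - (poch_inf p p)\<^sup>2 * c"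
    using DERIV_unique by blast
  then show ?thesis using ck(1) poch_pp_nonzero by auto
qed

lemma eventually_theta_nonzero:
  assumes "z0 \<noteq> 0" "c \<noteq> 0" "k > 0"
  shows "eventually (\<lambda>z. theta p (c * z ^ k) \<noteq> 0) (at z0)"
proof -
  \<comment> \<open>With this radius \<open>c * r ^ k\<close> has norm halfway between
    \<open>norm p\<close> and 1, where \<open>theta p\<close> has no zero.\<close>
  define r where "r = root k (((1 + norm p) / 2) / norm c)"
  have r: "r > 0" "norm c * r ^ k = (1 + norm p) / 2"
  proof -
    have "(1 + norm p) / 2 / norm c > 0" using zero_less_norm_iff[of c] assms(2) norm_ge_zero[of p]
      by (intro divide_pos_pos) (linarith | blast)+
    then show "r > 0" "norm c * r ^ k = (1 + norm p) / 2"
      unfolding r_def using assms by (auto simp: real_root_gt_zero real_root_pow_pos2)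
  qed
  have "theta p (c * of_real r ^ k) \<noteq> 0"
  proof -
    have "norm (c * complex_of_real r ^ k) = (1 + norm p) / 2"
      using r by (simp add: norm_mult norm_power)
    then show ?thesis
      using power_int_eq_1_imp[OF p, of "c * of_real r ^ k"] theta_eq_0_iff[OF p, of "c * of_real r ^ k"] p r assms
      by auto
  qed
  then have "eventually (\<lambda>z. theta p (c * z ^ k) \<noteq> 0 \<and> z \<in> -{0}) (at z0)"
    using assms r p
    by (intro non_zero_neighbour_alt[where \<beta> = "of_real r"])
       (auto intro!: holomorphic_theta holomorphic_intros connected_punctured_universe simp: open_delete)
  then show ?thesis by (rule eventually_mono) auto
qed

section \<open>The theta function \<open>psi\<close>: symmetries, zeros and the addition
  formula\<close>

lemma psi_inverse1: "x \<noteq> 0 \<Longrightarrow> z \<noteq> 0 \<Longrightarrow> psi p (1 / x) z = psi p x z"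
proof -
  assume xz: "x \<noteq> 0" "z \<noteq> 0"
  have 1: "theta p (1 / x * z) = - theta p (x / z) / (x / z)"
    using theta_inverse[OF p(1), of "x / z"] xz by simp
  have 2: "theta p (1 / x / z) = - theta p (x * z) / (x * z)"
    using theta_inverse[OF p(1), of "x * z"] xz by simp
  show ?thesis unfolding psi_def 1 2 using xz by (simp add: field_simps)
qed

lemma psi_inverse2: "x \<noteq> 0 \<Longrightarrow> z \<noteq> 0 \<Longrightarrow> psi p x (1 / z) = psi p x z"
  by (simp add: psi_def field_simps)

lemma psi_antisym: "x \<noteq> 0 \<Longrightarrow> z \<noteq> 0 \<Longrightarrow> psi p z x = - psi p x z"
proof -
  assume xz: "x \<noteq> 0" "z \<noteq> 0"
  have 1: "theta p (z / x) = - theta p (x / z) / (x / z)"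
    using theta_inverse[OF p(1), of "x / z"] xz by simp
  show ?thesis unfolding psi_def 1 using xz by (simp add: field_simps mult.commute)
qed

lemma psi_p1: "x \<noteq> 0 \<Longrightarrow> z \<noteq> 0 \<Longrightarrow> psi p (p * x) z = psi p x z / (p * x\<^sup>2)"
  using theta_pmult[OF p, of "x * z"] theta_pmult[OF p, of "x / z"] p
  by (simp add: psi_def power2_eq_square mult.assoc) (simp add: field_simps)

lemma psi_p2: "x \<noteq> 0 \<Longrightarrow> z \<noteq> 0 \<Longrightarrow> psi p x (p * z) = psi p x z / (p * z\<^sup>2)"
  using psi_p1[of z x] psi_antisym[of x z] psi_antisym[of x "p * z"] p by (simp add: minus_equation_iff)

lemma psi_self [simp]: "x \<noteq> 0 \<Longrightarrow> psi p x x = 0"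
  by (simp add: psi_def)

lemma psi_eq_0_iff:
  assumes "x \<noteq> 0" "z \<noteq> 0"
  shows "psi p x z = 0 \<longleftrightarrow> (\<exists>i::int. z = x * p powi i \<or> z = p powi i / x)"
proof -
  have "(\<exists>i::int. x / z = p powi i) \<longleftrightarrow> (\<exists>i::int. z = x * p powi i)"
  proof
    assume "\<exists>i::int. x / z = p powi i"
    then obtain i where "x / z = p powi i" by blast
    then have "z = x * p powi (-i)" using assms p by (simp add: power_int_minus field_simps)
    then show "\<exists>i::int. z = x * p powi i" by blast
  next
    assume "\<exists>i::int. z = x * p powi i"
    then obtain i where "z = x * p powi i" by blast
    then have "x / z = p powi (-i)" using assms p by (simp add: power_int_minus field_simps)
    then show "\<exists>i::int. x / z = p powi i" by blast
  qed
  moreover have "x * z = p powi i \<longleftrightarrow> z = p powi i / x" for i using assms by (simp add: field_simps)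
  ultimately show ?thesis
    using assms theta_eq_0_iff[OF p, of "x * z"] theta_eq_0_iff[OF p, of "x / z"] by (auto simp: psi_def)
qed

lemma holomorphic_psi:
  assumes "f holomorphic_on A" "g holomorphic_on A" "\<And>z. z \<in> A \<Longrightarrow> f z \<noteq> 0" "\<And>z. z \<in> A \<Longrightarrow> g z \<noteq> 0"
  shows "(\<lambda>z. psi p (f z) (g z)) holomorphic_on A"
  unfolding psi_def using assms p by (intro holomorphic_intros holomorphic_theta) auto

text \<open>The zeros form the families x p^i and p^i / x. If x^2 is no power of \<open>p\<close>
  these are disjoint, so at each zero exactly one of the two theta factors vanishes, and it does so
  simply. The second family is reduced to the first by replacing x by 1 / x.\<close>

lemma deriv_psi_nonzero:
  assumes "x \<noteq> 0" "z \<noteq> 0" "psi p x z = 0" "theta p (x\<^sup>2) \<noteq> 0"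
  shows "deriv (psi p x) z \<noteq> 0"
proof -
  have *: "deriv (psi p x) z \<noteq> 0"
    if x: "x \<noteq> 0" "theta p (x\<^sup>2) \<noteq> 0" and z: "z = x * p powi i" for x z i
  proof -
    have z0: "z \<noteq> 0" using x z p by simp
    have xz: "x / z = p powi (-i)" using x z p by (simp add: power_int_minus field_simps)
    have "((\<lambda>w. theta p (x / w)) has_field_derivative deriv (theta p) (x / z) * (- x / z\<^sup>2)) (at z)"
      using x z0 by (intro DERIV_chain2[OF theta_field_differentiable])
        (auto intro!: derivative_eq_intros simp: power2_eq_square)
    moreover have "((\<lambda>w. inverse x * theta p (x * w)) has_field_derivative
        deriv (\<lambda>w. inverse x * theta p (x * w)) z) (at z)"
      using x z0 p by (intro holomorphic_derivI[of _ "-{0}"])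
        (auto intro!: holomorphic_intros holomorphic_theta simp: open_delete)
    ultimately have "((\<lambda>w. inverse x * theta p (x * w) * theta p (x / w)) has_field_derivative
        deriv (\<lambda>w. inverse x * theta p (x * w)) z * theta p (x / z) +
        deriv (theta p) (x / z) * (- x / z\<^sup>2) * (inverse x * theta p (x * z))) (at z)"
      by (rule DERIV_mult[rotated])
    moreover have "theta p (x / z) = 0" using theta_eq_0_iff[OF p, of "x / z"] x z0 xz by (metis divide_eq_0_iff)
    ultimately have "(psi p x has_field_derivative
        deriv (theta p) (x / z) * (- x / z\<^sup>2) * (inverse x * theta p (x * z))) (at z)"
      by (simp add: psi_def[abs_def] mult.assoc)
    then have "deriv (psi p x) z = - deriv (theta p) (p powi (-i)) * theta p (x * z) / z\<^sup>2"
      using x xz by (simp add: DERIV_imp_deriv)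
    moreover have "theta p (x * z) \<noteq> 0"
    proof
      assume "theta p (x * z) = 0"
      then obtain j where "x * z = p powi j" using theta_eq_0_iff[OF p, of "x * z"] x z0 by auto
      then have "x\<^sup>2 = p powi (j - i)" using p z by (simp add: power_int_diff power2_eq_square field_simps)
      then show False using x theta_eq_0_iff[OF p, of "x\<^sup>2"] by (metis zero_eq_power2)
    qed
    ultimately show ?thesis using deriv_theta_nonzero z0 by simp
  qed
  from assms obtain i where "z = x * p powi i \<or> z = p powi i / x" by (auto simp: psi_eq_0_iff)
  then show ?thesis
  proof
    assume z: "z = p powi i / x"
    have "theta p ((1 / x)\<^sup>2) \<noteq> 0"
      using assms theta_inverse[OF p(1), of "x\<^sup>2"] by (simp add: power_divide)
    then have "deriv (psi p (1 / x)) z \<noteq> 0" using *[of "1 / x" z i] assms z by simp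
    moreover have "deriv (psi p (1 / x)) z = deriv (psi p x) z"
      using assms psi_inverse1[of x]
      by (intro deriv_cong_ev eventually_mono[OF eventually_nhds_in_open[of "-{0}" z]]) (auto simp: open_delete)
    ultimately show ?thesis by simp
  qed (use * assms in blast)
qed

text \<open>A closed fundamental annulus is compact, so the function is bounded by its values there;
  composed with \<open>exp\<close> it becomes a bounded entire function, and Liouville
  applies.\<close>

lemma periodic_constant:
  assumes hol: "g holomorphic_on -{0}" and per: "\<And>z. z \<noteq> 0 \<Longrightarrow> g (p * z) = g z"
  shows "z \<noteq> 0 \<Longrightarrow> w \<noteq> 0 \<Longrightarrow> g z = g w"
proof -
  have pow: "g (p powi k * z) = g z" if "z \<noteq> 0" for k z
  proof (induction k rule: int_induct[of _ 0])
    case (step1 i)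
    then show ?case using per[of "p powi i * z"] that p by (simp add: power_int_add mult_ac)
  next
    case (step2 i)
    then show ?case using per[of "p powi (i - 1) * z"] that p by (simp add: power_int_diff mult_ac)
  qed simp
  define K where "K = cball (0::complex) 1 - ball 0 (norm p)"
  have "compact K" unfolding K_def by (intro compact_diff) auto
  moreover have "continuous_on K g"
    using holomorphic_on_imp_continuous_on[OF hol] by (rule continuous_on_subset) (use p in \<open>auto simp: K_def\<close>)
  ultimately have bd: "bounded (g ` K)" using compact_continuous_image compact_imp_bounded by blast
  have range: "g z \<in> g ` K" if "z \<noteq> 0" for z
  proof -
    \<comment> \<open>The least integer that brings the norm of \<open>p powi k * z\<close> down to
      at most 1; that norm is then still at least \<open>norm p\<close>.\<close>
    define k where "k = \<lceil>- log (norm p) (norm z)\<rceil>"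
    have lp: "ln (norm p) < 0" using p by simp
    have 1: "norm (p powi k * z) = norm p powr (of_int k + log (norm p) (norm z))"
      using that p by (simp add: norm_mult norm_power_int powr_add powr_real_of_int' flip: powr_real_of_int)
    have "0 \<le> of_int k + log (norm p) (norm z)" "of_int k + log (norm p) (norm z) \<le> 1"
      unfolding k_def by linarith+
    then have "norm (p powi k * z) \<le> 1" "norm p \<le> norm (p powi k * z)"
      unfolding 1 using p powr_mono'[of 0 _ "norm p"] powr_mono'[of _ 1 "norm p"] by auto
    then have "p powi k * z \<in> K" by (auto simp: K_def)
    then show ?thesis using pow[OF that, of k] by (metis image_eqI)
  qed
  have "(\<lambda>w. g (exp w)) holomorphic_on UNIV"
    by (rule exp_image_nonzero[OF hol])
  moreover have "bounded (range (\<lambda>w. g (exp w)))"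
    by (rule bounded_subset[OF bd]) (use range in auto)
  ultimately obtain c where c: "\<And>w. g (exp w) = c"
    using Liouville_theorem unfolding constant_on_def by blast
  show "z \<noteq> 0 \<Longrightarrow> w \<noteq> 0 \<Longrightarrow> g z = g w" using c by (metis exp_Ln)
qed

text \<open>Both sides are symmetric theta functions of degree 1 in \<open>y\<close> vanishing at \<open>y = x\<^sup>\<plusminus>\<^sup>1\<close>, so their
  quotient is \<open>p\<close>-periodic and holomorphic, hence constant; \<open>y = d\<close> gives the constant.\<close>

lemma psi_addition:
  assumes nz: "x \<noteq> 0" "y \<noteq> 0" "c \<noteq> 0" "d \<noteq> 0"
  shows "psi p x y * psi p c d = psi p c x * psi p d y - psi p c y * psi p d x"
proof -
  have *: "psi p x y * psi p c d = psi p c x * psi p d y - psi p c y * psi p d x"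
    if x: "x \<noteq> 0" "theta p (x\<^sup>2) \<noteq> 0" "psi p x d \<noteq> 0" "y \<noteq> 0" for x y
  proof -
    define f where "f = (\<lambda>y. psi p c x * psi p d y - psi p c y * psi p d x)"
    define g where "g = remove_sings (\<lambda>y. f y / psi p x y)"
    have hol: "f holomorphic_on -{0}" "psi p x holomorphic_on -{0}"
      unfolding f_def using nz x by (auto intro!: holomorphic_intros holomorphic_psi)
    have op: "open (-{0::complex})" by auto
    have fq: "f (p * y) = f y / (p * y\<^sup>2)" if "y \<noteq> 0" for y
      using that psi_p2[of d y] psi_p2[of c y] nz by (simp add: f_def diff_divide_distrib)
    have fp: "f (p powi i * y) = 0 \<longleftrightarrow> f y = 0" if "y \<noteq> 0" for y i
    proof (induction i rule: int_induct[of _ 0])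
      case (step1 i)
      then show ?case using fq[of "p powi i * y"] that p by (simp add: power_int_add mult_ac)
    next
      case (step2 i)
      then show ?case using fq[of "p powi (i - 1) * y"] that p by (simp add: power_int_diff mult_ac)
    qed simp
    have psi_ne: "eventually (\<lambda>w. psi p x w \<noteq> 0 \<and> w \<in> -{0}) (at y)" if "y \<noteq> 0" for y
      using hol(2) op that x(1,3) nz
      by (intro non_zero_neighbour_alt[where \<beta> = d]) (auto intro: connected_punctured_universe)
    have sing: "\<exists>L. ((\<lambda>y. f y / psi p x y) \<longlongrightarrow> L) (at w)" if w: "w \<noteq> 0" for w
    proof (cases "psi p x w = 0")
      case False
      then show ?thesis using holomorphic_isCont[OF hol(1) op] holomorphic_isCont[OF hol(2) op] w
        by (metis ComplI isContD singletonD tendsto_divide)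
    next
      case True
      then obtain i :: int where i: "w = x * p powi i \<or> w = p powi i / x" using psi_eq_0_iff x w by auto
      have "f x = 0" "f (1 / x) = 0"
        using x nz by (auto simp: f_def psi_inverse2)
      then have fw: "f w = 0" using fp[of x i] fp[of "1 / x" i] i x by (auto simp: mult.commute)
      have "((\<lambda>y. f y / psi p x y) \<longlongrightarrow> deriv f w / deriv (psi p x) w) (at w)"
        using fw True deriv_psi_nonzero x w holomorphic_derivI[OF hol(1) op] holomorphic_derivI[OF hol(2) op]
        by (intro lhopital_complex_simple[where g = "psi p x" and f' = "deriv f w" and g' = "deriv (psi p x) w"]) auto
      then show ?thesis by blast
    qed
    have iso: "isolated_singularity_at (\<lambda>y. f y / psi p x y) w" if "w \<noteq> 0" for w
    proof -
      have "(\<lambda>y. f y / psi p x y) meromorphic_on -{0}"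
        using hol op by (intro meromorphic_intros analytic_on_imp_meromorphic_on) (auto simp: analytic_on_open)
      then show ?thesis using that by (auto simp: meromorphic_on_altdef)
    qed
    have "g analytic_on {w}" if "w \<noteq> 0" for w
      unfolding g_def using iso[OF that] sing[OF that] by (auto intro: remove_sings_analytic_at)
    then have "g analytic_on -{0}"
      by (subst analytic_on_analytic_at) auto
    then have holg: "g holomorphic_on -{0}" by (rule analytic_imp_holomorphic)
    have fg: "f y = g y * psi p x y" if "y \<noteq> 0" for y
    proof (rule isCont_eventually_eq[where a = y])
      show "eventually (\<lambda>w. f w = g w * psi p x w) (at y)"
        using eventually_remove_sings_eq_at[OF iso[OF that]] psi_ne[OF that] by eventually_elim (auto simp: g_def)
      show "isCont f y" "isCont (\<lambda>w. g w * psi p x w) y"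
        using holomorphic_isCont[OF _ op] hol holg that by (auto intro!: continuous_intros)
    qed
    have per: "g (p * z) = g z" if "z \<noteq> 0" for z
    proof (rule isCont_eventually_eq[where a = z])
      show "eventually (\<lambda>w. g (p * w) = g w) (at z)"
        using psi_ne[OF that]
      proof eventually_elim
        case (elim w)
        have "g (p * w) * psi p x (p * w) = g w * psi p x w / (p * w\<^sup>2)"
          using elim fq[of w] fg[of w] fg[of "p * w"] p by simp
        then show ?case using elim psi_p2[of x w] x p by simp
      qed
      show "isCont (\<lambda>w. g (p * w)) z" "isCont g z"
        using holomorphic_isCont[OF holg op] that p
        by (auto intro!: isCont_o2[of z "\<lambda>w. p * w" g] continuous_intros)
    qed
    have "g d = psi p c d"
      using fg[OF nz(4)] x nz psi_antisym[of d x] by (simp add: f_def)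
    then have "g y = psi p c d" using periodic_constant[OF holg per, of y d] x nz by simp
    then show ?thesis using fg[OF x(4)] by (simp add: f_def mult.commute)
  qed
  \<comment> \<open>So far \<open>x\<close> avoids the zeros of theta(x^2) and of psi(x, d). These
    exceptions are isolated, and both sides are continuous in \<open>x\<close>.\<close>
  define F where "F = (\<lambda>x. psi p x y * psi p c d - (psi p c x * psi p d y - psi p c y * psi p d x))"
  have holF: "F holomorphic_on -{0}"
    unfolding F_def using nz by (auto intro!: holomorphic_intros holomorphic_psi)
  have "eventually (\<lambda>x. F x = 0) (at x)"
  proof -
    have "eventually (\<lambda>x. theta p (1 * x ^ 2) \<noteq> 0) (at x)"
      by (rule eventually_theta_nonzero) (use nz in auto)
    moreover have "eventually (\<lambda>x. theta p (d * x ^ 1) \<noteq> 0) (at x)"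
      by (rule eventually_theta_nonzero) (use nz in auto)
    moreover have "eventually (\<lambda>x. theta p (1 / d * x ^ 1) \<noteq> 0) (at x)"
      by (rule eventually_theta_nonzero) (use nz in auto)
    moreover have "eventually (\<lambda>x. x \<in> -{0}) (at x)"
      using nz by (intro eventually_at_in_open') auto
    ultimately show ?thesis
    proof eventually_elim
      case (elim x)
      then have "psi p x d \<noteq> 0" using nz by (simp add: psi_def mult.commute)
      then show ?case using *[of x y] elim nz by (simp add: F_def)
    qed
  qed
  moreover have "isCont F x"
    using holomorphic_isCont[OF holF] nz by (auto simp: open_delete)
  ultimately have "F x = 0"
    by (intro isCont_eventually_eq[of x F "\<lambda>_. 0"]) auto
  then show ?thesis by (simp add: F_def)
qed

end

section \<open>Residues of cycles in the punctured plane\<close>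

lemma countable_no_limpt:
  fixes E :: "real set"
  assumes "\<And>t. t \<in> E \<Longrightarrow> \<not> t islimpt E"
  shows "countable E"
proof -
  have "closed {x. x islimpt E}" by (rule closed_limpts)
  then have "open (- {x. x islimpt E})" by auto
  moreover have "E sparse_in - {x. x islimpt E}"
    by (subst sparse_in_open) (use \<open>closed {x. x islimpt E}\<close> in auto)
  ultimately have "countable (- {x. x islimpt E} \<inter> E)" by (rule sparse_imp_countable)
  moreover have "- {x. x islimpt E} \<inter> E = E" using assms by auto
  ultimately show ?thesis by simp
qed

text \<open>Where the path stands still, integrand times velocity is 0 whatever the integrand is, so
  only passages through \<open>s\<close> with nonzero velocity count. At an accumulation point of
  such passages the difference quotients along them would be 0, contrary to the nonzero velocity; so
  there are countably many, up to the finitely many corners.\<close>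

lemma negligible_path_level:
  assumes "valid_path \<gamma>"
  shows "negligible {t \<in> {0..1}. \<gamma> t = s \<and> vector_derivative \<gamma> (at t within {0..1}) \<noteq> 0}"
proof -
  obtain S where S: "finite S" "\<And>t. t \<in> {0..1} - S \<Longrightarrow> \<gamma> differentiable at t"
    using assms unfolding valid_path_def piecewise_C1_differentiable_on_def C1_differentiable_on_eq by auto
  define E where "E = {t \<in> {0..1} - S. \<gamma> t = s \<and> vector_derivative \<gamma> (at t within {0..1}) \<noteq> 0}"
  have "\<not> t islimpt E" if t: "t \<in> E" for t
  proof
    assume lim: "t islimpt E"
    have d: "(\<gamma> has_vector_derivative vector_derivative \<gamma> (at t within {0..1})) (at t within {0..1})"
      using S(2)[of t] t by (auto simp: E_def vector_derivative_works[symmetric] intro: differentiable_at_withinI)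
    then have d: "(\<gamma> has_vector_derivative vector_derivative \<gamma> (at t within {0..1})) (at t within E)"
      by (rule has_vector_derivative_within_subset) (auto simp: E_def)
    have "((\<lambda>_. s) has_vector_derivative vector_derivative \<gamma> (at t within {0..1})) (at t within E)"
      by (rule has_vector_derivative_transform[OF _ _ d]) (use t in \<open>auto simp: E_def\<close>)
    moreover have "((\<lambda>_. s) has_vector_derivative 0) (at t within E)" by simp
    ultimately have "vector_derivative \<gamma> (at t within {0..1}) = 0"
      using lim by (meson trivial_limit_within vector_derivative_unique_within)
    then show False using t by (simp add: E_def)
  qed
  then have "countable (E \<union> S)" using countable_no_limpt S(1) by (auto intro: countable_finite)
  then have "negligible (E \<union> S)"
    by (simp add: negligible_iff_null_sets countable_imp_null_set_lborel null_sets_completionI)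
  then show ?thesis by (rule negligible_subset) (auto simp: E_def)
qed

text \<open>A path may run through a point arbitrarily often, yet values of the integrand at
  finitely many points do not count. Meromorphic functions are total here, and a contour may pass
  through a removable singularity, where the value is arbitrary.\<close>

lemma has_contour_integral_spike:
  assumes "valid_path \<gamma>" "finite B" "\<And>z. z \<in> path_image \<gamma> - B \<Longrightarrow> f z = g z"
    "(f has_contour_integral I) \<gamma>"
  shows "(g has_contour_integral I) \<gamma>"
proof -
  define N where "N = (\<Union>s\<in>B. {t \<in> {0..1}. \<gamma> t = s \<and> vector_derivative \<gamma> (at t within {0..1}) \<noteq> 0})"
  have N: "negligible N" unfolding N_def using assms(1,2) negligible_path_level by (intro negligible_Union) auto
  show ?thesis
    using assms(4) unfolding has_contour_integral_def
  proof (rule has_integral_spike[OF N, rotated])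
    fix t assume t: "t \<in> {0..1} - N"
    then have "vector_derivative \<gamma> (at t within {0..1}) = 0 \<or> \<gamma> t \<notin> B" by (auto simp: N_def)
    then show "g (\<gamma> t) * vector_derivative \<gamma> (at t within {0..1}) =
        f (\<gamma> t) * vector_derivative \<gamma> (at t within {0..1})"
      using assms(3)[of "\<gamma> t"] t by (auto simp: path_image_def)
  qed
qed

lemma contour_integral_spike:
  assumes "valid_path \<gamma>" "finite B" "\<And>z. z \<in> path_image \<gamma> - B \<Longrightarrow> f z = g z"
  shows "contour_integral \<gamma> f = contour_integral \<gamma> g"
    "f contour_integrable_on \<gamma> \<longleftrightarrow> g contour_integrable_on \<gamma>"
proof -
  have *: "(f has_contour_integral I) \<gamma> \<longleftrightarrow> (g has_contour_integral I) \<gamma>" for I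
    using has_contour_integral_spike[OF assms(1,2), of f g] has_contour_integral_spike[OF assms(1,2), of g f] assms(3)
    by metis
  then show "contour_integral \<gamma> f = contour_integral \<gamma> g" "f contour_integrable_on \<gamma> \<longleftrightarrow> g contour_integrable_on \<gamma>"
    unfolding contour_integral_def contour_integrable_on_def by auto
qed

section \<open>Primitives, principal parts and residues on annuli\<close>

definition annulus :: "real \<Rightarrow> real \<Rightarrow> complex set" where
  "annulus r R = {z. r < norm z \<and> norm z < R}"

lemma open_annulus [simp]: "open (annulus r R)"
  unfolding annulus_def by (intro open_Collect_conj open_Collect_less continuous_intros)

text \<open>Under \<open>exp\<close> the annulus is covered by a vertical strip, where g(exp w) exp
  w has a primitive H. The increment of H over the period 2 pi i is constant, and subtracting the
  matching linear function makes H periodic, hence a function on the annulus. The linear function is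
  what becomes the term c / z.\<close>

lemma annulus_primitive:
  assumes r: "0 < r" "r < R" and hol: "g holomorphic_on annulus r R"
  obtains c K where "\<And>z. z \<in> annulus r R \<Longrightarrow> (K has_field_derivative g z - c / z) (at z)"
proof -
  define S where "S = {w. ln r < Re w} \<inter> {w. Re w < ln R}"
  have S: "w \<in> S \<longleftrightarrow> exp w \<in> annulus r R" for w
    using r exp_less_cancel_iff[of "ln r" "Re w"] exp_less_cancel_iff[of "Re w" "ln R"]
    by (auto simp: S_def annulus_def)
  have cS: "convex S" unfolding S_def by (intro convex_Int convex_halfspace_Re_gt convex_halfspace_Re_lt)
  have oS: "open S" unfolding S_def by (intro open_Int open_halfspace_Re_gt open_halfspace_Re_lt)
  have "(\<lambda>w. g (exp w) * exp w) holomorphic_on S"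
    using holomorphic_on_compose_gen[OF holomorphic_on_exp hol, of S] S
    by (intro holomorphic_intros) (auto simp: o_def)
  then obtain H where H0: "\<And>w. w \<in> S \<Longrightarrow> (H has_field_derivative g (exp w) * exp w) (at w within S)"
    by (rule holomorphic_convex_primitive'[OF cS oS]) blast
  have H: "(H has_field_derivative g (exp w) * exp w) (at w)" if "w \<in> S" for w
    using H0[OF that] at_within_open[OF that oS] by simp
  define T where "T = 2 * of_real pi * \<i>"
  have ST: "w + T \<in> S \<longleftrightarrow> w \<in> S" for w by (simp add: S_def T_def)
  have "\<exists>c. \<forall>w\<in>S. H (w + T) - H w = c"
  proof (rule has_field_derivative_zero_constant[OF cS])
    fix w assume w: "w \<in> S"
    have "((\<lambda>w. H (w + T)) has_field_derivative g (exp (w + T)) * exp (w + T)) (at w)"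
      using H[of "w + T"] ST w by (simp add: DERIV_shift)
    moreover have "exp (w + T) = exp w" by (simp add: T_def exp_add)
    ultimately have "((\<lambda>w. H (w + T) - H w) has_field_derivative g (exp w) * exp w - g (exp w) * exp w) (at w)"
      using H[OF w] by (intro DERIV_diff) simp
    then show "((\<lambda>w. H (w + T) - H w) has_field_derivative 0) (at w within S)"
      by (simp add: has_field_derivative_at_within)
  qed
  then obtain c where c: "\<And>w. w \<in> S \<Longrightarrow> H (w + T) = H w + c" by (metis add.commute diff_add_cancel)
  define K' where "K' = (\<lambda>w. H w - c / T * w)"
  have T0: "T \<noteq> 0" by (simp add: T_def)
  have K'1: "K' (w + T) = K' w" if "w \<in> S" for w using c[OF that] T0 by (simp add: K'_def field_simps)
  have K'n: "K' (w + of_nat k * T) = K' w \<and> w + of_nat k * T \<in> S" if "w \<in> S" for w k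
  proof (induction k)
    case (Suc k)
    have "w + of_nat (Suc k) * T = (w + of_nat k * T) + T" by (simp add: algebra_simps)
    then show ?case using Suc K'1[of "w + of_nat k * T"] ST[of "w + of_nat k * T"] by metis
  qed (use that in auto)
  have K'i: "K' (w + of_int k * T) = K' w" if "w \<in> S" "w + of_int k * T \<in> S" for w k
  proof (cases "k \<ge> 0")
    case True
    then show ?thesis using K'n[OF that(1), of "nat k"] by simp
  next
    case False
    then show ?thesis using K'n[OF that(2), of "nat (-k)"] by simp
  qed
  show ?thesis
  proof (rule that[where c = "c / T" and K = "\<lambda>z. K' (Ln z)"])
    fix z assume z: "z \<in> annulus r R"
    then have z0: "z \<noteq> 0" using r by (auto simp: annulus_def)
    \<comment> \<open>A logarithm that is smooth near \<open>z\<close> even if \<open>z\<close> lies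
      on the cut of \<open>Ln\<close>. It differs from \<open>Ln\<close> by multiples of the period,
      which \<open>K'\<close> does not see.\<close>
    define L where "L = (\<lambda>y. Ln (y / z) + Ln z)"
    have "((\<lambda>y. Ln (y / z)) has_field_derivative inverse (z / z) * (1 / z)) (at z)"
      using z0 by (intro DERIV_chain2[OF has_field_derivative_Ln]) (auto intro!: derivative_eq_intros)
    then have dL: "(L has_field_derivative 1 / z) (at z)"
      using z0 unfolding L_def by (auto intro!: derivative_eq_intros)
    have Lz: "L z = Ln z" using z0 by (simp add: L_def)
    have "Ln z \<in> S" using S z z0 by simp
    then have "(K' has_field_derivative g (exp (L z)) * exp (L z) - c / T) (at (L z))"
      unfolding K'_def Lz using T0 by (auto intro!: derivative_eq_intros H)
    then have "((\<lambda>y. K' (L y)) has_field_derivative (g (exp (L z)) * exp (L z) - c / T) * (1 / z)) (at z)"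
      using dL by (rule DERIV_chain2)
    then have "((\<lambda>y. K' (L y)) has_field_derivative g z - c / T / z) (at z)"
      using z0 by (simp add: Lz diff_divide_distrib)
    then show "((\<lambda>z. K' (Ln z)) has_field_derivative g z - c / T / z) (at z)"
    proof (rule has_field_derivative_transform_within_open[OF _ open_annulus z])
      fix y assume y: "y \<in> annulus r R"
      then have y0: "y \<noteq> 0" using r by (auto simp: annulus_def)
      have "exp (L y) = y" using y0 z0 by (simp add: L_def exp_add)
      then have "exp (L y) = exp (Ln y)" using y0 by simp
      then obtain k :: int where k: "L y = Ln y + of_real (of_int (2 * k) * pi) * \<i>"
        unfolding exp_eq by blast
      have Ly: "L y = Ln y + of_int k * T" by (simp add: T_def k)
      have 1: "Ln y \<in> S" unfolding S using y y0 by simp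
      have 2: "Ln y + of_int k * T \<in> S" unfolding S Ly[symmetric] \<open>exp (L y) = y\<close> by (rule y)
      show "K' (L y) = K' (Ln y)" unfolding Ly by (rule K'i[OF 1 2])
    qed
  qed
qed

definition cloop :: "(real \<Rightarrow> complex) \<Rightarrow> bool" where
  "cloop \<gamma> \<longleftrightarrow> valid_path \<gamma> \<and> pathfinish \<gamma> = pathstart \<gamma> \<and> 0 \<notin> path_image \<gamma>"

text \<open>The constant belongs to \<open>g\<close> and the annulus: one and the same
  \<open>c\<close> serves all loops, which is what lets it cancel between two contours.\<close>

lemma annulus_contour_integral:
  assumes r: "0 < r" "r < R" and hol: "g holomorphic_on annulus r R"
  obtains c where "\<And>\<gamma>. cloop \<gamma> \<Longrightarrow> path_image \<gamma> \<subseteq> annulus r R \<Longrightarrow>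
    (g has_contour_integral c * winding_number \<gamma> 0) \<gamma>"
proof -
  obtain c K where K: "\<And>z. z \<in> annulus r R \<Longrightarrow> (K has_field_derivative g z - c / z) (at z)"
    using annulus_primitive[OF assms] by blast
  show ?thesis
  proof (rule that[where c = "c * (2 * of_real pi * \<i>)"])
    fix \<gamma> assume \<gamma>: "cloop \<gamma>" "path_image \<gamma> \<subseteq> annulus r R"
    have "((\<lambda>z. g z - c / z) has_contour_integral 0) \<gamma>"
      by (rule Cauchy_theorem_primitive[of "annulus r R" K])
        (use K \<gamma> in \<open>auto simp: cloop_def intro: has_field_derivative_at_within\<close>)
    moreover have "((\<lambda>w. c * (1 / (w - 0))) has_contour_integral c * (2 * of_real pi * \<i> * winding_number \<gamma> 0)) \<gamma>"
      using has_contour_integral_lmul[OF has_contour_integral_winding_number[of \<gamma> 0], of c] \<gamma>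
      by (simp add: cloop_def)
    ultimately have "((\<lambda>z. (g z - c / z) + c * (1 / (z - 0))) has_contour_integral
        0 + c * (2 * of_real pi * \<i> * winding_number \<gamma> 0)) \<gamma>"
      by (rule has_contour_integral_add)
    then show "(g has_contour_integral c * (2 * of_real pi * \<i>) * winding_number \<gamma> 0) \<gamma>"
      by (simp add: mult_ac)
  qed
qed

text \<open>Induction on the order: u(z) - u(s) is divisible by z - s, and the quotient is
  holomorphic again.\<close>

lemma principal_part_power:
  assumes S: "open S" "s \<in> S" and u: "u holomorphic_on S"
  shows "\<exists>P h. P holomorphic_on -{s} \<and> h holomorphic_on S \<and>
    (\<forall>z\<in>S - {s}. u z / (z - s) ^ k = h z + P z)"
  using u
proof (induction k arbitrary: u)
  case 0
  then show ?case by (intro exI[of _ "\<lambda>_. 0"] exI[of _ u]) auto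
next
  case (Suc k)
  define u1 where "u1 = (\<lambda>z. if z = s then deriv u s else (u z - u s) / (z - s))"
  have "u1 holomorphic_on S"
    unfolding u1_def by (rule pole_lemma_open) (use Suc S in auto)
  then obtain P h where Ph: "P holomorphic_on -{s}" "h holomorphic_on S"
    "\<And>z. z \<in> S - {s} \<Longrightarrow> u1 z / (z - s) ^ k = h z + P z"
    using Suc.IH by blast
  show ?case
  proof (rule exI[of _ "\<lambda>z. P z + u s / (z - s) ^ Suc k"], rule exI[of _ h], intro conjI ballI)
    show "(\<lambda>z. P z + u s / (z - s) ^ Suc k) holomorphic_on - {s}"
      using Ph by (intro holomorphic_intros) auto
    fix z assume z: "z \<in> S - {s}"
    have "u z / (z - s) ^ Suc k = u1 z / (z - s) ^ k + u s / (z - s) ^ Suc k"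
      using z by (simp add: u1_def diff_divide_distrib)
    then show "u z / (z - s) ^ Suc k = h z + (P z + u s / (z - s) ^ Suc k)"
      using Ph(3)[OF z] by simp
  qed (use Ph in auto)
qed

text \<open>The part that is split off is holomorphic on the whole plane except \<open>s\<close>, so
  the residue theorem applies to it for every loop that avoids \<open>s\<close>; the remainder is
  regular at \<open>s\<close>.\<close>

lemma principal_part:
  assumes S: "open S" "s \<in> S" and f: "f holomorphic_on S - {s}" "not_essential f s"
  obtains P h where "P holomorphic_on -{s}" "h holomorphic_on S" "\<And>z. z \<in> S - {s} \<Longrightarrow> f z = h z + P z"
proof -
  have "\<exists>k L. ((\<lambda>z. f z * (z - s) ^ k) \<longlongrightarrow> L) (at s)"
  proof (cases "is_pole f s")
    case False
    then have "\<exists>L. (f \<longlongrightarrow> L) (at s)" using f(2) unfolding not_essential_def by auto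
    then obtain L where "((\<lambda>z. f z * (z - s) ^ 0) \<longlongrightarrow> L) (at s)" by auto
    then show ?thesis by blast
  next
    case True
    define n where "n = zorder f s"
    have "\<exists>r>0. zor_poly f s s \<noteq> 0 \<and> zor_poly f s holomorphic_on cball s r \<and>
       (\<forall>w\<in>cball s r - {s}. f w = zor_poly f s w / (w - s) ^ nat (- n) \<and> zor_poly f s w \<noteq> 0)"
      using zorder_exist_pole[OF f(1) S True] unfolding n_def by auto
    then obtain r where r: "r > 0" "zor_poly f s holomorphic_on cball s r"
       "\<And>w. w\<in>cball s r - {s} \<Longrightarrow> f w = zor_poly f s w / (w - s) ^ nat (- n)" by auto
    have "isCont (zor_poly f s) s"
      using holomorphic_on_imp_continuous_on[OF r(2)] r(1)
      by (metis centre_in_ball continuous_on_eq_continuous_at continuous_on_subset ball_subset_cball open_ball)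
    then have "(zor_poly f s \<longlongrightarrow> zor_poly f s s) (at s)" by (simp add: isCont_def)
    then have "((\<lambda>z. f z * (z - s) ^ nat (-n)) \<longlongrightarrow> zor_poly f s s) (at s)"
    proof (rule Lim_transform_within_open[OF _ open_ball])
      show "s \<in> ball s r" using r by simp
      show "zor_poly f s z = f z * (z - s) ^ nat (- n)" if "z \<in> ball s r" "z \<noteq> s" for z
        using r(3)[of z] that by auto
    qed
    then show ?thesis by blast
  qed
  then obtain k L where L: "((\<lambda>z. f z * (z - s) ^ k) \<longlongrightarrow> L) (at s)" by blast
  define u where "u = (\<lambda>z. if z = s then L else f z * (z - s) ^ k)"
  have "u holomorphic_on S"
    unfolding u_def
    by (rule removable_singularity) (use S f L in \<open>auto intro!: holomorphic_intros\<close>)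
  then obtain P h where "P holomorphic_on -{s}" "h holomorphic_on S"
    "\<And>z. z \<in> S - {s} \<Longrightarrow> u z / (z - s) ^ k = h z + P z"
    using principal_part_power[OF S] by blast
  then show ?thesis by (intro that[of P h]) (auto simp: u_def)
qed

lemma principal_parts:
  assumes S: "open S" and F: "finite F" "F \<subseteq> S" and f: "f holomorphic_on S - F" "\<And>s. s \<in> F \<Longrightarrow> f meromorphic_on {s}"
  obtains P h where "\<And>s. s \<in> F \<Longrightarrow> P s holomorphic_on -{s}" "h holomorphic_on S"
    "\<And>z. z \<in> S - F \<Longrightarrow> f z = h z + (\<Sum>s\<in>F. P s z)"
proof -
  have "\<exists>P h. (\<forall>s\<in>F. P s holomorphic_on -{s}) \<and> h holomorphic_on S \<and> (\<forall>z\<in>S - F. f z = h z + (\<Sum>s\<in>F. P s z))"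
    using F f
  proof (induction F arbitrary: f rule: finite_induct)
    case empty
    then show ?case by auto
  next
    case (insert s F)
    have op: "open (S - F)" using S insert by (simp add: finite_imp_closed open_Diff)
    have hol: "f holomorphic_on (S - F) - {s}" using insert.prems by (metis Diff_insert)
    have sSF: "s \<in> S - F" using insert by auto
    have ess: "not_essential f s" using insert.prems by (intro meromorphic_on_not_essential) auto
    obtain P h where P: "P holomorphic_on -{s}" and h: "h holomorphic_on S - F"
       and fPh: "\<And>z. z \<in> S - F - {s} \<Longrightarrow> f z = h z + P z"
      by (rule principal_part[OF op sSF hol ess]) blast
    have ne: "h meromorphic_on {t}" if "t \<in> F" for t
    proof -
      have "P analytic_on {t}" using P that insert
        by (intro holomorphic_on_imp_analytic_at[of _ "-{s}"]) auto
      moreover have "f meromorphic_on {t}" using insert.prems that by (auto intro: meromorphic_on_subset)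
      ultimately have "(\<lambda>z. f z - P z) meromorphic_on {t}"
        by (auto intro: meromorphic_on_diff[OF _ analytic_on_imp_meromorphic_on])
      moreover have "eventually (\<lambda>z. f z - P z = h z) (at t)"
      proof -
        have "open (S - (insert s F - {t}))" using S insert by (simp add: finite_imp_closed open_Diff)
        then have "eventually (\<lambda>z. z \<in> S - (insert s F - {t}) - {t}) (at t)"
          using that insert by (intro eventually_at_in_open) auto
        then show ?thesis by eventually_elim (use fPh in auto)
      qed
      ultimately show ?thesis using meromorphic_on_cong[of "{t}"] by (metis singletonD)
    qed
    obtain P' h' where P': "\<forall>s\<in>F. P' s holomorphic_on -{s}" "h' holomorphic_on S"
       "\<forall>z\<in>S - F. h z = h' z + (\<Sum>s\<in>F. P' s z)"
      using insert.IH[of h] insert.prems h ne by auto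
    show ?case
    proof (rule exI[of _ "P'(s := P)"], rule exI[of _ h'], intro conjI ballI)
      fix z assume z: "z \<in> S - insert s F"
      have "(\<Sum>t\<in>F. (P'(s := P)) t z) = (\<Sum>t\<in>F. P' t z)" using insert by (intro sum.cong) auto
      then show "f z = h' z + (\<Sum>t\<in>insert s F. (P'(s := P)) t z)"
        using z fPh[of z] P'(3) insert by (simp add: algebra_simps)
    qed (use P P' insert in auto)
  qed
  then show ?thesis using that by blast
qed

lemma not_pole_limit:
  "f meromorphic_on {z} \<Longrightarrow> \<not> is_pole f z \<Longrightarrow> \<exists>L. f \<midarrow>z\<rightarrow> L"
  using meromorphic_on_not_essential[of f z] unfolding not_essential_def by auto

lemma remove_sings_analytic_at_nonpole:
  "f meromorphic_on {z} \<Longrightarrow> \<not> is_pole f z \<Longrightarrow> remove_sings f analytic_on {z}"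
  using not_pole_limit remove_sings_analytic_at meromorphic_on_isolated_singularity by blast

lemma residue_nonpole:
  assumes "f meromorphic_on {z}" "\<not> is_pole f z"
  shows "residue f z = 0"
proof -
  obtain A where "open A" "z \<in> A" "remove_sings f holomorphic_on A"
    using remove_sings_analytic_at_nonpole[OF assms] by (auto simp: analytic_at)
  then have "residue (remove_sings f) z = 0" by (intro residue_holo)
  then show ?thesis
    using residue_remove_sings[OF meromorphic_on_isolated_singularity[OF assms(1)]] by simp
qed

lemma finite_singularities_compact:
  assumes "f meromorphic_on -{0}" "compact K" "0 \<notin> K"
  shows "finite {z \<in> K. \<not> f analytic_on {z}}" "finite {z \<in> K. is_pole f z}"
proof -
  have "{w. \<not> f analytic_on {w}} sparse_in K"
    using meromorphic_on_imp_sparse_singularities[OF assms(1)] by (rule sparse_in_subset) (use assms in auto)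
  then have "finite (K \<inter> {w. \<not> f analytic_on {w}})" by (rule sparse_in_compact_finite[OF _ assms(2)])
  then show "finite {z \<in> K. \<not> f analytic_on {z}}" by (simp add: Int_def)
  then show "finite {z \<in> K. is_pole f z}"
    by (rule rev_finite_subset) (auto dest: analytic_at_imp_no_pole)
qed

text \<open>Poles may accumulate at 0, and a loop may wind around 0. Whatever lies within the inner
  circle is summarized in the constant \<open>c\<close>; the poles in the annulus, finite in number,
  contribute by their residues.\<close>

lemma annulus_residue:
  assumes r: "0 < r" "r < R" and f: "f meromorphic_on -{0}"
  obtains c where "\<And>\<gamma>. cloop \<gamma> \<Longrightarrow> path_image \<gamma> \<subseteq> annulus r R - {s. is_pole f s} \<Longrightarrow>
    (f has_contour_integral (c * winding_number \<gamma> 0 +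
       2 * of_real pi * \<i> * (\<Sum>s | s \<in> annulus r R \<and> is_pole f s. winding_number \<gamma> s * residue f s))) \<gamma>"
proof -
  define F where "F = {s. s \<in> annulus r R \<and> is_pole f s}"
  define g where "g = remove_sings f"
  have fm: "f meromorphic_on {z}" if "z \<in> annulus r R" for z
    using f by (rule meromorphic_on_subset) (use that r in \<open>auto simp: annulus_def\<close>)
  have "finite {z \<in> cball 0 R - ball 0 r. is_pole f z}"
    by (rule finite_singularities_compact[OF f]) (use r in \<open>auto intro: compact_diff\<close>)
  then have finF: "finite F"
    by (rule rev_finite_subset) (auto simp: F_def annulus_def)
  have "g analytic_on annulus r R - F"
    unfolding g_def analytic_on_analytic_at[of _ "annulus r R - F"]
    using fm by (auto simp: F_def intro!: remove_sings_analytic_at_nonpole)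
  then have holg: "g holomorphic_on annulus r R - F" by (rule analytic_imp_holomorphic)
  have gm: "g meromorphic_on {s}" if "s \<in> F" for s
    unfolding g_def using fm[of s] that by (auto simp: F_def intro: remove_sings_meromorphic)
  obtain P h where P: "\<And>s. s \<in> F \<Longrightarrow> P s holomorphic_on -{s}" and h: "h holomorphic_on annulus r R"
    and gPh: "\<And>z. z \<in> annulus r R - F \<Longrightarrow> g z = h z + (\<Sum>s\<in>F. P s z)"
    by (rule principal_parts[OF open_annulus finF _ holg gm]) (auto simp: F_def)
  have res: "residue (P s) s = residue f s" if s: "s \<in> F" for s
  proof -
    define A where "A = annulus r R - (F - {s})"
    have A: "open A" "s \<in> A" using finF s by (auto simp: A_def F_def finite_imp_closed open_Diff)
    define k where "k = (\<lambda>z. h z + (\<Sum>t\<in>F - {s}. P t z))"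
    have k: "k holomorphic_on A"
      unfolding k_def by (intro holomorphic_intros holomorphic_on_subset[OF h] holomorphic_on_subset[OF P])
        (auto simp: A_def)
    have Ps: "P s holomorphic_on A - {s}" by (rule holomorphic_on_subset[OF P[OF s]]) auto
    have "residue g s = residue (\<lambda>z. k z + P s z) s"
    proof (rule residue_cong)
      have "eventually (\<lambda>z. z \<in> A - {s}) (at s)" using A by (intro eventually_at_in_open)
      then show "eventually (\<lambda>z. g z = k z + P s z) (at s)"
      proof eventually_elim
        case (elim z)
        then have "g z = h z + (\<Sum>t\<in>F. P t z)" using gPh[of z] by (auto simp: A_def)
        also have "(\<Sum>t\<in>F. P t z) = P s z + (\<Sum>t\<in>F - {s}. P t z)" using finF s by (rule sum.remove)
        finally show ?case by (simp add: k_def)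
      qed
    qed simp
    also have "\<dots> = residue k s + residue (P s) s"
      by (rule residue_add[OF A]) (use k Ps in \<open>auto intro: holomorphic_on_subset\<close>)
    also have "residue k s = 0" by (rule residue_holo[OF A k])
    finally show ?thesis
      using residue_remove_sings[OF meromorphic_on_isolated_singularity[OF fm[of s]]] s by (simp add: g_def F_def)
  qed
  obtain c where c: "\<And>\<gamma>. cloop \<gamma> \<Longrightarrow> path_image \<gamma> \<subseteq> annulus r R \<Longrightarrow>
      (h has_contour_integral c * winding_number \<gamma> 0) \<gamma>"
    using annulus_contour_integral[OF r h] by blast
  show ?thesis
  proof (rule that[of c])
    fix \<gamma> assume \<gamma>: "cloop \<gamma>" "path_image \<gamma> \<subseteq> annulus r R - {s. is_pole f s}"
    have "(P s has_contour_integral 2 * of_real pi * \<i> * (winding_number \<gamma> s * residue f s)) \<gamma>" if s: "s \<in> F" for s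
    proof -
      have im: "path_image \<gamma> \<subseteq> -{s}" using \<gamma> s by (auto simp: F_def)
      have "P s contour_integrable_on \<gamma>"
        by (rule contour_integrable_holomorphic_simple[OF P[OF s]]) (use \<gamma> im in \<open>auto simp: cloop_def\<close>)
      moreover have "contour_integral \<gamma> (P s) = 2 * of_real pi * \<i> * (\<Sum>t\<in>{s}. winding_number \<gamma> t * residue (P s) t)"
        using Residue_theorem[of UNIV "{s}" "P s" \<gamma>] \<gamma> im P[OF s] by (auto simp: cloop_def Compl_eq_Diff_UNIV)
      ultimately show ?thesis using res[OF s] has_contour_integral_integral[of "P s" \<gamma>] by simp
    qed
    then have "((\<lambda>z. \<Sum>s\<in>F. P s z) has_contour_integral
        (\<Sum>s\<in>F. 2 * of_real pi * \<i> * (winding_number \<gamma> s * residue f s))) \<gamma>"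
      by (intro has_contour_integral_sum finF)
    then have "((\<lambda>z. h z + (\<Sum>s\<in>F. P s z)) has_contour_integral
        (c * winding_number \<gamma> 0 + (\<Sum>s\<in>F. 2 * of_real pi * \<i> * (winding_number \<gamma> s * residue f s)))) \<gamma>"
      using c[OF \<gamma>(1)] \<gamma>(2) by (intro has_contour_integral_add) auto
    \<comment> \<open>On the path \<open>f\<close> differs from the decomposed function at most at
      singularities of \<open>f\<close>, of which only finitely many lie there.\<close>
    then have hg: "(f has_contour_integral
        (c * winding_number \<gamma> 0 + (\<Sum>s\<in>F. 2 * of_real pi * \<i> * (winding_number \<gamma> s * residue f s)))) \<gamma>"
    proof (rule has_contour_integral_spike[rotated 3])
      show "valid_path \<gamma>" using \<gamma> by (simp add: cloop_def)
      then show "finite {z \<in> path_image \<gamma>. \<not> f analytic_on {z}}"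
        by (intro finite_singularities_compact[OF f] compact_valid_path_image)
           (use \<gamma> in \<open>auto simp: cloop_def\<close>)
      fix z assume z: "z \<in> path_image \<gamma> - {z \<in> path_image \<gamma>. \<not> f analytic_on {z}}"
      then have "g z = f z" by (simp add: g_def)
      moreover have "z \<in> annulus r R - F" using z \<gamma> by (auto simp: F_def)
      ultimately show "h z + (\<Sum>s\<in>F. P s z) = f z" using gPh by simp
    qed
    then show "(f has_contour_integral (c * winding_number \<gamma> 0 +
       2 * of_real pi * \<i> * (\<Sum>s | s \<in> annulus r R \<and> is_pole f s. winding_number \<gamma> s * residue f s))) \<gamma>"
      by (simp add: F_def sum_distrib_left)
  qed
qed

section \<open>Cycles with prescribed winding numbers\<close>

definition cycle :: "(real \<Rightarrow> complex) list \<Rightarrow> bool" where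
  "cycle Cs \<longleftrightarrow> (\<forall>\<gamma>\<in>set Cs. cloop \<gamma>)"

definition cyc_int :: "(real \<Rightarrow> complex) list \<Rightarrow> (complex \<Rightarrow> complex) \<Rightarrow> complex" where
  "cyc_int Cs f = (\<Sum>\<gamma>\<leftarrow>Cs. contour_integral \<gamma> f)"

lemma compact_contour_image: "cycle Cs \<Longrightarrow> compact (contour_image Cs)"
  unfolding contour_image_def cycle_def cloop_def
  by (intro compact_UN compact_valid_path_image) auto

lemma contour_image_nonzero: "cycle Cs \<Longrightarrow> 0 \<notin> contour_image Cs"
  by (auto simp: contour_image_def cycle_def cloop_def)

lemma compact_in_annulus:
  assumes "compact K" "0 \<notin> K"
  obtains r R where "0 < r" "r < R" "K \<subseteq> annulus r R"
proof -
  obtain R where R: "\<And>z. z \<in> K \<Longrightarrow> norm z \<le> R"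
    using compact_imp_bounded[OF assms(1)] by (auto simp: bounded_iff)
  have "open (- K)" using assms(1) compact_imp_closed by blast
  then obtain e where e: "e > 0" "ball 0 e \<subseteq> - K" using assms(2) by (metis ComplI openE)
  show ?thesis
  proof (rule that[of "e / 2" "max R e + 1"])
    show "K \<subseteq> annulus (e / 2) (max R e + 1)"
    proof
      fix z assume z: "z \<in> K"
      then have "norm z \<ge> e" using e(2) by (meson ComplD mem_ball_0 not_le subsetD)
      then show "z \<in> annulus (e / 2) (max R e + 1)" using R[OF z] e(1) by (auto simp: annulus_def)
    qed
  qed (use e in auto)
qed

text \<open>Both cycles lie in one annulus, and their equal winding numbers about 0 cancel the
  unknown constant; so only winding numbers at poles count. \<open>X\<close> collects the points
  that may change sides. It need not be known which of them are poles, since the residue at the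
  others is 0.\<close>

lemma cycle_residue:
  assumes Cs: "cycle Cs" "cycle Cs'" and f: "f meromorphic_on -{0}"
    and av: "\<And>s. is_pole f s \<Longrightarrow> s \<notin> contour_image Cs \<and> s \<notin> contour_image Cs'"
    and W0: "contour_winding Cs' 0 = contour_winding Cs 0"
    and X: "finite X" "0 \<notin> X" "\<And>s. s \<noteq> 0 \<Longrightarrow> is_pole f s \<Longrightarrow> s \<notin> X \<Longrightarrow> contour_winding Cs' s = contour_winding Cs s"
  shows "cyc_int Cs' f = cyc_int Cs f +
    2 * of_real pi * \<i> * (\<Sum>s\<in>X. (contour_winding Cs' s - contour_winding Cs s) * residue f s)"
proof -
  define K where "K = contour_image Cs \<union> contour_image Cs' \<union> X"
  have "compact K" "0 \<notin> K"
    unfolding K_def using compact_contour_image contour_image_nonzero Cs X by (auto intro: finite_imp_compact)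
  then obtain r R where rR: "0 < r" "r < R" and K: "K \<subseteq> annulus r R" by (rule compact_in_annulus)
  define F where "F = {s. s \<in> annulus r R \<and> is_pole f s}"
  have "finite {z \<in> cball 0 R - ball 0 r. is_pole f z}"
    by (rule finite_singularities_compact[OF f]) (use rR in \<open>auto intro: compact_diff\<close>)
  then have finF: "finite F"
    by (rule rev_finite_subset) (auto simp: F_def annulus_def)
  obtain c where c: "\<And>\<gamma>. cloop \<gamma> \<Longrightarrow> path_image \<gamma> \<subseteq> annulus r R - {s. is_pole f s} \<Longrightarrow>
    (f has_contour_integral (c * winding_number \<gamma> 0 +
       2 * of_real pi * \<i> * (\<Sum>s | s \<in> annulus r R \<and> is_pole f s. winding_number \<gamma> s * residue f s))) \<gamma>"
    using annulus_residue[OF rR f] by blast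
  have eq: "cyc_int Ds f = c * contour_winding Ds 0 +
      2 * of_real pi * \<i> * (\<Sum>s\<in>F. contour_winding Ds s * residue f s)"
    if "cycle Ds" "contour_image Ds \<subseteq> annulus r R - {s. is_pole f s}" for Ds
    using that
  proof (induction Ds)
    case Nil
    then show ?case by (simp add: cyc_int_def contour_winding_def)
  next
    case (Cons \<gamma> Ds)
    have "contour_integral \<gamma> f = c * winding_number \<gamma> 0 +
       2 * of_real pi * \<i> * (\<Sum>s\<in>F. winding_number \<gamma> s * residue f s)"
      unfolding F_def by (rule contour_integral_unique[OF c])
        (use Cons.prems in \<open>auto simp: cycle_def contour_image_def\<close>)
    moreover have "cyc_int Ds f = c * contour_winding Ds 0 +
      2 * of_real pi * \<i> * (\<Sum>s\<in>F. contour_winding Ds s * residue f s)"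
      using Cons by (auto simp: cycle_def contour_image_def)
    ultimately show ?case
      by (simp add: cyc_int_def contour_winding_def algebra_simps sum.distrib)
  qed
  have "contour_image Cs \<subseteq> annulus r R - {s. is_pole f s}" "contour_image Cs' \<subseteq> annulus r R - {s. is_pole f s}"
    using K av unfolding K_def by auto
  note eqs = eq[OF Cs(1) this(1)] eq[OF Cs(2) this(2)]
  define D where "D = (\<lambda>s. (contour_winding Cs' s - contour_winding Cs s) * residue f s)"
  have "sum D F = sum D X"
  proof (rule sum.mono_neutral_cong)
    show "D s = 0" if "s \<in> X - F" for s
    proof -
      have "\<not> is_pole f s" "f meromorphic_on {s}"
        using that K X(2) f by (auto simp: F_def K_def intro: meromorphic_on_subset)
      then show ?thesis by (simp add: D_def residue_nonpole)
    qed
    show "D s = 0" if "s \<in> F - X" for s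
    proof -
      have "s \<noteq> 0" using that rR by (auto simp: F_def annulus_def)
      then show ?thesis using that X(3)[of s] by (auto simp: D_def F_def)
    qed
  qed (use finF X in auto)
  moreover have "cyc_int Cs' f - cyc_int Cs f = 2 * of_real pi * \<i> * sum D F"
    unfolding eqs W0 D_def by (simp add: algebra_simps sum_subtractf)
  ultimately show ?thesis by (simp add: D_def algebra_simps)
qed

lemma cycle_integrable:
  assumes "cycle Cs" "f meromorphic_on -{0}" "\<And>s. is_pole f s \<Longrightarrow> s \<notin> contour_image Cs" "\<gamma> \<in> set Cs"
  shows "f contour_integrable_on \<gamma>"
proof -
  obtain r R where rR: "0 < r" "r < R" and K: "contour_image Cs \<subseteq> annulus r R"
    using compact_in_annulus[OF compact_contour_image contour_image_nonzero, OF assms(1,1)] by blast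
  have im: "path_image \<gamma> \<subseteq> annulus r R - {s. is_pole f s}"
    using K assms by (auto simp: contour_image_def)
  have "cloop \<gamma>" using assms by (auto simp: cycle_def)
  show ?thesis
    by (rule annulus_residue[OF rR assms(2)])
       (use \<open>cloop \<gamma>\<close> im in \<open>auto simp: contour_integrable_on_def\<close>)
qed

lemma winding_circlepath_outside:
  assumes "r > 0" "norm (w - z) > r"
  shows "winding_number (circlepath z r) w = 0"
  by (rule winding_number_zero_outside[of _ "cball z r"])
     (use assms in \<open>auto simp: dist_norm norm_minus_commute\<close>)

lemma cloop_circlepath: "r > 0 \<Longrightarrow> norm z \<noteq> r \<Longrightarrow> cloop (circlepath z r)"
  by (auto simp: cloop_def)

text \<open>Close to 0 all points of \<open>Z\<close> belong to \<open>In\<close>. So a small circle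
  about 0 encloses all but finitely many points of \<open>In\<close>, and each of the others gets a
  small circle of its own. That all paths are circles is recorded for the differentiation under the
  integral sign.\<close>

lemma labelled_cycle:
  assumes Z: "Z sparse_in -{0}" "0 \<notin> Z" and In: "In \<subseteq> Z" "\<And>s. s \<in> In \<Longrightarrow> norm s \<le> R0"
    and Out: "r0 > 0" "\<And>s. s \<in> Z - In \<Longrightarrow> norm s \<ge> r0"
  obtains Cs where "cycle Cs" "contour_image Cs \<inter> Z = {}" "contour_winding Cs 0 = 1"
    "\<And>s. s \<in> In \<Longrightarrow> contour_winding Cs s = 1" "\<And>s. s \<in> Z - In \<Longrightarrow> contour_winding Cs s = 0"
    "\<And>\<gamma>. \<gamma> \<in> set Cs \<Longrightarrow> \<exists>z r. r > 0 \<and> \<gamma> = circlepath z r"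
proof -
  have fin: "finite (K \<inter> Z)" if "compact K" "0 \<notin> K" for K
    by (rule sparse_in_compact_finite[OF sparse_in_subset[OF Z(1)] that(1)]) (use that in auto)
  have "finite ((cball 0 (r0 / 2) - ball 0 (r0 / 4)) \<inter> Z)"
    by (rule fin) (use Out in \<open>auto intro: compact_diff\<close>)
  then have "finite (norm ` ((cball 0 (r0 / 2) - ball 0 (r0 / 4)) \<inter> Z))" by blast
  moreover have "infinite {r0 / 4<..<r0 / 2}" using Out(1) by (simp add: infinite_Ioo)
  \<comment> \<open>Only finitely many radii in this interval meet \<open>Z\<close>.\<close>
  ultimately obtain r where r: "r \<in> {r0 / 4<..<r0 / 2}" "r \<notin> norm ` ((cball 0 (r0 / 2) - ball 0 (r0 / 4)) \<inter> Z)"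
    by (meson finite_subset subsetI)
  have rZ: "norm s \<noteq> r" if "s \<in> Z" for s using r that by (auto simp: image_iff)
  have rpos: "r > 0" using r Out by auto
  define F where "F = {s \<in> In. norm s > r}"
  have "finite ((cball 0 R0 - ball 0 r) \<inter> Z)"
    by (rule fin) (use rpos in \<open>auto intro: compact_diff\<close>)
  then have finF: "finite F"
    by (rule rev_finite_subset) (use In in \<open>auto simp: F_def\<close>)
  have "\<exists>e>0. cball s e \<inter> Z \<subseteq> {s} \<and> (\<forall>z\<in>cball s e. norm z > r)" if s: "s \<in> F" for s
  proof -
    have "s \<in> -{0}" using s Z In by (auto simp: F_def)
    then have "\<not> s islimpt Z" using Z(1) sparse_in_open[of "-{0::complex}" Z] by auto
    then obtain e where e: "e > 0" "\<And>z. z \<in> Z \<Longrightarrow> z \<noteq> s \<Longrightarrow> dist z s \<ge> e"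
      unfolding islimpt_approachable by (meson not_le)
    define e' where "e' = min (e / 2) ((norm s - r) / 2)"
    have "norm s > r" using s by (simp add: F_def)
    then have "e' > 0" "e' < e" "e' < norm s - r"
      unfolding e'_def using e(1) by (auto simp: min_def field_simps)
    moreover have "norm z > r" if "z \<in> cball s e'" for z
      using norm_triangle_ineq2[of s z] that \<open>e' < norm s - r\<close> by (auto simp: dist_norm)
    moreover have "z = s" if "z \<in> cball s e'" "z \<in> Z" for z
      using e(2)[OF that(2)] that(1) \<open>e' < e\<close> by (force simp: dist_commute)
    ultimately show ?thesis by (intro exI[of _ e']) auto
  qed
  then obtain e where e: "\<And>s. s \<in> F \<Longrightarrow> e s > 0" "\<And>s. s \<in> F \<Longrightarrow> cball s (e s) \<inter> Z \<subseteq> {s}"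
    "\<And>s z. s \<in> F \<Longrightarrow> z \<in> cball s (e s) \<Longrightarrow> norm z > r" by metis
  obtain xs where xs: "set xs = F" "distinct xs" using finite_distinct_list[OF finF] by blast
  define Cs where "Cs = circlepath 0 r # map (\<lambda>s. circlepath s (e s)) xs"
  have W: "contour_winding Cs z = winding_number (circlepath 0 r) z + (\<Sum>s\<in>F. winding_number (circlepath s (e s)) z)" for z
    using xs by (simp add: Cs_def contour_winding_def o_def sum_list_distinct_conv_sum_set)
  have w0: "winding_number (circlepath 0 r) z = (if norm z < r then 1 else 0)" if "norm z \<noteq> r" for z
    using winding_number_circlepath[of z 0 r] winding_circlepath_outside[OF rpos, of z 0] that by auto
  have ws: "winding_number (circlepath s (e s)) z = 0" if "s \<in> F" "z \<notin> cball s (e s)" for s z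
    using winding_circlepath_outside[OF e(1), of s z s] that by (auto simp: dist_norm norm_minus_commute)
  have sZ: "s \<noteq> 0 \<and> norm s > r \<and> s \<in> Z" if "s \<in> F" for s using that rpos In by (auto simp: F_def)
  show ?thesis
  proof (rule that[of Cs])
    have "cloop (circlepath s (e s))" if s: "s \<in> F" for s
    proof -
      have "0 \<notin> cball s (e s)" using e(3)[OF s, of 0] rpos by auto
      then have "norm s \<noteq> e s" by (auto simp: dist_norm)
      then show ?thesis using e(1)[OF s] by (rule cloop_circlepath[rotated])
    qed
    then show "cycle Cs"
      using rpos xs by (auto simp: cycle_def Cs_def intro!: cloop_circlepath)
    show "contour_image Cs \<inter> Z = {}"
    proof -
      have "z \<notin> Z" if "norm z = r" for z using rZ that by blast
      moreover have "z \<notin> Z" if "s \<in> F" "dist s z = e s" for s z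
      proof
        assume "z \<in> Z"
        then have "z \<in> cball s (e s) \<inter> Z" using that(2) by auto
        then have "z = s" using e(2)[OF that(1)] by auto
        then show False using that(2) e(1)[OF that(1)] by simp
      qed
      ultimately show ?thesis
        using rpos xs e(1) by (auto simp: contour_image_def Cs_def path_image_circlepath sphere_def less_imp_le)
    qed
    have "0 \<notin> cball s (e s)" if s: "s \<in> F" for s
      using e(3)[OF s, of 0] rpos by auto
    then show "contour_winding Cs 0 = 1"
      unfolding W using w0[of 0] ws rpos by (subst sum.neutral) auto
    show "contour_winding Cs s = 1" if s: "s \<in> In" for s
    proof (cases "s \<in> F")
      case False
      then have "norm s < r" using s rZ[of s] In by (auto simp: F_def)
      moreover have "s \<notin> cball t (e t)" if "t \<in> F" for t
        using e(3)[OF that, of s] \<open>norm s < r\<close> by auto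
      ultimately show ?thesis
        unfolding W using w0[of s] ws by (subst sum.neutral) auto
    next
      case True
      have "(\<Sum>t\<in>F. winding_number (circlepath t (e t)) s) = (\<Sum>t\<in>F. if t = s then 1 else 0)"
      proof (intro sum.cong refl)
        fix t assume t: "t \<in> F"
        show "winding_number (circlepath t (e t)) s = (if t = s then 1 else 0)"
        proof (cases "t = s")
          case False
          then have "s \<notin> cball t (e t)" using e(2)[OF t] sZ[OF True] by auto
          then show ?thesis using ws[OF t] False by simp
        qed (use e(1)[OF t] winding_number_circlepath[of s t "e t"] in simp)
      qed
      then show ?thesis unfolding W using w0[of s] sZ[OF True] True finF by (auto simp: F_def)
    qed
    show "contour_winding Cs s = 0" if s: "s \<in> Z - In" for s
    proof -
      have "norm s \<ge> r0" using Out s by auto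
      then have "norm s > r" using r Out by auto
      moreover have "s \<notin> cball t (e t)" if "t \<in> F" for t
        using e(2)[OF that] s that by (auto simp: F_def)
      ultimately show ?thesis unfolding W using w0[of s] ws by (subst sum.neutral) auto
    qed
    show "\<exists>z r. r > 0 \<and> \<gamma> = circlepath z r" if "\<gamma> \<in> set Cs" for \<gamma>
      using that rpos e(1) xs by (auto simp: Cs_def)
  qed
qed

lemma eventually_contour_winding:
  assumes "cycle Cs" "z \<notin> contour_image Cs"
  shows "eventually (\<lambda>w. w \<notin> contour_image Cs \<and> contour_winding Cs w = contour_winding Cs z) (nhds z)"
proof -
  have "open (- contour_image Cs)"
    using compact_imp_closed[OF compact_contour_image[OF assms(1)]] by auto
  then obtain e where e: "e > 0" "ball z e \<subseteq> - contour_image Cs" using assms(2) by (meson ComplI openE)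
  have "winding_number \<gamma> w = winding_number \<gamma> z" if "\<gamma> \<in> set Cs" "w \<in> ball z e" for \<gamma> w
  proof (rule winding_number_eq[of _ _ "ball z e"])
    show "ball z e \<inter> path_image \<gamma> = {}" using e that by (auto simp: contour_image_def)
  qed (use that assms e in \<open>auto simp: cycle_def cloop_def valid_path_imp_path\<close>)
  then have W: "contour_winding Cs w = contour_winding Cs z" if "w \<in> ball z e" for w
    unfolding contour_winding_def using that by (intro arg_cong[of _ _ sum_list] map_cong) auto
  have "eventually (\<lambda>w. w \<in> ball z e) (nhds z)" using e by (intro eventually_nhds_in_open) auto
  then show ?thesis by (rule eventually_mono) (use e W in blast)
qed

lemma contour_winding_far:
  assumes "cycle Cs"
  obtains R where "\<And>z. norm z \<ge> R \<Longrightarrow> z \<notin> contour_image Cs \<and> contour_winding Cs z = 0"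
proof -
  have "\<exists>R. \<forall>z. norm z \<ge> R \<longrightarrow> z \<notin> contour_image Cs \<and> contour_winding Cs z = 0"
    using assms
  proof (induction Cs)
    case Nil
    then show ?case by (auto simp: contour_image_def contour_winding_def)
  next
    case (Cons \<gamma> Cs)
    then obtain R where R: "\<And>z. norm z \<ge> R \<Longrightarrow> z \<notin> contour_image Cs \<and> contour_winding Cs z = 0"
      by (auto simp: cycle_def)
    have \<gamma>: "path \<gamma>" "pathfinish \<gamma> = pathstart \<gamma>"
      using Cons by (auto simp: cycle_def cloop_def valid_path_imp_path)
    obtain B where B: "\<And>z. norm z \<ge> B \<Longrightarrow> winding_number \<gamma> z = 0"
      using winding_number_zero_at_infinity[OF \<gamma>] by blast
    obtain B' where B': "\<And>z. z \<in> path_image \<gamma> \<Longrightarrow> norm z \<le> B'"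
      using compact_imp_bounded[OF compact_path_image[OF \<gamma>(1)]] by (auto simp: bounded_iff)
    show ?case
      using R B B' by (intro exI[of _ "max R (max B (B' + 1))"])
        (fastforce simp: contour_image_def contour_winding_def)
  qed
  then show ?thesis using that by blast
qed

lemma contour_winding_near:
  assumes "cycle Cs"
  obtains r where "r > 0" "\<And>z. norm z < r \<Longrightarrow> z \<notin> contour_image Cs \<and> contour_winding Cs z = contour_winding Cs 0"
  using eventually_contour_winding[OF assms contour_image_nonzero[OF assms]]
  by (auto simp: eventually_nhds_metric)

text \<open>Leibniz rule: kernel and derivative are jointly continuous, and the explicit
  parametrization of a circle makes the integrand continuous in its real variable.\<close>

lemma circlepath_param_holomorphic:
  assumes U: "open U" "convex U" and r: "r > 0"
    and g: "continuous_on (sphere z r) g"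
    and k: "\<And>v s. v \<in> U \<Longrightarrow> s \<in> sphere z r \<Longrightarrow> ((\<lambda>v. k v s) has_field_derivative k' v s) (at v)"
    and kc: "continuous_on (U \<times> sphere z r) (\<lambda>(v, s). k v s)"
    and k'c: "continuous_on (U \<times> sphere z r) (\<lambda>(v, s). k' v s)"
  shows "(\<lambda>v. contour_integral (circlepath z r) (\<lambda>s. g s * k v s)) holomorphic_on U"
proof -
  define c where "c = (\<lambda>t. z + of_real r * exp (2 * of_real pi * \<i> * of_real t))"
  define c' where "c' = (\<lambda>t. 2 * of_real pi * \<i> * of_real r * exp (2 * of_real pi * \<i> * of_real t))"
  have cs: "c t \<in> sphere z r" for t :: real
    using r by (simp add: c_def dist_norm norm_mult)
  have cc: "continuous_on S c" and c'c: "continuous_on S c'" for S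
    unfolding c_def c'_def by (intro continuous_intros)+
  have gc: "continuous_on S (\<lambda>t. g (c t) * c' t)" for S
    by (intro continuous_intros c'c continuous_on_compose2[OF g cc]) (use cs in auto)
  have eq: "contour_integral (circlepath z r) (\<lambda>s. g s * k v s) =
      integral (cbox 0 1) (\<lambda>t. (g (c t) * c' t) * k v (c t))" for v
    unfolding contour_integral_integral cbox_interval
    by (intro integral_cong) (simp add: vector_derivative_circlepath, simp add: circlepath c_def c'_def)
  show ?thesis
    unfolding eq
  proof (rule leibniz_rule_holomorphic[where fx = "\<lambda>v t. (g (c t) * c' t) * k' v (c t)"])
    show "((\<lambda>v. g (c t) * c' t * k v (c t)) has_field_derivative g (c t) * c' t * k' v (c t)) (at v within U)"
      if "v \<in> U" for v t
      using has_field_derivative_at_within[OF DERIV_cmult[OF k[OF that cs[of t]]]] by simp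
    show "(\<lambda>t. g (c t) * c' t * k v (c t)) integrable_on cbox 0 1" if "v \<in> U" for v
    proof -
      have "continuous_on (cbox 0 1) (\<lambda>t. (v, c t))" by (intro continuous_on_Pair continuous_on_const cc)
      then have "continuous_on (cbox 0 1) (\<lambda>t. case (v, c t) of (v, s) \<Rightarrow> k v s)"
        by (rule continuous_on_compose2[OF kc]) (use that cs in auto)
      then have "continuous_on (cbox 0 1) (\<lambda>t. k v (c t))" by simp
      then show ?thesis by (intro integrable_continuous continuous_on_mult gc)
    qed
    have "continuous_on (U \<times> cbox 0 1) (\<lambda>x. (fst x, c (snd x)))"
      by (intro continuous_on_Pair continuous_on_fst continuous_on_id
          continuous_on_compose2[OF cc continuous_on_snd]) auto
    then have "continuous_on (U \<times> cbox 0 1) (\<lambda>x. case (fst x, c (snd x)) of (v, s) \<Rightarrow> k' v s)"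
      by (rule continuous_on_compose2[OF k'c]) (use cs in auto)
    moreover have "continuous_on (U \<times> cbox 0 1) (\<lambda>x. g (c (snd x)) * c' (snd x))"
      by (rule continuous_on_compose2[OF gc[of UNIV] continuous_on_snd]) (auto intro: continuous_on_id)
    ultimately have "continuous_on (U \<times> cbox 0 1) (\<lambda>x. g (c (snd x)) * c' (snd x) * k' (fst x) (c (snd x)))"
      by (auto intro: continuous_on_mult)
    then show "continuous_on (U \<times> cbox 0 1) (\<lambda>(v, t). g (c t) * c' t * k' v (c t))"
      unfolding case_prod_unfold .
  qed fact
qed

section \<open>Cycle integrals of Cauchy kernels\<close>

lemma limit_not_pole: "f \<midarrow>z\<rightarrow> L \<Longrightarrow> \<not> is_pole f (z::complex)" for L :: complex
  unfolding is_pole_def using not_tendsto_and_filterlim_at_infinity[of "at z" f L] by auto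

lemma analytic_at_tendsto: "f analytic_on {z} \<Longrightarrow> f \<midarrow>z\<rightarrow> f z"
  using analytic_at_imp_isCont isContD by blast

lemma analytic_punctured:
  "f analytic_on -{0} \<Longrightarrow> z \<noteq> 0 \<Longrightarrow> f analytic_on {z}"
  by (meson ComplI analytic_on_subset empty_subsetI insert_subset singletonD)

lemma analytic_punctured_iff: "f holomorphic_on -{0} \<longleftrightarrow> f analytic_on -{0::complex}"
  by (subst analytic_on_open) auto

context nome
begin

text \<open>Here the exact value is needed and not only that it is nonzero: it is a meromorphic
  function of \<open>x\<close>, which makes the residues of the Cauchy kernel meromorphic in its
  parameter.\<close>

lemma psi_deriv_fam:
  assumes "x \<noteq> 0"
  shows "(psi p x has_field_derivative
    - deriv (theta p) (p powi (-i)) * theta p (x\<^sup>2 * p powi i) / (x * p powi i)\<^sup>2) (at (x * p powi i))"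
proof -
  define z where "z = x * p powi i"
  have z0: "z \<noteq> 0" using assms p by (simp add: z_def)
  have xz: "x / z = p powi (-i)" using assms p by (simp add: z_def power_int_minus field_simps)
  have xz2: "x * z = x\<^sup>2 * p powi i" by (simp add: z_def power2_eq_square)
  have "((\<lambda>w. theta p (x / w)) has_field_derivative deriv (theta p) (x / z) * (- x / z\<^sup>2)) (at z)"
    using assms z0 by (intro DERIV_chain2[OF theta_field_differentiable])
      (auto intro!: derivative_eq_intros simp: power2_eq_square)
  moreover have "((\<lambda>w. inverse x * theta p (x * w)) has_field_derivative
      deriv (\<lambda>w. inverse x * theta p (x * w)) z) (at z)"
    using assms z0 p by (intro holomorphic_derivI[of _ "-{0}"])
      (auto intro!: holomorphic_intros holomorphic_theta simp: open_delete)
  ultimately have "((\<lambda>w. inverse x * theta p (x * w) * theta p (x / w)) has_field_derivative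
      deriv (\<lambda>w. inverse x * theta p (x * w)) z * theta p (x / z) +
      deriv (theta p) (x / z) * (- x / z\<^sup>2) * (inverse x * theta p (x * z))) (at z)"
    by (rule DERIV_mult[rotated])
  moreover have "theta p (x / z) = 0" using theta_eq_0_iff[OF p, of "x / z"] assms z0 xz by (metis divide_eq_0_iff)
  ultimately have "(psi p x has_field_derivative
      deriv (theta p) (x / z) * (- x / z\<^sup>2) * (inverse x * theta p (x * z))) (at z)"
    by (simp add: psi_def[abs_def] mult.assoc)
  moreover have "deriv (theta p) (x / z) * (- x / z\<^sup>2) * (inverse x * theta p (x * z)) =
      - deriv (theta p) (p powi (-i)) * theta p (x\<^sup>2 * p powi i) / z\<^sup>2"
    using assms unfolding xz xz2 by simp
  ultimately show ?thesis by (simp only: z_def)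
qed

text \<open>The points v p^i and p^i / v with integral i. One half of them has to lie inside the
  contour when \<open>v\<close> and \<open>p / v\<close> are among the parameters.\<close>

definition fam :: "complex \<Rightarrow> complex set" where
  "fam v = {z. z \<noteq> 0 \<and> psi p v z = 0}"

lemma fam_iff: "v \<noteq> 0 \<Longrightarrow> z \<in> fam v \<longleftrightarrow> (\<exists>i::int. z = v * p powi i \<or> z = p powi i / v)"
  unfolding fam_def using psi_eq_0_iff[of v z] p by auto

lemma fam_nonzero: "0 \<notin> fam v" by (simp add: fam_def)

lemma fam_inverse: "v \<noteq> 0 \<Longrightarrow> fam (1 / v) = fam v"
  by (auto simp: fam_def psi_inverse1)

lemma psi_analytic: "v \<noteq> 0 \<Longrightarrow> psi p v analytic_on -{0}"
  unfolding analytic_punctured_iff[symmetric] by (auto intro!: holomorphic_psi holomorphic_intros)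

lemma psi_analytic1: "v \<noteq> 0 \<Longrightarrow> (\<lambda>x. psi p x v) analytic_on -{0}"
  unfolding analytic_punctured_iff[symmetric] by (auto intro!: holomorphic_psi holomorphic_intros)

lemma eventually_psi_nonzero:
  assumes "x \<noteq> 0" "z \<noteq> 0"
  shows "eventually (\<lambda>z. psi p x z \<noteq> 0) (at z)" "eventually (\<lambda>z. psi p z x \<noteq> 0) (at z)"
proof -
  have 1: "eventually (\<lambda>z. z \<in> -{0}) (at z)"
    using assms by (intro eventually_at_in_open') auto
  have 2: "eventually (\<lambda>z. theta p (x * z ^ 1) \<noteq> 0) (at z)"
    and 3: "eventually (\<lambda>z. theta p (1 / x * z ^ 1) \<noteq> 0) (at z)"
    by (rule eventually_theta_nonzero; use assms in simp)+
  from 1 2 3 have ev: "eventually (\<lambda>z. z \<noteq> 0 \<and> psi p x z \<noteq> 0) (at z)"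
  proof eventually_elim
    case (elim z)
    have "theta p (1 / (z / x)) = - theta p (z / x) / (z / x)"
      by (rule theta_inverse) (use p assms elim in auto)
    then show ?case using elim assms by (simp add: psi_def)
  qed
  show "eventually (\<lambda>z. psi p x z \<noteq> 0) (at z)" using ev by (rule eventually_mono) auto
  show "eventually (\<lambda>z. psi p z x \<noteq> 0) (at z)"
    using ev
  proof eventually_elim
    case (elim z)
    then show ?case using assms psi_antisym[of x z] by simp
  qed
qed

lemma fam_sparse: "v \<noteq> 0 \<Longrightarrow> fam v sparse_in -{0}"
  by (subst sparse_in_eventually_iff)
     (auto simp: fam_def intro: eventually_mono[OF eventually_psi_nonzero(1)])

text \<open>The Cauchy kernel: adjoining the parameters \<open>v\<close> and \<open>p / v\<close> to
  the weight \<open>g\<close> divides it by v psi(v, s); the factor 1 / s is that of the measure ds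
  / s.\<close>

definition ker :: "(complex \<Rightarrow> complex) \<Rightarrow> complex \<Rightarrow> complex \<Rightarrow> complex" where
  "ker g v = (\<lambda>s. g s / (s * psi p v s))"

lemma ker_inverse: "v \<noteq> 0 \<Longrightarrow> s \<noteq> 0 \<Longrightarrow> ker g (1 / v) s = ker g v s"
  by (simp add: ker_def psi_inverse1)

lemma meromorphic_ker:
  "g meromorphic_on -{0} \<Longrightarrow> v \<noteq> 0 \<Longrightarrow> ker g v meromorphic_on -{0}"
  unfolding ker_def by (intro meromorphic_intros analytic_on_imp_meromorphic_on[OF psi_analytic]) auto

lemma ker_not_pole:
  assumes "g meromorphic_on -{0}" "v \<noteq> 0" "s \<noteq> 0" "\<not> is_pole g s" "s \<notin> fam v"
  shows "\<not> is_pole (ker g v) s"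
proof -
  have "g meromorphic_on {s}" using assms by (auto intro: meromorphic_on_subset)
  then obtain L where "g \<midarrow>s\<rightarrow> L" using not_pole_limit assms(4) by blast
  moreover have "psi p v \<midarrow>s\<rightarrow> psi p v s"
    using assms by (intro analytic_at_tendsto analytic_punctured psi_analytic)
  ultimately have "ker g v \<midarrow>s\<rightarrow> L / (s * psi p v s)"
    unfolding ker_def using assms by (intro tendsto_intros) (auto simp: fam_def)
  then show ?thesis by (rule limit_not_pole)
qed

lemma ker_analytic:
  assumes "g analytic_on {s}" "v \<noteq> 0" "s \<noteq> 0" "s \<notin> fam v"
  shows "ker g v analytic_on {s}"
  unfolding ker_def using assms
  by (intro analytic_intros analytic_punctured[OF psi_analytic]) (auto simp: fam_def)

lemma ker_pole_g:
  assumes "g meromorphic_on -{0}" "v \<noteq> 0" "s \<noteq> 0" "is_pole g s"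
  shows "is_pole (ker g v) s"
proof (rule ccontr)
  assume "\<not> is_pole (ker g v) s"
  moreover have "ker g v meromorphic_on {s}"
    using meromorphic_ker[OF assms(1,2)] by (rule meromorphic_on_subset) (use assms in auto)
  ultimately obtain L where "ker g v \<midarrow>s\<rightarrow> L" using not_pole_limit by blast
  moreover have "psi p v \<midarrow>s\<rightarrow> psi p v s"
    using assms by (intro analytic_at_tendsto analytic_punctured psi_analytic)
  ultimately have "(\<lambda>w. ker g v w * (w * psi p v w)) \<midarrow>s\<rightarrow> L * (s * psi p v s)"
    by (intro tendsto_intros)
  moreover have "eventually (\<lambda>w. ker g v w * (w * psi p v w) = g w) (at s)"
  proof -
    have "eventually (\<lambda>w. psi p v w \<noteq> 0) (at s)" "eventually (\<lambda>w. w \<in> -{0}) (at s)"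
      using assms by (auto intro!: eventually_psi_nonzero eventually_at_in_open' simp del: Compl_iff)
    then show ?thesis by eventually_elim (simp add: ker_def)
  qed
  ultimately have "g \<midarrow>s\<rightarrow> L * (s * psi p v s)" by (rule Lim_transform_eventually)
  then show False using limit_not_pole assms(4) by blast
qed

text \<open>The residue of \<open>ker g v\<close> at v p^i, written as a function of
  \<open>v\<close>. The residue at p^i / v is the same function at 1 / v.\<close>

definition rterm :: "(complex \<Rightarrow> complex) \<Rightarrow> int \<Rightarrow> complex \<Rightarrow> complex" where
  "rterm g i v = - (g (v * p powi i) * (v * p powi i) / (theta p (v\<^sup>2 * p powi i) * deriv (theta p) (p powi (-i))))"

lemma theta_square_fam:
  assumes "v \<noteq> 0"
  shows "theta p (v\<^sup>2 * p powi i) = 0 \<longleftrightarrow> theta p (v\<^sup>2) = 0"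
proof -
  obtain c k where "c \<noteq> 0" "\<And>z. z \<noteq> 0 \<Longrightarrow> theta p (p powi i * z) = c * z powi k * theta p z"
    using theta_pow[OF p, of i] by metis
  then show ?thesis using assms by (simp add: mult.commute[of _ "p powi i"])
qed

lemma residue_ker:
  assumes g: "g analytic_on {v * p powi i}" and v: "v \<noteq> 0" "theta p (v\<^sup>2) \<noteq> 0"
  shows "residue (ker g v) (v * p powi i) = rterm g i v"
proof -
  define s where "s = v * p powi i"
  have s: "s \<noteq> 0" using v p by (simp add: s_def)
  define D where "D = - deriv (theta p) (p powi (-i)) * theta p (v\<^sup>2 * p powi i) / s\<^sup>2"
  have D: "(psi p v has_field_derivative D) (at s)"
    using psi_deriv_fam[OF v(1), of i] by (simp add: s_def D_def)
  have D0: "D \<noteq> 0" using deriv_theta_nonzero v s theta_square_fam by (simp add: D_def)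
  have ps: "psi p v s = 0" using psi_eq_0_iff[OF v(1) s] by (auto simp: s_def)
  obtain U where U: "open U" "s \<in> U" "g holomorphic_on U" using g by (auto simp: s_def analytic_at)
  have "eventually (\<lambda>w. w \<in> U \<and> w \<noteq> 0 \<and> psi p v w \<noteq> 0) (at s)"
  proof -
    have "eventually (\<lambda>w. psi p v w \<noteq> 0) (at s)" "eventually (\<lambda>w. w \<in> -{0}) (at s)" "eventually (\<lambda>w. w \<in> U) (at s)"
      using v s U by (auto intro!: eventually_psi_nonzero eventually_at_in_open' simp del: Compl_iff)
    then show ?thesis by eventually_elim auto
  qed
  then obtain e where e: "e > 0" "\<And>w. w \<noteq> s \<Longrightarrow> dist w s < e \<Longrightarrow> w \<in> U \<and> w \<noteq> 0 \<and> psi p v w \<noteq> 0"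
    by (auto simp: eventually_at)
  have "residue (ker g v) s = g s / s * (1 / D)"
  proof (rule residue_simple'[of "ball s e"])
    have "ball s e - {s} \<subseteq> U" "ball s e - {s} \<subseteq> -{0}" using e(2) s by (force simp: dist_commute)+
    then show "ker g v holomorphic_on ball s e - {s}"
      unfolding ker_def using e v
      by (intro holomorphic_intros holomorphic_on_subset[OF U(3)] holomorphic_psi) (auto simp: dist_commute)
    have "(\<lambda>w. (w - s) / psi p v w) \<midarrow>s\<rightarrow> 1 / D"
      by (rule lhopital_complex_simple[OF _ D _ ps D0]) (auto intro!: derivative_eq_intros)
    moreover have "(\<lambda>w. g w / w) \<midarrow>s\<rightarrow> g s / s"
      using s analytic_at_tendsto[OF g] by (intro tendsto_intros) (auto simp: s_def)
    ultimately have "(\<lambda>w. g w / w * ((w - s) / psi p v w)) \<midarrow>s\<rightarrow> g s / s * (1 / D)"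
      by (intro tendsto_mult)
    then show "(\<lambda>w. ker g v w * (w - s)) \<midarrow>s\<rightarrow> g s / s * (1 / D)"
      by (simp add: ker_def mult_ac)
  qed (use e in auto)
  also have "\<dots> = rterm g i v"
    using s p v by (simp add: D_def rterm_def s_def power2_eq_square)
  finally show ?thesis by (simp add: s_def)
qed

lemma residue_cong_punctured:
  assumes "s \<noteq> (0::complex)" "\<And>w. w \<noteq> 0 \<Longrightarrow> f w = g w"
  shows "residue f s = residue g s"
proof (rule residue_cong)
  have "eventually (\<lambda>w. w \<in> -{0}) (at s)" using assms by (intro eventually_at_in_open') auto
  then show "eventually (\<lambda>w. f w = g w) (at s)" by eventually_elim (use assms in auto)
qed simp

lemma residue_ker_inverse:
  assumes g: "g analytic_on {p powi i / v}" and v: "v \<noteq> 0" "theta p (v\<^sup>2) \<noteq> 0"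
  shows "residue (ker g v) (p powi i / v) = rterm g i (1 / v)"
proof -
  have "residue (ker g v) (p powi i / v) = residue (ker g (1 / v)) (p powi i / v)"
    using v p by (intro residue_cong_punctured) (auto simp: ker_inverse)
  also have "\<dots> = rterm g i (1 / v)"
    using residue_ker[of g "1 / v" i] v g theta_inverse[OF p(1), of "v\<^sup>2"] by (simp add: power_divide)
  finally show ?thesis .
qed

text \<open>\<open>lab\<close> says on which side the poles of \<open>g\<close> lie. Of the poles of
  the kernel, p^i v and p^i (p / v) with i \<ge> 0 lie inside, hence the bound 1 for the exponents
  in p^i / v. By the residue theorem these data determine the integral.\<close>

definition good :: "(complex \<Rightarrow> complex) \<Rightarrow> (complex \<Rightarrow> complex) \<Rightarrow> complex \<Rightarrow> (real \<Rightarrow> complex) list \<Rightarrow> bool" where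
  "good g lab v Cs \<longleftrightarrow> cycle Cs \<and> contour_winding Cs 0 = 1 \<and>
     contour_image Cs \<inter> (fam v \<union> {s. \<not> g analytic_on {s}}) = {} \<and>
     (\<forall>s. s \<noteq> 0 \<longrightarrow> is_pole g s \<longrightarrow> contour_winding Cs s = lab s) \<and>
     (\<forall>i::int. contour_winding Cs (v * p powi i) = of_bool (i \<ge> 0) \<and>
               contour_winding Cs (p powi i / v) = of_bool (i \<ge> 1))"

lemma powi_small:
  assumes "e > 0"
  obtains N :: int where "N > 0" "\<And>i. i > N \<Longrightarrow> norm (p powi i) < e"
proof -
  obtain n where n: "norm p ^ n < e" using real_arch_pow_inv[of e "norm p"] assms p by auto
  show ?thesis
  proof (rule that[of "int n + 1"])
    fix i assume i: "i > int n + 1"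
    then have "norm (p powi i) = norm p ^ nat i" by (simp add: power_int_def norm_power)
    also have "\<dots> \<le> norm p ^ n" using i p by (intro power_decreasing) auto
    finally show "norm (p powi i) < e" using n by simp
  qed auto
qed

lemma powi_large:
  obtains N :: int where "N > 0" "\<And>i. i < -N \<Longrightarrow> norm (p powi i) > e"
proof -
  define e' where "e' = max e 1"
  obtain N :: int where N: "N > 0" "\<And>i. i > N \<Longrightarrow> norm (p powi i) < 1 / e'"
    by (rule powi_small[of "1 / e'"]) (auto simp: e'_def)
  show ?thesis
  proof (rule that[OF N(1)])
    fix i assume "i < -N"
    then have "norm (p powi (-i)) < 1 / e'" using N(2)[of "-i"] by simp
    then have "1 / norm (p powi i) < 1 / e'" by (simp add: power_int_minus norm_inverse divide_inverse)
    then have "norm (p powi i) > e'" using p by (simp add: field_simps e'_def split: if_splits) 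
    then show "norm (p powi i) > e" by (simp add: e'_def)
  qed
qed

lemma powi_inj: "p powi i = p powi j \<Longrightarrow> i = j"
proof (rule ccontr)
  have *: False if "p powi i = p powi j" "i < j" for i j
  proof -
    have "p powi (j - i) = 1" using that p by (simp add: power_int_diff)
    moreover have "norm (p powi (j - i)) < 1"
      using that p by (simp add: power_int_def norm_power power_less_one_iff)
    ultimately show False by simp
  qed
  assume "p powi i = p powi j" "i \<noteq> j"
  then show False using *[of i j] *[of j i] by force
qed


lemma fam_inj:
  assumes "v \<noteq> 0" "theta p (v\<^sup>2) \<noteq> 0"
  shows "v * p powi i = v * p powi j \<Longrightarrow> i = j" "p powi i / v = p powi j / v \<Longrightarrow> i = j"
    "v * p powi i \<noteq> p powi j / v"
proof -
  show "v * p powi i = v * p powi j \<Longrightarrow> i = j" "p powi i / v = p powi j / v \<Longrightarrow> i = j"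
    using assms powi_inj by auto
  show "v * p powi i \<noteq> p powi j / v"
  proof
    assume "v * p powi i = p powi j / v"
    then have "v\<^sup>2 = p powi (j - i)" using assms p by (simp add: power2_eq_square power_int_diff field_simps)
    then show False using assms theta_eq_0_iff[OF p, of "v\<^sup>2"] by (metis zero_eq_power2)
  qed
qed

lemma good_cycle_residue:
  assumes g: "g meromorphic_on -{0}" and v: "v \<noteq> 0" and Cs: "cycle Cs" "contour_winding Cs 0 = 1"
    and good: "good g lab v Cs'"
    and av: "\<And>s. s \<noteq> 0 \<Longrightarrow> is_pole (ker g v) s \<Longrightarrow> s \<notin> contour_image Cs"
    and X: "finite X" "0 \<notin> X" "\<And>s. s \<noteq> 0 \<Longrightarrow> is_pole (ker g v) s \<Longrightarrow> s \<notin> X \<Longrightarrow> contour_winding Cs' s = contour_winding Cs s"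
  shows "cyc_int Cs' (ker g v) = cyc_int Cs (ker g v) +
    2 * of_real pi * \<i> * (\<Sum>s\<in>X. (contour_winding Cs' s - contour_winding Cs s) * residue (ker g v) s)"
proof (rule cycle_residue)
  show "ker g v meromorphic_on -{0}" by (rule meromorphic_ker) fact+
  fix s assume s: "is_pole (ker g v) s"
  show "s \<notin> contour_image Cs \<and> s \<notin> contour_image Cs'"
  proof (cases "s = 0")
    case True
    then show ?thesis using contour_image_nonzero Cs good by (auto simp: good_def)
  next
    case False
    then have "is_pole g s \<or> s \<in> fam v" using ker_not_pole[OF g v] s by blast
    then have "s \<notin> contour_image Cs'" using good by (auto simp: good_def dest: analytic_at_imp_no_pole)
    then show ?thesis using av[OF False s] by blast
  qed
qed (use assms in \<open>auto simp: good_def\<close>)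

text \<open>Makes an integral over a cycle picked by \<open>SOME\<close> independent of the
  choice.\<close>

lemma good_unique:
  assumes g: "g meromorphic_on -{0}" and v: "v \<noteq> 0" and good: "good g lab v Cs" "good g lab v Cs'"
  shows "cyc_int Cs' (ker g v) = cyc_int Cs (ker g v)"
proof -
  have "cyc_int Cs' (ker g v) = cyc_int Cs (ker g v) +
    2 * of_real pi * \<i> * (\<Sum>s\<in>{}. (contour_winding Cs' s - contour_winding Cs s) * residue (ker g v) s)"
  proof (rule good_cycle_residue[OF g v _ _ good(2)])
    fix s assume s: "s \<noteq> 0" "is_pole (ker g v) s"
    then have *: "is_pole g s \<or> s \<in> fam v" using ker_not_pole[OF g v] by blast
    then show "s \<notin> contour_image Cs" using good(1) by (auto simp: good_def dest: analytic_at_imp_no_pole)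
    show "contour_winding Cs' s = contour_winding Cs s"
      using * good s(1) by (auto simp: good_def fam_iff[OF v])
  qed (use good in \<open>auto simp: good_def\<close>)
  then show ?thesis by simp
qed

section \<open>Replacing a moving cycle by a fixed one\<close>

lemma eventually_nonan:
  assumes "g meromorphic_on -{0}" "z \<noteq> 0"
  shows "eventually (\<lambda>w. g analytic_on {w}) (at z)"
  using meromorphic_on_imp_sparse_singularities[OF assms(1)] assms(2)
  by (subst (asm) sparse_in_eventually_iff) auto

text \<open>Uniformly for \<open>v\<close> close to \<open>v0\<close>, all but finitely many members
  of the two families are either tiny or huge. This reduces the infinitely many poles of the kernel
  to a fixed finite range of exponents.\<close>

lemma fam_far:
  assumes v0: "v0 \<noteq> 0" and r: "r > 0"
  obtains N :: int where "N > 0"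
    "\<And>v i. norm v0 / 2 < norm v \<Longrightarrow> norm v < 2 * norm v0 \<Longrightarrow> i > N \<Longrightarrow> norm (v * p powi i) < r \<and> norm (p powi i / v) < r"
    "\<And>v i. norm v0 / 2 < norm v \<Longrightarrow> norm v < 2 * norm v0 \<Longrightarrow> i < -N \<Longrightarrow> norm (v * p powi i) > R \<and> norm (p powi i / v) > R"
proof -
  define a where "a = norm v0"
  have a: "a > 0" using v0 by (simp add: a_def)
  have "min (r / (2 * a)) (r * a / 2) > 0" using r a by simp
  then obtain N1 :: int where N1: "N1 > 0" "\<And>i. i > N1 \<Longrightarrow> norm (p powi i) < min (r / (2 * a)) (r * a / 2)"
    by (rule powi_small) blast
  obtain N2 :: int where N2: "N2 > 0" "\<And>i. i < -N2 \<Longrightarrow> norm (p powi i) > max (max (R * 2 / a) (R * (2 * a))) 0"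
    by (rule powi_large) blast
  show ?thesis
  proof (rule that[of "max N1 N2", folded a_def])
    show "max N1 N2 > 0" using N1 by simp
    fix v :: complex and i :: int assume v: "a / 2 < norm v" "norm v < 2 * a"
    have v': "norm v > 0" using v a by linarith
    show "norm (v * p powi i) < r \<and> norm (p powi i / v) < r" if "i > max N1 N2"
    proof -
      have "norm (p powi i) * (2 * a) < r" "norm (p powi i) < r * (a / 2)"
        using N1(2)[of i] that a by (simp_all add: field_simps)
      moreover have "norm v * norm (p powi i) \<le> 2 * a * norm (p powi i)" "r * (a / 2) \<le> r * norm v"
        using v r by (auto intro: mult_right_mono)
      ultimately show ?thesis using v' by (simp add: norm_mult norm_divide field_simps)
    qed
    show "norm (v * p powi i) > R \<and> norm (p powi i / v) > R" if "i < - max N1 N2"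
    proof -
      have "R < norm (p powi i) * (a / 2)" "R < norm (p powi i) / (2 * a)"
        using N2(2)[of i] that a by (simp_all add: field_simps)
      moreover have "norm (p powi i) * (a / 2) \<le> norm (p powi i) * norm v" "norm (p powi i) / (2 * a) \<le> norm (p powi i) / norm v"
        using mult_left_mono[of "a / 2" "norm v" "norm (p powi i)"] v v' by (auto intro: divide_left_mono)
      ultimately show ?thesis by (auto simp: norm_mult norm_divide mult.commute)
    qed
  qed
qed

lemma eventually_fam_analytic:
  assumes g: "g meromorphic_on -{0}" and v0: "v0 \<noteq> 0"
  shows "eventually (\<lambda>v. g analytic_on {v * p powi i} \<and> g analytic_on {p powi i / v}) (at v0)"
proof -
  have "filterlim (\<lambda>v. v * p powi i) (at (v0 * p powi i)) (at v0)"
    "filterlim (\<lambda>v. p powi i / v) (at (p powi i / v0)) (at v0)"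
    using v0 p by (auto simp: filterlim_at eventually_at_filter field_simps intro!: tendsto_intros)
  then show ?thesis
    using eventually_compose_filterlim[OF eventually_nonan[OF g], of "v0 * p powi i"]
      eventually_compose_filterlim[OF eventually_nonan[OF g], of "p powi i / v0"] v0 p by (intro eventually_conj) auto
qed

lemma eventually_norm_bounds:
  assumes "v0 \<noteq> 0"
  shows "eventually (\<lambda>v::complex. norm v0 / 2 < norm v \<and> norm v < 2 * norm v0) (at v0)"
  using assms by (intro eventually_conj order_tendstoD[of _ "norm v0"]) (auto intro!: tendsto_intros)

text \<open>The integral over a cycle \<open>G\<close> that stays fixed while \<open>v\<close>
  moves, corrected by the residues at those members of the families that \<open>G\<close> has on the
  wrong side. The winding numbers are taken at \<open>v0\<close>; the residues vary with
  \<open>v\<close>.\<close>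

abbreviation (input) crossed where
  "crossed g G N v0 v \<equiv> cyc_int G (ker g v) + 2 * of_real pi * \<i> * (\<Sum>i\<in>{-N..N}.
    (of_bool (i \<ge> 0) - contour_winding G (v0 * p powi i)) * rterm g i v +
    (of_bool (i \<ge> 1) - contour_winding G (p powi i / v0)) * rterm g i (1 / v))"

text \<open>For \<open>v\<close> near \<open>v0\<close> the members of the families stay on the side
  of \<open>G\<close> on which they are at \<open>v0\<close>. A good cycle, which moves with
  \<open>v\<close>, therefore differs from \<open>G\<close> by finitely many residues with constant
  coefficients. The point \<open>v0\<close> itself is excluded: there a member may meet a
  singularity of \<open>g\<close>, or the two families may coincide.\<close>

lemma decomposition:
  assumes g: "g meromorphic_on -{0}" and v0: "v0 \<noteq> 0"
    and G: "cycle G" "contour_winding G 0 = 1" "contour_image G \<inter> (fam v0 \<union> {s. \<not> g analytic_on {s}}) = {}"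
    and labG: "\<And>s. s \<noteq> 0 \<Longrightarrow> is_pole g s \<Longrightarrow> contour_winding G s = lab s"
  obtains N :: int where "eventually (\<lambda>v. \<forall>Cs. good g lab v Cs \<longrightarrow>
    cyc_int Cs (ker g v) = crossed g G N v0 v) (at v0)"
proof -
  obtain R where R: "\<And>z. norm z \<ge> R \<Longrightarrow> z \<notin> contour_image G \<and> contour_winding G z = 0"
    by (rule contour_winding_far[OF G(1)]) blast
  obtain r where r: "r > 0" "\<And>z. norm z < r \<Longrightarrow> z \<notin> contour_image G \<and> contour_winding G z = contour_winding G 0"
    by (rule contour_winding_near[OF G(1)]) blast
  obtain N where N: "N > 0"
    "\<And>v i. norm v0 / 2 < norm v \<Longrightarrow> norm v < 2 * norm v0 \<Longrightarrow> i > N \<Longrightarrow> norm (v * p powi i) < r \<and> norm (p powi i / v) < r"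
    "\<And>v i. norm v0 / 2 < norm v \<Longrightarrow> norm v < 2 * norm v0 \<Longrightarrow> i < -N \<Longrightarrow> norm (v * p powi i) > R \<and> norm (p powi i / v) > R"
    by (rule fam_far[OF v0 r(1)]) blast
  \<comment> \<open>Very small members are inside and very large ones outside \<open>G\<close>, as a
    good cycle demands; they never need a correction.\<close>
  have far: "(x \<notin> contour_image G \<and> contour_winding G x = of_bool (i \<ge> 0)) \<and>
       (y \<notin> contour_image G \<and> contour_winding G y = of_bool (i \<ge> 1))"
    if v: "norm v0 / 2 < norm v" "norm v < 2 * norm v0" and i: "i > N \<or> i < -N"
      and xy: "x = v * p powi i" "y = p powi i / v" for v i x y
    using i
  proof
    assume i: "i > N"
    then show ?thesis using N(1) N(2)[OF v i] r(2) G(2) unfolding xy by simp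
  next
    assume i: "i < -N"
    then show ?thesis using N(1) N(3)[OF v i] R unfolding xy by (simp add: less_imp_le)
  qed
  have evI: "eventually (\<lambda>v. v * p powi i \<notin> contour_image G \<and> contour_winding G (v * p powi i) = contour_winding G (v0 * p powi i)) (at v0)"
    "eventually (\<lambda>v. p powi i / v \<notin> contour_image G \<and> contour_winding G (p powi i / v) = contour_winding G (p powi i / v0)) (at v0)" for i
  proof -
    have 1: "filterlim (\<lambda>v. v * p powi i) (nhds (v0 * p powi i)) (at v0)"
      "filterlim (\<lambda>v. p powi i / v) (nhds (p powi i / v0)) (at v0)"
      using v0 by (auto intro!: tendsto_intros)
    have in_fam: "v0 * p powi i \<in> fam v0" "p powi i / v0 \<in> fam v0" using fam_iff[OF v0] by blast+
    then show "eventually (\<lambda>v. v * p powi i \<notin> contour_image G \<and> contour_winding G (v * p powi i) = contour_winding G (v0 * p powi i)) (at v0)"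
      "eventually (\<lambda>v. p powi i / v \<notin> contour_image G \<and> contour_winding G (p powi i / v) = contour_winding G (p powi i / v0)) (at v0)"
      using eventually_compose_filterlim[OF eventually_contour_winding[OF G(1)] 1(1)]
        eventually_compose_filterlim[OF eventually_contour_winding[OF G(1)] 1(2)] G(3) by auto
  qed
  have evN: "eventually (\<lambda>v. \<forall>i\<in>{-N..N}. (v * p powi i \<notin> contour_image G \<and> contour_winding G (v * p powi i) = contour_winding G (v0 * p powi i)) \<and>
     (p powi i / v \<notin> contour_image G \<and> contour_winding G (p powi i / v) = contour_winding G (p powi i / v0)) \<and>
     g analytic_on {v * p powi i} \<and> g analytic_on {p powi i / v}) (at v0)"
    by (intro eventually_ball_finite ballI eventually_conj evI eventually_fam_analytic[OF g v0]) auto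
  \<comment> \<open>Keeps the two families disjoint, so that no residue is counted twice.\<close>
  have evt: "eventually (\<lambda>v. theta p (1 * v ^ 2) \<noteq> 0) (at v0)"
    by (rule eventually_theta_nonzero) (use v0 in auto)
  show ?thesis
  proof (rule that[of N])
    from evN eventually_norm_bounds[OF v0] evt show "eventually (\<lambda>v. \<forall>Cs. good g lab v Cs \<longrightarrow>
    cyc_int Cs (ker g v) = crossed g G N v0 v) (at v0)"
    proof eventually_elim
      case (elim v)
      then have v: "v \<noteq> 0" "theta p (v\<^sup>2) \<noteq> 0" using v0 by auto
      show ?case
      proof (intro allI impI)
        fix Cs assume good: "good g lab v Cs"
        define X where "X = (\<lambda>i. v * p powi i) ` {-N..N} \<union> (\<lambda>i. p powi i / v) ` {-N..N}"
        have nimg: "s \<notin> contour_image G" if "s \<in> fam v" for s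
          using that far[of v] elim unfolding fam_iff[OF v(1)] by (metis atLeastAtMost_iff not_le)
        have "cyc_int Cs (ker g v) = cyc_int G (ker g v) +
          2 * of_real pi * \<i> * (\<Sum>s\<in>X. (contour_winding Cs s - contour_winding G s) * residue (ker g v) s)"
        proof (rule good_cycle_residue[OF g v(1) G(1,2) good])
          show "finite X" "0 \<notin> X" using v p by (auto simp: X_def)
          fix s assume s: "s \<noteq> 0" "is_pole (ker g v) s"
          then have *: "is_pole g s \<or> s \<in> fam v" using ker_not_pole[OF g v(1)] by blast
          then show "s \<notin> contour_image G" using G(3) nimg by (auto dest: analytic_at_imp_no_pole)
          show "contour_winding Cs s = contour_winding G s" if sX: "s \<notin> X"
          proof (cases "is_pole g s")
            case True
            then show ?thesis using labG[OF s(1)] good s(1) by (simp add: good_def)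
          next
            case False
            then obtain i where i: "s = v * p powi i \<or> s = p powi i / v" using * fam_iff[OF v(1)] by blast
            then have "i \<notin> {-N..N}" using sX by (auto simp: X_def)
            then have "i > N \<or> i < -N" by auto
            then show ?thesis using i far[of v i] elim good by (auto simp: good_def)
          qed
        qed
        also have "(\<Sum>s\<in>X. (contour_winding Cs s - contour_winding G s) * residue (ker g v) s) =
          (\<Sum>i\<in>{-N..N}. (of_bool (i \<ge> 0) - contour_winding G (v0 * p powi i)) * rterm g i v) +
          (\<Sum>i\<in>{-N..N}. (of_bool (i \<ge> 1) - contour_winding G (p powi i / v0)) * rterm g i (1 / v))"
          unfolding X_def
        proof (subst sum.union_disjoint, goal_cases)
          case 4
          have "(\<Sum>s\<in>(\<lambda>i. v * p powi i) ` {-N..N}. (contour_winding Cs s - contour_winding G s) * residue (ker g v) s) =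
            (\<Sum>i\<in>{-N..N}. (of_bool (i \<ge> 0) - contour_winding G (v0 * p powi i)) * rterm g i v)"
          proof (subst sum.reindex)
            show "inj_on (\<lambda>i. v * p powi i) {-N..N}" using fam_inj[OF v] by (auto simp: inj_on_def)
          qed (use elim good residue_ker[OF _ v] in \<open>auto simp: good_def intro!: sum.cong\<close>)
          moreover have "(\<Sum>s\<in>(\<lambda>i. p powi i / v) ` {-N..N}. (contour_winding Cs s - contour_winding G s) * residue (ker g v) s) =
            (\<Sum>i\<in>{-N..N}. (of_bool (i \<ge> 1) - contour_winding G (p powi i / v0)) * rterm g i (1 / v))"
          proof (subst sum.reindex)
            show "inj_on (\<lambda>i. p powi i / v) {-N..N}" using fam_inj[OF v] by (auto simp: inj_on_def)
          qed (use elim good residue_ker_inverse[OF _ v] in \<open>auto simp: good_def intro!: sum.cong\<close>)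
          ultimately show ?case by simp
        qed (use fam_inj[OF v] in auto)
        finally show "cyc_int Cs (ker g v) = crossed g G N v0 v"
          by (simp add: sum.distrib)
      qed
    qed
  qed
qed

end

section \<open>Limits and meromorphy in the parameter of the kernel\<close>

context nome
begin

lemma psi_decomposition:
  assumes "c \<noteq> 0" "d \<noteq> 0" "psi p c d \<noteq> 0" "x \<noteq> 0" "y \<noteq> 0"
  shows "psi p x y = psi p c x * (psi p d y / psi p c d) - psi p d x / psi p c d * psi p c y"
  using psi_addition[of x y c d] assms by (simp add: field_simps)

lemma ex_psi_nonzero:
  assumes "c \<noteq> 0"
  obtains d where "d \<noteq> 0" "psi p c d \<noteq> 0"
proof -
  have "eventually (\<lambda>z. psi p c z \<noteq> 0 \<and> z \<in> -{0}) (at 1)"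
    using assms by (intro eventually_conj eventually_psi_nonzero eventually_at_in_open') auto
  then show ?thesis using that eventually_happens[of _ "at (1::complex)"] by auto
qed

lemma psi_holomorphic2: "v \<noteq> 0 \<Longrightarrow> psi p v holomorphic_on -{0}"
  using psi_analytic analytic_imp_holomorphic by blast

text \<open>Separating the variables turns joint continuity into continuity of functions of one
  variable.\<close>

lemma psi_jointly:
  obtains A B where "A holomorphic_on -{0}" "B holomorphic_on -{0}"
    "\<And>x y. x \<noteq> 0 \<Longrightarrow> y \<noteq> 0 \<Longrightarrow> psi p x y = A x * B y - B x * A y"
proof -
  obtain d where d: "d \<noteq> 0" "psi p 1 d \<noteq> 0" using ex_psi_nonzero[of 1] by auto
  show ?thesis
  proof (rule that[of "psi p 1" "\<lambda>y. psi p d y / psi p 1 d"])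
    show "psi p 1 holomorphic_on -{0}" "(\<lambda>y. psi p d y / psi p 1 d) holomorphic_on -{0}"
      using d by (auto intro!: holomorphic_intros psi_holomorphic2)
    show "psi p x y = psi p 1 x * (psi p d y / psi p 1 d) - psi p d x / psi p 1 d * psi p 1 y"
      if "x \<noteq> 0" "y \<noteq> 0" for x y
      by (rule psi_decomposition) (use d that in auto)
  qed
qed

text \<open>Tube lemma: the zeros with \<open>v\<close> in a closed ball and \<open>s\<close> in
  \<open>K\<close> form a compact set, whose projection to \<open>v\<close> is closed and misses
  \<open>v0\<close>.\<close>

lemma psi_tube:
  assumes "v0 \<noteq> 0" "compact K" "0 \<notin> K" "K \<inter> fam v0 = {}"
  obtains e where "e > 0" "0 \<notin> ball v0 e" "\<And>v s. v \<in> ball v0 e \<Longrightarrow> s \<in> K \<Longrightarrow> psi p v s \<noteq> 0"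
proof -
  obtain A B where AB: "A holomorphic_on -{0}" "B holomorphic_on -{0}"
    "\<And>x y. x \<noteq> 0 \<Longrightarrow> y \<noteq> 0 \<Longrightarrow> psi p x y = A x * B y - B x * A y" using psi_jointly by blast
  define U where "U = cball v0 (norm v0 / 2)"
  have U0: "0 \<notin> U" using assms by (auto simp: U_def)
  have cA: "continuous_on U A" "continuous_on U B" "continuous_on K A" "continuous_on K B"
    by (rule continuous_on_subset[OF holomorphic_on_imp_continuous_on]; (rule AB)?; use U0 assms in auto)+
  define Q where "Q = {x \<in> U \<times> K. A (fst x) * B (snd x) - B (fst x) * A (snd x) = 0}"
  have cUK: "compact (U \<times> K)" unfolding U_def using assms by (intro compact_Times) auto
  have "continuous_on (U \<times> K) (\<lambda>x. A (fst x) * B (snd x) - B (fst x) * A (snd x))"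
    by (intro continuous_intros continuous_on_compose2[OF cA(1) continuous_on_fst]
        continuous_on_compose2[OF cA(2) continuous_on_fst] continuous_on_compose2[OF cA(3) continuous_on_snd]
        continuous_on_compose2[OF cA(4) continuous_on_snd]) auto
  then have "closed Q"
    unfolding Q_def by (intro continuous_closed_preimage_constant compact_imp_closed cUK)
  then have "compact Q" using cUK unfolding Q_def by (metis (no_types, lifting) compact_Int_closed inf.absorb_iff2 inf_commute mem_Collect_eq subsetI)
  then have "compact (fst ` Q)" by (intro compact_continuous_image continuous_intros)
  then have "open (- (fst ` Q) \<inter> ball v0 (norm v0 / 2))" using compact_imp_closed by auto
  moreover have "v0 \<notin> fst ` Q"
  proof
    assume "v0 \<in> fst ` Q"
    then obtain s where "s \<in> K" "A v0 * B s - B v0 * A s = 0" by (auto simp: Q_def)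
    then have "s \<in> fam v0" using AB(3)[of v0 s] assms by (auto simp: fam_def)
    then show False using assms \<open>s \<in> K\<close> by auto
  qed
  ultimately obtain e where e: "e > 0" "ball v0 e \<subseteq> - (fst ` Q) \<inter> ball v0 (norm v0 / 2)"
    using assms by (metis ComplI Int_iff centre_in_ball half_gt_zero_iff openE zero_less_norm_iff)
  show ?thesis
  proof (rule that[OF e(1)])
    have *: "v \<in> U" "v \<notin> fst ` Q" if "v \<in> ball v0 e" for v using e(2) that by (auto simp: U_def)
    show "0 \<notin> ball v0 e" using *(1) U0 by blast
    fix v s assume v: "v \<in> ball v0 e" and s: "s \<in> K"
    have "A v * B s - B v * A s \<noteq> 0"
    proof
      assume "A v * B s - B v * A s = 0"
      then have "(v, s) \<in> Q" using *[OF v] s by (auto simp: Q_def)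
      then show False using *[OF v] by (metis fst_conv image_eqI)
    qed
    then show "psi p v s \<noteq> 0" using AB(3)[of v s] *(1)[OF v] U0 s assms(3) by metis
  qed
qed

lemma cyc_int_ker_holomorphic:
  assumes v0: "v0 \<noteq> 0" and G: "cycle G" "contour_image G \<inter> (fam v0 \<union> {s. \<not> g analytic_on {s}}) = {}"
    "\<And>\<gamma>. \<gamma> \<in> set G \<Longrightarrow> \<exists>z r. r > 0 \<and> \<gamma> = circlepath z r"
  obtains e where "e > 0" "(\<lambda>v. cyc_int G (ker g v)) holomorphic_on ball v0 e"
proof -
  obtain A B where AB: "A holomorphic_on -{0}" "B holomorphic_on -{0}"
    "\<And>x y. x \<noteq> 0 \<Longrightarrow> y \<noteq> 0 \<Longrightarrow> psi p x y = A x * B y - B x * A y" using psi_jointly by blast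
  obtain e where e: "e > 0" "0 \<notin> ball v0 e" "\<And>v s. v \<in> ball v0 e \<Longrightarrow> s \<in> contour_image G \<Longrightarrow> psi p v s \<noteq> 0"
    using psi_tube[OF v0 compact_contour_image[OF G(1)] contour_image_nonzero[OF G(1)]] G(2) by blast
  have "(\<lambda>v. contour_integral \<gamma> (ker g v)) holomorphic_on ball v0 e" if \<gamma>: "\<gamma> \<in> set G" for \<gamma>
  proof -
    obtain z r where zr: "r > 0" "\<gamma> = circlepath z r" using G(3) \<gamma> by blast
    have sub: "sphere z r \<subseteq> contour_image G"
      using \<gamma> zr by (force simp: contour_image_def path_image_circlepath)
    then have s0: "0 \<notin> sphere z r" using contour_image_nonzero[OF G(1)] by blast
    define h where "h = (\<lambda>v s. A v * B s - B v * A s)"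
    have h: "psi p v s = h v s" "h v s \<noteq> 0" if "v \<in> ball v0 e" "s \<in> sphere z r" for v s
      using e(2,3) that AB(3)[of v s] sub s0 unfolding h_def by (metis subsetD)+
    have cA: "continuous_on (ball v0 e) f" "continuous_on (sphere z r) f" if "f holomorphic_on -{0}" for f
      by (rule continuous_on_subset[OF holomorphic_on_imp_continuous_on[OF that]]; use e s0 in auto)+
    have dA: "deriv A holomorphic_on -{0}" "deriv B holomorphic_on -{0}"
      using AB by (auto intro!: holomorphic_deriv)
    have jc: "continuous_on (ball v0 e \<times> sphere z r) (\<lambda>x. f (fst x))" "continuous_on (ball v0 e \<times> sphere z r) (\<lambda>x. f (snd x))"
      if "f holomorphic_on -{0}" for f
      by (rule continuous_on_compose2[OF cA(1)[OF that] continuous_on_fst[OF continuous_on_id]]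
          continuous_on_compose2[OF cA(2)[OF that] continuous_on_snd[OF continuous_on_id]]; auto)+
    have "(\<lambda>v. contour_integral (circlepath z r) (\<lambda>s. g s / s * (1 / h v s))) holomorphic_on ball v0 e"
    proof (rule circlepath_param_holomorphic[where k' = "\<lambda>v s. - (deriv A v * B s - deriv B v * A s) / (h v s)\<^sup>2"])
      have "continuous_on (sphere z r) g"
        unfolding continuous_on_eq_continuous_within
      proof
        fix s assume "s \<in> sphere z r"
        then have "g analytic_on {s}" using sub G(2) by blast
        then show "continuous (at s within sphere z r) g"
          using analytic_at_imp_isCont continuous_at_imp_continuous_at_within by blast
      qed
      then show "continuous_on (sphere z r) (\<lambda>s. g s / s)"
        using s0 by (intro continuous_intros) auto
      fix v s assume vs: "v \<in> ball v0 e" "s \<in> sphere z r"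
      have "(A has_field_derivative deriv A v) (at v)" "(B has_field_derivative deriv B v) (at v)"
        using AB vs e(2) by (auto intro!: holomorphic_derivI[of _ "-{0}"] simp del: mem_ball)
      then show "((\<lambda>v. 1 / h v s) has_field_derivative - (deriv A v * B s - deriv B v * A s) / (h v s)\<^sup>2) (at v)"
        using h(2)[OF vs] unfolding h_def by (auto intro!: derivative_eq_intros simp: power2_eq_square)
    next
      show "continuous_on (ball v0 e \<times> sphere z r) (\<lambda>(v, s). 1 / h v s)"
        unfolding case_prod_unfold h_def using h(2)
        by (intro continuous_intros jc AB) (auto simp: h_def)
      show "continuous_on (ball v0 e \<times> sphere z r) (\<lambda>(v, s). - (deriv A v * B s - deriv B v * A s) / (h v s)\<^sup>2)"
        unfolding case_prod_unfold h_def using h(2)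
        by (intro continuous_intros jc AB dA) (auto simp: h_def)
    qed (use zr in auto)
    moreover have "contour_integral \<gamma> (ker g v) = contour_integral (circlepath z r) (\<lambda>s. g s / s * (1 / h v s))"
      if "v \<in> ball v0 e" for v
      unfolding zr(2) using h(1)[OF that] zr(1)
      by (intro contour_integral_eq) (auto simp: ker_def path_image_circlepath)
    ultimately show ?thesis
      by (metis (no_types, lifting) holomorphic_cong)
  qed
  then have "(\<lambda>v. \<Sum>\<gamma>\<leftarrow>G'. contour_integral \<gamma> (ker g v)) holomorphic_on ball v0 e" if "set G' \<subseteq> set G" for G'
    using that by (induction G') (auto intro!: holomorphic_intros)
  then show ?thesis using that[OF e(1)] by (simp add: cyc_int_def)
qed

text \<open>The only labels that a cycle with winding number 1 about 0 can realize: inside near 0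
  and outside near infinity.\<close>

definition lab_bounded :: "complex set \<Rightarrow> (complex \<Rightarrow> complex) \<Rightarrow> bool" where
  "lab_bounded Z lab \<longleftrightarrow> (\<forall>s\<in>Z. lab s \<in> {0, 1}) \<and>
     (\<exists>r>0. \<forall>s\<in>Z. norm s < r \<longrightarrow> lab s = 1) \<and> (\<exists>R. \<forall>s\<in>Z. norm s > R \<longrightarrow> lab s = 0)"

text \<open>Completes a labelling of the points that matter by an arbitrary admissible one, given by
  the unit disc, at the others.\<close>

lemma lab_bounded_extend:
  assumes "lab_bounded {s \<in> Z. P s} lab"
  shows "lab_bounded Z (\<lambda>s. if P s then lab s else of_bool (norm s < 1))"
proof -
  obtain r R where "r > 0" "\<And>s. s \<in> Z \<Longrightarrow> P s \<Longrightarrow> norm s < r \<Longrightarrow> lab s = 1"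
    "\<And>s. s \<in> Z \<Longrightarrow> P s \<Longrightarrow> norm s > R \<Longrightarrow> lab s = 0" "\<And>s. s \<in> Z \<Longrightarrow> P s \<Longrightarrow> lab s \<in> {0, 1}"
    using assms unfolding lab_bounded_def by blast
  then show ?thesis unfolding lab_bounded_def
    by (intro conjI exI[of _ "min r 1"] exI[of _ "max R 1"]) auto
qed

lemma lab_bounded_winding:
  assumes Cs: "cycle Cs" "contour_winding Cs 0 = 1" and "\<And>s. s \<in> Z \<Longrightarrow> contour_winding Cs s \<in> {0, 1}"
  shows "lab_bounded Z (contour_winding Cs)"
proof -
  obtain R where "\<And>z. norm z \<ge> R \<Longrightarrow> z \<notin> contour_image Cs \<and> contour_winding Cs z = 0"
    by (rule contour_winding_far[OF Cs(1)]) blast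
  moreover obtain r where "r > 0" "\<And>z. norm z < r \<Longrightarrow> z \<notin> contour_image Cs \<and> contour_winding Cs z = contour_winding Cs 0"
    by (rule contour_winding_near[OF Cs(1)]) blast
  ultimately show ?thesis using assms unfolding lab_bounded_def
    by (intro conjI exI[of _ r] exI[of _ R]) auto
qed

definition singset :: "(complex \<Rightarrow> complex) \<Rightarrow> complex \<Rightarrow> complex set" where
  "singset g v = fam v \<union> {s. s \<noteq> 0 \<and> \<not> g analytic_on {s}}"

lemma ex_labelled_cycle:
  assumes g: "g meromorphic_on -{0}" and v: "v \<noteq> 0" and lab: "lab_bounded (singset g v) lab"
  obtains G where "cycle G" "contour_winding G 0 = 1" "contour_image G \<inter> (fam v \<union> {s. \<not> g analytic_on {s}}) = {}"
    "\<And>s. s \<in> singset g v \<Longrightarrow> contour_winding G s = lab s"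
    "\<And>\<gamma>. \<gamma> \<in> set G \<Longrightarrow> \<exists>z r. r > 0 \<and> \<gamma> = circlepath z r"
proof -
  have "{s. s \<noteq> 0 \<and> \<not> g analytic_on {s}} sparse_in -{0}"
    using meromorphic_on_imp_sparse_singularities'[OF g] by (simp add: Collect_conj_eq)
  then have Z: "singset g v sparse_in -{0}" "0 \<notin> singset g v"
    unfolding singset_def using fam_sparse[OF v] fam_nonzero by (auto intro: sparse_in_union')
  define In where "In = {s \<in> singset g v. lab s = 1}"
  from lab obtain r R where rR: "r > 0" "\<And>s. s \<in> singset g v \<Longrightarrow> norm s < r \<Longrightarrow> lab s = 1"
    "\<And>s. s \<in> singset g v \<Longrightarrow> norm s > R \<Longrightarrow> lab s = 0" "\<And>s. s \<in> singset g v \<Longrightarrow> lab s \<in> {0, 1}"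
    unfolding lab_bounded_def by blast
  have 1: "In \<subseteq> singset g v" by (auto simp: In_def)
  have 2: "norm s \<le> R" if "s \<in> In" for s using rR(3)[of s] that by (force simp: In_def)
  have 3: "norm s \<ge> r" if "s \<in> singset g v - In" for s using rR(2)[of s] that by (force simp: In_def)
  obtain G where G: "cycle G" "contour_image G \<inter> singset g v = {}" "contour_winding G 0 = 1"
    "\<And>s. s \<in> In \<Longrightarrow> contour_winding G s = 1" "\<And>s. s \<in> singset g v - In \<Longrightarrow> contour_winding G s = 0"
    "\<And>\<gamma>. \<gamma> \<in> set G \<Longrightarrow> \<exists>z r. r > 0 \<and> \<gamma> = circlepath z r"
    by (rule labelled_cycle[OF Z 1 2 rR(1) 3]) blast+
  show ?thesis
  proof (rule that[OF G(1,3) _ _ G(6)])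
    show "contour_image G \<inter> (fam v \<union> {s. \<not> g analytic_on {s}}) = {}"
      using G(2) contour_image_nonzero[OF G(1)] unfolding singset_def by fastforce
    show "contour_winding G s = lab s" if "s \<in> singset g v" for s
      using G(4,5)[of s] rR(4)[OF that] that by (auto simp: In_def)
  qed
qed

lemma fam_label_bounds:
  assumes v: "v \<noteq> 0"
  shows "i \<ge> 0 \<Longrightarrow> norm (v * p powi i) \<le> norm v" "i < 0 \<Longrightarrow> norm (v * p powi i) \<ge> norm v"
    "i \<ge> 1 \<Longrightarrow> norm (p powi i / v) \<le> 1 / norm v" "i < 1 \<Longrightarrow> norm (p powi i / v) \<ge> 1 / norm v"
proof -
  have 1: "norm (p powi i) \<le> 1" if "i \<ge> 0" for i
    using that p by (simp add: power_int_def norm_power power_le_one)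
  have 2: "norm (p powi i) \<ge> 1" if "i \<le> 0" for i
  proof -
    have "inverse (norm (p powi i)) \<le> 1" using 1[of "-i"] that by (simp add: power_int_minus norm_inverse)
    moreover have "norm (p powi i) > 0" using p by simp
    ultimately show ?thesis unfolding inverse_le_1_iff by linarith
  qed
  show "i \<ge> 0 \<Longrightarrow> norm (v * p powi i) \<le> norm v"
    using mult_left_mono[OF 1[of i] norm_ge_zero[of v]] by (simp add: norm_mult)
  show "i < 0 \<Longrightarrow> norm (v * p powi i) \<ge> norm v"
    using mult_left_mono[OF 2[of i] norm_ge_zero[of v]] by (simp add: norm_mult)
  show "i \<ge> 1 \<Longrightarrow> norm (p powi i / v) \<le> 1 / norm v"
    using divide_right_mono[OF 1[of i] norm_ge_zero[of v]] by (simp add: norm_divide)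
  show "i < 1 \<Longrightarrow> norm (p powi i / v) \<ge> 1 / norm v"
    using divide_right_mono[OF 2[of i] norm_ge_zero[of v]] by (simp add: norm_divide)
qed

text \<open>A point of \<open>fam v\<close> may also be a pole of \<open>g\<close>; then the two
  demands on its winding number have to agree, which is the hypothesis \<open>compat\<close>. The
  singularities of \<open>g\<close> that are no poles only have to be avoided by the paths.\<close>

lemma good_exists:
  assumes g: "g meromorphic_on -{0}" and v: "v \<noteq> 0" "theta p (v\<^sup>2) \<noteq> 0"
    and compat: "\<And>i::int. is_pole g (v * p powi i) \<Longrightarrow> lab (v * p powi i) = of_bool (i \<ge> 0)"
      "\<And>i::int. is_pole g (p powi i / v) \<Longrightarrow> lab (p powi i / v) = of_bool (i \<ge> 1)"
    and lab: "lab_bounded {s. s \<noteq> 0 \<and> is_pole g s} lab"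
  obtains G where "good g lab v G" "\<And>\<gamma>. \<gamma> \<in> set G \<Longrightarrow> \<exists>z r. r > 0 \<and> \<gamma> = circlepath z r"
proof -
  define L where "L = (\<lambda>s. if s \<in> fam v then of_bool ((\<exists>i\<ge>0. s = v * p powi i) \<or> (\<exists>i\<ge>1. s = p powi i / v))
     else if is_pole g s then lab s else of_bool (norm s < 1))"
  from lab obtain r R where rR: "r > 0" "\<And>s. s \<noteq> 0 \<Longrightarrow> is_pole g s \<Longrightarrow> norm s < r \<Longrightarrow> lab s = 1"
    "\<And>s. s \<noteq> 0 \<Longrightarrow> is_pole g s \<Longrightarrow> norm s > R \<Longrightarrow> lab s = 0" "\<And>s. s \<noteq> 0 \<Longrightarrow> is_pole g s \<Longrightarrow> lab s \<in> {0, 1}"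
    unfolding lab_bounded_def by blast
  have Lf: "L (v * p powi i) = of_bool (i \<ge> 0)" "L (p powi i / v) = of_bool (i \<ge> 1)" for i :: int
  proof -
    have in_fam: "v * p powi i \<in> fam v" "p powi i / v \<in> fam v" using fam_iff[OF v(1)] by blast+
    show "L (v * p powi i) = of_bool (i \<ge> 0)"
      unfolding L_def using in_fam(1) fam_inj[OF v] by auto
    show "L (p powi i / v) = of_bool (i \<ge> 1)"
      unfolding L_def using in_fam(2) fam_inj[OF v] by (auto; metis)
  qed
  have "lab_bounded (singset g v) L"
    unfolding lab_bounded_def
  proof (intro conjI ballI)
    fix s assume "s \<in> singset g v"
    then have "s \<noteq> 0" by (auto simp: singset_def fam_nonzero)
    then show "L s \<in> {0, 1}" using rR(4)[of s] by (auto simp: L_def)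
  next
    show "\<exists>r>0. \<forall>s\<in>singset g v. norm s < r \<longrightarrow> L s = 1"
    proof (intro exI[of _ "min (min r 1) (min (norm v) (1 / norm v))"] conjI ballI impI)
      fix s assume s: "s \<in> singset g v" "norm s < min (min r 1) (min (norm v) (1 / norm v))"
      then have s0: "s \<noteq> 0" by (auto simp: singset_def fam_nonzero)
      show "L s = 1"
      proof (cases "s \<in> fam v")
        case True
        then obtain i where i: "s = v * p powi i \<or> s = p powi i / v" using fam_iff[OF v(1)] by blast
        then show ?thesis
          using fam_label_bounds(2,4)[OF v(1), of i] s(2) Lf[of i] by (auto; fastforce)
      next
        case False
        then show ?thesis using s s0 rR(2)[of s] by (auto simp: L_def)
      qed
    qed (use rR v in auto)
    show "\<exists>R. \<forall>s\<in>singset g v. norm s > R \<longrightarrow> L s = 0"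
    proof (intro exI[of _ "max (max R 1) (max (norm v) (1 / norm v))"] conjI ballI impI)
      fix s assume s: "s \<in> singset g v" "norm s > max (max R 1) (max (norm v) (1 / norm v))"
      then have s0: "s \<noteq> 0" by (auto simp: singset_def fam_nonzero)
      show "L s = 0"
      proof (cases "s \<in> fam v")
        case True
        then obtain i where i: "s = v * p powi i \<or> s = p powi i / v" using fam_iff[OF v(1)] by blast
        then show ?thesis
          using fam_label_bounds(1,3)[OF v(1), of i] s(2) Lf[of i] by (auto; fastforce)
      next
        case False
        then show ?thesis using s s0 rR(3)[of s] by (auto simp: L_def)
      qed
    qed
  qed
  then obtain G where G: "cycle G" "contour_winding G 0 = 1" "contour_image G \<inter> (fam v \<union> {s. \<not> g analytic_on {s}}) = {}"
    "\<And>s. s \<in> singset g v \<Longrightarrow> contour_winding G s = L s"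
    "\<And>\<gamma>. \<gamma> \<in> set G \<Longrightarrow> \<exists>z r. r > 0 \<and> \<gamma> = circlepath z r"
    by (rule ex_labelled_cycle[OF g v(1)]) blast
  have "contour_winding G s = lab s" if "s \<noteq> 0" "is_pole g s" for s
  proof -
    have "\<not> g analytic_on {s}" using that analytic_at_imp_no_pole by blast
    then have s: "s \<in> singset g v" using that by (auto simp: singset_def)
    show ?thesis
    proof (cases "s \<in> fam v")
      case True
      then obtain i where "s = v * p powi i \<or> s = p powi i / v" using fam_iff[OF v(1)] by blast
      then show ?thesis using G(4)[OF s] Lf[of i] compat[of i] that(2) by auto
    next
      case False
      then show ?thesis using G(4)[OF s] that by (simp add: L_def)
    qed
  qed
  moreover have "v * p powi i \<in> singset g v" "p powi i / v \<in> singset g v" for i :: int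
    unfolding singset_def using fam_iff[OF v(1)] by blast+
  ultimately have "good g lab v G"
    unfolding good_def using G Lf by (intro conjI allI impI) auto
  then show ?thesis using that G(5) by blast
qed

text \<open>The kernel at \<open>v0\<close> can lack a pole at v0 p^i because \<open>g\<close>
  vanishes there. Then the residue at the moving point v p^i dies out: up to harmless factors it is
  the convergent value of \<open>ker g v0\<close> at the moving point, times theta(v0 / (v p^i)),
  which tends to 0, times a quotient of theta functions with a finite limit.\<close>

lemma rterm_tendsto_0:
  assumes g: "g meromorphic_on -{0}" and v0: "v0 \<noteq> 0" and np: "\<not> is_pole (ker g v0) (v0 * p powi i)"
  shows "(rterm g i \<longlongrightarrow> 0) (at v0)"
proof -
  define s0 where "s0 = v0 * p powi i"
  have s0: "s0 \<noteq> 0" using v0 p by (simp add: s0_def)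
  have "ker g v0 meromorphic_on {s0}"
    using meromorphic_ker[OF g v0] by (rule meromorphic_on_subset) (use s0 in auto)
  then obtain L where L: "ker g v0 \<midarrow>s0\<rightarrow> L" using not_pole_limit np by (auto simp: s0_def)
  have lim: "filterlim (\<lambda>v. v * p powi i) (at s0) (at v0)"
    unfolding s0_def using v0 p by (auto simp: filterlim_at eventually_at_filter intro!: tendsto_intros)
  have K: "((\<lambda>v. ker g v0 (v * p powi i)) \<longlongrightarrow> L) (at v0)"
    using filterlim_compose[OF L lim] .
  have T1: "((\<lambda>v. theta p (v0 / (v * p powi i))) \<longlongrightarrow> 0) (at v0)"
  proof -
    have "isCont (theta p) (v0 / (v0 * p powi i))"
      using theta_field_differentiable[of "v0 / (v0 * p powi i)"] DERIV_isCont v0 p by auto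
    then have "((\<lambda>v. theta p (v0 / (v * p powi i))) \<longlongrightarrow> theta p (v0 / (v0 * p powi i))) (at v0)"
    proof (rule isCont_tendsto_compose)
      show "((\<lambda>v. v0 / (v * p powi i)) \<longlongrightarrow> v0 / (v0 * p powi i)) (at v0)"
        by (intro tendsto_intros) (use v0 p in auto)
    qed
    moreover have "theta p (v0 / (v0 * p powi i)) = 0"
    proof -
      have "v0 / (v0 * p powi i) = p powi (-i)" using v0 by (simp add: power_int_minus divide_inverse)
      then show ?thesis using theta_eq_0_iff[OF p, of "p powi (-i)"] p by (metis power_int_eq_0_iff)
    qed
    ultimately show ?thesis by simp
  qed
  define a where "a = p powi i"
  have a0: "a \<noteq> 0" using p by (simp add: a_def)
  define f1 where "f1 = (\<lambda>v. theta p (v0 * v * a))"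
  define f2 where "f2 = (\<lambda>v. theta p (v\<^sup>2 * a))"
  have d1: "(f1 has_field_derivative deriv (theta p) (v0\<^sup>2 * a) * (v0 * a)) (at v0)"
    unfolding f1_def using theta_field_differentiable[of "v0\<^sup>2 * a"] v0 a0
    by (intro DERIV_chain2[where f = "theta p"]) (auto intro!: derivative_eq_intros simp: power2_eq_square)
  have d2: "(f2 has_field_derivative deriv (theta p) (v0\<^sup>2 * a) * (2 * v0 * a)) (at v0)"
    unfolding f2_def using theta_field_differentiable[of "v0\<^sup>2 * a"] v0 a0
    by (intro DERIV_chain2[where f = "theta p"]) (auto intro!: derivative_eq_intros simp: power2_eq_square)
  have e12: "f1 v0 = theta p (v0\<^sup>2 * a)" "f2 v0 = theta p (v0\<^sup>2 * a)" by (simp_all add: f1_def f2_def power2_eq_square)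
  \<comment> \<open>If both theta functions vanish at \<open>v0\<close>, their zeros in
    \<open>v\<close> are simple and the quotient still converges.\<close>
  have "\<exists>M. ((\<lambda>v. f1 v / f2 v) \<longlongrightarrow> M) (at v0)"
  proof (cases "theta p (v0\<^sup>2 * a) = 0")
    case False
    have "f1 \<midarrow>v0\<rightarrow> f1 v0" "f2 \<midarrow>v0\<rightarrow> f2 v0" using d1 d2 DERIV_isCont isContD by blast+
    then have "((\<lambda>v. f1 v / f2 v) \<longlongrightarrow> f1 v0 / f2 v0) (at v0)" using False e12 by (intro tendsto_divide) auto
    then show ?thesis by blast
  next
    case True
    then obtain j where "v0\<^sup>2 * a = p powi j" using theta_eq_0_iff[OF p, of "v0\<^sup>2 * a"] v0 a0 by auto
    then have "deriv (theta p) (v0\<^sup>2 * a) \<noteq> 0" using deriv_theta_nonzero by simp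
    then show ?thesis
      using lhopital_complex_simple[OF d1 d2 _ _ _ refl] True e12 v0 a0 by auto
  qed
  then obtain M where M: "((\<lambda>v. f1 v / f2 v) \<longlongrightarrow> M) (at v0)" by blast
  define c where "c = deriv (theta p) (p powi (-i))"
  have "((\<lambda>v. - (ker g v0 (v * a) * (f1 v / f2 v) * theta p (v0 / (v * a)) * (v * a)\<^sup>2 / (v0 * c))) \<longlongrightarrow>
      - (L * M * 0 * (v0 * a)\<^sup>2 / (v0 * c))) (at v0)"
    using K T1 M v0 deriv_theta_nonzero by (intro tendsto_intros) (auto simp: a_def c_def)
  moreover have "eventually (\<lambda>v. - (ker g v0 (v * a) * (f1 v / f2 v) * theta p (v0 / (v * a)) * (v * a)\<^sup>2 / (v0 * c)) = rterm g i v) (at v0)"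
  proof -
    have 1: "eventually (\<lambda>v. v \<in> -{0}) (at v0)" using v0 by (intro eventually_at_in_open') auto
    have 2: "eventually (\<lambda>v. psi p v0 (v * a) \<noteq> 0) (at v0)"
      using eventually_compose_filterlim[OF eventually_psi_nonzero(1)[OF v0 s0] lim] by (simp add: a_def)
    from 1 2 show ?thesis
    proof eventually_elim
      case (elim v)
      have "psi p v0 (v * a) = theta p (v0 * v * a) * theta p (v0 / (v * a)) / v0"
        by (simp add: psi_def divide_inverse mult_ac)
      moreover from this have "theta p (v0 / (v * a)) \<noteq> 0" "theta p (v0 * v * a) \<noteq> 0" using elim by auto
      ultimately show ?case
        using v0 a0 elim by (simp add: ker_def rterm_def f1_def f2_def a_def[symmetric] c_def[symmetric] power2_eq_square)
    qed
  qed
  ultimately show ?thesis using Lim_transform_eventually by fastforce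
qed

text \<open>\<open>Cs\<close> is tied to actual poles only, so it may have members of the families
  on a side that a good cycle forbids, namely where the kernel at \<open>v0\<close> has no pole. The
  corrections for these members tend to 0. Hence the integral over \<open>Cs\<close> is the limit of
  those over good cycles, even if no good cycle exists at \<open>v0\<close>.\<close>

lemma ker_cycle_tendsto:
  assumes g: "g meromorphic_on -{0}" and v0: "v0 \<noteq> 0"
    and Cs: "cycle Cs" "contour_winding Cs 0 = 1"
    and av: "\<And>s. s \<noteq> 0 \<Longrightarrow> is_pole (ker g v0) s \<Longrightarrow> s \<notin> contour_image Cs \<and> contour_winding Cs s \<in> {0, 1}"
    and fam: "\<And>i. is_pole (ker g v0) (v0 * p powi i) \<Longrightarrow> contour_winding Cs (v0 * p powi i) = of_bool (i \<ge> 0)"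
      "\<And>i. is_pole (ker g v0) (p powi i / v0) \<Longrightarrow> contour_winding Cs (p powi i / v0) = of_bool (i \<ge> 1)"
    and lab: "\<And>s. s \<noteq> 0 \<Longrightarrow> is_pole g s \<Longrightarrow> contour_winding Cs s = lab s"
    and H: "eventually (\<lambda>v. \<exists>G. good g lab v G \<and> H v = cyc_int G (ker g v)) (at v0)"
  shows "(H \<longlongrightarrow> cyc_int Cs (ker g v0)) (at v0)"
proof -
  \<comment> \<open>At the poles of the kernel the auxiliary circles imitate \<open>Cs\<close>;
    elsewhere any admissible side will do.\<close>
  define L where "L = (\<lambda>s. if is_pole (ker g v0) s then contour_winding Cs s else of_bool (norm s < 1))"
  have "s \<noteq> 0" if "s \<in> singset g v0" for s using that by (auto simp: singset_def fam_nonzero)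
  then have "lab_bounded (singset g v0) L"
    unfolding L_def using av Cs by (intro lab_bounded_extend lab_bounded_winding) simp_all
  then obtain G where G: "cycle G" "contour_winding G 0 = 1" "contour_image G \<inter> (fam v0 \<union> {s. \<not> g analytic_on {s}}) = {}"
    "\<And>s. s \<in> singset g v0 \<Longrightarrow> contour_winding G s = L s"
    "\<And>\<gamma>. \<gamma> \<in> set G \<Longrightarrow> \<exists>z r. r > 0 \<and> \<gamma> = circlepath z r"
    by (rule ex_labelled_cycle[OF g v0]) blast
  have pole_sing: "s \<in> singset g v0" if "s \<noteq> 0" "is_pole (ker g v0) s" for s
    using ker_not_pole[OF g v0 that(1)] that by (auto simp: singset_def dest: analytic_at_imp_no_pole)
  have "cyc_int G (ker g v0) = cyc_int Cs (ker g v0) +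
    2 * of_real pi * \<i> * (\<Sum>s\<in>{}. (contour_winding G s - contour_winding Cs s) * residue (ker g v0) s)"
  proof (rule cycle_residue[OF Cs(1) G(1) meromorphic_ker[OF g v0]])
    fix s assume s: "is_pole (ker g v0) s"
    show "s \<notin> contour_image Cs \<and> s \<notin> contour_image G"
    proof (cases "s = 0")
      case True
      then show ?thesis using contour_image_nonzero Cs G by auto
    next
      case False
      then have "s \<in> fam v0 \<union> {s. \<not> g analytic_on {s}}" using pole_sing[OF False s] by (auto simp: singset_def)
      then show ?thesis using av[OF False s] G(3) by blast
    qed
    show "contour_winding G s = contour_winding Cs s" if "s \<noteq> 0"
      using G(4)[OF pole_sing[OF that s]] s by (simp add: L_def)
  qed (use G Cs in auto)
  then have eqG: "cyc_int G (ker g v0) = cyc_int Cs (ker g v0)" by simp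
  have labG: "contour_winding G s = lab s" if "s \<noteq> 0" "is_pole g s" for s
  proof -
    have "is_pole (ker g v0) s" by (rule ker_pole_g) (use that g v0 in auto)
    then show ?thesis using G(4)[OF pole_sing] that lab by (simp add: L_def)
  qed
  obtain N :: int where N: "eventually (\<lambda>v. \<forall>Cs. good g lab v Cs \<longrightarrow>
    cyc_int Cs (ker g v) = crossed g G N v0 v) (at v0)"
    using decomposition[OF g v0 G(1-3) labG] by blast
  obtain e where e: "e > 0" "(\<lambda>v. cyc_int G (ker g v)) holomorphic_on ball v0 e"
    using cyc_int_ker_holomorphic[OF v0 G(1,3,5)] by blast
  have "((\<lambda>v. cyc_int G (ker g v)) \<longlongrightarrow> cyc_int G (ker g v0)) (at v0)"
    using holomorphic_isCont[OF e(2)] e(1) by (simp add: isCont_def)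
  moreover have "((\<lambda>v. (of_bool (i \<ge> 0) - contour_winding G (v0 * p powi i)) * rterm g i v) \<longlongrightarrow> 0) (at v0)" for i
  proof (cases "is_pole (ker g v0) (v0 * p powi i)")
    case True
    have "contour_winding G (v0 * p powi i) = of_bool (i \<ge> 0)"
      using G(4)[OF pole_sing[OF _ True]] v0 p fam(1)[OF True] True by (simp add: L_def)
    then show ?thesis by simp
  next
    case False
    then show ?thesis using rterm_tendsto_0[OF g v0] by (intro tendsto_mult_right_zero)
  qed
  moreover have "((\<lambda>v. (of_bool (i \<ge> 1) - contour_winding G (p powi i / v0)) * rterm g i (1 / v)) \<longlongrightarrow> 0) (at v0)" for i
  proof (cases "is_pole (ker g v0) (p powi i / v0)")
    case True
    have "contour_winding G (p powi i / v0) = of_bool (i \<ge> 1)"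
      using G(4)[OF pole_sing[OF _ True]] v0 p fam(2)[OF True] True by (simp add: L_def)
    then show ?thesis by simp
  next
    case False
    have "is_pole (ker g (1 / v0)) (p powi i / v0) \<longleftrightarrow> is_pole (ker g v0) (p powi i / v0)"
    proof (rule is_pole_cong)
      have "eventually (\<lambda>w. w \<in> -{0}) (at (p powi i / v0))" using v0 p by (intro eventually_at_in_open') auto
      then show "eventually (\<lambda>w. ker g (1 / v0) w = ker g v0 w) (at (p powi i / v0))"
        by eventually_elim (use v0 in \<open>auto simp: ker_inverse\<close>)
    qed simp
    then have "(rterm g i \<longlongrightarrow> 0) (at (1 / v0))"
      using rterm_tendsto_0[OF g, of "1 / v0" i] v0 False by simp
    moreover have "filterlim (\<lambda>v. 1 / v) (at (1 / v0)) (at v0)"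
      using v0 by (auto simp: filterlim_at eventually_at_filter intro!: tendsto_intros)
    ultimately show ?thesis by (intro tendsto_mult_right_zero) (rule filterlim_compose)
  qed
  ultimately have "((\<lambda>v. crossed g G N v0 v) \<longlongrightarrow>
      cyc_int G (ker g v0) + 2 * of_real pi * \<i> * (\<Sum>i\<in>{-N..N}. 0 + 0)) (at v0)"
    by (intro tendsto_intros)
  then have "((\<lambda>v. crossed g G N v0 v) \<longlongrightarrow>
      cyc_int Cs (ker g v0)) (at v0)" by (simp add: eqG)
  moreover from N H have "eventually (\<lambda>v. crossed g G N v0 v = H v) (at v0)"
  proof eventually_elim
    case (elim v)
    then obtain G' where "good g lab v G'" "H v = cyc_int G' (ker g v)" by blast
    then show ?case using elim(1) by simp
  qed
  ultimately show ?thesis by (rule Lim_transform_eventually)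
qed

text \<open>In \<open>decomposition\<close> the integral over the fixed cycle is holomorphic in
  \<open>v\<close> and every \<open>rterm\<close> is meromorphic. The cycle depends on
  \<open>v0\<close>, so meromorphy is obtained point by point.\<close>

lemma ker_cycle_meromorphic:
  assumes g: "g meromorphic_on -{0}" and v0: "v0 \<noteq> 0"
    and lab: "lab_bounded {s. s \<noteq> 0 \<and> is_pole g s} lab"
    and H: "eventually (\<lambda>v. \<exists>G. good g lab v G \<and> H v = cyc_int G (ker g v)) (at v0)"
  shows "H meromorphic_on {v0}"
proof -
  define L where "L = (\<lambda>s. if is_pole g s then lab s else of_bool (norm s < 1))"
  have "{s \<in> singset g v0. is_pole g s} = {s. s \<noteq> 0 \<and> is_pole g s}"
    by (auto simp: singset_def fam_nonzero dest: analytic_at_imp_no_pole)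
  then have "lab_bounded (singset g v0) L"
    unfolding L_def using lab by (intro lab_bounded_extend) simp
  then obtain G where G: "cycle G" "contour_winding G 0 = 1" "contour_image G \<inter> (fam v0 \<union> {s. \<not> g analytic_on {s}}) = {}"
    "\<And>s. s \<in> singset g v0 \<Longrightarrow> contour_winding G s = L s"
    "\<And>\<gamma>. \<gamma> \<in> set G \<Longrightarrow> \<exists>z r. r > 0 \<and> \<gamma> = circlepath z r"
    by (rule ex_labelled_cycle[OF g v0]) blast
  have labG: "contour_winding G s = lab s" if "s \<noteq> 0" "is_pole g s" for s
  proof -
    have "s \<in> singset g v0" using that by (auto simp: singset_def dest: analytic_at_imp_no_pole)
    then show ?thesis using G(4) that by (simp add: L_def)
  qed
  obtain N :: int where N: "eventually (\<lambda>v. \<forall>Cs. good g lab v Cs \<longrightarrow>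
    cyc_int Cs (ker g v) = crossed g G N v0 v) (at v0)"
    using decomposition[OF g v0 G(1-3) labG] by blast
  obtain e where e: "e > 0" "(\<lambda>v. cyc_int G (ker g v)) holomorphic_on ball v0 e"
    using cyc_int_ker_holomorphic[OF v0 G(1,3,5)] by blast
  have 1: "(\<lambda>v. cyc_int G (ker g v)) meromorphic_on {v0}"
    using e by (intro analytic_on_imp_meromorphic_on holomorphic_on_imp_analytic_at[OF e(2)]) auto
  have rt: "rterm g i meromorphic_on -{0}" for i
  proof -
    have "(\<lambda>v. g (v * p powi i)) meromorphic_on -{0}"
      by (rule meromorphic_on_compose[OF g]) (use p in \<open>auto intro!: analytic_intros\<close>)
    moreover have "(\<lambda>v. theta p (v\<^sup>2 * p powi i)) meromorphic_on -{0}"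
      by (intro analytic_on_imp_meromorphic_on, subst analytic_punctured_iff[symmetric])
        (use p in \<open>auto intro!: holomorphic_theta holomorphic_intros\<close>)
    ultimately show ?thesis unfolding rterm_def[abs_def] by (intro meromorphic_intros)
  qed
  have rt': "(\<lambda>v. rterm g i (1 / v)) meromorphic_on -{0}" for i
    by (rule meromorphic_on_compose[OF rt]) (auto intro!: analytic_intros)
  have "(\<lambda>v. crossed g G N v0 v) meromorphic_on {v0}"
    using v0 by (intro meromorphic_intros 1 meromorphic_on_subset[OF rt] meromorphic_on_subset[OF rt']) auto
  moreover from N H have "eventually (\<lambda>v. crossed g G N v0 v = H v) (at v0)"
  proof eventually_elim
    case (elim v)
    then obtain G' where "good g lab v G'" "H v = cyc_int G' (ker g v)" by blast
    then show ?case using elim(1) by simp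
  qed
  ultimately show ?thesis
    using meromorphic_on_cong[of "{v0}" "\<lambda>v. crossed g G N v0 v" H] by blast
qed

end

section \<open>Hankel determinants\<close>

abbreviation (input) jdet :: "'a::comm_ring_1 Matrix.mat \<Rightarrow> 'a" where "jdet \<equiv> Determinant.det"

definition hankel :: "nat \<Rightarrow> (nat \<Rightarrow> complex) \<Rightarrow> complex Matrix.mat" where
  "hankel N \<mu> = Matrix.mat N N (\<lambda>(i, j). \<mu> (i + j))"

abbreviation (input) hdet :: "nat \<Rightarrow> (nat \<Rightarrow> complex) \<Rightarrow> complex" where
  "hdet N \<mu> \<equiv> jdet (hankel N \<mu>)"

lemma hankel_carrier [simp]: "hankel N \<mu> \<in> carrier_mat N N"
  by (simp add: hankel_def)

text \<open>From the left it subtracts x times the preceding row from every row but the first. On a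
  matrix of moments this multiplies the weight by t - x, outside row 0.\<close>

definition umat :: "nat \<Rightarrow> complex \<Rightarrow> complex Matrix.mat" where
  "umat N x = Matrix.mat N N (\<lambda>(i, j). if i = j then 1 else if i = Suc j then - x else 0)"

lemma umat_carrier [simp]: "umat N x \<in> carrier_mat N N"
  by (simp add: umat_def)

lemma det_umat [simp]: "jdet (umat N x) = 1"
proof -
  have "jdet (umat N x) = prod_list (diag_mat (umat N x))"
    by (rule det_lower_triangular[of N]) (auto simp: umat_def)
  also have "diag_mat (umat N x) = map (\<lambda>_. 1) [0..<N]"
    by (auto simp: diag_mat_def umat_def)
  also have "prod_list \<dots> = 1" by (induction N) auto
  finally show ?thesis .
qed

lemma mat_mult_index:
  assumes "A \<in> carrier_mat N K" "B \<in> carrier_mat K M" "i < N" "j < M"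
  shows "(A * B) $$ (i, j) = (\<Sum>k<K. A $$ (i, k) * B $$ (k, j))"
  using assms by (auto simp: scalar_prod_def atLeast0LessThan intro!: sum.cong)

lemma umat_mult_index:
  assumes "A \<in> carrier_mat N M" "i < N" "j < M"
  shows "(umat N x * A) $$ (i, j) = (if i = 0 then A $$ (0, j) else A $$ (i, j) - x * A $$ (i - 1, j))"
proof -
  have "(umat N x * A) $$ (i, j) = (\<Sum>k<N. (if k = i then A $$ (k, j) else 0) + (if Suc k = i then - x * A $$ (k, j) else 0))"
    using mat_mult_index[OF umat_carrier assms, of x] assms
    by (auto simp: umat_def intro!: sum.cong)
  also have "\<dots> = A $$ (i, j) + (\<Sum>k<N. if Suc k = i then - x * A $$ (k, j) else 0)"
    using assms by (simp add: sum.distrib)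
  also have "(\<Sum>k<N. if Suc k = i then - x * A $$ (k, j) else 0) = (if i = 0 then 0 else - x * A $$ (i - 1, j))"
  proof (cases i)
    case (Suc i')
    then have "(\<Sum>k<N. if Suc k = i then - x * A $$ (k, j) else 0) = (\<Sum>k<N. if k = i' then - x * A $$ (k, j) else 0)"
      by (intro sum.cong) auto
    then show ?thesis using Suc assms by simp
  qed auto
  finally show ?thesis by auto
qed

lemma mult_umat_index:
  assumes "A \<in> carrier_mat M N" "i < M" "j < N"
  shows "(A * transpose_mat (umat N x)) $$ (i, j) = (if j = 0 then A $$ (i, 0) else A $$ (i, j) - x * A $$ (i, j - 1))"
proof -
  have A: "transpose_mat A \<in> carrier_mat N M" using assms by simp
  have 1: "A * transpose_mat (umat N x) = transpose_mat (umat N x * transpose_mat A)"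
    using assms by (simp add: transpose_mult[OF umat_carrier A])
  have "umat N x * transpose_mat A \<in> carrier_mat N M" by (rule mult_carrier_mat[OF umat_carrier A])
  then have "transpose_mat (umat N x * transpose_mat A) $$ (i, j) = (umat N x * transpose_mat A) $$ (j, i)"
    using assms by (simp only: index_transpose_mat(1) carrier_matD)
  then show ?thesis unfolding 1 umat_mult_index[OF A assms(3,2), of x] using assms by auto
qed

lemma det_umat_sandwich:
  assumes "A \<in> carrier_mat N N"
  shows "jdet (umat N x * A * transpose_mat (umat N y)) = jdet A"
proof -
  have c: "umat N x * A \<in> carrier_mat N N" by (rule mult_carrier_mat[OF umat_carrier assms])
  have "jdet (umat N x * A * transpose_mat (umat N y)) = jdet (umat N x * A) * jdet (transpose_mat (umat N y))"
    by (rule det_mult[OF c]) simp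
  also have "jdet (umat N x * A) = jdet (umat N x) * jdet A"
    by (rule det_mult[OF umat_carrier assms])
  also have "jdet (transpose_mat (umat N y)) = jdet (umat N y)" by (rule det_transpose[OF umat_carrier])
  finally show ?thesis by simp
qed

lemma umat_sandwich_index:
  assumes "A \<in> carrier_mat N N" "i < N" "j < N"
  shows "(umat N x * A * transpose_mat (umat N y)) $$ (i, j) =
    (if i = 0 then (if j = 0 then A $$ (0, 0) else A $$ (0, j) - y * A $$ (0, j - 1))
     else if j = 0 then A $$ (i, 0) - x * A $$ (i - 1, 0)
     else A $$ (i, j) - x * A $$ (i - 1, j) - y * (A $$ (i, j - 1) - x * A $$ (i - 1, j - 1)))"
proof -
  have c: "umat N x * A \<in> carrier_mat N N" by (rule mult_carrier_mat[OF umat_carrier assms(1)])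
  show ?thesis
    using mult_umat_index[OF c assms(2,3), of y] umat_mult_index[OF assms(1), of _ _ x] assms(2,3) by auto
qed

section \<open>Bordered determinants and modifications of the weight\<close>

lemma det_first_column:
  assumes Z: "Z \<in> carrier_mat (Suc n) (Suc n)" and 0: "\<And>i. 0 < i \<Longrightarrow> i < Suc n \<Longrightarrow> Z $$ (i, 0) = 0"
    and H: "H \<in> carrier_mat n n" "\<And>i j. i < n \<Longrightarrow> j < n \<Longrightarrow> Z $$ (Suc i, Suc j) = H $$ (i, j)"
  shows "jdet Z = Z $$ (0, 0) * jdet H"
proof -
  have "jdet Z = (\<Sum>i<Suc n. Z $$ (i, 0) * cofactor Z i 0)"
    by (rule laplace_expansion_column[OF Z]) simp
  also have "\<dots> = Z $$ (0, 0) * cofactor Z 0 0"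
    unfolding sum.lessThan_Suc_shift using 0 by simp
  also have "mat_delete Z 0 0 = H"
    using Z H by (intro eq_matI) (auto simp: mat_delete_def)
  then have "cofactor Z 0 0 = jdet H" by (simp add: cofactor_def)
  finally show ?thesis .
qed

lemma det_first_column_id:
  assumes "Q = Matrix.mat (Suc n) (Suc n) (\<lambda>(i, j). if j = 0 then y i else if i = j then 1 else 0)"
  shows "jdet Q = y 0"
proof -
  have "jdet Q = prod_list (diag_mat Q)"
    by (rule det_lower_triangular[of "Suc n"]) (auto simp: assms)
  also have "diag_mat Q = y 0 # map (\<lambda>_. 1) [0..<n]"
    by (auto simp: diag_mat_def assms upt_conv_Cons map_Suc_upt[symmetric] simp del: upt_Suc)
  also have "prod_list \<dots> = y 0" by (induction n) auto
  finally show ?thesis .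
qed

text \<open>Cramer's rule: multiplication by an identity matrix with first column \<open>y\<close>
  replaces the first column of \<open>Z\<close> by c e_0.\<close>

lemma det_replace_first_column:
  fixes Z :: "complex Matrix.mat"
  assumes Z: "Z \<in> carrier_mat (Suc n) (Suc n)"
    and y: "\<And>i. i < Suc n \<Longrightarrow> (\<Sum>j<Suc n. Z $$ (i, j) * y j) = (if i = 0 then c else 0)"
    and H: "H \<in> carrier_mat n n" "\<And>i j. i < n \<Longrightarrow> j < n \<Longrightarrow> Z $$ (Suc i, Suc j) = H $$ (i, j)"
  shows "jdet Z * y 0 = c * jdet H"
proof -
  define Q where "Q = Matrix.mat (Suc n) (Suc n) (\<lambda>(i, j). if j = 0 then y i else if i = j then (1::complex) else 0)"
  have Q: "Q \<in> carrier_mat (Suc n) (Suc n)" by (simp add: Q_def)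
  have ZQ: "(Z * Q) $$ (i, j) = (if j = 0 then (if i = 0 then c else 0) else Z $$ (i, j))"
    if "i < Suc n" "j < Suc n" for i j
  proof (cases "j = 0")
    case True
    then show ?thesis using mat_mult_index[OF Z Q that] that y[OF that(1)] by (simp add: Q_def)
  next
    case False
    have "(Z * Q) $$ (i, j) = (\<Sum>k<Suc n. if k = j then Z $$ (i, k) else 0)"
      unfolding mat_mult_index[OF Z Q that] using that False by (intro sum.cong) (auto simp: Q_def)
    then show ?thesis using False that by simp
  qed
  have "jdet (Z * Q) = (Z * Q) $$ (0, 0) * jdet H"
    by (rule det_first_column) (use Z Q H ZQ in auto)
  moreover have "jdet (Z * Q) = jdet Z * jdet Q" by (rule det_mult[OF Z Q])
  moreover have "jdet Q = y 0" by (rule det_first_column_id[OF Q_def])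
  ultimately show ?thesis using ZQ[of 0 0] by simp
qed

locale hankel_inverse =
  fixes n :: nat and \<mu> :: "nat \<Rightarrow> complex" and G :: "nat \<Rightarrow> nat \<Rightarrow> complex"
  assumes HG: "\<And>i j. i < n \<Longrightarrow> j < n \<Longrightarrow> (\<Sum>k<n. \<mu> (i + k) * G k j) = (if i = j then 1 else 0)"
    and GH: "\<And>i j. i < n \<Longrightarrow> j < n \<Longrightarrow> (\<Sum>k<n. G i k * \<mu> (k + j)) = (if i = j then 1 else 0)"
begin

text \<open>For the powers of two variables this is the Christoffel-Darboux kernel of the moments
  \<open>\<mu>\<close>.\<close>

definition bil :: "(nat \<Rightarrow> complex) \<Rightarrow> (nat \<Rightarrow> complex) \<Rightarrow> complex" where
  "bil u w = (\<Sum>i<n. \<Sum>j<n. u i * G i j * w j)"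

definition gvec :: "(nat \<Rightarrow> complex) \<Rightarrow> nat \<Rightarrow> complex" where
  "gvec u i = (\<Sum>j<n. G i j * u j)"

lemma bil_gvec: "bil u w = (\<Sum>i<n. u i * gvec w i)"
  by (simp add: bil_def gvec_def sum_distrib_left mult.assoc)

lemma gvec_inverse: "i < n \<Longrightarrow> (\<Sum>k<n. \<mu> (i + k) * gvec u k) = u i"
proof -
  assume i: "i < n"
  have "(\<Sum>k<n. \<mu> (i + k) * gvec u k) = (\<Sum>j<n. \<Sum>k<n. \<mu> (i + k) * G k j * u j)"
    unfolding gvec_def sum_distrib_left by (subst sum.swap) (simp add: mult.assoc)
  also have "\<dots> = (\<Sum>j<n. (if i = j then 1 else 0) * u j)"
    using HG[OF i] by (intro sum.cong) (simp_all flip: sum_distrib_right)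
  also have "\<dots> = (\<Sum>j<n. if j = i then u j else 0)" by (intro sum.cong) auto
  finally show ?thesis using i by simp
qed

lemma G_sym: "i < n \<Longrightarrow> j < n \<Longrightarrow> G i j = G j i"
proof -
  assume ij: "i < n" "j < n"
  have "G i j = (\<Sum>k<n. G i k * (if k = j then 1 else 0))"
    using ij by (simp add: if_distrib[of "(*) _"] cong: if_cong)
  also have "\<dots> = (\<Sum>k<n. G i k * (\<Sum>l<n. G j l * \<mu> (l + k)))"
    using GH[of j] ij by (intro sum.cong) auto
  also have "\<dots> = (\<Sum>l<n. (\<Sum>k<n. G i k * \<mu> (k + l)) * G j l)"
    unfolding sum_distrib_left sum_distrib_right
    by (subst sum.swap) (simp add: mult_ac add.commute)
  also have "\<dots> = (\<Sum>l<n. (if i = l then 1 else 0) * G j l)"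
    using GH[of i] ij by (intro sum.cong) auto
  also have "\<dots> = (\<Sum>l<n. if l = i then G j l else 0)" by (intro sum.cong) auto
  finally show ?thesis using ij by simp
qed

lemma bil_sym: "bil u w = bil w u"
  unfolding bil_def using G_sym by (subst sum.swap) (auto intro!: sum.cong simp: mult_ac)

lemma bil_mu: "n > 0 \<Longrightarrow> bil \<mu> w = w 0" "n > 0 \<Longrightarrow> bil w \<mu> = w 0"
proof -
  show "n > 0 \<Longrightarrow> bil \<mu> w = w 0" using gvec_inverse[of 0 w] by (simp add: bil_gvec)
  then show "n > 0 \<Longrightarrow> bil w \<mu> = w 0" using bil_sym by simp
qed

text \<open>Schur complement. With c the lower part of the first column, the vector (1, - G c) is
  annihilated by all rows but the first.\<close>

lemma det_bordered:
  assumes Z: "Z \<in> carrier_mat (Suc n) (Suc n)"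
    and H: "\<And>i j. i < n \<Longrightarrow> j < n \<Longrightarrow> Z $$ (Suc i, Suc j) = \<mu> (i + j)"
  shows "jdet Z = hdet n \<mu> * (Z $$ (0, 0) - bil (\<lambda>i. Z $$ (0, Suc i)) (\<lambda>i. Z $$ (Suc i, 0)))"
proof -
  define c where "c = (\<lambda>i. Z $$ (Suc i, 0))"
  define y where "y = (\<lambda>i. if i = 0 then 1 else - gvec c (i - 1))"
  have "jdet Z * y 0 = (Z $$ (0, 0) - bil (\<lambda>i. Z $$ (0, Suc i)) c) * hdet n \<mu>"
  proof (rule det_replace_first_column[OF Z])
    fix i assume i: "i < Suc n"
    have "(\<Sum>j<Suc n. Z $$ (i, j) * y j) = Z $$ (i, 0) - (\<Sum>j<n. Z $$ (i, Suc j) * gvec c j)"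
      unfolding sum.lessThan_Suc_shift by (simp add: y_def sum_negf)
    also have "\<dots> = (if i = 0 then Z $$ (0, 0) - bil (\<lambda>i. Z $$ (0, Suc i)) c else 0)"
    proof (cases i)
      case (Suc k)
      have "(\<Sum>j<n. Z $$ (i, Suc j) * gvec c j) = c k"
        using gvec_inverse[of k c] Suc i H by simp
      then show ?thesis using Suc by (simp add: c_def)
    qed (simp add: bil_gvec)
    finally show "(\<Sum>j<Suc n. Z $$ (i, j) * y j) = (if i = 0 then Z $$ (0, 0) - bil (\<lambda>i. Z $$ (0, Suc i)) c else 0)" .
  qed (use H in \<open>auto simp: hankel_def\<close>)
  then show ?thesis by (simp add: y_def c_def mult.commute)
qed

text \<open>Read \<open>\<mu>\<close> as moments of a weight, \<open>kx\<close> and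
  \<open>kv\<close> as those of the weight over x - t and over v - t, and \<open>l\<close> as those
  of the weight over the product of both. The row operation by x and the column operation by v undo
  both divisions outside the border, leaving the old Hankel matrix bordered by \<open>kx\<close> and
  \<open>kv\<close>.\<close>

lemma det_hankel_plus:
  assumes "\<And>m. m < 2 * n \<Longrightarrow> v * l m - l (Suc m) = kx m" "\<And>m. m < 2 * n \<Longrightarrow> x * l m - l (Suc m) = kv m"
    "\<And>m. m + 1 < 2 * n \<Longrightarrow> x * kx m - kx (Suc m) = \<mu> m"
  shows "hdet (Suc n) l = hdet n \<mu> * (l 0 - bil kx kv)"
proof -
  define Y where "Y = umat (Suc n) x * hankel (Suc n) l * transpose_mat (umat (Suc n) v)"
  have Y: "Y \<in> carrier_mat (Suc n) (Suc n)"
    unfolding Y_def by (rule mult_carrier_mat[OF mult_carrier_mat[OF umat_carrier hankel_carrier]]) simp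
  have idx: "Y $$ (i, j) = (if i = 0 then (if j = 0 then l 0 else l j - v * l (j - 1))
     else if j = 0 then l i - x * l (i - 1)
     else l (i + j) - x * l (i - 1 + j) - v * (l (i + (j - 1)) - x * l (i - 1 + (j - 1))))"
    if "i < Suc n" "j < Suc n" for i j
    unfolding Y_def umat_sandwich_index[OF hankel_carrier that] using that by (auto simp: hankel_def)
  have "hdet (Suc n) l = jdet Y" unfolding Y_def by (rule det_umat_sandwich[symmetric]) simp
  also have "\<dots> = hdet n \<mu> * (Y $$ (0, 0) - bil (\<lambda>i. Y $$ (0, Suc i)) (\<lambda>i. Y $$ (Suc i, 0)))"
  proof (rule det_bordered[OF Y])
    fix i j assume ij: "i < n" "j < n"
    have "Y $$ (Suc i, Suc j) = l (Suc (Suc (i + j))) - x * l (Suc (i + j)) - v * (l (Suc (i + j)) - x * l (i + j))"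
      using ij by (simp add: idx)
    also have "\<dots> = x * (v * l (i + j) - l (Suc (i + j))) - (v * l (Suc (i + j)) - l (Suc (Suc (i + j))))"
      by (simp add: algebra_simps)
    also have "\<dots> = x * kx (i + j) - kx (Suc (i + j))" using ij by (simp add: assms(1))
    also have "\<dots> = \<mu> (i + j)" using ij by (simp add: assms(3))
    finally show "Y $$ (Suc i, Suc j) = \<mu> (i + j)" .
  qed
  also have "bil (\<lambda>i. Y $$ (0, Suc i)) (\<lambda>i. Y $$ (Suc i, 0)) = bil kx kv"
    unfolding bil_def
  proof (intro sum.cong refl)
    fix i j assume ij: "i \<in> {..<n}" "j \<in> {..<n}"
    have "Y $$ (0, Suc i) = - kx i" "Y $$ (Suc j, 0) = - kv j"
      using ij assms(1)[of i] assms(2)[of j] by (auto simp: idx algebra_simps)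
    then show "Y $$ (0, Suc i) * G i j * Y $$ (Suc j, 0) = kx i * G i j * kv j" by simp
  qed
  finally show ?thesis by (simp add: idx)
qed

text \<open>The weight is multiplied by (x - t) / (v - t), and \<open>k\<close> are the moments of
  the weight over v - t. One bordered matrix is evaluated twice: by its Schur complement, and by row
  operations that clear its first column 1, 1, x, x^2, ...\<close>

lemma det_hankel_zero:
  assumes k: "\<And>m. m + 1 < 2 * n \<Longrightarrow> v * k m - k (Suc m) = \<mu> m"
  shows "hdet n (\<lambda>m. x * k m - k (Suc m)) = hdet n \<mu> * (1 + (x - v) * bil (\<lambda>i. x ^ i) k)"
proof (cases "n = 0")
  case True
  then have "bil (\<lambda>i. x ^ i) k = 0" "hankel n (\<lambda>m. x * k m - k (Suc m)) = hankel n \<mu>"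
    unfolding bil_def hankel_def using True by (auto intro!: eq_matI)
  then show ?thesis by simp
next
  case False
  define nu where "nu = (\<lambda>m. x * k m - k (Suc m))"
  have nu: "nu m = (x - v) * k m + \<mu> m" if "m + 1 < 2 * n" for m
    using k[OF that] by (simp add: nu_def algebra_simps)
  define Z where "Z = Matrix.mat (Suc n) (Suc n) (\<lambda>(i, j).
     if i = 0 then (if j = 0 then 1 else - ((x - v) * k (j - 1)))
     else if j = 0 then x ^ (i - 1) else \<mu> (i - 1 + (j - 1)))"
  have Z: "Z \<in> carrier_mat (Suc n) (Suc n)" by (simp add: Z_def)
  have "jdet Z = hdet n \<mu> * (Z $$ (0, 0) - bil (\<lambda>i. Z $$ (0, Suc i)) (\<lambda>i. Z $$ (Suc i, 0)))"
    by (rule det_bordered[OF Z]) (simp add: Z_def)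
  also have "bil (\<lambda>i. Z $$ (0, Suc i)) (\<lambda>i. Z $$ (Suc i, 0)) = - (x - v) * bil (\<lambda>i. x ^ i) k"
  proof -
    have "bil (\<lambda>i. Z $$ (0, Suc i)) (\<lambda>i. Z $$ (Suc i, 0)) = (\<Sum>i<n. \<Sum>j<n. - (x - v) * (k i * G i j * x ^ j))"
      unfolding bil_def by (intro sum.cong refl) (auto simp: Z_def algebra_simps)
    also have "\<dots> = - (x - v) * bil k (\<lambda>i. x ^ i)"
      unfolding bil_def by (simp only: sum_distrib_left)
    finally show ?thesis unfolding bil_sym[of k] .
  qed
  also have "Z $$ (0, 0) = 1" by (simp add: Z_def)
  finally have 1: "jdet Z = hdet n \<mu> * (1 + (x - v) * bil (\<lambda>i. x ^ i) k)"
    by (simp add: algebra_simps)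
  define E where "E = Matrix.mat (Suc n) (Suc n) (\<lambda>(i, j). if i = j then 1 else
      if i = 1 \<and> j = 0 then - 1 else if 2 \<le> i \<and> i = Suc j then - x else 0)"
  have E: "E \<in> carrier_mat (Suc n) (Suc n)" by (simp add: E_def)
  have "jdet E = prod_list (diag_mat E)"
    by (rule det_lower_triangular[of "Suc n"]) (auto simp: E_def)
  also have "diag_mat E = map (\<lambda>_. 1) [0..<Suc n]"
    unfolding diag_mat_def by (auto simp: E_def simp del: upt_Suc)
  also have "prod_list \<dots> = 1" by (induction n) auto
  finally have dE: "jdet E = 1" .
  have EZ: "(E * Z) $$ (i, j) = (if i = 0 then Z $$ (0, j) else if i = 1 then Z $$ (1, j) - Z $$ (0, j)
      else Z $$ (i, j) - x * Z $$ (i - 1, j))" if ij: "i < Suc n" "j < Suc n" for i j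
  proof -
    have "(E * Z) $$ (i, j) = (\<Sum>k<Suc n. (if k = i then Z $$ (k, j) else 0) +
        (if Suc k = i then (if k = 0 then - 1 else - x) * Z $$ (k, j) else 0))"
      unfolding mat_mult_index[OF E Z ij] using ij by (intro sum.cong) (auto simp: E_def)
    also have "\<dots> = Z $$ (i, j) + (\<Sum>k<Suc n. if Suc k = i then (if k = 0 then - 1 else - x) * Z $$ (k, j) else 0)"
      unfolding sum.distrib using ij by simp
    also have "(\<Sum>k<Suc n. if Suc k = i then (if k = 0 then - 1 else - x) * Z $$ (k, j) else 0) =
        (if i = 0 then 0 else if i = 1 then - Z $$ (0, j) else - x * Z $$ (i - 1, j))"
    proof (cases i)
      case (Suc i')
      then have "(\<Sum>k<Suc n. if Suc k = i then (if k = 0 then - 1 else - x) * Z $$ (k, j) else 0) =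
         (\<Sum>k<Suc n. if k = i' then (if k = 0 then - 1 else - x) * Z $$ (k, j) else 0)"
        by (intro sum.cong) auto
      then show ?thesis using Suc ij by simp
    qed auto
    finally show ?thesis by auto
  qed
  \<comment> \<open>Row 0 of what remains is a row of \<open>nu\<close>. Below it, \<open>nu\<close>
    after the operation by v and \<open>\<mu>\<close> after the operation by x are both moments of
    the weight times t - x, so they agree.\<close>
  define B where "B = umat n v * hankel n nu"
  have B: "B \<in> carrier_mat n n" unfolding B_def by (rule mult_carrier_mat[OF umat_carrier hankel_carrier])
  have Zi: "Z $$ (i, j) = (if i = 0 then (if j = 0 then 1 else - ((x - v) * k (j - 1)))
     else if j = 0 then x ^ (i - 1) else \<mu> (i - 1 + (j - 1)))" if "i < Suc n" "j < Suc n" for i j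
    using that by (simp add: Z_def)
  have "jdet (E * Z) = (E * Z) $$ (0, 0) * jdet B"
  proof (rule det_first_column[where n = n])
    show "E * Z \<in> carrier_mat (Suc n) (Suc n)" using E Z by auto
    show "(E * Z) $$ (i, 0) = 0" if i: "0 < i" "i < Suc n" for i
    proof (cases "i = 1")
      case False
      then obtain i' where "i = Suc (Suc i')" using i by (metis One_nat_def gr0_implies_Suc neq0_conv)
      then show ?thesis using i by (simp add: EZ Zi)
    qed (use i False in \<open>simp add: EZ Zi\<close>)
    fix i j assume ij: "i < n" "j < n"
    have B0: "B $$ (i, j) = (if i = 0 then nu j else nu (i + j) - v * nu (i - 1 + j))"
      unfolding B_def umat_mult_index[OF hankel_carrier ij] using ij by (auto simp: hankel_def)
    show "(E * Z) $$ (Suc i, Suc j) = B $$ (i, j)"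
    proof (cases i)
      case 0
      then show ?thesis unfolding B0 using ij False nu[of j] by (simp add: EZ Zi)
    next
      case (Suc i')
      have "nu (i + j) = (x - v) * k (Suc (i' + j)) + \<mu> (i + j)" "nu (i' + j) = (x - v) * k (i' + j) + \<mu> (i' + j)"
        using ij Suc nu[of "i + j"] nu[of "i' + j"] by simp_all
      then have "nu (i + j) - v * nu (i' + j) = \<mu> (i + j) - v * \<mu> (i' + j) - (x - v) * (v * k (i' + j) - k (Suc (i' + j)))"
        by (simp only:) (simp add: algebra_simps)
      also have "v * k (i' + j) - k (Suc (i' + j)) = \<mu> (i' + j)" using k[of "i' + j"] ij Suc by simp
      finally have *: "nu (i + j) - v * nu (i' + j) = \<mu> (i + j) - x * \<mu> (i' + j)"
        by (simp add: algebra_simps)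
      show ?thesis unfolding B0 using ij Suc * by (simp add: EZ Zi)
    qed
  qed (rule B)
  moreover have "jdet (E * Z) = jdet E * jdet Z" by (rule det_mult[OF E Z])
  moreover have "jdet B = jdet (umat n v) * hdet n nu" unfolding B_def by (rule det_mult[OF umat_carrier hankel_carrier])
  ultimately have "jdet Z = hdet n nu" using dE EZ[of 0 0] Zi[of 0 0] by simp
  then show ?thesis using 1 by (simp add: nu_def)
qed

text \<open>The weight is multiplied by (x - t)(y - t), which lowers the size by one. Cramer's rule
  is applied to the transformed matrix \<open>Y\<close>; the first entry of the solution is the
  Christoffel-Darboux kernel.\<close>

lemma det_hankel_minus:
  assumes n: "n = Suc n'"
    and w: "\<And>m. m + 2 < 2 * n - 1 \<Longrightarrow> w m = x * y * \<mu> m - (x + y) * \<mu> (Suc m) + \<mu> (Suc (Suc m))"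
  shows "hdet n' w = hdet n \<mu> * bil (\<lambda>i. x ^ i) (\<lambda>i. y ^ i)"
proof -
  define Y where "Y = umat n x * hankel n \<mu> * transpose_mat (umat n y)"
  have Y: "Y \<in> carrier_mat (Suc n') (Suc n')"
    unfolding Y_def n by (rule mult_carrier_mat[OF mult_carrier_mat[OF umat_carrier hankel_carrier]]) simp
  have idx: "Y $$ (i, j) = (if i = 0 then (if j = 0 then \<mu> 0 else \<mu> j - y * \<mu> (j - 1))
     else if j = 0 then \<mu> i - x * \<mu> (i - 1)
     else \<mu> (i + j) - x * \<mu> (i - 1 + j) - y * (\<mu> (i + (j - 1)) - x * \<mu> (i - 1 + (j - 1))))"
    if "i < n" "j < n" for i j
    unfolding Y_def umat_sandwich_index[OF hankel_carrier that] using that by (auto simp: hankel_def)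
  define g where "g = gvec (\<lambda>i. x ^ i)"
  \<comment> \<open>Solves z_i - y z_(i+1) = g_i with z_n = 0, so the column operation in
    \<open>Y\<close> turns \<open>z\<close> back into \<open>g\<close>.\<close>
  define z where "z = (\<lambda>i. \<Sum>k=i..<n. y ^ (k - i) * g k)"
  have z: "z i - y * z (Suc i) = g i" if "i < n" for i
  proof -
    have "z i = g i + (\<Sum>k=Suc i..<n. y ^ (k - i) * g k)"
      unfolding z_def using that by (simp add: sum.atLeast_Suc_lessThan)
    also have "(\<Sum>k=Suc i..<n. y ^ (k - i) * g k) = y * z (Suc i)"
      unfolding z_def sum_distrib_left
      by (intro sum.cong refl) (auto simp: Suc_diff_le[symmetric] mult_ac simp flip: power_Suc)
    finally show ?thesis by simp
  qed
  have zn: "z n = 0" by (simp add: z_def)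
  define T where "T = (\<lambda>i j. if i = 0 then \<mu> j else \<mu> (i + j) - x * \<mu> (i - 1 + j))"
  have YT: "Y $$ (i, j) = T i j - (if j = 0 then 0 else y * T i (j - 1))" if "i < n" "j < n" for i j
    using idx[OF that] by (auto simp: T_def algebra_simps)
  have Tz: "(\<Sum>j<n. Y $$ (i, j) * z j) = (if i = 0 then 1 else 0)" if i: "i < n" for i
  proof -
    have "(\<Sum>j<n. Y $$ (i, j) * z j) = (\<Sum>j<n. T i j * z j) - (\<Sum>j<n. if j = 0 then 0 else y * T i (j - 1) * z j)"
      unfolding sum_subtractf[symmetric]
    proof (intro sum.cong refl)
      fix j assume "j \<in> {..<n}"
      then show "Y $$ (i, j) * z j = T i j * z j - (if j = 0 then 0 else y * T i (j - 1) * z j)"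
        by (cases "j = 0") (simp_all add: YT[OF i] algebra_simps)
    qed
    also have "(\<Sum>j<n. if j = 0 then 0 else y * T i (j - 1) * z j) = (\<Sum>j<n'. y * T i j * z (Suc j))"
      unfolding n sum.lessThan_Suc_shift by simp
    also have "\<dots> = (\<Sum>j<n. y * T i j * z (Suc j))"
      using zn by (simp add: n)
    also have "(\<Sum>j<n. T i j * z j) - (\<Sum>j<n. y * T i j * z (Suc j)) = (\<Sum>j<n. T i j * g j)"
      unfolding sum_subtractf[symmetric]
    proof (intro sum.cong refl)
      fix j assume "j \<in> {..<n}"
      then have g: "g j = z j - y * z (Suc j)" using z by simp
      show "T i j * z j - y * T i j * z (Suc j) = T i j * g j" unfolding g by (simp add: algebra_simps)
    qed
    also have "\<dots> = (if i = 0 then 1 else 0)"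
    proof (cases i)
      case 0
      then show ?thesis using gvec_inverse[of 0 "\<lambda>i. x ^ i"] n by (simp add: T_def g_def)
    next
      case (Suc i')
      have "(\<Sum>j<n. T i j * g j) = (\<Sum>j<n. \<mu> (i + j) * g j) - x * (\<Sum>j<n. \<mu> (i' + j) * g j)"
        unfolding T_def Suc by (simp add: algebra_simps sum_subtractf sum_distrib_left)
      then show ?thesis
        using gvec_inverse[of i "\<lambda>i. x ^ i"] gvec_inverse[of i' "\<lambda>i. x ^ i"] i Suc by (simp add: g_def)
    qed
    finally show ?thesis .
  qed
  have "jdet Y * z 0 = 1 * hdet n' w"
  proof (rule det_replace_first_column[OF Y])
    show "(\<Sum>j<Suc n'. Y $$ (i, j) * z j) = (if i = 0 then 1 else 0)" if "i < Suc n'" for i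
      using Tz[of i] that n by simp
    show "Y $$ (Suc i, Suc j) = hankel n' w $$ (i, j)" if ij: "i < n'" "j < n'" for i j
    proof -
      have "Y $$ (Suc i, Suc j) = w (i + j)"
      proof -
        have "Y $$ (Suc i, Suc j) = x * y * \<mu> (i + j) - (x + y) * \<mu> (Suc (i + j)) + \<mu> (Suc (Suc (i + j)))"
          using ij n by (simp add: idx algebra_simps)
        then show ?thesis using ij n w[of "i + j"] by simp
      qed
      then show ?thesis using ij by (simp add: hankel_def)
    qed
  qed simp
  moreover have "z 0 = bil (\<lambda>i. y ^ i) (\<lambda>i. x ^ i)"
    by (simp add: z_def g_def bil_gvec atLeast0LessThan)
  moreover have "jdet Y = hdet n \<mu>" unfolding Y_def by (rule det_umat_sandwich) simp
  ultimately show ?thesis using bil_sym by simp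
qed

text \<open>The Christoffel-Darboux kernel has displacement rank 2; its two generators are the
  orthogonal polynomials of degrees \<open>n - 1\<close> and \<open>n\<close>, up to normalization. The value
  \<open>\<mu> (2 * n - 1)\<close>, which has no meaning for the moments below, drops out.\<close>

definition gen1 :: "(nat \<Rightarrow> complex) \<Rightarrow> complex \<Rightarrow> complex" where
  "gen1 u s = (if n = 0 then u 0 else gvec u (n - 1))"

definition gen2 :: "(nat \<Rightarrow> complex) \<Rightarrow> complex \<Rightarrow> complex" where
  "gen2 u s = (if n = 0 then s else (\<Sum>k<n. \<mu> (n + k) * gvec u k) - u n)"

text \<open>\<open>s\<close> and \<open>t\<close> measure how far a vector is from being geometric:
  0 for powers, 1 for Cauchy moments. Shifting indices gives a double sum over \<mu>(i + k + 1) that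
  is symmetric in the two vectors and cancels; boundary terms at index n remain. For n = 0 only t
  u_0 - s w_0 is left, which dictates that case of \<open>gen1\<close> and
  \<open>gen2\<close>.\<close>

lemma bil_rank2:
  assumes u: "\<And>i. i < n \<Longrightarrow> x * u i - u (Suc i) = s * \<mu> i" and w: "\<And>i. i < n \<Longrightarrow> y * w i - w (Suc i) = t * \<mu> i"
  shows "(x - y) * bil u w + t * u 0 - s * w 0 = gen1 u s * gen2 w t - gen2 u s * gen1 w t"
proof (cases n)
  case 0
  then show ?thesis unfolding gen1_def gen2_def bil_def by simp
next
  case (Suc n')
  then have n: "n > 0" by simp
  have split: "(\<Sum>i<n. f i) = (\<Sum>i<n'. f i) + f n'" for f :: "nat \<Rightarrow> complex"
    by (simp add: Suc)
  have shift: "(\<Sum>i<n. u (Suc i) * gvec w i) = (\<Sum>i<n. \<Sum>k<n. \<mu> (i + k + 1) * gvec u k * gvec w i)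
      - gvec w n' * (\<Sum>k<n. \<mu> (n + k) * gvec u k) + u n * gvec w n'" for u w
  proof -
    have "(\<Sum>i<n. u (Suc i) * gvec w i) = (\<Sum>i<n'. (\<Sum>k<n. \<mu> (i + k + 1) * gvec u k) * gvec w i) + u n * gvec w n'"
    proof -
      have "u (Suc i) = (\<Sum>k<n. \<mu> (i + k + 1) * gvec u k)" if "i < n'" for i
        using gvec_inverse[of "Suc i" u] that Suc by simp
      then show ?thesis unfolding split by (simp add: Suc)
    qed
    also have "(\<Sum>i<n'. (\<Sum>k<n. \<mu> (i + k + 1) * gvec u k) * gvec w i) =
       (\<Sum>i<n. (\<Sum>k<n. \<mu> (i + k + 1) * gvec u k) * gvec w i) - (\<Sum>k<n. \<mu> (n' + k + 1) * gvec u k) * gvec w n'"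
      unfolding split[of "\<lambda>i. (\<Sum>k<n. \<mu> (i + k + 1) * gvec u k) * gvec w i"] by simp
    also have "(\<Sum>k<n. \<mu> (n' + k + 1) * gvec u k) = (\<Sum>k<n. \<mu> (n + k) * gvec u k)"
      using Suc by simp
    finally show ?thesis by (simp add: sum_distrib_right mult.commute[of "gvec w n'"])
  qed
  have "x * bil u w = (\<Sum>i<n. (u (Suc i) + s * \<mu> i) * gvec w i)"
    unfolding bil_gvec sum_distrib_left
  proof (intro sum.cong refl)
    fix i assume "i \<in> {..<n}"
    then have "u (Suc i) + s * \<mu> i = x * u i" using u[of i] by (simp add: algebra_simps)
    then show "x * (u i * gvec w i) = (u (Suc i) + s * \<mu> i) * gvec w i" by (simp add: mult.assoc)
  qed
  also have "\<dots> = (\<Sum>i<n. u (Suc i) * gvec w i) + s * bil \<mu> w"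
    by (simp add: bil_gvec distrib_right sum.distrib sum_distrib_left mult.assoc)
  also have "bil \<mu> w = w 0" by (rule bil_mu(1)[OF n])
  finally have 1: "x * bil u w = (\<Sum>i<n. u (Suc i) * gvec w i) + s * w 0" .
  have "y * bil u w = (\<Sum>i<n. (w (Suc i) + t * \<mu> i) * gvec u i)"
  proof -
    have "(w (Suc i) + t * \<mu> i) * gvec u i = y * (w i * gvec u i)" if "i < n" for i
    proof -
      have "w (Suc i) + t * \<mu> i = y * w i" using w[OF that] by (simp add: algebra_simps)
      then show ?thesis by (simp add: mult.assoc)
    qed
    then have "(\<Sum>i<n. (w (Suc i) + t * \<mu> i) * gvec u i) = y * bil w u"
      unfolding bil_gvec sum_distrib_left by (intro sum.cong refl) auto
    then show ?thesis using bil_sym[of u w] by simp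
  qed
  also have "\<dots> = (\<Sum>i<n. w (Suc i) * gvec u i) + t * bil \<mu> u"
    by (simp add: bil_gvec distrib_right sum.distrib sum_distrib_left mult.assoc)
  also have "bil \<mu> u = u 0" by (rule bil_mu(1)[OF n])
  finally have 2: "y * bil u w = (\<Sum>i<n. w (Suc i) * gvec u i) + t * u 0" .
  have 3: "(\<Sum>i<n. \<Sum>k<n. \<mu> (i + k + 1) * gvec u k * gvec w i) = (\<Sum>i<n. \<Sum>k<n. \<mu> (i + k + 1) * gvec w k * gvec u i)"
    by (subst sum.swap) (intro sum.cong refl, simp add: mult_ac add_ac)
  have "(x - y) * bil u w + t * u 0 - s * w 0 = (\<Sum>i<n. u (Suc i) * gvec w i) - (\<Sum>i<n. w (Suc i) * gvec u i)"
    using 1 2 by (simp add: algebra_simps)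
  also have "\<dots> = gen1 u s * gen2 w t - gen2 u s * gen1 w t"
    unfolding shift[of u w] shift[of w u] 3 gen1_def gen2_def using Suc by (simp add: algebra_simps)
  finally show ?thesis .
qed

end

lemma hankel_inverse_exists:
  assumes "hdet n \<mu> \<noteq> 0"
  obtains G where "hankel_inverse n \<mu> G"
proof -
  obtain B where B: "B \<in> carrier_mat n n" "B * hankel n \<mu> = 1\<^sub>m n" "hankel n \<mu> * B = 1\<^sub>m n"
    using det_non_zero_imp_unit[OF hankel_carrier assms] unfolding Units_def ring_mat_def by auto
  have "hankel_inverse n \<mu> (\<lambda>i j. B $$ (i, j))"
  proof
    fix i j assume ij: "i < n" "j < n"
    have "(\<Sum>k<n. hankel n \<mu> $$ (i, k) * B $$ (k, j)) = 1\<^sub>m n $$ (i, j)"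
      using mat_mult_index[OF hankel_carrier[of n \<mu>] B(1) ij] B(3) by simp
    then show "(\<Sum>k<n. \<mu> (i + k) * B $$ (k, j)) = (if i = j then 1 else 0)"
      using ij by (simp add: hankel_def)
    have "(\<Sum>k<n. B $$ (i, k) * hankel n \<mu> $$ (k, j)) = 1\<^sub>m n $$ (i, j)"
      using mat_mult_index[OF B(1) hankel_carrier[of n \<mu>] ij] B(2) by simp
    then show "(\<Sum>k<n. B $$ (i, k) * \<mu> (k + j)) = (if i = j then 1 else 0)"
      using ij by (simp add: hankel_def)
  qed
  then show ?thesis using that by blast
qed

section \<open>The Andreief identity\<close>

lemma det_scale_columns:
  fixes c :: "nat \<Rightarrow> complex"
  shows "jdet (Matrix.mat n n (\<lambda>(i, j). c j * M i j)) = (\<Prod>j<n. c j) * jdet (Matrix.mat n n (\<lambda>(i, j). M i j))"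
proof -
  have 1: "jdet (Matrix.mat n n (\<lambda>(i, j). A i j)) = (\<Sum>\<sigma> | \<sigma> permutes {0..<n}. signof \<sigma> * (\<Prod>j<n. A (\<sigma> j) j))"
    for A :: "nat \<Rightarrow> nat \<Rightarrow> complex"
    by (subst det_col[of _ n]) (auto intro!: sum.cong prod.cong dest: permutes_in_image)
  show ?thesis unfolding 1 sum_distrib_left
    by (intro sum.cong refl) (simp add: prod.distrib)
qed

text \<open>The row operation by t_0 clears the first column and leaves the factor t_j - t_0 in
  every other column.\<close>

lemma vandermonde:
  fixes t :: "nat \<Rightarrow> complex"
  shows "jdet (Matrix.mat N N (\<lambda>(i, j). t j ^ i)) = (\<Prod>j<N. \<Prod>i<j. t j - t i)"
proof (induction N arbitrary: t)
  case 0
  then show ?case by simp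
next
  case (Suc n)
  define V where "V = Matrix.mat (Suc n) (Suc n) (\<lambda>(i, j). t j ^ i)"
  define Z where "Z = umat (Suc n) (t 0) * V"
  define H where "H = Matrix.mat n n (\<lambda>(i, j). (t (Suc j) - t 0) * t (Suc j) ^ i)"
  have V: "V \<in> carrier_mat (Suc n) (Suc n)" by (simp add: V_def)
  have Z: "Z \<in> carrier_mat (Suc n) (Suc n)" unfolding Z_def by (rule mult_carrier_mat[OF umat_carrier V])
  have Zi: "Z $$ (i, j) = (if i = 0 then 1 else t j ^ i - t 0 * t j ^ (i - 1))" if "i < Suc n" "j < Suc n" for i j
    unfolding Z_def using that umat_mult_index[OF V that, of "t 0"] by (simp add: V_def)
  have "jdet V = jdet Z" unfolding Z_def using V by (subst det_mult[of _ "Suc n"]) auto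
  also have "\<dots> = Z $$ (0, 0) * jdet H"
  proof (rule det_first_column[OF Z])
    show "Z $$ (i, 0) = 0" if "0 < i" "i < Suc n" for i
      using that by (cases i) (auto simp: Zi)
    show "H \<in> carrier_mat n n" by (simp add: H_def)
    show "Z $$ (Suc i, Suc j) = H $$ (i, j)" if "i < n" "j < n" for i j
      using that by (simp add: Zi H_def algebra_simps)
  qed
  also have "Z $$ (0, 0) = 1" by (simp add: Zi)
  also have "jdet H = (\<Prod>j<n. t (Suc j) - t 0) * (\<Prod>j<n. \<Prod>i<j. t (Suc j) - t (Suc i))"
    unfolding H_def det_scale_columns Suc.IH[symmetric] ..
  also have "\<dots> = (\<Prod>j<Suc n. \<Prod>i<j. t j - t i)"
    by (simp add: prod.lessThan_Suc_shift prod.distrib del: prod.lessThan_Suc)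
  finally show ?case by (simp add: V_def)
qed

text \<open>The square of a Vandermonde determinant in homogeneous coordinates (a : b). Each
  variable occurs with total degree 2 N - 2, and this power of a_i removes the denominators of b_i /
  a_i.\<close>

lemma vandermonde_homogeneous:
  fixes a b :: "nat \<Rightarrow> complex"
  assumes a: "\<And>i. i < N \<Longrightarrow> a i \<noteq> 0"
  shows "(\<Prod>j<N. \<Prod>i<j. (b j * a i - a j * b i)\<^sup>2) =
    (\<Sum>\<sigma> | \<sigma> permutes {0..<N}. \<Sum>\<tau> | \<tau> permutes {0..<N}.
       signof \<sigma> * signof \<tau> * (\<Prod>i<N. a i ^ (2 * N - 2 - (\<sigma> i + \<tau> i)) * b i ^ (\<sigma> i + \<tau> i)))"
proof -
  define t where "t = (\<lambda>i. b i / a i)"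
  have V: "(\<Prod>j<N. \<Prod>i<j. t j - t i) = (\<Sum>\<sigma> | \<sigma> permutes {0..<N}. signof \<sigma> * (\<Prod>i<N. t i ^ \<sigma> i))"
    unfolding vandermonde[symmetric]
    by (subst det_col[of _ N]) (auto intro!: sum.cong prod.cong dest: permutes_in_image)
  have A: "(\<Prod>j<N. \<Prod>i<j. (a j * a i)\<^sup>2) = (\<Prod>i<N. a i ^ (2 * N - 2))"
  proof (induction N)
    case (Suc n)
    have "(\<Prod>j<Suc n. \<Prod>i<j. (a j * a i)\<^sup>2) = (\<Prod>i<n. a i ^ (2 * n - 2)) * (\<Prod>i<n. a n ^ 2 * a i ^ 2)"
      using Suc by (simp add: power_mult_distrib)
    also have "\<dots> = (\<Prod>i<n. a i ^ (2 * n - 2) * a i ^ 2) * (a n ^ 2) ^ n"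
      by (simp add: prod.distrib)
    also have "(\<Prod>i<n. a i ^ (2 * n - 2) * a i ^ 2) = (\<Prod>i<n. a i ^ (2 * n))"
      by (intro prod.cong refl) (cases n; simp add: power_add[symmetric])
    finally show ?case by (simp add: power_mult[symmetric])
  qed simp
  have "(\<Prod>j<N. \<Prod>i<j. (b j * a i - a j * b i)\<^sup>2) = (\<Prod>j<N. \<Prod>i<j. (a j * a i)\<^sup>2 * (t j - t i)\<^sup>2)"
  proof (intro prod.cong refl)
    fix j i assume "j \<in> {..<N}" "i \<in> {..<j}"
    then have "a i \<noteq> 0" "a j \<noteq> 0" using a by auto
    then have "b j * a i - a j * b i = a j * a i * (t j - t i)" by (simp add: t_def field_simps)
    then show "(b j * a i - a j * b i)\<^sup>2 = (a j * a i)\<^sup>2 * (t j - t i)\<^sup>2" by (simp add: power_mult_distrib)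
  qed
  also have "\<dots> = (\<Prod>i<N. a i ^ (2 * N - 2)) * (\<Prod>j<N. \<Prod>i<j. t j - t i)\<^sup>2"
    by (simp add: prod.distrib A prod_power_distrib)
  also have "\<dots> = (\<Sum>\<sigma> | \<sigma> permutes {0..<N}. \<Sum>\<tau> | \<tau> permutes {0..<N}.
       (\<Prod>i<N. a i ^ (2 * N - 2)) * ((signof \<sigma> * (\<Prod>i<N. t i ^ \<sigma> i)) * (signof \<tau> * (\<Prod>i<N. t i ^ \<tau> i))))"
    unfolding V power2_eq_square sum_product by (simp only: sum_distrib_left)
  also have "\<dots> = (\<Sum>\<sigma> | \<sigma> permutes {0..<N}. \<Sum>\<tau> | \<tau> permutes {0..<N}.
       signof \<sigma> * signof \<tau> * (\<Prod>i<N. a i ^ (2 * N - 2 - (\<sigma> i + \<tau> i)) * b i ^ (\<sigma> i + \<tau> i)))"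
  proof (intro sum.cong refl)
    fix \<sigma> \<tau> assume st: "\<sigma> \<in> {\<sigma>. \<sigma> permutes {0..<N}}" "\<tau> \<in> {\<tau>. \<tau> permutes {0..<N}}"
    have "(\<Prod>i<N. a i ^ (2 * N - 2 - (\<sigma> i + \<tau> i)) * b i ^ (\<sigma> i + \<tau> i)) =
      (\<Prod>i<N. a i ^ (2 * N - 2) * (t i ^ \<sigma> i * t i ^ \<tau> i))"
    proof (intro prod.cong refl)
      fix i assume i: "i \<in> {..<N}"
      then have "\<sigma> i < N" "\<tau> i < N" using st permutes_in_image[of _ "{0..<N}" i] by auto
      then have "a i ^ (2 * N - 2) = a i ^ (2 * N - 2 - (\<sigma> i + \<tau> i)) * a i ^ (\<sigma> i + \<tau> i)"
        unfolding power_add[symmetric] by (intro arg_cong[where f = "power (a i)"]) linarith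
      moreover have "a i \<noteq> 0" using a i by auto
      ultimately show "a i ^ (2 * N - 2 - (\<sigma> i + \<tau> i)) * b i ^ (\<sigma> i + \<tau> i) = a i ^ (2 * N - 2) * (t i ^ \<sigma> i * t i ^ \<tau> i)"
        by (simp add: t_def power_divide power_add)
    qed
    then show "(\<Prod>i<N. a i ^ (2 * N - 2)) * ((signof \<sigma> * (\<Prod>i<N. t i ^ \<sigma> i)) * (signof \<tau> * (\<Prod>i<N. t i ^ \<tau> i))) =
       signof \<sigma> * signof \<tau> * (\<Prod>i<N. a i ^ (2 * N - 2 - (\<sigma> i + \<tau> i)) * b i ^ (\<sigma> i + \<tau> i))"
      by (simp add: prod.distrib mult_ac)
  qed
  finally show ?thesis .
qed

text \<open>For each \<sigma> the inner sum is the determinant with rows permuted by \<sigma>; its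
  sign cancels against the one in front, so all N! terms agree.\<close>

lemma hankel_double_sum:
  "(\<Sum>\<sigma> | \<sigma> permutes {0..<N}. \<Sum>\<tau> | \<tau> permutes {0..<N}. signof \<sigma> * signof \<tau> * (\<Prod>i<N. l (\<sigma> i + \<tau> i))) =
    fact N * hdet N l"
proof -
  have "(\<Sum>\<tau> | \<tau> permutes {0..<N}. signof \<sigma> * signof \<tau> * (\<Prod>i<N. l (\<sigma> i + \<tau> i))) = hdet N l"
    if s: "\<sigma> permutes {0..<N}" for \<sigma>
  proof -
    have "signof \<sigma> * hdet N l = jdet (Matrix.mat N N (\<lambda>(i, j). hankel N l $$ (\<sigma> i, j)))"
      by (rule det_permute_rows[OF _ s, symmetric]) simp
    also have "\<dots> = (\<Sum>\<tau> | \<tau> permutes {0..<N}. signof \<tau> * (\<Prod>i<N. l (\<sigma> i + \<tau> i)))"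
    proof (subst det_def'[of _ N], force, intro sum.cong refl)
      fix \<tau> assume t: "\<tau> \<in> {\<tau>. \<tau> permutes {0..<N}}"
      have "(\<Prod>i = 0..<N. Matrix.mat N N (\<lambda>(i, j). hankel N l $$ (\<sigma> i, j)) $$ (i, \<tau> i)) = (\<Prod>i<N. l (\<sigma> i + \<tau> i))"
      proof (intro prod.cong)
        fix i assume i: "i \<in> {..<N}"
        then have "\<sigma> i < N" "\<tau> i < N" using s t permutes_in_image[of _ "{0..<N}" i] by auto
        then show "Matrix.mat N N (\<lambda>(i, j). hankel N l $$ (\<sigma> i, j)) $$ (i, \<tau> i) = l (\<sigma> i + \<tau> i)"
          using i by (simp add: hankel_def)
      qed auto
      then show "signof \<tau> * (\<Prod>i = 0..<N. Matrix.mat N N (\<lambda>(i, j). hankel N l $$ (\<sigma> i, j)) $$ (i, \<tau> i)) =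
         signof \<tau> * (\<Prod>i<N. l (\<sigma> i + \<tau> i))" by simp
    qed
    finally have "(\<Sum>\<tau> | \<tau> permutes {0..<N}. signof \<tau> * (\<Prod>i<N. l (\<sigma> i + \<tau> i))) = signof \<sigma> * hdet N l" ..
    then have "(\<Sum>\<tau> | \<tau> permutes {0..<N}. signof \<sigma> * signof \<tau> * (\<Prod>i<N. l (\<sigma> i + \<tau> i))) =
        signof \<sigma> * (signof \<sigma> * hdet N l)"
      by (simp add: sum_distrib_left[symmetric] mult.assoc)
    moreover have "signof \<sigma> * (signof \<sigma> :: complex) = 1" by (simp add: sign_def)
    ultimately show ?thesis by (simp add: mult.assoc[symmetric])
  qed
  then have "(\<Sum>\<sigma> | \<sigma> permutes {0..<N}. \<Sum>\<tau> | \<tau> permutes {0..<N}. signof \<sigma> * signof \<tau> * (\<Prod>i<N. l (\<sigma> i + \<tau> i))) =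
      (\<Sum>\<sigma> | \<sigma> permutes {0..<N}. hdet N l)" by (intro sum.cong) auto
  also have "\<dots> = fact N * hdet N l"
    by (simp add: card_permutations[of "{0..<N}" N])
  finally show ?thesis .
qed

lemma det_hankel_scale: "hdet N (\<lambda>m. k * l m) = k ^ N * hdet N l"
proof -
  have "hankel N (\<lambda>m. k * l m) = k \<cdot>\<^sub>m hankel N l" by (auto simp: hankel_def)
  then show ?thesis by (simp add: hankel_def)
qed

lemma det_hankel_cong: "(\<And>m. m \<le> 2 * N - 2 \<Longrightarrow> N > 0 \<Longrightarrow> l m = l' m) \<Longrightarrow> hdet N l = hdet N l'"
  by (rule arg_cong[where f = jdet]) (auto simp: hankel_def)

lemma cyc_int_sum:
  assumes "finite S" "\<And>s \<gamma>. s \<in> S \<Longrightarrow> \<gamma> \<in> set Cs \<Longrightarrow> f s contour_integrable_on \<gamma>"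
  shows "cyc_int Cs (\<lambda>z. \<Sum>s\<in>S. k s * f s z) = (\<Sum>s\<in>S. k s * cyc_int Cs (f s))"
proof -
  have "contour_integral \<gamma> (\<lambda>z. \<Sum>s\<in>S. k s * f s z) = (\<Sum>s\<in>S. k s * contour_integral \<gamma> (f s))" if "\<gamma> \<in> set Cs" for \<gamma>
    using assms that by (subst contour_integral_sum) (auto intro!: contour_integrable_lmul contour_integral_lmul sum.cong)
  then have "cyc_int Cs (\<lambda>z. \<Sum>s\<in>S. k s * f s z) = (\<Sum>\<gamma>\<leftarrow>Cs. \<Sum>s\<in>S. k s * contour_integral \<gamma> (f s))"
    unfolding cyc_int_def by (intro arg_cong[where f = sum_list] map_cong) auto
  also have "\<dots> = (\<Sum>s\<in>S. \<Sum>\<gamma>\<leftarrow>Cs. k s * contour_integral \<gamma> (f s))"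
    by (induction Cs) (auto simp: sum.distrib)
  finally show ?thesis by (simp add: cyc_int_def sum_list_const_mult)
qed

lemma iterated_integral_Suc_cyc:
  "iterated_integral (Suc N) Cs f = cyc_int Cs (\<lambda>z. iterated_integral N Cs (\<lambda>zs. f (z # zs)))"
  by (simp add: cyc_int_def)

lemma iterated_integral_products:
  assumes "finite S" "\<And>s i \<gamma>. s \<in> S \<Longrightarrow> i < N \<Longrightarrow> \<gamma> \<in> set Cs \<Longrightarrow> F s i contour_integrable_on \<gamma>"
  shows "iterated_integral N Cs (\<lambda>zs. \<Sum>s\<in>S. c s * (\<Prod>i<N. F s i (zs ! i))) = (\<Sum>s\<in>S. c s * (\<Prod>i<N. cyc_int Cs (F s i)))"
  using assms(2)
proof (induction N arbitrary: c F)
  case (Suc N)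
  have "iterated_integral N Cs (\<lambda>zs. \<Sum>s\<in>S. c s * (\<Prod>i<Suc N. F s i ((z # zs) ! i))) =
      (\<Sum>s\<in>S. (c s * (\<Prod>i<N. cyc_int Cs (F s (Suc i)))) * F s 0 z)" for z
  proof -
    have "iterated_integral N Cs (\<lambda>zs. \<Sum>s\<in>S. (c s * F s 0 z) * (\<Prod>i<N. F s (Suc i) (zs ! i))) =
        (\<Sum>s\<in>S. (c s * F s 0 z) * (\<Prod>i<N. cyc_int Cs (F s (Suc i))))"
      by (rule Suc.IH) (use Suc.prems in auto)
    then show ?thesis by (simp add: prod.lessThan_Suc_shift mult_ac del: prod.lessThan_Suc)
  qed
  then have "iterated_integral (Suc N) Cs (\<lambda>zs. \<Sum>s\<in>S. c s * (\<Prod>i<Suc N. F s i (zs ! i))) =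
      cyc_int Cs (\<lambda>z. \<Sum>s\<in>S. (c s * (\<Prod>i<N. cyc_int Cs (F s (Suc i)))) * F s 0 z)"
    unfolding iterated_integral_Suc_cyc by simp
  also have "\<dots> = (\<Sum>s\<in>S. (c s * (\<Prod>i<N. cyc_int Cs (F s (Suc i)))) * cyc_int Cs (F s 0))"
    by (rule cyc_int_sum) (use assms(1) Suc.prems in auto)
  finally show ?case by (simp add: prod.lessThan_Suc_shift mult_ac del: prod.lessThan_Suc)
qed simp

text \<open>The exceptional points of an inner variable depend on the outer ones: for every
  \<open>z\<close> finitely many \<open>y\<close> are excluded. Recording this as
  \<open>sorted_wrt R\<close> lets the induction add one finite set per integration.\<close>

lemma iterated_integral_cong:
  assumes Cs: "cycle Cs" and R: "\<And>z. z \<in> contour_image Cs \<Longrightarrow> finite {y \<in> contour_image Cs. \<not> R z y}"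
    and B: "finite B"
    and eq: "\<And>zs. length zs = N \<Longrightarrow> set zs \<subseteq> contour_image Cs - B \<Longrightarrow> sorted_wrt R zs \<Longrightarrow> f zs = f' zs"
  shows "iterated_integral N Cs f = iterated_integral N Cs f'"
  using B eq
proof (induction N arbitrary: f f' B)
  case (Suc N)
  have "iterated_integral N Cs (\<lambda>zs. f (z # zs)) = iterated_integral N Cs (\<lambda>zs. f' (z # zs))"
    if z: "z \<in> contour_image Cs - B" for z
  proof (rule Suc.IH[of "B \<union> {y \<in> contour_image Cs. \<not> R z y}"])
    fix zs assume zs: "length zs = N" "set zs \<subseteq> contour_image Cs - (B \<union> {y \<in> contour_image Cs. \<not> R z y})" "sorted_wrt R zs"
    then have "\<forall>y\<in>set zs. R z y" by blast
    then show "f (z # zs) = f' (z # zs)" using zs z by (intro Suc.prems(2)) auto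
  qed (use Suc.prems R z in auto)
  then show ?case
    unfolding iterated_integral.simps
    using Cs by (intro arg_cong[where f = sum_list] map_cong refl contour_integral_spike(1)[OF _ Suc.prems(1)])
      (auto simp: cycle_def cloop_def contour_image_def)
qed auto

text \<open>\<open>K\<close> is the interaction as given, a quotient of elliptic Gamma functions. It
  is compared with the square for each outer point off a finite set only, since total functions take
  conventional values at zeros of denominators.\<close>

lemma andreief:
  assumes Cs: "cycle Cs" and a: "finite {z \<in> contour_image Cs. a z = 0}"
    and int: "\<And>m \<gamma>. m \<le> 2 * N - 2 \<Longrightarrow> \<gamma> \<in> set Cs \<Longrightarrow> (\<lambda>z. a z ^ (2 * N - 2 - m) * b z ^ m * g z) contour_integrable_on \<gamma>"
    and K: "\<And>z. z \<in> contour_image Cs \<Longrightarrow> finite {y \<in> contour_image Cs. K z y \<noteq> (b y * a z - a y * b z)\<^sup>2}"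
    and g: "finite {z \<in> contour_image Cs. g' z \<noteq> g z}"
  shows "iterated_integral N Cs (\<lambda>zs. (\<Prod>j<length zs. \<Prod>i<j. K (zs ! i) (zs ! j)) * (\<Prod>i<length zs. g' (zs ! i))) =
    fact N * hdet N (\<lambda>m. cyc_int Cs (\<lambda>z. a z ^ (2 * N - 2 - m) * b z ^ m * g z))"
proof -
  define S where "S = {\<sigma>. \<sigma> permutes {0..<N}}"
  define F :: "(nat \<Rightarrow> nat) \<times> (nat \<Rightarrow> nat) \<Rightarrow> nat \<Rightarrow> complex \<Rightarrow> complex" where "F = (\<lambda>(\<sigma>, \<tau>) i z. a z ^ (2 * N - 2 - (\<sigma> i + \<tau> i)) * b z ^ (\<sigma> i + \<tau> i) * g z)"
  define c :: "(nat \<Rightarrow> nat) \<times> (nat \<Rightarrow> nat) \<Rightarrow> complex" where "c = (\<lambda>(\<sigma>, \<tau>). signof \<sigma> * signof \<tau>)"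
  have fin: "finite S" unfolding S_def by (rule finite_permutations) simp
  have "iterated_integral N Cs (\<lambda>zs. (\<Prod>j<length zs. \<Prod>i<j. K (zs ! i) (zs ! j)) * (\<Prod>i<length zs. g' (zs ! i))) =
    iterated_integral N Cs (\<lambda>zs. \<Sum>s\<in>S \<times> S. c s * (\<Prod>i<N. F s i (zs ! i)))"
  proof (rule iterated_integral_cong[OF Cs K, where B = "{z \<in> contour_image Cs. a z = 0} \<union> {z \<in> contour_image Cs. g' z \<noteq> g z}"])
    fix zs assume len: "length zs = N"
      and sub: "set zs \<subseteq> contour_image Cs - ({z \<in> contour_image Cs. a z = 0} \<union> {z \<in> contour_image Cs. g' z \<noteq> g z})"
      and srt: "sorted_wrt (\<lambda>z y. K z y = (b y * a z - a y * b z)\<^sup>2) zs"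
    have nz: "a (zs ! i) \<noteq> 0" "g' (zs ! i) = g (zs ! i)" if "i < N" for i
      using subsetD[OF sub nth_mem[of i zs]] that len by auto
    have "(\<Prod>j<N. \<Prod>i<j. K (zs ! i) (zs ! j)) = (\<Prod>j<N. \<Prod>i<j. (b (zs ! j) * a (zs ! i) - a (zs ! j) * b (zs ! i))\<^sup>2)"
      using srt len by (intro prod.cong refl) (auto simp: sorted_wrt_iff_nth_less)
    also have "\<dots> = (\<Sum>\<sigma>\<in>S. \<Sum>\<tau>\<in>S. signof \<sigma> * signof \<tau> * (\<Prod>i<N. a (zs ! i) ^ (2 * N - 2 - (\<sigma> i + \<tau> i)) * b (zs ! i) ^ (\<sigma> i + \<tau> i)))"
      unfolding S_def by (rule vandermonde_homogeneous) (use nz in auto)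
    finally have h: "(\<Prod>j<N. \<Prod>i<j. K (zs ! i) (zs ! j)) = \<dots>" .
    have "(\<Prod>j<N. \<Prod>i<j. K (zs ! i) (zs ! j)) * (\<Prod>i<N. g (zs ! i)) =
       (\<Sum>\<sigma>\<in>S. \<Sum>\<tau>\<in>S. c (\<sigma>, \<tau>) * (\<Prod>i<N. F (\<sigma>, \<tau>) i (zs ! i)))"
      unfolding h sum_distrib_right by (simp add: c_def F_def prod.distrib mult_ac)
    moreover have "(\<Prod>i<N. g' (zs ! i)) = (\<Prod>i<N. g (zs ! i))" using nz by (intro prod.cong) auto
    ultimately show "(\<Prod>j<length zs. \<Prod>i<j. K (zs ! i) (zs ! j)) * (\<Prod>i<length zs. g' (zs ! i)) =
        (\<Sum>s\<in>S \<times> S. c s * (\<Prod>i<N. F s i (zs ! i)))"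
      by (simp add: sum.cartesian_product len case_prod_unfold)
  qed (use a g in auto)
  also have "\<dots> = (\<Sum>s\<in>S \<times> S. c s * (\<Prod>i<N. cyc_int Cs (F s i)))"
  proof (rule iterated_integral_products)
    fix s i \<gamma> assume s: "s \<in> S \<times> S" "i < N" "\<gamma> \<in> set Cs"
    then have "fst s i < N" "snd s i < N" using permutes_in_image[of _ "{0..<N}" i] by (auto simp: S_def)
    then show "F s i contour_integrable_on \<gamma>" using int[of "fst s i + snd s i" \<gamma>] s
      by (auto simp: F_def case_prod_unfold)
  qed (use fin in auto)
  also have "\<dots> = fact N * hdet N (\<lambda>m. cyc_int Cs (\<lambda>z. a z ^ (2 * N - 2 - m) * b z ^ m * g z))"
    unfolding hankel_double_sum[symmetric] S_def sum.cartesian_product by (simp add: c_def F_def case_prod_unfold)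
  finally show ?thesis .
qed

section \<open>The weight function\<close>

lemma cosparse_punctured:
  "(\<forall>\<^sup>*z. P z) \<longleftrightarrow> (\<forall>z. z \<noteq> 0 \<longrightarrow> eventually P (at z))"
  by (subst eventually_cosparse_open_eq) auto

lemma cosparse_nz: "\<forall>\<^sup>*z. z \<noteq> (0::complex)"
  by (auto simp: cosparse_punctured intro: eventually_neq_at_within)

lemma analytic_cosparse_nonzero:
  assumes "f holomorphic_on -{0}" "\<beta> \<noteq> 0" "f \<beta> \<noteq> (0::complex)"
  shows "\<forall>\<^sup>*z. f z \<noteq> 0"
  unfolding cosparse_punctured
proof (intro allI impI)
  fix z :: complex assume "z \<noteq> 0"
  then have "eventually (\<lambda>w. f w \<noteq> 0 \<and> w \<in> -{0}) (at z)"
    using assms by (intro non_zero_neighbour_alt[where \<beta> = \<beta>]) (auto intro: connected_punctured_universe simp: open_delete)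
  then show "eventually (\<lambda>w. f w \<noteq> 0) (at z)" by (rule eventually_mono) auto
qed

lemma finite_not_cosparse:
  assumes "\<forall>\<^sup>*z. P z" "compact K" "0 \<notin> K"
  shows "finite {z \<in> K. \<not> P z}"
proof -
  have "{z. \<not> P z} sparse_in K"
    using assms unfolding eventually_cosparse by (elim sparse_in_subset) auto
  then show ?thesis using sparse_in_compact_finite[of "{z. \<not> P z}" K] assms(2) by (simp add: Int_def conj_commute)
qed

lemma cyc_int_spike:
  assumes "cycle Cs" "\<forall>\<^sup>*z. f z = g z"
  shows "cyc_int Cs f = cyc_int Cs g"
proof -
  have fin: "finite {z \<in> contour_image Cs. f z \<noteq> g z}"
    using finite_not_cosparse[OF assms(2) compact_contour_image contour_image_nonzero] assms(1) by simp
  show ?thesis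
    unfolding cyc_int_def using assms(1)
    by (intro arg_cong[where f = sum_list] map_cong refl contour_integral_spike(1)[OF _ fin])
      (auto simp: cycle_def cloop_def contour_image_def)
qed

lemma dpoch_nonzero: "norm p < 1 \<Longrightarrow> norm q < 1 \<Longrightarrow> norm x < 1 \<Longrightarrow> dpoch p q x \<noteq> 0"
proof
  assume *: "norm p < 1" "norm q < 1" "norm x < 1" "dpoch p q x = 0"
  then obtain i j where "p ^ i * q ^ j * x = 1" by (auto simp: dpoch_eq_0_iff)
  then have "norm p ^ i * norm q ^ j * norm x = 1" by (metis norm_mult norm_power norm_one)
  moreover have "norm p ^ i \<le> 1" "norm q ^ j \<le> 1" using * by (auto intro!: power_le_one)
  then have "norm p ^ i * norm q ^ j * norm x \<le> 1 * norm x" by (intro mult_right_mono mult_le_one) auto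
  ultimately show False using * by simp
qed

locale elliptic = nome p for p :: complex +
  fixes q :: complex
  assumes q: "norm q < 1" "q \<noteq> 0"
begin

lemma dpoch_cosparse:
  assumes "k > 0"
  shows "\<forall>\<^sup>*z. dpoch p q (c * z ^ k) \<noteq> 0" "\<forall>\<^sup>*z. dpoch p q (c / z ^ k) \<noteq> 0"
proof -
  \<comment> \<open>For this radius c / s^k has norm less than 1, where \<open>dpoch\<close> does
    not vanish. The points 1 / s and s are the witnesses for the two functions.\<close>
  define s :: real where "s = 2 * (1 + norm c)"
  have s: "s \<ge> 2" "norm c < s" by (auto simp: s_def intro: add_nonneg_pos add_pos_nonneg)
  have s': "s ^ k \<ge> s" using s assms by (intro self_le_power) auto
  have "norm (c * complex_of_real (1 / s) ^ k) < 1" "norm (c / complex_of_real s ^ k) < 1"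
    using s s' by (auto simp: norm_mult norm_power norm_divide power_divide divide_simps)
  then have d: "dpoch p q (c * of_real (1 / s) ^ k) \<noteq> 0" "dpoch p q (c / of_real s ^ k) \<noteq> 0"
    by (intro dpoch_nonzero p q; simp)+
  show "\<forall>\<^sup>*z. dpoch p q (c * z ^ k) \<noteq> 0"
    by (rule analytic_cosparse_nonzero[where \<beta> = "of_real (1 / s)"]) (use d(1) p q s in \<open>auto intro!: holomorphic_intros\<close>)
  show "\<forall>\<^sup>*z. dpoch p q (c / z ^ k) \<noteq> 0"
    by (rule analytic_cosparse_nonzero[where \<beta> = "of_real s"]) (use d(2) p q s in \<open>auto intro!: holomorphic_intros\<close>)
qed

lemma dpoch_cosparse1:
  "\<forall>\<^sup>*z. dpoch p q (c * z) \<noteq> 0" "\<forall>\<^sup>*z. dpoch p q (c / z) \<noteq> 0"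
  using dpoch_cosparse[of 1 c] by simp_all

lemma egamma_reflect:
  assumes "y \<noteq> 0" "dpoch p q y \<noteq> 0" "dpoch p q (p / y) \<noteq> 0"
  shows "egamma p q y * egamma p q (p / y) = 1 / theta p y"
proof -
  have "dpoch p q y = poch_inf p y * dpoch p q (q * y)" "dpoch p q (p / y) = poch_inf p (p / y) * dpoch p q (p * q / y)"
    using dpoch_q[OF p(1) q(1), of y] dpoch_q[OF p(1) q(1), of "p / y"] by (simp_all add: mult_ac)
  then show ?thesis using assms p q by (simp add: egamma_eq theta_eq divide_simps)
qed

lemma egamma_reflect_shift:
  assumes "y \<noteq> 0" "dpoch p q y \<noteq> 0" "dpoch p q (p / y) \<noteq> 0"
  shows "egamma p q (q * y) * egamma p q (p * q / y) = theta p y"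
proof -
  have "dpoch p q y = poch_inf p y * dpoch p q (q * y)" "dpoch p q (p / y) = poch_inf p (p / y) * dpoch p q (p * q / y)"
    using dpoch_q[OF p(1) q(1), of y] dpoch_q[OF p(1) q(1), of "p / y"] by (simp_all add: mult_ac)
  then show ?thesis using assms p q by (simp add: egamma_eq theta_eq divide_simps)
qed

lemma egamma_q_shift:
  assumes "y \<noteq> 0" "dpoch p q y \<noteq> 0" "dpoch p q (p * q / y) \<noteq> 0"
  shows "egamma p q (q * y) = theta p y * egamma p q y" "egamma p q y \<noteq> 0"
proof -
  have "dpoch p q y = poch_inf p y * dpoch p q (q * y)" "dpoch p q (p / y) = poch_inf p (p / y) * dpoch p q (p * q / y)"
    using dpoch_q[OF p(1) q(1), of y] dpoch_q[OF p(1) q(1), of "p / y"] by (simp_all add: mult_ac)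
  then show "egamma p q (q * y) = theta p y * egamma p q y" "egamma p q y \<noteq> 0"
    using assms p q by (auto simp: egamma_eq theta_eq divide_simps)
qed

lemma theta_pair: "x \<noteq> 0 \<Longrightarrow> theta p (x * z) * theta p (x / z) = x * psi p x z"
  by (simp add: psi_def)

text \<open>Two reflections of the elliptic Gamma function. Through them the additional parameter
  pairs of the functions \<open>F\<close> act as division by, or multiplication with, a linear
  factor in the coordinate t.\<close>

lemma egamma2_pair:
  assumes x: "x \<noteq> 0"
  shows "\<forall>\<^sup>*z. egamma2 p q x z * egamma2 p q (p / x) z = 1 / (x * psi p x z)"
    and "\<forall>\<^sup>*z. egamma2 p q (q * x) z * egamma2 p q (p * q / x) z = x * psi p x z"
proof -
  have ev: "\<forall>\<^sup>*z. z \<noteq> 0 \<and> dpoch p q (x * z) \<noteq> 0 \<and> dpoch p q (x / z) \<noteq> 0 \<and>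
      dpoch p q (p / (x * z)) \<noteq> 0 \<and> dpoch p q (p / (x / z)) \<noteq> 0"
    using cosparse_nz dpoch_cosparse1[of x] dpoch_cosparse1[of "p / x"]
    by eventually_elim (use x in auto)
  then show "\<forall>\<^sup>*z. egamma2 p q x z * egamma2 p q (p / x) z = 1 / (x * psi p x z)"
  proof eventually_elim
    case (elim z)
    have "egamma2 p q x z * egamma2 p q (p / x) z =
       (egamma p q (x * z) * egamma p q (p / (x * z))) * (egamma p q (x / z) * egamma p q (p / (x / z)))"
      by (simp add: egamma2_def mult_ac)
    also have "\<dots> = 1 / theta p (x * z) * (1 / theta p (x / z))"
      using elim x by (subst (1 2) egamma_reflect) auto
    finally show ?case using x by (simp flip: theta_pair)
  qed
  from ev show "\<forall>\<^sup>*z. egamma2 p q (q * x) z * egamma2 p q (p * q / x) z = x * psi p x z"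
  proof eventually_elim
    case (elim z)
    have "egamma2 p q (q * x) z * egamma2 p q (p * q / x) z =
       (egamma p q (q * (x * z)) * egamma p q (p * q / (x * z))) * (egamma p q (q * (x / z)) * egamma p q (p * q / (x / z)))"
      by (simp add: egamma2_def mult_ac)
    also have "\<dots> = theta p (x * z) * theta p (x / z)"
      using elim x by (subst (1 2) egamma_reflect_shift) auto
    finally show ?case using x by (simp flip: theta_pair)
  qed
qed

text \<open>Each of the four arguments contributes \<Gamma>(q x) / \<Gamma>(x) = \<theta>_p(x), and
  the arguments come in inverse pairs, so that the result is the perfect square that the Andreief
  identity requires.\<close>

lemma egamma4_ratio:
  assumes z: "z \<noteq> 0"
  shows "\<forall>\<^sup>*y. egamma4 p q q z y / egamma4 p q 1 z y = (psi p z y)\<^sup>2"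
  using cosparse_nz dpoch_cosparse1[of z] dpoch_cosparse1[of "1 / z"]
    dpoch_cosparse1[of "p * q / z"] dpoch_cosparse1[of "p * q * z"]
proof eventually_elim
  case (elim y)
  have sh: "egamma p q (q * x) = theta p x * egamma p q x \<and> egamma p q x \<noteq> 0"
    if "x \<in> {z * y, z / y, 1 / z * y, 1 / z / y}" for x
    by (intro conjI egamma_q_shift) (use elim z that in \<open>auto simp: mult.assoc\<close>)
  have "egamma4 p q q z y / egamma4 p q 1 z y =
     theta p (z * y) * theta p (z / y) * (theta p (1 / z * y) * theta p (1 / z / y))"
    using sh[of "z * y"] sh[of "z / y"] sh[of "1 / z * y"] sh[of "1 / z / y"]
    by (simp add: egamma4_def egamma2_def field_simps)
  also have "\<dots> = z * psi p z y * (1 / z * psi p (1 / z) y)"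
    using z by (subst (1 2) theta_pair) auto
  also have "\<dots> = (psi p z y)\<^sup>2" using z elim by (simp add: psi_inverse1 power2_eq_square)
  finally show ?case .
qed

section \<open>Poles of the weight and the given contours\<close>

definition inner_points :: "complex list \<Rightarrow> complex set" where
  "inner_points as = {p ^ i * q ^ j * a | i j a. a \<in> set as}"

text \<open>\<open>Num\<close> and \<open>Den\<close> write \<Delta> as a quotient of functions
  holomorphic on the punctured plane. The factors of \<open>Num\<close> in z^2 stand for the
  reciprocal of \<Gamma>(z^2) \<Gamma>(z^-2), which has no poles there.\<close>

definition Den :: "complex list \<Rightarrow> complex \<Rightarrow> complex" where
  "Den as z = (\<Prod>a\<leftarrow>as. dpoch p q (a * z) * dpoch p q (a / z))"

definition Num :: "complex list \<Rightarrow> complex \<Rightarrow> complex" where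
  "Num as z = (\<Prod>a\<leftarrow>as. dpoch p q (p * q / (a * z)) * dpoch p q (p * q * z / a)) *
     (poch_inf q (z\<^sup>2) * poch_inf p (p * z\<^sup>2) * (poch_inf q (1 / z\<^sup>2) * poch_inf p (p / z\<^sup>2)))"

lemma holomorphic_Den: "Den as holomorphic_on -{0}"
  unfolding Den_def by (induction as) (use p q in \<open>auto intro!: holomorphic_intros\<close>)

lemma holomorphic_Num: "0 \<notin> set as \<Longrightarrow> Num as holomorphic_on -{0}"
proof -
  assume "0 \<notin> set as"
  then have "(\<lambda>z. \<Prod>a\<leftarrow>as. dpoch p q (p * q / (a * z)) * dpoch p q (p * q * z / a)) holomorphic_on -{0}"
    by (induction as) (use p q in \<open>auto intro!: holomorphic_intros\<close>)
  then show ?thesis unfolding Num_def using p q by (auto intro!: holomorphic_intros)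
qed

lemma Den_cosparse: "\<forall>\<^sup>*z. Den as z \<noteq> 0"
proof (induction as)
  case (Cons a as)
  from Cons dpoch_cosparse1[of a] show ?case by eventually_elim (simp add: Den_def)
qed (simp add: Den_def)

lemma dpoch_scaled_eq_0_iff:
  "z \<noteq> 0 \<Longrightarrow> dpoch p q (a * z) = 0 \<longleftrightarrow> (\<exists>i j. 1 / z = p ^ i * q ^ j * a)"
  "z \<noteq> 0 \<Longrightarrow> dpoch p q (a / z) = 0 \<longleftrightarrow> (\<exists>i j. z = p ^ i * q ^ j * a)"
  using p q by (auto simp: dpoch_eq_0_iff field_simps)

lemma Den_eq_0_iff:
  assumes z: "z \<noteq> 0"
  shows "Den as z = 0 \<longleftrightarrow> z \<in> inner_points as \<or> 1 / z \<in> inner_points as"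
proof -
  have "Den as z = 0 \<longleftrightarrow> (\<exists>a\<in>set as. dpoch p q (a * z) = 0 \<or> dpoch p q (a / z) = 0)"
    unfolding Den_def prod_list_zero_iff set_map image_iff by (auto simp: eq_commute[of 0])
  also have "\<dots> \<longleftrightarrow> (\<exists>a\<in>set as. (\<exists>i j. 1 / z = p ^ i * q ^ j * a) \<or> (\<exists>i j. z = p ^ i * q ^ j * a))"
    by (simp only: dpoch_scaled_eq_0_iff[OF z])
  finally show ?thesis unfolding inner_points_def by blast
qed

lemma inverse_egamma2_one:
  "\<forall>\<^sup>*z. 1 / egamma2 p q 1 (z\<^sup>2) =
    poch_inf q (z\<^sup>2) * poch_inf p (p * z\<^sup>2) * (poch_inf q (1 / z\<^sup>2) * poch_inf p (p / z\<^sup>2))"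
  using cosparse_nz dpoch_cosparse[OF zero_less_numeral, of 1 "num.Bit0 num.One"]
    dpoch_cosparse[OF zero_less_numeral, of "p * q" "num.Bit0 num.One"]
proof eventually_elim
  case (elim z)
  have "dpoch p q x = poch_inf q x * poch_inf p (p * x) * dpoch p q (p * q * x)" for x
    using dpoch_p[OF p(1) q(1), of x] dpoch_q[OF p(1) q(1), of "p * x"] by (simp add: mult_ac)
  from this[of "z\<^sup>2"] this[of "1 / z\<^sup>2"] show ?case
    using elim p q by (simp add: egamma2_def egamma_eq field_simps)
qed

lemma Delta_eq:
  assumes "0 \<notin> set as"
  shows "\<forall>\<^sup>*z. Delta p q z as = Num as z / Den as z"
  using cosparse_nz Den_cosparse[of as] inverse_egamma2_one
proof eventually_elim
  case (elim z)
  have "(\<Prod>a\<leftarrow>as. egamma2 p q a z) = (\<Prod>a\<leftarrow>as. dpoch p q (p * q / (a * z)) * dpoch p q (p * q * z / a)) / Den as z"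
    using elim(2) assms unfolding Den_def
    by (induction as) (use p q in \<open>auto simp: egamma2_def egamma_eq mult_ac\<close>)
  moreover have "Delta p q z as = (\<Prod>a\<leftarrow>as. egamma2 p q a z) * (1 / egamma2 p q 1 (z\<^sup>2))" by (simp add: Delta_def)
  ultimately show ?case by (simp only: Num_def elim(3)) simp
qed

lemma meromorphic_Delta: 
  assumes "0 \<notin> set as"
  shows "(\<lambda>z. Delta p q z as) meromorphic_on -{0}"
proof -
  have "(\<lambda>z. Num as z / Den as z) meromorphic_on -{0}"
    using holomorphic_Num[OF assms] holomorphic_Den
    by (intro meromorphic_intros analytic_on_imp_meromorphic_on) (auto simp: analytic_punctured_iff)
  then show ?thesis using meromorphic_on_cong'[OF Delta_eq[OF assms] refl] by simp
qed

lemma Delta_inverse: "Delta p q (1 / z) as = Delta p q z as"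
  by (simp add: Delta_def egamma2_def power_divide mult_ac)

lemma Delta_pole:
  assumes "0 \<notin> set as" "is_pole (\<lambda>z. Delta p q z as) s" "s \<noteq> 0"
  shows "s \<in> inner_points as \<or> 1 / s \<in> inner_points as"
proof (rule ccontr)
  assume "\<not> ?thesis"
  then have "Den as s \<noteq> 0" using assms(3) by (simp add: Den_eq_0_iff)
  then have "(\<lambda>z. Num as z / Den as z) \<midarrow>s\<rightarrow> Num as s / Den as s"
    using holomorphic_isCont[OF holomorphic_Num[OF assms(1)], of s] holomorphic_isCont[OF holomorphic_Den, of s as] assms(3)
    by (intro tendsto_divide) (auto simp: isCont_def open_delete)
  then have "\<not> is_pole (\<lambda>z. Num as z / Den as z) s" by (rule limit_not_pole)
  moreover have "eventually (\<lambda>z. Delta p q z as = Num as z / Den as z) (at s)"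
    using Delta_eq[OF assms(1)] assms(3) by (auto simp: cosparse_punctured)
  ultimately show False using is_pole_transform[OF assms(2), of "\<lambda>z. Num as z / Den as z" s] by simp
qed

lemma is_pole_inverse:
  assumes f: "\<And>z. f (1 / z) = f z" and s: "is_pole f s" "s \<noteq> (0::complex)"
  shows "is_pole f (1 / s)"
proof -
  have "filterlim (\<lambda>z. 1 / z) (at s) (at (1 / s))"
  proof (rule filterlim_atI)
    have "(\<lambda>z. 1 / z) \<midarrow>1 / s\<rightarrow> 1 / (1 / s)" using s by (intro tendsto_intros) auto
    then show "(\<lambda>z. 1 / z) \<midarrow>1 / s\<rightarrow> s" by simp
    have "\<forall>\<^sub>F z in at (1 / s). z \<noteq> 1 / s" by (rule eventually_neq_at_within)
    then show "\<forall>\<^sub>F z in at (1 / s). 1 / z \<noteq> s" by eventually_elim (use s in auto)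
  qed
  from filterlim_compose[OF s(1)[unfolded is_pole_def] this] show ?thesis by (simp add: is_pole_def f)
qed

text \<open>Winding number 1 about 0 follows by inversion from winding number 0 far out. Poles at
  inverses of \<open>inner_points\<close> lie outside, because \<open>Delta\<close> is invariant
  under inversion and the contour exchanges its two sides.\<close>

lemma contour_facts:
  assumes as: "0 \<notin> set as" and Cs: "is_contour_for p q as Cs"
  shows "cycle Cs" "contour_winding Cs 0 = 1" "\<And>z. z \<notin> contour_image Cs \<Longrightarrow> contour_winding Cs z \<in> {0, 1}"
    "\<And>s. s \<noteq> 0 \<Longrightarrow> is_pole (\<lambda>z. Delta p q z as) s \<Longrightarrow> s \<notin> contour_image Cs"
    "\<And>s. s \<noteq> 0 \<Longrightarrow> is_pole (\<lambda>z. Delta p q z as) s \<Longrightarrow> s \<in> inner_points as \<Longrightarrow> contour_winding Cs s = 1"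
    "\<And>s. s \<noteq> 0 \<Longrightarrow> is_pole (\<lambda>z. Delta p q z as) s \<Longrightarrow> 1 / s \<in> inner_points as \<Longrightarrow> contour_winding Cs s = 0"
proof -
  show c: "cycle Cs" using Cs by (auto simp: is_contour_for_def closed_contour_def cycle_def cloop_def)
  show "\<And>z. z \<notin> contour_image Cs \<Longrightarrow> contour_winding Cs z \<in> {0, 1}"
    using Cs by (auto simp: is_contour_for_def closed_contour_def)
  have inv: "inverse ` contour_image Cs = contour_image Cs"
     "\<And>z. z \<noteq> 0 \<Longrightarrow> z \<notin> contour_image Cs \<Longrightarrow> contour_winding Cs (inverse z) = 1 - contour_winding Cs z"
    using Cs by (auto simp: is_contour_for_def inversion_invariant_def)
  obtain r where r: "r > 0" "\<And>z. norm z < r \<Longrightarrow> z \<notin> contour_image Cs \<and> contour_winding Cs z = contour_winding Cs 0"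
    using contour_winding_near[OF c] by blast
  obtain R where R: "\<And>z. norm z \<ge> R \<Longrightarrow> z \<notin> contour_image Cs \<and> contour_winding Cs z = 0"
    using contour_winding_far[OF c] by blast
  \<comment> \<open>Far enough out to have winding number 0, with an inverse close enough to 0 to
    have the winding number of 0.\<close>
  define z :: complex where "z = of_real (max (max R 1) (2 / r))"
  have z: "norm z \<ge> R" "norm z \<ge> 2 / r" "norm z \<ge> 1" by (auto simp: z_def)
  then have "z \<noteq> 0" by auto
  have "norm (inverse z) \<le> r / 2" using z(2,3) r(1) le_imp_inverse_le[OF z(2)] by (simp add: norm_inverse)
  then have "norm (inverse z) < r" using r(1) by linarith
  then show "contour_winding Cs 0 = 1" using inv(2)[of z] r(2)[of "inverse z"] R[OF z(1)] \<open>z \<noteq> 0\<close> by simp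
  have inn: "s \<notin> contour_image Cs \<and> contour_winding Cs s = 1"
    if "is_pole (\<lambda>z. Delta p q z as) s" "s \<in> inner_points as" for s
    using Cs that unfolding is_contour_for_def contour_interior_def inner_points_def by blast
  have out: "s \<notin> contour_image Cs \<and> contour_winding Cs s = 0"
    if "is_pole (\<lambda>z. Delta p q z as) s" "1 / s \<in> inner_points as" "s \<noteq> 0" for s
  proof -
    have *: "1 / s \<notin> contour_image Cs \<and> contour_winding Cs (1 / s) = 1"
      using inn is_pole_inverse[OF Delta_inverse that(1,3)] that(2) by blast
    then have "s \<notin> contour_image Cs" using inv(1) by (metis imageI inverse_eq_divide)
    moreover have "contour_winding Cs s = 0" using inv(2)[of "1 / s"] * that(3) by (simp add: inverse_eq_divide)
    ultimately show ?thesis by blast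
  qed
  show "s \<notin> contour_image Cs" if "s \<noteq> 0" "is_pole (\<lambda>z. Delta p q z as) s" for s
    using inn out Delta_pole[OF as] that by blast
  show "contour_winding Cs s = 1" if "is_pole (\<lambda>z. Delta p q z as) s" "s \<in> inner_points as" for s
    using inn that by blast
  show "contour_winding Cs s = 0" if "s \<noteq> 0" "is_pole (\<lambda>z. Delta p q z as) s" "1 / s \<in> inner_points as" for s
    using out that by blast
qed

end

section \<open>Generic contours\<close>

context nome
begin

text \<open>Close to but not at \<open>v0\<close>, the members of the families of moderate size
  avoid the singularities of \<open>g\<close>; the others are so small or so large that
  \<open>lab\<close> agrees with the required side anyway.\<close>

lemma eventually_good:
  assumes g: "g meromorphic_on -{0}" and v0: "v0 \<noteq> 0" and lab: "lab_bounded {s. s \<noteq> 0 \<and> is_pole g s} lab"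
  shows "eventually (\<lambda>v. \<exists>G. good g lab v G) (at v0)"
proof -
  from lab obtain r R where rR: "r > 0" "\<And>s. s \<noteq> 0 \<Longrightarrow> is_pole g s \<Longrightarrow> norm s < r \<Longrightarrow> lab s = 1"
    "\<And>s. s \<noteq> 0 \<Longrightarrow> is_pole g s \<Longrightarrow> norm s > R \<Longrightarrow> lab s = 0"
    unfolding lab_bounded_def by blast
  obtain N where N: "N > 0"
    "\<And>v i. norm v0 / 2 < norm v \<Longrightarrow> norm v < 2 * norm v0 \<Longrightarrow> i > N \<Longrightarrow> norm (v * p powi i) < r \<and> norm (p powi i / v) < r"
    "\<And>v i. norm v0 / 2 < norm v \<Longrightarrow> norm v < 2 * norm v0 \<Longrightarrow> i < -N \<Longrightarrow> norm (v * p powi i) > R \<and> norm (p powi i / v) > R"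
    by (rule fam_far[OF v0 rR(1)]) blast
  have "eventually (\<lambda>v. \<forall>i\<in>{-N..N}. g analytic_on {v * p powi i} \<and> g analytic_on {p powi i / v}) (at v0)"
    by (intro eventually_ball_finite ballI eventually_fam_analytic[OF g v0]) auto
  moreover have "eventually (\<lambda>v. theta p (1 * v ^ 2) \<noteq> 0) (at v0)"
    by (rule eventually_theta_nonzero) (use v0 in auto)
  ultimately show ?thesis using eventually_norm_bounds[OF v0]
  proof eventually_elim
    case (elim v)
    then have v: "v \<noteq> 0" using v0 by auto
    note big = N(2)[OF conjunct1[OF elim(3)] conjunct2[OF elim(3)]] and small = N(3)[OF conjunct1[OF elim(3)] conjunct2[OF elim(3)]]
    have np: "\<not> is_pole g (v * p powi i) \<and> \<not> is_pole g (p powi i / v)" if "i \<in> {-N..N}" for i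
      using elim(1) that analytic_at_imp_no_pole by blast
    have c1: "lab (v * p powi i) = of_bool (i \<ge> 0)" if "is_pole g (v * p powi i)" for i
    proof -
      consider "i > N" | "i < -N" | "i \<in> {-N..N}" by fastforce
      then show ?thesis
        by cases (use that rR(2,3)[of "v * p powi i"] np[of i] big[of i] small[of i] v p N(1) in auto)
    qed
    have c2: "lab (p powi i / v) = of_bool (i \<ge> 1)" if "is_pole g (p powi i / v)" for i
    proof -
      consider "i > N" | "i < -N" | "i \<in> {-N..N}" by fastforce
      then show ?thesis
        by cases (use that rR(2,3)[of "p powi i / v"] np[of i] big[of i] small[of i] v p N(1) in auto)
    qed
    obtain G where "good g lab v G"
      by (rule good_exists[OF g v _ c1 c2 lab]) (use elim(2) in auto)
    then show ?case by blast
  qed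
qed

text \<open>A common zero \<open>s\<close> makes the right-hand side of the addition formula vanish,
  while the auxiliary point \<open>e\<close> keeps psi(s, e) away from 0.\<close>

lemma fam_disjoint:
  assumes "x \<noteq> 0" "v \<noteq> 0" "psi p x v \<noteq> 0" "s \<in> fam x"
  shows "s \<notin> fam v"
proof
  assume "s \<in> fam v"
  then have s: "s \<noteq> 0" "psi p x s = 0" "psi p v s = 0" using assms by (auto simp: fam_def)
  obtain e where e: "e \<noteq> 0" "psi p s e \<noteq> 0" by (rule ex_psi_nonzero[OF s(1)]) blast
  have "psi p s x = 0" "psi p s v = 0" using psi_antisym[of x s] psi_antisym[of v s] assms s by simp_all
  then show False using psi_addition[OF assms(1,2) s(1) e(1)] assms e by simp
qed

text \<open>\<open>Fplus\<close> carries two Cauchy kernels and needs one cycle that is good for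
  both parameters. Their families are disjoint, so the two labellings can be merged.\<close>

lemma joint_good_exists:
  assumes g: "g meromorphic_on -{0}" and xv: "x \<noteq> 0" "v \<noteq> 0" "psi p x v \<noteq> 0" and G: "good g lab x Gx" "good g lab v Gv"
    and lab: "\<And>s. lab s \<in> {0, 1}"
  obtains G where "good g lab x G" "good g lab v G"
proof -
  define Z where "Z = fam x \<union> fam v \<union> {s. s \<noteq> 0 \<and> \<not> g analytic_on {s}}"
  define L where "L = (\<lambda>s. if s \<in> fam x then contour_winding Gx s else contour_winding Gv s)"
  define In where "In = {s \<in> Z. L s = 1}"
  have cyc: "cycle Gx" "cycle Gv" using G by (auto simp: good_def)
  obtain r1 where r1: "r1 > 0" "\<And>z. norm z < r1 \<Longrightarrow> contour_winding Gx z = 1"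
    using contour_winding_near[OF cyc(1)] G(1) unfolding good_def by metis
  obtain r2 where r2: "r2 > 0" "\<And>z. norm z < r2 \<Longrightarrow> contour_winding Gv z = 1"
    using contour_winding_near[OF cyc(2)] G(2) unfolding good_def by metis
  obtain R1 where R1: "\<And>z. norm z \<ge> R1 \<Longrightarrow> z \<notin> contour_image Gx \<and> contour_winding Gx z = 0"
    by (rule contour_winding_far[OF cyc(1)]) blast
  obtain R2 where R2: "\<And>z. norm z \<ge> R2 \<Longrightarrow> z \<notin> contour_image Gv \<and> contour_winding Gv z = 0"
    by (rule contour_winding_far[OF cyc(2)]) blast
  have sp: "Z sparse_in -{0}"
  proof -
    have "{s. \<not> g analytic_on {s}} sparse_in -{0}"
      using meromorphic_on_imp_analytic_cosparse[OF g] by (simp add: eventually_cosparse)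
    then have "{s. s \<noteq> 0 \<and> \<not> g analytic_on {s}} sparse_in -{0}" by (rule sparse_in_subset2) auto
    then show ?thesis unfolding Z_def using fam_sparse xv by (intro sparse_in_union') auto
  qed
  obtain Cs where Cs: "cycle Cs" "contour_image Cs \<inter> Z = {}" "contour_winding Cs 0 = 1"
    "\<And>s. s \<in> In \<Longrightarrow> contour_winding Cs s = 1" "\<And>s. s \<in> Z - In \<Longrightarrow> contour_winding Cs s = 0"
  proof (rule labelled_cycle[OF sp, of In "max R1 R2" "min r1 r2"])
    show "0 \<notin> Z" by (auto simp: Z_def fam_nonzero)
    show "norm s \<le> max R1 R2" if "s \<in> In" for s
      using that R1[of s] R2[of s] by (force simp: In_def L_def split: if_splits)
    show "norm s \<ge> min r1 r2" if "s \<in> Z - In" for s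
      using that r1(2)[of s] r2(2)[of s] by (force simp: In_def L_def split: if_splits)
    show "In \<subseteq> Z" by (auto simp: In_def)
  qed (use r1(1) r2(1) in auto)
  have W: "contour_winding Cs s = L s" if "s \<in> Z" "L s \<in> {0, 1}" for s
    using Cs(4)[of s] Cs(5)[of s] that by (auto simp: In_def)
  have famx: "contour_winding Gx (x * p powi i) = of_bool (i \<ge> 0) \<and> contour_winding Gx (p powi i / x) = of_bool (i \<ge> 1)"
    and famv: "contour_winding Gv (v * p powi i) = of_bool (i \<ge> 0) \<and> contour_winding Gv (p powi i / v) = of_bool (i \<ge> 1)" for i
    using G by (auto simp: good_def)
  have inx: "x * p powi i \<in> fam x" "p powi i / x \<in> fam x" for i using fam_iff[OF xv(1)] by blast+
  have inv: "v * p powi i \<in> fam v" "p powi i / v \<in> fam v" for i using fam_iff[OF xv(2)] by blast+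
  have Wx: "contour_winding Cs (x * p powi i) = of_bool (i \<ge> 0) \<and> contour_winding Cs (p powi i / x) = of_bool (i \<ge> 1)" for i
    using W[of "x * p powi i"] W[of "p powi i / x"] inx[of i] famx[of i] by (auto simp: L_def Z_def)
  have Wv: "contour_winding Cs (v * p powi i) = of_bool (i \<ge> 0) \<and> contour_winding Cs (p powi i / v) = of_bool (i \<ge> 1)" for i
  proof -
    have "v * p powi i \<notin> fam x" "p powi i / v \<notin> fam x" using inv[of i] fam_disjoint[OF xv] by blast+
    then show ?thesis using W[of "v * p powi i"] W[of "p powi i / v"] inv[of i] famv[of i] by (auto simp: L_def Z_def)
  qed
  have Wp: "contour_winding Cs s = lab s" if s: "s \<noteq> 0" "is_pole g s" for s
  proof -
    have "s \<in> Z" using s analytic_at_imp_no_pole by (auto simp: Z_def)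
    moreover have "L s = lab s" using G s by (auto simp: L_def good_def)
    ultimately show ?thesis using W[of s] lab[of s] by auto
  qed
  have im: "contour_image Cs \<inter> (fam y \<union> {s. \<not> g analytic_on {s}}) = {}" if "y \<in> {x, v}" for y
    using Cs(2) contour_image_nonzero[OF Cs(1)] that by (auto simp: Z_def)
  show ?thesis
    by (rule that[of Cs]) (use Cs(1,3) im Wx Wv Wp in \<open>simp_all add: good_def\<close>)
qed

lemma product_pole:
  assumes "g meromorphic_on -{0}" "f holomorphic_on -{0}" "s \<noteq> 0" "is_pole (\<lambda>s. g s * f s) s"
  shows "is_pole g s"
proof (rule ccontr)
  assume "\<not> is_pole g s"
  moreover have "g meromorphic_on {s}" by (rule meromorphic_on_subset[OF assms(1)]) (use assms(3) in auto)
  ultimately obtain L where "g \<midarrow>s\<rightarrow> L" using not_pole_limit by blast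
  moreover have "f \<midarrow>s\<rightarrow> f s" using holomorphic_isCont[OF assms(2), of s] assms(3) by (auto simp: isCont_def open_delete)
  ultimately have "(\<lambda>s. g s * f s) \<midarrow>s\<rightarrow> L * f s" by (rule tendsto_mult)
  then show False using assms(4) limit_not_pole by blast
qed

lemma good_mult:
  assumes "good g lab v G" "g meromorphic_on -{0}" "f holomorphic_on -{0}"
  shows "good (\<lambda>s. g s * f s) lab v G"
proof -
  have c: "cycle G" using assms(1) by (simp add: good_def)
  have "(\<lambda>s. g s * f s) analytic_on {s}" if "s \<in> contour_image G" for s
    using that assms(1) contour_image_nonzero[OF c] analytic_punctured[OF assms(3)[unfolded analytic_punctured_iff], of s]
    by (intro analytic_on_mult) (auto simp: good_def)
  then show ?thesis using assms(1) product_pole[OF assms(2,3)] by (auto simp: good_def)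
qed

text \<open>A single choice of cycle for the weight \<open>g\<close> serves all moments, that is,
  all holomorphic factors \<open>h\<close>.\<close>

lemma eventually_some_good:
  assumes "eventually (\<lambda>v. \<exists>G. good g lab v G) F" "g meromorphic_on -{0}" "h holomorphic_on -{0}"
  shows "eventually (\<lambda>v. \<exists>G. good (\<lambda>s. g s * h s) lab v G \<and>
    cyc_int (SOME G. good g lab v G) (ker (\<lambda>s. g s * h s) v) = cyc_int G (ker (\<lambda>s. g s * h s) v)) F"
  using assms(1) by (rule eventually_mono) (rule exI, rule conjI, rule good_mult[OF someI_ex assms(2,3)], assumption, rule refl)

lemma good_integrable:
  assumes "good g lab v G" "g meromorphic_on -{0}" "v \<noteq> 0" "\<gamma> \<in> set G"
  shows "ker g v contour_integrable_on \<gamma>"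
proof (rule cycle_integrable[OF _ meromorphic_ker[OF assms(2,3)] _ assms(4)])
  show c: "cycle G" using assms(1) by (simp add: good_def)
  fix s assume s: "is_pole (ker g v) s"
  show "s \<notin> contour_image G"
  proof
    assume *: "s \<in> contour_image G"
    then have "ker g v analytic_on {s}"
      using assms(1,3) contour_image_nonzero[OF c] by (intro ker_analytic) (auto simp: good_def)
    then show False using s analytic_at_imp_no_pole by blast
  qed
qed

text \<open>The families of v and p / v are the same set with the two halves exchanged; the shift of
  the exponent by one turns the bound 0 into the bound 1 and conversely.\<close>

lemma good_shift: "v \<noteq> 0 \<Longrightarrow> good g lab v G \<Longrightarrow> good g lab (p / v) G"
proof -
  assume v: "v \<noteq> 0" and G: "good g lab v G"
  have 1: "p / v * p powi i = p powi (i + 1) / v" "p powi i / (p / v) = v * p powi (i - 1)" for i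
    using p v by (simp_all add: power_int_add power_int_diff field_simps)
  have "z \<in> fam (p / v) \<longleftrightarrow> z \<in> fam v" for z
    using psi_p1[of "1 / v" z] v p by (cases "z = 0") (auto simp: fam_def psi_inverse1)
  then have "fam (p / v) = fam v" by blast
  then show ?thesis using G unfolding good_def 1 by auto
qed

end

section \<open>Determinants of moments\<close>

lemma cyc_int_lin:
  assumes "\<And>\<gamma>. \<gamma> \<in> set Cs \<Longrightarrow> f contour_integrable_on \<gamma>" "\<And>\<gamma>. \<gamma> \<in> set Cs \<Longrightarrow> g contour_integrable_on \<gamma>"
  shows "cyc_int Cs (\<lambda>z. a * f z + b * g z) = a * cyc_int Cs f + b * cyc_int Cs g"
proof -
  have "cyc_int Cs (\<lambda>z. \<Sum>i\<in>{True, False}. (if i then a else b) * (if i then f else g) z) =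
     (\<Sum>i\<in>{True, False}. (if i then a else b) * cyc_int Cs (if i then f else g))"
    by (rule cyc_int_sum) (use assms in auto)
  then show ?thesis by simp
qed

lemma cyc_int_lmul:
  assumes "\<And>\<gamma>. \<gamma> \<in> set Cs \<Longrightarrow> f contour_integrable_on \<gamma>"
  shows "cyc_int Cs (\<lambda>z. a * f z) = a * cyc_int Cs f"
  using cyc_int_lin[OF assms assms, of Cs a 0] by simp

locale theta_basis = elliptic p q for p q :: complex +
  fixes c d :: complex
  assumes cd: "c \<noteq> 0" "d \<noteq> 0" "psi p c d \<noteq> 0"
begin

text \<open>\<open>A\<close> and \<open>B\<close> are normalized so that \<open>psi\<close> is their
  determinant. The quotient \<open>t\<close> is invariant under inversion and under shifts by
  \<open>p\<close>, and serves as coordinate on the projective line.\<close>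

definition A :: "complex \<Rightarrow> complex" where "A = psi p c"

definition B :: "complex \<Rightarrow> complex" where "B = (\<lambda>x. - psi p d x / psi p c d)"

definition t :: "complex \<Rightarrow> complex" where "t x = B x / A x"

definition \<kappa> :: complex where "\<kappa> = poch_inf p p * poch_inf q q * egamma p q q"

text \<open>The constant per integration variable: \<kappa> / 2 from the prefactor of
  \<open>II\<close>, and 1 / (2 pi i) from the measure.\<close>

definition K :: complex where "K = \<kappa> / (4 * of_real pi * \<i>)"

lemma psi_AB: "x \<noteq> 0 \<Longrightarrow> y \<noteq> 0 \<Longrightarrow> psi p x y = B x * A y - A x * B y"
  using psi_decomposition[OF cd, of x y] by (simp add: A_def B_def)

lemma psi_t: "x \<noteq> 0 \<Longrightarrow> y \<noteq> 0 \<Longrightarrow> A x \<noteq> 0 \<Longrightarrow> A y \<noteq> 0 \<Longrightarrow> psi p x y = A x * A y * (t x - t y)"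
  by (simp add: psi_AB t_def field_simps)

lemma holomorphic_A: "A holomorphic_on -{0}" and holomorphic_B: "B holomorphic_on -{0}"
  using psi_holomorphic2[of c] psi_holomorphic2[of d] cd by (auto simp: A_def B_def intro!: holomorphic_intros)

lemma A_cosparse: "\<forall>\<^sup>*z. A z \<noteq> 0"
  using analytic_cosparse_nonzero[OF holomorphic_A cd(2)] cd by (simp add: A_def)

text \<open>Homogeneous monomials of degree N in A and B, in place of t^m. They are meant for m
  \<le> N, as the subtraction is truncated.\<close>

definition \<phi> :: "nat \<Rightarrow> nat \<Rightarrow> complex \<Rightarrow> complex" where
  "\<phi> N m s = A s ^ (N - m) * B s ^ m"

lemma holomorphic_\<phi> [holomorphic_intros]: "\<phi> N m holomorphic_on -{0}"
  unfolding \<phi>_def by (intro holomorphic_intros holomorphic_A holomorphic_B)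

lemma \<phi>_psi: "m < N \<Longrightarrow> x \<noteq> 0 \<Longrightarrow> s \<noteq> 0 \<Longrightarrow> B x * \<phi> N m s - A x * \<phi> N (Suc m) s = psi p x s * \<phi> (N - 1) m s"
  by (simp add: \<phi>_def psi_AB Suc_diff_Suc[symmetric] algebra_simps)

lemma \<phi>_A: "m < N \<Longrightarrow> A s * \<phi> (N - 1) m s = \<phi> N m s"
  by (simp add: \<phi>_def Suc_diff_Suc[symmetric])

lemma weight_integrable:
  assumes Cs: "cycle Cs" and g: "g meromorphic_on -{0}" and h: "h holomorphic_on -{0}"
    and av: "\<And>s. s \<noteq> 0 \<Longrightarrow> is_pole (\<lambda>s. g s * h s) s \<Longrightarrow> s \<notin> contour_image Cs" and \<gamma>: "\<gamma> \<in> set Cs"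
  shows "(\<lambda>s. g s * h s / s) contour_integrable_on \<gamma>"
proof (rule cycle_integrable[OF Cs _ _ \<gamma>])
  have m: "(\<lambda>s. g s * h s) meromorphic_on -{0}"
    by (intro meromorphic_intros g analytic_on_imp_meromorphic_on) (use h in \<open>auto simp: analytic_punctured_iff\<close>)
  then show "(\<lambda>s. g s * h s / s) meromorphic_on -{0}" by (rule meromorphic_on_divide) (rule meromorphic_on_id)
  fix s assume s: "is_pole (\<lambda>s. g s * h s / s) s"
  show "s \<notin> contour_image Cs"
  proof (cases "s = 0")
    case False
    have "is_pole (\<lambda>s. g s * h s) s"
      by (rule product_pole[OF m, of "\<lambda>s. 1 / s"]) (use s False in \<open>auto intro!: holomorphic_intros\<close>)
    then show ?thesis using av False by blast
  qed (use contour_image_nonzero[OF Cs] in auto)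
qed

text \<open>The Andreief identity with homogeneous coordinates \<open>A\<close>, \<open>B\<close>.
  Its N! cancels the one in \<open>II\<close>; the remaining constants are N-th powers and go into
  the entries.\<close>

lemma II_hankel:
  assumes as: "0 \<notin> set as" and ex: "contour_exists p q as"
  shows "II p q (int N) as = hdet N (\<lambda>m. K * cyc_int (SOME Cs. is_contour_for p q as Cs)
    (\<lambda>s. Delta p q s as * \<phi> (2 * N - 2) m s / s))"
proof (cases "N = 0")
  case False
  define Cs where "Cs = (SOME Cs. is_contour_for p q as Cs)"
  have con: "is_contour_for p q as Cs" unfolding Cs_def by (rule some_contour[OF ex])
  note cf = contour_facts[OF as con]
  have mD: "(\<lambda>z. Delta p q z as) meromorphic_on -{0}" by (rule meromorphic_Delta[OF as])
  have av: "s \<notin> contour_image Cs" if "s \<noteq> 0" "is_pole (\<lambda>s. Delta p q s as * h s) s" "h holomorphic_on -{0}" for s h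
    using product_pole[OF mD that(3,1,2)] cf(4) that(1) by blast
  have int: "(\<lambda>s. Delta p q s as * \<phi> M m s / s) contour_integrable_on \<gamma>" if "\<gamma> \<in> set Cs" for \<gamma> M m
    by (rule weight_integrable[OF cf(1) mD holomorphic_\<phi> _ that]) (rule av, auto intro: holomorphic_\<phi>)
  have int': "(\<lambda>z. A z ^ (2 * N - 2 - m) * B z ^ m * (Delta p q z as / (2 * of_real pi * \<i> * z))) =
      (\<lambda>z. 1 / (2 * of_real pi * \<i>) * (Delta p q z as * \<phi> (2 * N - 2) m z / z))" for m
    by (auto simp: \<phi>_def)
  have fin: "finite {z \<in> contour_image Cs. \<not> P z}" if "\<forall>\<^sup>*z. P z" for P
    by (rule finite_not_cosparse[OF that compact_contour_image[OF cf(1)] contour_image_nonzero[OF cf(1)]])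
  have "iterated_integral N Cs (II_integrand p q as) =
    iterated_integral N Cs (\<lambda>zs. (\<Prod>j<length zs. \<Prod>i<j. egamma4 p q q (zs ! i) (zs ! j) / egamma4 p q 1 (zs ! i) (zs ! j)) *
      (\<Prod>i<length zs. (\<lambda>z. Delta p q z as / (2 * of_real pi * \<i> * z)) (zs ! i)))"
    by (intro arg_cong[where f = "iterated_integral N Cs"] ext) (simp add: II_integrand_def)
  also have "\<dots> = fact N * hdet N (\<lambda>m. cyc_int Cs (\<lambda>z. A z ^ (2 * N - 2 - m) * B z ^ m * (Delta p q z as / (2 * of_real pi * \<i> * z))))"
  proof (rule andreief[OF cf(1), where K = "\<lambda>x y. egamma4 p q q x y / egamma4 p q 1 x y"])
    show "finite {z \<in> contour_image Cs. A z = 0}" using fin[OF A_cosparse] by simp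
    fix z assume "z \<in> contour_image Cs"
    then have z: "z \<noteq> 0" using contour_image_nonzero[OF cf(1)] by auto
    have "\<forall>\<^sup>*y. egamma4 p q q z y / egamma4 p q 1 z y = (B y * A z - A y * B z)\<^sup>2"
      using egamma4_ratio[OF z] cosparse_nz
    proof eventually_elim
      case (elim y)
      then show ?case using z by (simp add: psi_AB power2_eq_square algebra_simps)
    qed
    from fin[OF this] show "finite {y \<in> contour_image Cs. egamma4 p q q z y / egamma4 p q 1 z y \<noteq> (B y * A z - A y * B z)\<^sup>2}"
      by simp
  next
    show "(\<lambda>z. A z ^ (2 * N - 2 - m) * B z ^ m * (Delta p q z as / (2 * of_real pi * \<i> * z))) contour_integrable_on \<gamma>"
      if "\<gamma> \<in> set Cs" for m \<gamma>
      unfolding int' by (rule contour_integrable_lmul[OF int[OF that]])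
    show "finite {z \<in> contour_image Cs. Delta p q z as / (2 * of_real pi * \<i> * z) \<noteq> Delta p q z as / (2 * of_real pi * \<i> * z)}"
      by simp
  qed
  also have "\<dots> = fact N * hdet N (\<lambda>m. 1 / (2 * of_real pi * \<i>) * cyc_int Cs (\<lambda>z. Delta p q z as * \<phi> (2 * N - 2) m z / z))"
    unfolding int' by (subst cyc_int_lmul) (use int in auto)
  finally have "II p q (int N) as = \<kappa> ^ N / 2 ^ N *
     hdet N (\<lambda>m. 1 / (2 * of_real pi * \<i>) * cyc_int Cs (\<lambda>z. Delta p q z as * \<phi> (2 * N - 2) m z / z))"
    using False by (simp add: II_def Cs_def \<kappa>_def)
  also have "\<dots> = hdet N (\<lambda>m. \<kappa> / 2 * (1 / (2 * of_real pi * \<i>) * cyc_int Cs (\<lambda>z. Delta p q z as * \<phi> (2 * N - 2) m z / z)))"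
    by (simp only: det_hankel_scale) (simp add: power_divide)
  finally show ?thesis unfolding Cs_def[symmetric] by (simp add: K_def mult_ac)
qed (simp add: II_def hankel_def)

end

section \<open>Moments and Cauchy moments of one weight\<close>

locale weighted = theta_basis p q c d for p q c d :: complex +
  fixes us :: "complex list" and n :: nat
  assumes us: "0 \<notin> set us" and contour: "contour_exists p q us" 
    and gen_c: "\<And>s. s \<in> fam c \<Longrightarrow> \<not> is_pole (\<lambda>z. Delta p q z us) s" and D0: "II p q (int n) us \<noteq> 0"
begin

definition w :: "complex \<Rightarrow> complex" where "w = (\<lambda>z. Delta p q z us)"

definition lab :: "complex \<Rightarrow> complex" where "lab s = of_bool (s \<in> inner_points us)"

text \<open>Dividing by \<open>A\<close> raises the degree of the moments by one, which is needed for \<open>n = 0\<close>. The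
  additional poles on \<open>fam c\<close> cancel out of all results, so their side of the contour is arbitrary.\<close>

definition w1 :: "complex \<Rightarrow> complex" where "w1 s = w s / A s"
abbreviation w1\<phi> where "w1\<phi> m s \<equiv> w1 s * \<phi> (2 * n) m s"

definition lab1 :: "complex \<Rightarrow> complex" where
  "lab1 s = (if is_pole w s then lab s else of_bool (norm s < 1))"
abbreviation G1 where "G1 v \<equiv> SOME G. good w1 lab1 v G"

definition Cs0 :: "(real \<Rightarrow> complex) list" where "Cs0 = (SOME Cs. is_contour_for p q us Cs)"

definition \<mu> :: "nat \<Rightarrow> complex" where
  "\<mu> m = K * cyc_int Cs0 (\<lambda>s. w s * \<phi> (2 * n - 2) m s / s)"

text \<open>In the coordinate t these are the moments for the weight w A^(2n - 2) / (t(v) - t). The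
  factor \<open>A v\<close> makes up for the one in psi(v, s) = A(v) A(s) (t(v) - t(s)).\<close>

definition kk :: "complex \<Rightarrow> nat \<Rightarrow> complex" where
  "kk v m = A v * (K * cyc_int (G1 v) (ker (w1\<phi> m) v))"

definition generic :: "complex \<Rightarrow> bool" where
  "generic v \<longleftrightarrow> v \<noteq> 0 \<and> A v \<noteq> 0 \<and> (\<exists>G. good w1 lab1 v G)"

lemma con: "is_contour_for p q us Cs0"
  unfolding Cs0_def by (rule some_contour[OF contour])

lemmas base = contour_facts[OF us con, folded w_def]

lemma w_meromorphic: "w meromorphic_on -{0}" unfolding w_def by (rule meromorphic_Delta[OF us])

lemma w_inverse: "w (1 / z) = w z" unfolding w_def by (rule Delta_inverse)

lemma w_pole: "is_pole w s \<Longrightarrow> s \<noteq> 0 \<Longrightarrow> s \<in> inner_points us \<or> 1 / s \<in> inner_points us"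
  unfolding w_def by (rule Delta_pole[OF us])

lemma w1_meromorphic: "w1 meromorphic_on -{0}"
  unfolding w1_def using holomorphic_A
  by (intro meromorphic_intros w_meromorphic analytic_on_imp_meromorphic_on) (auto simp: analytic_punctured_iff)

lemma w1_A: "\<forall>\<^sup>*s. w1 s * A s = w s"
  using A_cosparse by eventually_elim (simp add: w1_def)

lemma w_pole_w1: "s \<noteq> 0 \<Longrightarrow> is_pole w s \<Longrightarrow> is_pole w1 s"
proof -
  assume s: "s \<noteq> 0" "is_pole w s"
  have "eventually (\<lambda>s. w1 s * A s = w s) (at s)" using w1_A s(1) by (simp add: cosparse_punctured)
  then have "is_pole (\<lambda>s. w1 s * A s) s" using is_pole_cong[of "\<lambda>s. w1 s * A s" w s s] s(2) by simp
  then show "is_pole w1 s" by (rule product_pole[OF w1_meromorphic holomorphic_A s(1)])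
qed

lemma inner_points_bounds:
  obtains r R where "r > 0" "\<And>s. s \<in> inner_points us \<Longrightarrow> norm s \<le> R" "\<And>s. s \<noteq> 0 \<Longrightarrow> 1 / s \<in> inner_points us \<Longrightarrow> norm s \<ge> r"
proof -
  define R where "R = 1 + (\<Sum>a\<leftarrow>us. norm a)"
  have R: "norm s \<le> R" if s: "s \<in> inner_points us" for s
  proof -
    obtain i j a where a: "a \<in> set us" "s = p ^ i * q ^ j * a" using s by (auto simp: inner_points_def)
    have "norm (p ^ i * q ^ j) \<le> 1" using p q by (auto simp: norm_mult norm_power intro!: mult_le_one power_le_one)
    then have "norm s \<le> norm a" using a(2) mult_right_mono[of "norm (p ^ i * q ^ j)" 1 "norm a"] by (simp add: norm_mult)
    also have "\<dots> \<le> (\<Sum>a\<leftarrow>us. norm a)" using a(1) by (intro member_le_sum_list) auto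
    finally show ?thesis by (simp add: R_def)
  qed
  have "(\<Sum>a\<leftarrow>us. norm a) \<ge> 0" by (intro sum_list_nonneg) auto
  then have R0: "R > 0" unfolding R_def by linarith
  show ?thesis
  proof (rule that[of "1 / R" R])
    fix s :: complex assume "s \<noteq> 0" "1 / s \<in> inner_points us"
    then show "1 / R \<le> norm s" using R[of "1 / s"] R0 by (simp add: norm_divide field_simps)
  qed (use R R0 in auto)
qed

lemma lab1_values: "lab1 s \<in> {0, 1}" by (simp add: lab1_def lab_def)

lemma lab1_bounded: "lab_bounded {s. s \<noteq> 0 \<and> is_pole w1 s} lab1"
proof -
  obtain r R where rR: "r > 0" "\<And>s. s \<in> inner_points us \<Longrightarrow> norm s \<le> R" "\<And>s. s \<noteq> 0 \<Longrightarrow> 1 / s \<in> inner_points us \<Longrightarrow> norm s \<ge> r"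
    by (rule inner_points_bounds) blast
  have "lab1 s = 1" if "norm s < min r 1" "s \<noteq> 0" for s
    using that rR(3)[of s] w_pole[of s] by (auto simp: lab1_def lab_def)
  moreover have "lab1 s = 0" if "norm s > max R 1" "s \<noteq> 0" for s
    using that rR(2)[of s] by (auto simp: lab1_def lab_def)
  moreover have "min r 1 > 0" using rR(1) by simp
  ultimately show ?thesis unfolding lab_bounded_def using lab1_values by blast
qed

lemma eventually_generic: "v0 \<noteq> 0 \<Longrightarrow> eventually generic (at v0)"
proof -
  assume v0: "v0 \<noteq> 0"
  have "eventually (\<lambda>v. A v \<noteq> 0) (at v0)" using A_cosparse v0 by (simp add: cosparse_punctured)
  moreover have "eventually (\<lambda>v. v \<noteq> 0) (at v0)" by (rule eventually_neq_at_within)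
  ultimately show ?thesis
    using eventually_good[OF w1_meromorphic v0 lab1_bounded] by eventually_elim (simp add: generic_def)
qed

lemma good_w1_\<phi>: "good w1 lab1 v G \<Longrightarrow> h holomorphic_on -{0} \<Longrightarrow> good (\<lambda>s. w1 s * h s) lab1 v G"
  using good_mult w1_meromorphic by blast

lemma w1h_meromorphic: "h holomorphic_on -{0} \<Longrightarrow> (\<lambda>s. w1 s * h s) meromorphic_on -{0}"
  by (intro meromorphic_intros w1_meromorphic analytic_on_imp_meromorphic_on) (auto simp: analytic_punctured_iff)

lemma kk_eq:
  assumes "v \<noteq> 0" "good w1 lab1 v G"
  shows "kk v m = A v * (K * cyc_int G (ker (w1\<phi> m) v))"
proof -
  have "good w1 lab1 v (G1 v)" using assms(2) by (rule someI)
  from good_unique[OF w1h_meromorphic[OF holomorphic_\<phi>] assms(1) good_w1_\<phi>[OF assms(2) holomorphic_\<phi>] good_w1_\<phi>[OF this holomorphic_\<phi>]]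
  show ?thesis by (simp add: kk_def)
qed

text \<open>Without a Cauchy kernel every cycle with the right sides at the actual poles gives the
  same moments. So they may be computed over the good cycles of the kernels, and integrands over one
  and the same cycle can be compared.\<close>

lemma base_independent:
  assumes h: "h holomorphic_on -{0}" and G: "cycle G" "contour_winding G 0 = 1"
    and lab: "\<And>s. s \<noteq> 0 \<Longrightarrow> is_pole (\<lambda>s. w s * h s) s \<Longrightarrow> s \<notin> contour_image G \<and> contour_winding G s = lab s"
  shows "cyc_int G (\<lambda>s. w s * h s / s) = cyc_int Cs0 (\<lambda>s. w s * h s / s)"
proof -
  have m: "(\<lambda>s. w s * h s) meromorphic_on -{0}"
    by (intro meromorphic_intros w_meromorphic analytic_on_imp_meromorphic_on) (use h in \<open>auto simp: analytic_punctured_iff\<close>)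
  have pole: "is_pole (\<lambda>s. w s * h s) s" if "is_pole (\<lambda>s. w s * h s / s) s" "s \<noteq> 0" for s
    by (rule product_pole[OF m, of "\<lambda>s. 1 / s"]) (use that in \<open>auto intro!: holomorphic_intros\<close>)
  have Cs0: "s \<notin> contour_image Cs0 \<and> contour_winding Cs0 s = lab s" if "is_pole (\<lambda>s. w s * h s) s" "s \<noteq> 0" for s
  proof -
    have ws: "is_pole w s" by (rule product_pole[OF w_meromorphic h that(2,1)])
    have "contour_winding Cs0 s = lab s"
      using base(5)[OF that(2) ws] base(6)[OF that(2) ws] w_pole[OF ws that(2)] by (auto simp: lab_def)
    then show ?thesis using base(4)[OF that(2) ws] by blast
  qed
  have "cyc_int G (\<lambda>s. w s * h s / s) = cyc_int Cs0 (\<lambda>s. w s * h s / s) +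
     2 * of_real pi * \<i> * (\<Sum>s\<in>{}. (contour_winding G s - contour_winding Cs0 s) * residue (\<lambda>s. w s * h s / s) s)"
  proof (rule cycle_residue[OF base(1) G(1)])
    show "(\<lambda>s. w s * h s / s) meromorphic_on -{0}" using m by (rule meromorphic_on_divide) (rule meromorphic_on_id)
    show "contour_winding G 0 = contour_winding Cs0 0" using G(2) base(2) by simp
    fix s assume s: "is_pole (\<lambda>s. w s * h s / s) s"
    show "s \<notin> contour_image Cs0 \<and> s \<notin> contour_image G"
      using pole[OF s] Cs0 assms(4) contour_image_nonzero[OF G(1)] contour_image_nonzero[OF base(1)] by (cases "s = 0") auto
    show "contour_winding G s = contour_winding Cs0 s" if "s \<noteq> 0"
      using pole[OF s that] Cs0 assms(4) that by auto
  qed auto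
  then show ?thesis by simp
qed

lemma good_base:
  assumes "v \<noteq> 0" "good w1 lab1 v G" "h holomorphic_on -{0}"
  shows "cyc_int G (\<lambda>s. w s * h s / s) = cyc_int Cs0 (\<lambda>s. w s * h s / s)"
proof (rule base_independent[OF assms(3)])
  show "cycle G" "contour_winding G 0 = 1" using assms(2) by (auto simp: good_def)
  fix s assume s: "s \<noteq> 0" "is_pole (\<lambda>s. w s * h s) s"
  then have ws: "is_pole w s" using product_pole[OF w_meromorphic assms(3)] by blast
  then have "is_pole w1 s" using w_pole_w1 s by blast
  then show "s \<notin> contour_image G \<and> contour_winding G s = lab s"
    using assms(2) s ws analytic_at_imp_no_pole[of w1 s] by (auto simp: good_def lab1_def)
qed

text \<open>Multiplying by t(v) - t cancels the kernel. The bound on \<open>m\<close> ensures that a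
  monomial of degree 2 n - 2 is left over.\<close>

lemma kk_recursion:
  assumes "generic v" "m + 1 < 2 * n"
  shows "t v * kk v m - kk v (Suc m) = \<mu> m"
proof -
  obtain G where G: "good w1 lab1 v G" and v: "v \<noteq> 0" "A v \<noteq> 0" using assms(1) by (auto simp: generic_def)
  note gd = good_w1_\<phi>[OF G holomorphic_\<phi>]
  have int: "ker (\<lambda>s. w1 s * \<phi> (2 * n) i s) v contour_integrable_on \<gamma>" if "\<gamma> \<in> set G" for i \<gamma>
    by (rule good_integrable[OF gd w1h_meromorphic[OF holomorphic_\<phi>] v(1) that])
  have "t v * kk v m - kk v (Suc m) =
     K * (B v * cyc_int G (ker (w1\<phi> m) v) + (- A v) * cyc_int G (ker (w1\<phi> (Suc m)) v))"
    using v by (simp add: kk_eq[OF v(1) G] t_def algebra_simps)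
  also have "\<dots> = K * cyc_int G (\<lambda>s. B v * ker (w1\<phi> m) v s + (- A v) * ker (w1\<phi> (Suc m)) v s)"
    by (subst cyc_int_lin) (use int in auto)
  also have "cyc_int G (\<lambda>s. B v * ker (w1\<phi> m) v s + (- A v) * ker (w1\<phi> (Suc m)) v s) =
      cyc_int G (\<lambda>s. w s * \<phi> (2 * n - 2) m s / s)"
  proof (rule cyc_int_spike)
    show "cycle G" using G by (simp add: good_def)
    have "\<forall>\<^sup>*s. psi p v s \<noteq> 0"
      using eventually_psi_nonzero[OF v(1)] by (simp add: cosparse_punctured)
    then show "\<forall>\<^sup>*s. B v * ker (w1\<phi> m) v s + - A v * ker (w1\<phi> (Suc m)) v s =
        w s * \<phi> (2 * n - 2) m s / s"
      using w1_A cosparse_nz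
    proof eventually_elim
      case (elim s)
      have "B v * ker (w1\<phi> m) v s + - A v * ker (w1\<phi> (Suc m)) v s =
         w1 s * (B v * \<phi> (2 * n) m s - A v * \<phi> (2 * n) (Suc m) s) / (s * psi p v s)"
        by (simp add: ker_def diff_divide_distrib algebra_simps)
      also have "\<dots> = w1 s * \<phi> (2 * n - 1) m s / s"
        using elim assms(2) v by (subst \<phi>_psi) auto
      also have "\<dots> = w1 s * A s * \<phi> (2 * n - 1 - 1) m s / s"
        using \<phi>_A[of m "2 * n - 1" s] assms(2) by (simp add: mult_ac)
      finally show ?case using elim(2) by (simp add: numeral_2_eq_2)
    qed
  qed
  also have "\<dots> = cyc_int Cs0 (\<lambda>s. w s * \<phi> (2 * n - 2) m s / s)"
    by (rule good_base[OF v(1) G holomorphic_\<phi>])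
  finally show ?thesis by (simp add: \<mu>_def)
qed

end

section \<open>The rank two factorization\<close>

context hankel_inverse
begin

lemma gen_cong:
  assumes "\<And>i. i \<le> n \<Longrightarrow> u i = u' i"
  shows "gen1 u s = gen1 u' s" "gen2 u s = gen2 u' s"
proof -
  have "gvec u k = gvec u' k" for k unfolding gvec_def using assms by (intro sum.cong) auto
  then show "gen1 u s = gen1 u' s" "gen2 u s = gen2 u' s" using assms by (auto simp: gen1_def gen2_def)
qed

lemma gen_linear:
  "gen1 (\<lambda>i. u i + k * u' i) (s + k * s') = gen1 u s + k * gen1 u' s'"
  "gen2 (\<lambda>i. u i + k * u' i) (s + k * s') = gen2 u s + k * gen2 u' s'"
proof -
  have "gvec (\<lambda>i. u i + k * u' i) j = gvec u j + k * gvec u' j" for j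
    by (simp add: gvec_def sum.distrib sum_distrib_left algebra_simps)
  then show "gen1 (\<lambda>i. u i + k * u' i) (s + k * s') = gen1 u s + k * gen1 u' s'"
    "gen2 (\<lambda>i. u i + k * u' i) (s + k * s') = gen2 u s + k * gen2 u' s'"
    by (simp_all add: gen1_def gen2_def sum.distrib sum_distrib_left algebra_simps)
qed

end

context theta_basis
begin

lemma A_inverse: "z \<noteq> 0 \<Longrightarrow> A (1 / z) = A z" and B_inverse: "z \<noteq> 0 \<Longrightarrow> B (1 / z) = B z"
  using psi_inverse2 cd by (simp_all add: A_def B_def)

lemma A_shift: "z \<noteq> 0 \<Longrightarrow> A (p * z) = A z / (p * z\<^sup>2)" and B_shift: "z \<noteq> 0 \<Longrightarrow> B (p * z) = B z / (p * z\<^sup>2)"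
  using psi_p2 cd by (simp_all add: A_def B_def)

lemma t_inverse: "z \<noteq> 0 \<Longrightarrow> t (1 / z) = t z" by (simp add: t_def A_inverse B_inverse)

lemma t_shift: "z \<noteq> 0 \<Longrightarrow> t (p * z) = t z" using p by (simp add: t_def A_shift B_shift)

end

context weighted
begin

definition D :: complex where "D = II p q (int n) us"

lemma D_nonzero: "D \<noteq> 0" using D0 by (simp add: D_def)

lemma det_\<mu>: "hdet n \<mu> = D"
  unfolding D_def II_hankel[OF us contour] \<mu>_def Cs0_def w_def ..

definition GG :: "nat \<Rightarrow> nat \<Rightarrow> complex" where "GG = (SOME G. hankel_inverse n \<mu> G)"

lemma GG: "hankel_inverse n \<mu> GG"
proof -
  have "hdet n \<mu> \<noteq> 0" using D_nonzero det_\<mu> by simp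
  then obtain G where "hankel_inverse n \<mu> G" by (rule hankel_inverse_exists) blast
  then show ?thesis unfolding GG_def by (rule someI[of "hankel_inverse n \<mu>"])
qed

end

sublocale weighted \<subseteq> H: hankel_inverse n \<mu> GG by (rule GG)

context weighted
begin

text \<open>\<open>P1\<close>, \<open>P2\<close> apply the two displacement generators to the powers
  of t(x), which are geometric, hence the argument 0; the factor A^n makes them homogeneous
  polynomials of degree n in A and B. \<open>R1\<close>, \<open>R2\<close> apply the generators to
  the Cauchy moments, hence the argument 1: they are the functions of the second kind.\<close>

definition P1 :: "complex \<Rightarrow> complex" where "P1 x = A x ^ n * H.gen1 (\<lambda>i. t x ^ i) 0"
definition P2 :: "complex \<Rightarrow> complex" where "P2 x = A x ^ n * H.gen2 (\<lambda>i. t x ^ i) 0"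
definition R1 :: "complex \<Rightarrow> complex" where "R1 v = H.gen1 (kk v) 1 / A v ^ n"
definition R2 :: "complex \<Rightarrow> complex" where "R2 v = H.gen2 (kk v) 1 / A v ^ n"

abbreviation PP where "PP x v \<equiv> D * (P1 x * P2 v - P2 x * P1 v)"
abbreviation PR where "PR x v \<equiv> D * (P1 x * R2 v - P2 x * R1 v)"
abbreviation RR where "RR x v \<equiv> D * (R1 x * R2 v - R2 x * R1 v)"

lemma kk_rec_n: "generic v \<Longrightarrow> i < n \<Longrightarrow> t v * kk v i - kk v (Suc i) = 1 * \<mu> i"
  using kk_recursion[of v i] by simp

lemma det_PR:
  assumes "generic v"
  shows "(A x / A v) ^ n * (1 + (t x - t v) * H.bil (\<lambda>i. t x ^ i) (kk v)) = P1 x * R2 v - P2 x * R1 v"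
proof -
  have h: "1 + (t x - t v) * H.bil (\<lambda>i. t x ^ i) (kk v) =
      H.gen1 (\<lambda>i. t x ^ i) 0 * H.gen2 (kk v) 1 - H.gen2 (\<lambda>i. t x ^ i) 0 * H.gen1 (kk v) 1"
    using H.bil_rank2[of "t x" "\<lambda>i. t x ^ i" 0 "t v" "kk v" 1] kk_rec_n[OF assms] by (simp add: add.commute)
  show ?thesis unfolding h P1_def P2_def R1_def R2_def by (simp add: power_divide right_diff_distrib diff_divide_distrib mult.assoc)
qed

text \<open>At coinciding arguments the displacement identity loses its bilinear term. This constant
  makes the fundamental matrix nonsingular and later excludes poles of \<open>R1\<close> and
  \<open>R2\<close> at admissible points.\<close>

lemma det_PR_diag: "generic v \<Longrightarrow> P1 v * R2 v - P2 v * R1 v = 1"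
  using det_PR[of v v] by (simp add: generic_def)

lemma det_RR:
  assumes "generic x" "generic v"
  shows "((t x - t v) * H.bil (kk x) (kk v) + kk x 0 - kk v 0) / (A x ^ n * A v ^ n) = R1 x * R2 v - R2 x * R1 v"
  using H.bil_rank2[of "t x" "kk x" 1 "t v" "kk v" 1] kk_rec_n[OF assms(1)] kk_rec_n[OF assms(2)]
  by (simp add: R1_def R2_def diff_divide_distrib[symmetric])

lemma det_PP:
  "(A x * A v) ^ n * ((t x - t v) * H.bil (\<lambda>i. t x ^ i) (\<lambda>i. t v ^ i)) = P1 x * P2 v - P2 x * P1 v"
proof -
  have h: "(t x - t v) * H.bil (\<lambda>i. t x ^ i) (\<lambda>i. t v ^ i) =
      H.gen1 (\<lambda>i. t x ^ i) 0 * H.gen2 (\<lambda>i. t v ^ i) 0 - H.gen2 (\<lambda>i. t x ^ i) 0 * H.gen1 (\<lambda>i. t v ^ i) 0"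
    using H.bil_rank2[of "t x" "\<lambda>i. t x ^ i" 0 "t v" "\<lambda>i. t v ^ i" 0] by simp
  show ?thesis unfolding h P1_def P2_def by (simp add: power_mult_distrib right_diff_distrib)
qed

text \<open>The case of \<open>det_hankel_zero\<close>: numerator and kernel change the weight by
  (t(x) - t) / (t(v) - t), up to the constant A(x) / A(v).\<close>

lemma F_generic:
  assumes x: "x \<noteq> 0" "A x \<noteq> 0" and v: "generic v" "good w1 lab1 v G"
  shows "hdet n (\<lambda>m. K * cyc_int G (ker (\<lambda>s. w s * psi p x s * \<phi> (2 * n - 2) m s) v)) =
    PR x v"
proof -
  have v0: "v \<noteq> 0" "A v \<noteq> 0" using v(1) by (auto simp: generic_def)
  have int: "ker (\<lambda>s. w1 s * \<phi> (2 * n) i s) v contour_integrable_on \<gamma>" if "\<gamma> \<in> set G" for i \<gamma>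
    by (rule good_integrable[OF good_w1_\<phi>[OF v(2) holomorphic_\<phi>] w1h_meromorphic[OF holomorphic_\<phi>] v0(1) that])
  have "K * cyc_int G (ker (\<lambda>s. w s * psi p x s * \<phi> (2 * n - 2) m s) v) = A x / A v * (t x * kk v m - kk v (Suc m))"
    if m: "m \<le> 2 * n - 2" "n > 0" for m
  proof -
    have "cyc_int G (ker (\<lambda>s. w s * psi p x s * \<phi> (2 * n - 2) m s) v) =
      cyc_int G (\<lambda>s. B x * ker (w1\<phi> m) v s + (- A x) * ker (w1\<phi> (Suc m)) v s)"
    proof (rule cyc_int_spike)
      show "cycle G" using v(2) by (simp add: good_def)
      show "\<forall>\<^sup>*s. ker (\<lambda>s. w s * psi p x s * \<phi> (2 * n - 2) m s) v s =
         B x * ker (w1\<phi> m) v s + - A x * ker (w1\<phi> (Suc m)) v s"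
        using w1_A cosparse_nz
      proof eventually_elim
        case (elim s)
        have "w s * psi p x s * \<phi> (2 * n - 2) m s = w1 s * psi p x s * (A s * \<phi> (2 * n - 1 - 1) m s)"
          by (simp flip: elim(1) add: numeral_2_eq_2)
        also have "\<dots> = w1 s * (psi p x s * \<phi> (2 * n - 1) m s)" using m by (subst \<phi>_A) auto
        also have "\<dots> = w1 s * (B x * \<phi> (2 * n) m s - A x * \<phi> (2 * n) (Suc m) s)"
          using m x elim(2) by (subst \<phi>_psi) auto
        finally have h: "w s * psi p x s * \<phi> (2 * n - 2) m s = \<dots>" .
        show ?case unfolding ker_def h by (simp add: diff_divide_distrib right_diff_distrib mult_ac)
      qed
    qed
    also have "\<dots> = B x * cyc_int G (ker (w1\<phi> m) v) + (- A x) * cyc_int G (ker (w1\<phi> (Suc m)) v)"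
      by (rule cyc_int_lin) (use int in auto)
    finally have h: "cyc_int G (ker (\<lambda>s. w s * psi p x s * \<phi> (2 * n - 2) m s) v) = \<dots>" .
    show ?thesis unfolding h kk_eq[OF v0(1) v(2)] using x v0 by (simp add: t_def field_simps)
  qed
  then have "hdet n (\<lambda>m. K * cyc_int G (ker (\<lambda>s. w s * psi p x s * \<phi> (2 * n - 2) m s) v)) =
     hdet n (\<lambda>m. A x / A v * (t x * kk v m - kk v (Suc m)))" by (rule det_hankel_cong)
  also have "\<dots> = (A x / A v) ^ n * (D * (1 + (t x - t v) * H.bil (\<lambda>i. t x ^ i) (kk v)))"
    unfolding det_hankel_scale det_\<mu>[symmetric]
    by (subst H.det_hankel_zero[where v = "t v" and k = "kk v"]) (use kk_recursion[OF v(1)] in auto)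
  also have "\<dots> = PR x v" unfolding det_PR[OF v(1), symmetric] by simp
  finally show ?thesis .
qed

text \<open>The case of \<open>det_hankel_plus\<close>, over a cycle good for both arguments. The
  prefactor psi(v, x) supplies the difference t(v) - t(x), which turns \<open>l 0\<close> into kk x
  0 - kk v 0.\<close>

lemma Fplus_generic:
  assumes x: "generic x" "good w1 lab1 x G" and v: "generic v" "good w1 lab1 v G"
  shows "psi p v x * hdet (Suc n) (\<lambda>m. K * cyc_int G (ker (\<lambda>s. w s / psi p x s * \<phi> (2 * n) m s) v)) =
    RR x v"
proof -
  have v0: "v \<noteq> 0" "A v \<noteq> 0" "x \<noteq> 0" "A x \<noteq> 0" using x(1) v(1) by (auto simp: generic_def)
  have G: "cycle G" using v(2) by (simp add: good_def)
  have spikes: "\<forall>\<^sup>*s. psi p x s \<noteq> 0" "\<forall>\<^sup>*s. psi p v s \<noteq> 0"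
    using eventually_psi_nonzero[OF v0(1)] eventually_psi_nonzero[OF v0(3)] by (simp_all add: cosparse_punctured)
  \<comment> \<open>Written with \<open>w1\<close>, hence degree 2 n + 1: one factor
    \<open>A\<close> of the monomial restores \<open>w\<close>.\<close>
  define f where "f m = ker (\<lambda>s. w1 s * \<phi> (2 * n + 1) m s / psi p x s) v" for m
  define l where "l m = A x * A v * (K * cyc_int G (f m))" for m
  have int: "f m contour_integrable_on \<gamma>" if "\<gamma> \<in> set G" for m \<gamma>
  proof (rule cycle_integrable[OF G _ _ that])
    have "psi p x meromorphic_on -{0}" using psi_analytic[OF v0(3)] by (rule analytic_on_imp_meromorphic_on)
    then show "f m meromorphic_on -{0}"
      unfolding f_def using v0(1)
      by (intro meromorphic_ker meromorphic_on_divide[OF w1h_meromorphic[OF holomorphic_\<phi>]]) auto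
    fix s assume s: "is_pole (f m) s"
    show "s \<notin> contour_image G"
    proof
      assume *: "s \<in> contour_image G"
      then have s0: "s \<noteq> 0" using contour_image_nonzero[OF G] by auto
      have an: "(\<lambda>s. w1 s * \<phi> (2 * n + 1) m s / psi p x s) analytic_on {s}"
        using * x(2) s0 analytic_punctured[OF psi_analytic[OF v0(3)] s0]
          analytic_punctured[OF holomorphic_\<phi>[unfolded analytic_punctured_iff] s0]
        by (intro analytic_intros) (auto simp: good_def fam_def)
      have "f m analytic_on {s}"
        unfolding f_def using * v(2) v0(1) s0 by (intro ker_analytic an) (auto simp: good_def)
      then show False using s analytic_at_imp_no_pole by blast
    qed
  qed
  have rec: "t y * l m - l (Suc m) = kk z m" if m: "m < 2 * n + 1" and yz: "(y, z) \<in> {(v, x), (x, v)}" for m y z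
  proof -
    have y0: "y \<noteq> 0" "A y \<noteq> 0" "z \<noteq> 0" "A z \<noteq> 0" "good w1 lab1 z G" using yz v0 x v by auto
    have "cyc_int G (ker (w1\<phi> m) z) = cyc_int G (\<lambda>s. B y * f m s + (- A y) * f (Suc m) s)"
    proof (rule cyc_int_spike[OF G])
      show "\<forall>\<^sup>*s. ker (w1\<phi> m) z s = B y * f m s + - A y * f (Suc m) s"
        using spikes cosparse_nz
      proof eventually_elim
        case (elim s)
        have "B y * f m s + - A y * f (Suc m) s =
            w1 s * (B y * \<phi> (2 * n + 1) m s - A y * \<phi> (2 * n + 1) (Suc m) s) / (s * psi p x s * psi p v s)"
          by (simp add: f_def ker_def diff_divide_distrib algebra_simps)
        also have "\<dots> = w1 s * (psi p y s * \<phi> (2 * n) m s) / (s * psi p x s * psi p v s)"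
          using m y0 elim(3) by (subst \<phi>_psi) auto
        also have "\<dots> = w1 s * \<phi> (2 * n) m s / (s * psi p z s)" using elim yz by auto
        finally show ?case by (simp add: ker_def)
      qed
    qed
    also have "\<dots> = B y * cyc_int G (f m) + (- A y) * cyc_int G (f (Suc m))"
      by (rule cyc_int_lin) (use int in auto)
    finally have "kk z m = A z * (K * (B y * cyc_int G (f m) - A y * cyc_int G (f (Suc m))))"
      unfolding kk_eq[OF y0(3,5)] by simp
    moreover have "A x * A v = A z * A y" using yz by auto
    ultimately show ?thesis using y0 by (simp add: l_def t_def field_simps)
  qed
  have l: "K * cyc_int G (ker (\<lambda>s. w s / psi p x s * \<phi> (2 * n) m s) v) = 1 / (A x * A v) * l m" if "m \<le> 2 * n" for m
  proof -
    have "cyc_int G (ker (\<lambda>s. w s / psi p x s * \<phi> (2 * n) m s) v) = cyc_int G (f m)"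
    proof (rule cyc_int_spike[OF G])
      show "\<forall>\<^sup>*s. ker (\<lambda>s. w s / psi p x s * \<phi> (2 * n) m s) v s = f m s"
        using w1_A
      proof eventually_elim
        case (elim s)
        then show ?case using \<phi>_A[of m "2 * n + 1" s] that by (simp add: f_def ker_def mult_ac flip: elim)
      qed
    qed
    then show ?thesis using v0 by (simp add: l_def)
  qed
  have "hdet (Suc n) (\<lambda>m. K * cyc_int G (ker (\<lambda>s. w s / psi p x s * \<phi> (2 * n) m s) v)) =
     hdet (Suc n) (\<lambda>m. 1 / (A x * A v) * l m)" by (rule det_hankel_cong) (use l in auto)
  also have "\<dots> = (1 / (A x * A v)) ^ Suc n * (D * (l 0 - H.bil (kk x) (kk v)))"
    unfolding det_hankel_scale det_\<mu>[symmetric]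
    by (subst H.det_hankel_plus[where v = "t v" and x = "t x" and kx = "kk x" and kv = "kk v"])
      (use rec kk_recursion[OF x(1)] in auto)
  finally have h: "hdet (Suc n) (\<lambda>m. K * cyc_int G (ker (\<lambda>s. w s / psi p x s * \<phi> (2 * n) m s) v)) = \<dots>" .
  have "psi p v x * hdet (Suc n) (\<lambda>m. K * cyc_int G (ker (\<lambda>s. w s / psi p x s * \<phi> (2 * n) m s) v)) =
     D * ((t v * l 0 - t x * l 0) - (t v - t x) * H.bil (kk x) (kk v)) / (A x ^ n * A v ^ n)"
    unfolding h using v0 by (simp add: psi_t power_mult_distrib power_divide field_simps)
  also have "t v * l 0 - t x * l 0 = kk x 0 - kk v 0" using rec[of 0 v x] rec[of 0 x v] by (simp add: algebra_simps)
  also have "D * ((kk x 0 - kk v 0) - (t v - t x) * H.bil (kk x) (kk v)) / (A x ^ n * A v ^ n) =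
     D * (((t x - t v) * H.bil (kk x) (kk v) + kk x 0 - kk v 0) / (A x ^ n * A v ^ n))" by (simp add: algebra_simps)
  finally show ?thesis unfolding det_RR[OF x(1) v(1)] .
qed

text \<open>The case of \<open>det_hankel_minus\<close>. There is no Cauchy kernel, so the integrals
  can be taken over the basic contour \<open>Cs0\<close>.\<close>

lemma Fminus_generic:
  assumes x: "x \<noteq> 0" "A x \<noteq> 0" and v: "v \<noteq> 0" "A v \<noteq> 0" and n: "n = Suc n'"
  shows "psi p x v * hdet n' (\<lambda>m. K * cyc_int Cs0 (\<lambda>s. w s * (psi p x s * psi p v s * \<phi> (2 * n' - 2) m s) / s)) =
    PP x v"
proof -
  define f where "f i s = w s * \<phi> (2 * n - 2) i s / s" for i s
  have int: "f i contour_integrable_on \<gamma>" if "\<gamma> \<in> set Cs0" for i \<gamma>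
  proof -
    have "s \<notin> contour_image Cs0" if "s \<noteq> 0" "is_pole (\<lambda>s. w s * \<phi> (2 * n - 2) i s) s" for s
      using product_pole[OF w_meromorphic holomorphic_\<phi> that] base(4) that(1) by blast
    then show ?thesis unfolding f_def[abs_def]
      by (rule weight_integrable[OF base(1) w_meromorphic holomorphic_\<phi> _ that])
  qed
  have "K * cyc_int Cs0 (\<lambda>s. w s * (psi p x s * psi p v s * \<phi> (2 * n' - 2) m s) / s) =
     A x * A v * (t x * t v * \<mu> m - (t x + t v) * \<mu> (Suc m) + \<mu> (Suc (Suc m)))" if m: "m \<le> 2 * n' - 2" "n' > 0" for m
  proof -
    \<comment> \<open>The coefficients of psi(x, s) psi(v, s) as a quadratic form in A(s) and
      B(s).\<close>
    define k where "k i = (if i = 0 then B x * B v else if i = Suc 0 then - (B x * A v + A x * B v) else A x * A v)" for i :: nat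
    have "cyc_int Cs0 (\<lambda>s. w s * (psi p x s * psi p v s * \<phi> (2 * n' - 2) m s) / s) = cyc_int Cs0 (\<lambda>s. \<Sum>i\<in>{0, 1, 2}. k i * f (m + i) s)"
    proof (rule cyc_int_spike[OF base(1)])
      show "\<forall>\<^sup>*s. w s * (psi p x s * psi p v s * \<phi> (2 * n' - 2) m s) / s = (\<Sum>i\<in>{0, 1, 2}. k i * f (m + i) s)"
        using cosparse_nz
      proof eventually_elim
        case (elim s)
        obtain r where r: "2 * n' - 2 = m + r" using m le_Suc_ex by blast
        then have r': "2 * n - 2 = m + r + 2" using m n by auto
        show ?case
          using elim x v unfolding f_def r r' k_def psi_AB[OF x(1) elim] psi_AB[OF v(1) elim]
          by (simp add: \<phi>_def power2_eq_square field_simps)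
      qed
    qed
    also have "\<dots> = (\<Sum>i\<in>{0, 1, 2}. k i * cyc_int Cs0 (f (m + i)))"
      by (rule cyc_int_sum) (use int in auto)
    finally have h: "cyc_int Cs0 (\<lambda>s. w s * (psi p x s * psi p v s * \<phi> (2 * n' - 2) m s) / s) =
      B x * B v * cyc_int Cs0 (f m) - (B x * A v + A x * B v) * cyc_int Cs0 (f (Suc m)) + A x * A v * cyc_int Cs0 (f (Suc (Suc m)))"
      by (simp add: k_def numeral_2_eq_2 left_diff_distrib distrib_right)
    have \<mu>f: "\<mu> i = K * cyc_int Cs0 (f i)" for i by (simp add: \<mu>_def f_def[abs_def])
    show ?thesis unfolding h \<mu>f using x v by (simp add: t_def field_simps)
  qed
  then have "hdet n' (\<lambda>m. K * cyc_int Cs0 (\<lambda>s. w s * (psi p x s * psi p v s * \<phi> (2 * n' - 2) m s) / s)) =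
     hdet n' (\<lambda>m. A x * A v * (t x * t v * \<mu> m - (t x + t v) * \<mu> (Suc m) + \<mu> (Suc (Suc m))))"
    by (rule det_hankel_cong)
  also have "\<dots> = (A x * A v) ^ n' * (D * H.bil (\<lambda>i. t x ^ i) (\<lambda>i. t v ^ i))"
    unfolding det_hankel_scale det_\<mu>[symmetric]
    by (subst H.det_hankel_minus[OF n, where x = "t x" and y = "t v"]) auto
  finally have "psi p x v * hdet n' (\<lambda>m. K * cyc_int Cs0 (\<lambda>s. w s * (psi p x s * psi p v s * \<phi> (2 * n' - 2) m s) / s)) =
     D * ((A x * A v) ^ n * ((t x - t v) * H.bil (\<lambda>i. t x ^ i) (\<lambda>i. t v ^ i)))"
    using x v n by (simp add: psi_t mult_ac)
  then show ?thesis unfolding det_PP .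
qed

end

section \<open>Symmetries\<close>

lemma meromorphic_on_points: "(\<And>z. z \<in> S \<Longrightarrow> f meromorphic_on {z}) \<Longrightarrow> f meromorphic_on S"
  unfolding meromorphic_on_def by blast

lemma meromorphic_on_sum_family:
  "(\<And>i. i \<in> I \<Longrightarrow> f i meromorphic_on S) \<Longrightarrow> (\<lambda>z. \<Sum>i\<in>I. f i z) meromorphic_on S"
  by (induction I rule: infinite_finite_induct) (auto intro!: meromorphic_intros)

context weighted
begin

lemma A_meromorphic: "A meromorphic_on -{0}" and B_meromorphic: "B meromorphic_on -{0}"
  using holomorphic_A holomorphic_B by (auto simp: analytic_punctured_iff intro: analytic_on_imp_meromorphic_on)

lemma kk_meromorphic: "(\<lambda>v. kk v m) meromorphic_on -{0}"
proof -
  have "(\<lambda>v. cyc_int (G1 v) (ker (w1\<phi> m) v)) meromorphic_on -{0}"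
  proof (rule meromorphic_on_points)
    fix v0 :: complex assume "v0 \<in> -{0}"
    then have v0: "v0 \<noteq> 0" by simp
    show "(\<lambda>v. cyc_int (G1 v) (ker (w1\<phi> m) v)) meromorphic_on {v0}"
    proof (rule ker_cycle_meromorphic[OF w1h_meromorphic[OF holomorphic_\<phi>] v0])
      show "lab_bounded {s. s \<noteq> 0 \<and> is_pole (w1\<phi> m) s} lab1"
        using lab1_bounded product_pole[OF w1_meromorphic holomorphic_\<phi>[of "2 * n" m]]
        unfolding lab_bounded_def by blast
      show "\<forall>\<^sub>F v in at v0. \<exists>G. good (w1\<phi> m) lab1 v G \<and>
        cyc_int (G1 v) (ker (w1\<phi> m) v) = cyc_int G (ker (w1\<phi> m) v)"
        by (intro eventually_some_good w1_meromorphic holomorphic_\<phi> eventually_mono[OF eventually_generic[OF v0]])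
          (simp add: generic_def)
    qed
  qed
  then show ?thesis unfolding kk_def by (intro meromorphic_intros A_meromorphic)
qed

lemma gen_meromorphic:
  assumes "\<And>i. (\<lambda>z. u z i) meromorphic_on S"
  shows "(\<lambda>z. H.gen1 (u z) s) meromorphic_on S" "(\<lambda>z. H.gen2 (u z) s) meromorphic_on S"
proof -
  have "(\<lambda>z. H.gvec (u z) i) meromorphic_on S" for i
    unfolding H.gvec_def by (intro meromorphic_on_sum_family meromorphic_intros assms)
  then show "(\<lambda>z. H.gen1 (u z) s) meromorphic_on S" "(\<lambda>z. H.gen2 (u z) s) meromorphic_on S"
    unfolding H.gen1_def H.gen2_def using assms
    by (cases "n = 0"; auto intro!: meromorphic_on_sum_family meromorphic_intros)+
qed

lemma t_meromorphic: "t meromorphic_on -{0}"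
  unfolding t_def[abs_def] by (intro meromorphic_intros A_meromorphic B_meromorphic)

lemma P_meromorphic: "P1 meromorphic_on -{0}" "P2 meromorphic_on -{0}"
  unfolding P1_def[abs_def] P2_def[abs_def]
  by (intro meromorphic_intros A_meromorphic gen_meromorphic t_meromorphic)+

lemma R_meromorphic: "R1 meromorphic_on -{0}" "R2 meromorphic_on -{0}"
  unfolding R1_def[abs_def] R2_def[abs_def]
  by (intro meromorphic_intros A_meromorphic gen_meromorphic kk_meromorphic)+

lemma P_isCont:
  assumes "x \<noteq> 0" "A x \<noteq> 0"
  shows "isCont P1 x" "isCont P2 x"
proof -
  have "isCont A x" "isCont B x"
    using holomorphic_isCont[OF holomorphic_A] holomorphic_isCont[OF holomorphic_B] assms(1) by (auto simp: open_delete)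
  then have t: "isCont t x" unfolding t_def[abs_def] using assms(2) by (intro continuous_intros)
  have "isCont (\<lambda>z. H.gvec (\<lambda>i. t z ^ i) i) x" for i
    unfolding H.gvec_def by (intro continuous_intros t)
  then show "isCont P1 x" "isCont P2 x"
    unfolding P1_def[abs_def] P2_def[abs_def] H.gen1_def H.gen2_def using t \<open>isCont A x\<close>
    by (cases "n = 0"; auto intro!: continuous_intros)+
qed

lemma P_inverse: "z \<noteq> 0 \<Longrightarrow> P1 (1 / z) = P1 z" "z \<noteq> 0 \<Longrightarrow> P2 (1 / z) = P2 z"
  by (simp_all add: P1_def P2_def A_inverse t_inverse)

lemma P_shift: "z \<noteq> 0 \<Longrightarrow> P1 (p * z) = P1 z / (p * z\<^sup>2) ^ n" "z \<noteq> 0 \<Longrightarrow> P2 (p * z) = P2 z / (p * z\<^sup>2) ^ n"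
  by (simp_all add: P1_def P2_def A_shift t_shift power_divide)

text \<open>psi(p / v, .) is psi(v, .) times v^2 / p, and \<open>A\<close> picks up the same factor,
  so the Cauchy moments do not change at all; only the normalization by A^n does. A cycle good for v
  is good for p / v.\<close>

lemma R_reflect:
  assumes "generic v"
  shows "R1 (p / v) = R1 v / (v\<^sup>2 / p) ^ n" "R2 (p / v) = R2 v / (v\<^sup>2 / p) ^ n"
proof -
  obtain G where G: "good w1 lab1 v G" and v: "v \<noteq> 0" "A v \<noteq> 0" using assms by (auto simp: generic_def)
  have A: "A (p / v) = A v * (v\<^sup>2 / p)"
    using A_shift[of "1 / v"] A_inverse[of v] v p by (simp add: power_divide)
  have psi: "psi p (p / v) s = psi p v s * (v\<^sup>2 / p)" if "s \<noteq> 0" for s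
    using psi_p1[of "1 / v" s] psi_inverse1[of v s] v p that by (simp add: power_divide)
  have "kk (p / v) = kk v"
  proof
    fix m
    have "cyc_int G (ker (w1\<phi> m) (p / v)) =
       cyc_int G (\<lambda>s. p / v\<^sup>2 * ker (w1\<phi> m) v s)"
    proof (rule cyc_int_spike)
      show "\<forall>\<^sup>*s. ker (w1\<phi> m) (p / v) s = p / v\<^sup>2 * ker (w1\<phi> m) v s"
        using cosparse_nz by eventually_elim (use v p in \<open>simp add: ker_def psi divide_simps\<close>)
    qed (use G in \<open>simp add: good_def\<close>)
    also have "\<dots> = p / v\<^sup>2 * cyc_int G (ker (w1\<phi> m) v)"
      by (rule cyc_int_lmul)
        (rule good_integrable[OF good_w1_\<phi>[OF G holomorphic_\<phi>] w1h_meromorphic[OF holomorphic_\<phi>] v(1)])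
    finally have h: "cyc_int G (ker (w1\<phi> m) (p / v)) = \<dots>" .
    show "kk (p / v) m = kk v m"
      using kk_eq[OF _ good_shift[OF v(1) G], of m] kk_eq[OF v(1) G, of m] v p by (simp add: A h)
  qed
  then show "R1 (p / v) = R1 v / (v\<^sup>2 / p) ^ n" "R2 (p / v) = R2 v / (v\<^sup>2 / p) ^ n"
    unfolding R1_def R2_def A power_mult_distrib by simp_all
qed

definition c2 :: "complex \<Rightarrow> complex" where "c2 z = inverse z * theta p (z\<^sup>2) / w z"

text \<open>The constant in the jump of the Cauchy moments: 4 pi i \<open>K\<close> over the square
  of (p; p), which is the derivative of theta at 1 up to sign.\<close>

definition \<omega> :: complex where "\<omega> = \<kappa> / (poch_inf p p)\<^sup>2"

text \<open>The poles that change sides are v, inside only for the parameter v, and 1 / v, inside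
  only for the parameter 1 / v. Their residues are opposite, and so are the changes of winding
  number; the contributions add up and account for a factor 2.\<close>

lemma kk_inverse:
  assumes gv: "generic v" "generic (1 / v)" and \<theta>: "theta p (v\<^sup>2) \<noteq> 0" and an: "w1 analytic_on {v}" "w1 analytic_on {1 / v}"
    and m: "m \<le> 2 * n"
  shows "kk (1 / v) m = kk v m - \<omega> / c2 v * (A v ^ (2 * n) * t v ^ m)"
proof -
  obtain G where G: "good w1 lab1 v G" and v: "v \<noteq> 0" "A v \<noteq> 0" using gv by (auto simp: generic_def)
  obtain G' where G': "good w1 lab1 (1 / v) G'" using gv by (auto simp: generic_def)
  define g where "g = (w1\<phi> m)"
  have g: "g meromorphic_on -{0}" unfolding g_def by (rule w1h_meromorphic[OF holomorphic_\<phi>])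
  have gg: "good g lab1 v G" "good g lab1 (1 / v) G'"
    unfolding g_def using good_w1_\<phi>[OF _ holomorphic_\<phi>] G G' by blast+
  have an': "g analytic_on {v * p powi 0}" "g analytic_on {p powi 0 / v}"
    unfolding g_def using an v analytic_punctured[OF holomorphic_\<phi>[of "2 * n" m, unfolded analytic_punctured_iff]]
    by (auto intro!: analytic_on_mult)
  have "theta p 1 = 0" by simp
  then have v1: "v \<noteq> 1 / v" using \<theta> v by (auto simp: field_simps power2_eq_square)
  have cyc: "cycle G" "cycle G'" using G G' by (auto simp: good_def)
  have fv: "fam (1 / v) = fam v" using fam_inverse v by blast
  have W: "contour_winding G (v * p powi i) = of_bool (i \<ge> 0)" "contour_winding G (p powi i / v) = of_bool (i \<ge> 1)"
     "contour_winding G' (p powi i / v) = of_bool (i \<ge> 0)" "contour_winding G' (v * p powi i) = of_bool (i \<ge> 1)" for i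
    using G G' by (auto simp: good_def mult.commute)
  have "cyc_int G' (ker g v) = cyc_int G (ker g v) +
    2 * of_real pi * \<i> * (\<Sum>s\<in>{v, 1 / v}. (contour_winding G' s - contour_winding G s) * residue (ker g v) s)"
  proof (rule cycle_residue[OF cyc meromorphic_ker[OF g v(1)]])
    show "contour_winding G' 0 = contour_winding G 0" using G G' by (simp add: good_def)
    fix s assume s: "is_pole (ker g v) s"
    have s': "s \<notin> fam v \<Longrightarrow> s \<noteq> 0 \<Longrightarrow> is_pole g s" using ker_not_pole[OF g v(1)] s by blast
    then show "s \<notin> contour_image G \<and> s \<notin> contour_image G'"
      using gg fv contour_image_nonzero[OF cyc(1)] contour_image_nonzero[OF cyc(2)] analytic_at_imp_no_pole[of g s]
      unfolding good_def by (cases "s = 0") auto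
    assume s0: "s \<noteq> 0" "s \<notin> {v, 1 / v}"
    show "contour_winding G' s = contour_winding G s"
    proof (cases "s \<in> fam v")
      case True
      then obtain i where i: "s = v * p powi i \<or> s = p powi i / v" using fam_iff[OF v(1)] by blast
      then have "i \<noteq> 0" using s0 by auto
      then show ?thesis using i W[of i] by auto
    next
      case False
      then show ?thesis using s' s0 gg by (auto simp: good_def)
    qed
  qed (use v in auto)
  also have "(\<Sum>s\<in>{v, 1 / v}. (contour_winding G' s - contour_winding G s) * residue (ker g v) s) =
     - rterm g 0 v + rterm g 0 (1 / v)"
    using v1 W[of 0] residue_ker[OF an'(1) v(1) \<theta>] residue_ker_inverse[OF an'(2) v(1) \<theta>] by simp
  also have "rterm g 0 (1 / v) = - rterm g 0 v"
  proof -
    have "g (1 / v) = g v" using v w_inverse by (simp add: g_def w1_def A_inverse \<phi>_def B_inverse)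
    then show ?thesis using theta_inverse[OF p(1), of "v\<^sup>2"] v
      by (simp add: rterm_def power_divide power2_eq_square)
  qed
  also have "rterm g 0 v = w v * v / (theta p (v\<^sup>2) * (poch_inf p p)\<^sup>2) * (A v ^ (2 * n - m) * B v ^ m / A v)"
    using DERIV_imp_deriv[OF deriv_theta_1] by (simp add: rterm_def g_def w1_def \<phi>_def mult_ac)
  also have "A v ^ (2 * n - m) * B v ^ m = A v ^ (2 * n) * t v ^ m"
    using v m by (simp add: t_def power_divide power_diff)
  finally have h: "cyc_int G' (ker g v) = cyc_int G (ker g v) -
    4 * of_real pi * \<i> * (w v * v / (theta p (v\<^sup>2) * (poch_inf p p)\<^sup>2) * (A v ^ (2 * n) * t v ^ m / A v))" by (simp add: mult_ac)
  have "cyc_int G' (ker g (1 / v)) = cyc_int G' (ker g v)"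
  proof (rule cyc_int_spike[OF cyc(2)])
    show "\<forall>\<^sup>*s. ker g (1 / v) s = ker g v s" using cosparse_nz by eventually_elim (use v ker_inverse in auto)
  qed
  then have "kk (1 / v) m = A v * (K * (cyc_int G (ker g v) -
    4 * of_real pi * \<i> * (w v * v / (theta p (v\<^sup>2) * (poch_inf p p)\<^sup>2) * (A v ^ (2 * n) * t v ^ m / A v))))"
    using kk_eq[OF _ G', of m] v h by (simp add: A_inverse g_def)
  also have "\<dots> = kk v m - \<omega> / c2 v * (A v ^ (2 * n) * t v ^ m)"
    using kk_eq[OF v(1) G, of m] v \<theta> poch_pp_nonzero
    by (cases "w v = 0") (simp_all add: g_def \<omega>_def c2_def K_def field_simps)
  finally show ?thesis .
qed

lemma R_inverse:
  assumes gv: "generic v" "generic (1 / v)" and \<theta>: "theta p (v\<^sup>2) \<noteq> 0" and an: "w1 analytic_on {v}" "w1 analytic_on {1 / v}"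
  shows "R1 (1 / v) = R1 v - \<omega> / c2 v * P1 v" "R2 (1 / v) = R2 v - \<omega> / c2 v * P2 v"
proof -
  define k where "k = - \<omega> / c2 v * A v ^ (2 * n)"
  have v: "v \<noteq> 0" "A v \<noteq> 0" using gv by (auto simp: generic_def)
  have kk: "kk (1 / v) m = kk v m + k * t v ^ m" if "m \<le> n" for m
    using kk_inverse[OF assms, of m] that by (simp add: k_def)
  \<comment> \<open>The correction is a multiple of the powers of t(v), whose inhomogeneity is 0;
    that of the Cauchy moments remains 1.\<close>
  have 1: "H.gen1 (kk (1 / v)) 1 = H.gen1 (\<lambda>m. kk v m + k * t v ^ m) (1 + k * 0)"
    "H.gen2 (kk (1 / v)) 1 = H.gen2 (\<lambda>m. kk v m + k * t v ^ m) (1 + k * 0)"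
    using H.gen_cong[of "kk (1 / v)" "\<lambda>m. kk v m + k * t v ^ m" 1] kk by simp_all
  have 2: "(x + k * y) / A v ^ n = x / A v ^ n - \<omega> / c2 v * (A v ^ n * y)" for x y
    using v by (cases "c2 v = 0") (simp_all add: k_def mult_2_right power_add field_simps)
  show "R1 (1 / v) = R1 v - \<omega> / c2 v * P1 v"
    unfolding R1_def P1_def 1 H.gen_linear A_inverse[OF v(1)] 2 ..
  show "R2 (1 / v) = R2 v - \<omega> / c2 v * P2 v"
    unfolding R2_def P2_def 1 H.gen_linear A_inverse[OF v(1)] 2 ..
qed

end

section \<open>The functions \<open>F\<close> as limits of generic values\<close>

lemma det_hankel_tendsto:
  assumes "\<And>m. (l m \<longlongrightarrow> l' m) F"
  shows "((\<lambda>x. hdet N (\<lambda>m. l m x)) \<longlongrightarrow> hdet N l') F"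
proof -
  have 1: "hdet N a = (\<Sum>\<sigma> | \<sigma> permutes {0..<N}. signof \<sigma> * (\<Prod>i = 0..<N. a (i + \<sigma> i)))" for a
    by (subst det_def'[of _ N]) (auto simp: hankel_def intro!: sum.cong prod.cong dest: permutes_in_image)
  show ?thesis unfolding 1 by (intro tendsto_intros assms)
qed

lemma extend_approx:
  fixes f :: "'a::metric_space \<Rightarrow> complex"
  assumes "Defs.extend S f a = Some y" "e > 0"
  obtains a' where "a' \<in> S" "dist a' a < e" "dist (f a') y < e"
proof (cases "a \<in> S")
  case True
  then show ?thesis using assms that[of a] by (simp add: Defs.extend_def)
next
  case False
  then obtain L where L: "a islimpt S" "(f \<longlongrightarrow> L) (at a within S)" "y = Lim (at a within S) f"
    using assms(1) unfolding Defs.extend_def by (auto split: if_splits)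
  have nt: "at a within S \<noteq> bot" using L(1) by (simp add: trivial_limit_within)
  then have "(f \<longlongrightarrow> y) (at a within S)" using L tendsto_Lim by blast
  then have "eventually (\<lambda>x. dist (f x) y < e) (at a within S)" using assms(2) by (rule tendstoD)
  moreover have "eventually (\<lambda>x. x \<in> S \<and> dist x a < e) (at a within S)"
    using assms(2) by (auto simp: eventually_at)
  ultimately have "eventually (\<lambda>x. x \<in> S \<and> dist x a < e \<and> dist (f x) y < e) (at a within S)"
    by eventually_elim auto
  then show ?thesis using eventually_happens'[OF nt] that by blast
qed

section \<open>Given contours as limits of good cycles\<close>

context elliptic
begin

text \<open>If \<open>v\<close> and \<open>p / v\<close> are parameters, the members of
  \<open>fam v\<close> with the exponents demanded by \<open>good\<close> are inner points, and
  inversion carries the remaining ones to these.\<close>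

lemma contour_fam:
  assumes as: "0 \<notin> set as" and con: "is_contour_for p q as Cs" and v: "v \<in> set as" "p / v \<in> set as"
  shows "is_pole (\<lambda>s. Delta p q s as) (v * p powi i) \<Longrightarrow> contour_winding Cs (v * p powi i) = of_bool (i \<ge> 0)"
    "is_pole (\<lambda>s. Delta p q s as) (p powi i / v) \<Longrightarrow> contour_winding Cs (p powi i / v) = of_bool (i \<ge> 1)"
proof -
  note cf = contour_facts[OF as con]
  have v0: "v \<noteq> 0" using v as by auto
  have inn: "v * p powi i \<in> inner_points as" if "i \<ge> 0" for i
    unfolding inner_points_def using v that
    by (intro CollectI exI[of _ "nat i"] exI[of _ 0] exI[of _ v]) (auto simp: power_int_def mult.commute)
  have inn': "p powi i / v \<in> inner_points as" if "i \<ge> 1" for i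
  proof -
    have "p powi i = p powi (i - 1) * p" using p by (simp add: power_int_diff)
    then have "p powi i / v = p ^ nat (i - 1) * q ^ 0 * (p / v)" using that by (simp add: power_int_def)
    then show ?thesis unfolding inner_points_def using v by blast
  qed
  have nz: "v * p powi i \<noteq> 0" "p powi i / v \<noteq> 0" using v0 p by auto
  have inv: "1 / (v * p powi i) = p powi (-i) / v" "1 / (p powi i / v) = v * p powi (-i)"
    by (simp_all add: power_int_minus field_simps)
  show "contour_winding Cs (v * p powi i) = of_bool (i \<ge> 0)" if "is_pole (\<lambda>s. Delta p q s as) (v * p powi i)"
    using cf(5)[OF nz(1) that] cf(6)[OF nz(1) that] inn[of i] inn'[of "-i"] unfolding inv by (cases "i \<ge> 0") auto
  show "contour_winding Cs (p powi i / v) = of_bool (i \<ge> 1)" if "is_pole (\<lambda>s. Delta p q s as) (p powi i / v)"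
    using cf(5)[OF nz(2) that] cf(6)[OF nz(2) that] inn'[of i] inn[of "-i"] unfolding inv by (cases "i \<ge> 1") auto
qed

lemma ker_pole_Delta:
  assumes as: "0 \<notin> set as" and h: "h holomorphic_on -{0}" and k: "k \<noteq> 0"
    and eq: "\<forall>\<^sup>*s. Delta p q s as * h s / s = k * ker g v s"
    and s: "s \<noteq> 0" "is_pole (ker g v) s"
  shows "is_pole (\<lambda>s. Delta p q s as) s"
proof -
  have "eventually (\<lambda>s. Delta p q s as * h s / s = k * ker g v s) (at s)" using eq s(1) by (simp add: cosparse_punctured)
  moreover have "eventually (\<lambda>s. s \<noteq> 0) (at s)" using cosparse_nz s(1) by (simp add: cosparse_punctured)
  ultimately have "eventually (\<lambda>s. ker g v s = Delta p q s as * (h s / (k * s))) (at s)"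
    by eventually_elim (use k in \<open>simp add: field_simps\<close>)
  then have "is_pole (\<lambda>s. Delta p q s as * (h s / (k * s))) s"
    using is_pole_cong[of "ker g v" "\<lambda>s. Delta p q s as * (h s / (k * s))" s s] s(2) by simp
  then show ?thesis
    by (rule product_pole[OF meromorphic_Delta[OF as], of "\<lambda>s. h s / (k * s)", OF _ s(1), rotated]) (use h k in \<open>auto intro!: holomorphic_intros\<close>)
qed

text \<open>Links moments over a given contour to moments over good cycles. The kernel parameter
  varies, while the contour belongs to the parameters at \<open>v0\<close> and stays fixed.\<close>

lemma moment_tendsto:
  assumes as: "0 \<notin> set as" and con: "is_contour_for p q as Cs" and v0: "v0 \<in> set as" "p / v0 \<in> set as"
    and g: "g meromorphic_on -{0}" and h: "h holomorphic_on -{0}" and k: "k \<noteq> 0"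
    and eq: "\<forall>\<^sup>*s. Delta p q s as * h s / s = k * ker g v0 s"
    and lab: "\<And>s. s \<noteq> 0 \<Longrightarrow> is_pole g s \<Longrightarrow> is_pole (\<lambda>s. Delta p q s as) s \<Longrightarrow> contour_winding Cs s = lab s"
    and H: "eventually (\<lambda>v. \<exists>G. good g lab v G \<and> H v = cyc_int G (ker g v)) (at v0)"
  shows "((\<lambda>v. k * H v) \<longlongrightarrow> cyc_int Cs (\<lambda>s. Delta p q s as * h s / s)) (at v0)"
proof -
  note cf = contour_facts[OF as con]
  have v: "v0 \<noteq> 0" using v0 as by auto
  note pole = ker_pole_Delta[OF as h k eq]
  have av: "s \<notin> contour_image Cs \<and> contour_winding Cs s \<in> {0, 1}" if "s \<noteq> 0" "is_pole (ker g v0) s" for s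
    using cf(3,4) pole that by blast
  have nz: "v0 * p powi i \<noteq> 0" "p powi i / v0 \<noteq> 0" for i using v p by auto
  have "(H \<longlongrightarrow> cyc_int Cs (ker g v0)) (at v0)"
  proof (rule ker_cycle_tendsto[OF g v cf(1,2) av contour_fam(1)[OF as con v0 pole] contour_fam(2)[OF as con v0 pole] _ H])
    fix s assume s: "s \<noteq> 0" "is_pole g s"
    then show "contour_winding Cs s = lab s" using lab pole ker_pole_g[OF g v s] by blast
  qed (use nz in auto)
  then have "((\<lambda>v. k * H v) \<longlongrightarrow> k * cyc_int Cs (ker g v0)) (at v0)" by (intro tendsto_intros)
  also have "k * cyc_int Cs (ker g v0) = cyc_int Cs (\<lambda>s. k * ker g v0 s)"
  proof (rule cyc_int_lmul[symmetric])
    fix \<gamma> assume "\<gamma> \<in> set Cs"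
    then show "ker g v0 contour_integrable_on \<gamma>"
      using av contour_image_nonzero[OF cf(1)] by (intro cycle_integrable[OF cf(1) meromorphic_ker[OF g v]]) metis
  qed
  also have "\<dots> = cyc_int Cs (\<lambda>s. Delta p q s as * h s / s)"
    by (rule cyc_int_spike[OF cf(1)]) (use eq in \<open>eventually_elim; simp\<close>)
  finally show ?thesis .
qed

lemma Delta_append: "Delta p q s (as @ [a, b, c, d]) = Delta p q s as * (egamma2 p q a s * egamma2 p q b s) * (egamma2 p q c s * egamma2 p q d s)"
  by (simp add: Delta_def)

lemma inner_points_append: "inner_points as \<subseteq> inner_points (as @ bs)"
  by (auto simp: inner_points_def)

end

context weighted
begin

lemma lab_inner:
  assumes con: "is_contour_for p q (us @ bs) Cs" and bs: "0 \<notin> set bs"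
    and s: "s \<noteq> 0" "is_pole w s" "is_pole (\<lambda>s. Delta p q s (us @ bs)) s"
  shows "contour_winding Cs s = lab1 s"
proof -
  have "0 \<notin> set (us @ bs)" using us bs by simp
  note cf = contour_facts[OF this con]
  show ?thesis
    using cf(5)[OF s(1,3)] cf(6)[OF s(1,3)] w_pole[OF s(2,1)] inner_points_append[of us bs] s(2)
    by (auto simp: lab1_def lab_def)
qed

text \<open>The factor \<open>A\<close> cancels the artificial denominator of
  \<open>w1\<close>.\<close>

lemma w1A_pole:
  assumes "h holomorphic_on -{0}" "s \<noteq> 0" "is_pole (\<lambda>s. w1 s * (A s * h s)) s"
  shows "is_pole w s"
proof -
  have "eventually (\<lambda>s. w1 s * (A s * h s) = w s * h s) (at s)"
    using w1_A assms(2) unfolding cosparse_punctured by (auto elim!: eventually_mono simp flip: mult.assoc)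
  then have "is_pole (\<lambda>s. w s * h s) s"
    using is_pole_cong[of "\<lambda>s. w1 s * (A s * h s)" "\<lambda>s. w s * h s" s s] assms(3) by simp
  then show ?thesis by (rule product_pole[OF w_meromorphic assms(1,2)])
qed

definition F_set :: "(complex \<times> complex) set" where
  "F_set = {(x, v). x \<noteq> 0 \<and> v \<noteq> 0 \<and> contour_exists p q (us @ [q * x, p * q / x, v, p / v])}"

definition F_value :: "complex \<times> complex \<Rightarrow> complex" where
  "F_value = (\<lambda>(x, v). x powi (- int n) * v ^ n * II p q (int n) (us @ [q * x, p * q / x, v, p / v]))"

text \<open>A limit in \<open>v\<close> alone is enough: the pair attached to \<open>x\<close> only
  contributes the factor psi(x, s), which creates no poles that the contour would have to
  separate.\<close>

lemma F_value_tendsto: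
  assumes S: "(x, v0) \<in> F_set" and Ax: "A x \<noteq> 0"
  shows "((\<lambda>v. PR x v) \<longlongrightarrow> F_value (x, v0)) (at v0)"
proof -
  define as where "as = us @ [q * x, p * q / x, v0, p / v0]"
  have nz: "x \<noteq> 0" "v0 \<noteq> 0" and ex: "contour_exists p q as" using S by (auto simp: F_set_def as_def)
  have as: "0 \<notin> set as" using us nz p q by (auto simp: as_def)
  define Cs where "Cs = (SOME Cs. is_contour_for p q as Cs)"
  have con: "is_contour_for p q as Cs" unfolding Cs_def by (rule some_contour[OF ex])
  define h where "h m s = psi p x s * \<phi> (2 * n - 2) m s" for m s
  have h: "h m holomorphic_on -{0}" for m
    unfolding h_def using psi_holomorphic2 nz by (intro holomorphic_intros) auto
  define g where "g m s = w1 s * (A s * h m s)" for m s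
  define H where "H m v = cyc_int (G1 v) (ker (g m) v)" for m v
  have Ah: "(\<lambda>s. A s * h m s) holomorphic_on -{0}" for m by (intro holomorphic_intros holomorphic_A h)
  have lim: "((\<lambda>v. x / v0 * H m v) \<longlongrightarrow> cyc_int Cs (\<lambda>s. Delta p q s as * \<phi> (2 * n - 2) m s / s)) (at v0)" for m
  proof (rule moment_tendsto[OF as con])
    show "g m meromorphic_on -{0}" unfolding g_def using Ah by (rule w1h_meromorphic)
    show "\<forall>\<^sup>*s. Delta p q s as * \<phi> (2 * n - 2) m s / s = x / v0 * ker (g m) v0 s"
      using egamma2_pair(2)[OF nz(1)] egamma2_pair(1)[OF nz(2)] w1_A
    proof eventually_elim
      case (elim s)
      have "Delta p q s as = w1 s * A s * (x * psi p x s) * (1 / (v0 * psi p v0 s))"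
        unfolding as_def Delta_append elim by (simp add: w_def)
      then show ?case by (simp add: ker_def g_def h_def mult_ac)
    qed
    show "contour_winding Cs s = lab1 s" if "s \<noteq> 0" "is_pole (g m) s" "is_pole (\<lambda>s. Delta p q s as) s" for s
      using that con nz p q unfolding as_def g_def by (intro lab_inner w1A_pole[OF h]) auto
    show "\<forall>\<^sub>F v in at v0. \<exists>G. good (g m) lab1 v G \<and> H m v = cyc_int G (ker (g m) v)"
      unfolding g_def H_def
      by (intro eventually_some_good w1_meromorphic Ah eventually_mono[OF eventually_generic[OF nz(2)]]) (simp add: generic_def)
  qed (use nz in \<open>auto simp: as_def intro: holomorphic_\<phi>\<close>)
  have "((\<lambda>v. x powi (- int n) * v0 ^ n * hdet n (\<lambda>m. K * (x / v0 * H m v))) \<longlongrightarrow> F_value (x, v0)) (at v0)"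
    unfolding F_value_def prod.case as_def[symmetric] II_hankel[OF as ex] Cs_def[symmetric]
    by (intro tendsto_intros det_hankel_tendsto lim)
  moreover have "eventually (\<lambda>v. x powi (- int n) * v0 ^ n * hdet n (\<lambda>m. K * (x / v0 * H m v)) =
      PR x v) (at v0)"
    using eventually_generic[OF nz(2)]
  proof (rule eventually_mono)
    fix v assume v: "generic v"
    define G where "G = (G1 v)"
    have G: "good w1 lab1 v G" using v unfolding G_def by (auto simp: generic_def intro: someI_ex)
    have "H m v = cyc_int G (ker (\<lambda>s. w s * psi p x s * \<phi> (2 * n - 2) m s) v)" for m
      unfolding H_def G_def[symmetric]
    proof (rule cyc_int_spike)
      show "\<forall>\<^sup>*s. ker (g m) v s = ker (\<lambda>s. w s * psi p x s * \<phi> (2 * n - 2) m s) v s"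
        using w1_A
      proof eventually_elim
        case (elim s)
        show ?case unfolding ker_def g_def h_def elim[symmetric] by (simp add: mult_ac)
      qed
    qed (use G in \<open>simp add: good_def\<close>)
    then have "hdet n (\<lambda>m. K * (x / v0 * H m v)) = hdet n (\<lambda>m. (x / v0) * (K * cyc_int G (ker (\<lambda>s. w s * psi p x s * \<phi> (2 * n - 2) m s) v)))"
      by (simp add: mult_ac)
    also have "\<dots> = (x / v0) ^ n * (PR x v)"
      unfolding det_hankel_scale[of n "x / v0"] F_generic[OF nz(1) Ax v G] ..
    finally show "x powi (- int n) * v0 ^ n * hdet n (\<lambda>m. K * (x / v0 * H m v)) = PR x v"
      using nz by (simp add: power_int_minus power_divide)
  qed
  ultimately show ?thesis by (rule Lim_transform_eventually)
qed

definition Fplus_set :: "(complex \<times> complex) set" where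
  "Fplus_set = {(x, v). x \<noteq> 0 \<and> v \<noteq> 0 \<and> contour_exists p q (us @ [x, p / x, v, p / v])}"

definition Fplus_value :: "complex \<times> complex \<Rightarrow> complex" where
  "Fplus_value = (\<lambda>(x, v). v ^ (n + 1) * x ^ (n + 1) * psi p v x * II p q (int n + 1) (us @ [x, p / x, v, p / v]))"

lemma meromorphic_divide_psi:
  assumes "g meromorphic_on -{0}" "v \<noteq> 0"
  shows "(\<lambda>s. g s / psi p v s) meromorphic_on -{0}"
  by (rule meromorphic_on_divide[OF assms(1) analytic_on_imp_meromorphic_on[OF psi_analytic[OF assms(2)]]])

lemma pole_divide_psi:
  assumes "g meromorphic_on -{0}" "v \<noteq> 0" "s \<noteq> 0"
  shows "is_pole g s \<Longrightarrow> is_pole (\<lambda>s. g s / psi p v s) s"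
    "is_pole (\<lambda>s. g s / psi p v s) s \<Longrightarrow> s \<notin> fam v \<Longrightarrow> is_pole g s"
proof -
  have m: "(\<lambda>s. g s / psi p v s) meromorphic_on -{0}"
    by (rule meromorphic_divide_psi[OF assms(1,2)])
  have 1: "ker g v = (\<lambda>s. (g s / psi p v s) * (1 / s))" by (simp add: ker_def mult.commute)
  have ev: "eventually (\<lambda>s. g s / psi p v s = ker g v s * s) (at s)"
  proof -
    have "\<forall>\<^sup>*s. g s / psi p v s = ker g v s * s"
      using cosparse_nz by eventually_elim (simp add: ker_def)
    then show ?thesis using assms(3) by (simp add: cosparse_punctured)
  qed
  show "is_pole (\<lambda>s. g s / psi p v s) s" if "is_pole g s"
    using ker_pole_g[OF assms that] unfolding 1
    by (rule product_pole[OF m, rotated 2]) (use assms in \<open>auto intro!: holomorphic_intros\<close>)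
  assume s: "is_pole (\<lambda>s. g s / psi p v s) s" "s \<notin> fam v"
  have "is_pole (\<lambda>s. ker g v s * s) s" using is_pole_cong[OF ev refl] s(1) by simp
  then have "is_pole (ker g v) s"
    by (rule product_pole[OF meromorphic_ker[OF assms(1,2)], rotated 2]) (use assms in \<open>auto intro!: holomorphic_intros\<close>)
  then show "is_pole g s" using ker_not_pole[OF assms] s(2) by blast
qed

text \<open>Both arguments enter through Cauchy kernels, so the limit is iterated. With x at x0 the
  kernel of x0 is counted to the weight and v moves off v0; for fixed generic v the kernel of v is
  counted to the weight and x moves off x0.\<close>

lemma Fplus_value_tendsto:
  assumes S: "(x0, v0) \<in> Fplus_set"
  obtains \<Psi> where "(\<Psi> \<longlongrightarrow> Fplus_value (x0, v0)) (at v0)"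
    "eventually (\<lambda>v. ((\<lambda>x. RR x v) \<longlongrightarrow> \<Psi> v) (at x0)) (at v0)"
proof -
  define as where "as = us @ [x0, p / x0, v0, p / v0]"
  have nz: "x0 \<noteq> 0" "v0 \<noteq> 0" and ex: "contour_exists p q as" using S by (auto simp: Fplus_set_def as_def)
  have as: "0 \<notin> set as" using us nz p by (auto simp: as_def)
  define Cs where "Cs = (SOME Cs. is_contour_for p q as Cs)"
  have con: "is_contour_for p q as Cs" unfolding Cs_def by (rule some_contour[OF ex])
  note cf = contour_facts[OF as con]
  define \<Delta> where "\<Delta> = (\<lambda>s. Delta p q s as)"
  \<comment> \<open>Sides are read off the contour at the actual poles. This also labels the poles
    in \<open>fam x0\<close>, which now belong to the weight \<open>g0\<close>.\<close>
  define L where "L s = (if is_pole \<Delta> s then contour_winding Cs s else of_bool (norm s < 1))" for s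
  have L01: "L s \<in> {0, 1}" if "s \<noteq> 0" for s using cf(3)[of s] cf(4)[of s] that by (auto simp: L_def \<Delta>_def)
  define g0 where "g0 s = w1 s / psi p x0 s" for s
  define h where "h m s = A s * \<phi> (2 * n) m s" for m s
  define g where "g m s = g0 s * h m s" for m s
  define H where "H m v = cyc_int (SOME G. good g0 L v G) (ker (g m) v)" for m v
  have h: "h m holomorphic_on -{0}" for m unfolding h_def by (intro holomorphic_intros holomorphic_A)
  have g0: "g0 meromorphic_on -{0}"
    unfolding g0_def by (rule meromorphic_divide_psi[OF w1_meromorphic nz(1)])
  have g: "g m meromorphic_on -{0}" for m
    unfolding g_def using h by (intro meromorphic_on_mult g0 analytic_on_imp_meromorphic_on) (auto simp: analytic_punctured_iff)
  have eq: "\<forall>\<^sup>*s. Delta p q s as * \<phi> (2 * n) m s / s = 1 / (x0 * v0) * ker (g m) v0 s" for m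
    using egamma2_pair(1)[OF nz(1)] egamma2_pair(1)[OF nz(2)] w1_A
  proof eventually_elim
    case (elim s)
    have "Delta p q s as = w1 s * A s * (1 / (x0 * psi p x0 s)) * (1 / (v0 * psi p v0 s))"
      unfolding as_def Delta_append elim by (simp add: w_def)
    then show ?case by (simp add: ker_def g_def g0_def h_def mult_ac)
  qed
  have poleg: "is_pole \<Delta> s" if "s \<noteq> 0" "is_pole (g m) s" for s m
    unfolding \<Delta>_def using ker_pole_Delta[OF as holomorphic_\<phi> _ eq that(1) ker_pole_g[OF g nz(2) that]] nz by simp
  have bd: "lab_bounded {s. s \<noteq> 0 \<and> is_pole g0 s} L"
    unfolding L_def using cf L01
    by (intro lab_bounded_extend lab_bounded_winding) (auto simp: L_def \<Delta>_def)
  have evg: "eventually (\<lambda>v. \<exists>G. good g0 L v G) (at v0)" by (rule eventually_good[OF g0 nz(2) bd])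
  have lim: "((\<lambda>v. 1 / (x0 * v0) * H m v) \<longlongrightarrow> cyc_int Cs (\<lambda>s. Delta p q s as * \<phi> (2 * n) m s / s)) (at v0)" for m
  proof (rule moment_tendsto[OF as con _ _ g holomorphic_\<phi> _ eq, where lab = L])
    show "contour_winding Cs s = L s" if "is_pole (\<lambda>s. Delta p q s as) s" for s
      using that by (simp add: L_def \<Delta>_def)
    show "\<forall>\<^sub>F v in at v0. \<exists>G. good (g m) L v G \<and> H m v = cyc_int G (ker (g m) v)"
      unfolding g_def H_def by (intro eventually_some_good evg g0 h)
  qed (use nz in \<open>auto simp: as_def\<close>)
  define \<Psi> where "\<Psi> v = v0 ^ (n + 1) * x0 ^ (n + 1) * psi p v x0 * hdet (Suc n) (\<lambda>m. K * (1 / (x0 * v0) * H m v))" for v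
  have "isCont (\<lambda>v. psi p v x0) v0"
    using psi_analytic1[OF nz(1)] nz(2) by (intro analytic_at_imp_isCont) (rule analytic_on_subset, auto)
  then have "(\<Psi> \<longlongrightarrow> v0 ^ (n + 1) * x0 ^ (n + 1) * psi p v0 x0 *
     hdet (Suc n) (\<lambda>m. K * cyc_int Cs (\<lambda>s. Delta p q s as * \<phi> (2 * n) m s / s))) (at v0)"
    unfolding \<Psi>_def isCont_def by (intro tendsto_intros det_hankel_tendsto lim)
  also have "v0 ^ (n + 1) * x0 ^ (n + 1) * psi p v0 x0 *
     hdet (Suc n) (\<lambda>m. K * cyc_int Cs (\<lambda>s. Delta p q s as * \<phi> (2 * n) m s / s)) = Fplus_value (x0, v0)"
    using II_hankel[OF as ex, of "Suc n"] unfolding Cs_def[symmetric] Fplus_value_def prod.case as_def[symmetric]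
    by (simp add: add.commute)
  finally have lim1: "(\<Psi> \<longlongrightarrow> Fplus_value (x0, v0)) (at v0)" .
  have lim2: "((\<lambda>x. RR x v) \<longlongrightarrow> \<Psi> v) (at x0)"
    if gv: "generic v" and psiv: "psi p v x0 \<noteq> 0" and exG: "\<exists>G. good g0 L v G" for v
  proof -
    define G where "G = (SOME G. good g0 L v G)"
    have G: "good g0 L v G" unfolding G_def using exG by (rule someI_ex)
    have v: "v \<noteq> 0" using gv by (simp add: generic_def)
    have Gc: "cycle G" "contour_winding G 0 = 1" using G by (auto simp: good_def)
    define gv where "gv m s = w1 s * h m s / psi p v s" for m s
    \<comment> \<open>One cycle has to serve both kernels, as \<open>Fplus_generic\<close>
      demands.\<close>
    define G' where "G' x = (SOME G'. good w1 lab1 x G' \<and> good w1 lab1 v G')" for x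
    define H' where "H' m x = cyc_int (G' x) (ker (gv m) x)" for m x
    have mw: "(\<lambda>s. w1 s * h m s) meromorphic_on -{0}" for m by (rule w1h_meromorphic[OF h])
    have gvm: "gv m meromorphic_on -{0}" for m
      unfolding gv_def by (rule meromorphic_divide_psi[OF mw v])
    have ker_eq: "ker (g m) v = ker (gv m) x0" for m by (auto simp: ker_def g_def g0_def gv_def)
    have g0_winding: "s \<notin> contour_image G \<and> contour_winding G s = L s" if "is_pole g0 s" "s \<noteq> 0" for s
      using G that analytic_at_imp_no_pole[of g0 s] by (auto simp: good_def)
    have fam_winding: "s \<notin> contour_image G \<and> contour_winding G s \<in> {0, 1}" if s: "s \<in> fam v" for s
    proof -
      obtain i where "s = v * p powi i \<or> s = p powi i / v" using s fam_iff[OF v] by blast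
      then show ?thesis using G s by (auto simp: good_def)
    qed
    have pole_g: "is_pole (g m) s" if "is_pole (ker (gv m) x0) s" "s \<noteq> 0" "s \<notin> fam v" for m s
      using ker_not_pole[OF g v that(2)] that(1,3) unfolding ker_eq[symmetric] by blast
    have pole_g0: "is_pole g0 s" if "is_pole (g m) s" "s \<noteq> 0" for m s
      using that(1) unfolding g_def by (rule product_pole[OF g0 h that(2)])
    have famx: "contour_winding G s = contour_winding Cs s \<and> is_pole \<Delta> s"
      if "is_pole (ker (gv m) x0) s" "s \<in> fam x0" for m s
    proof -
      have s: "s \<noteq> 0" "s \<notin> fam v" using fam_disjoint[OF v nz(1) psiv] that(2) fam_nonzero by auto
      note pg = pole_g[OF that(1) s]
      show ?thesis using g0_winding[OF pole_g0[OF pg s(1)] s(1)] poleg[OF s(1) pg] by (simp add: L_def)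
    qed
    \<comment> \<open>A pole of \<open>w\<close> persists after division by the two psi factors, so
      it is a pole of the full integrand and its side is known from
      \<open>lab_inner\<close>.\<close>
    have w_winding: "contour_winding G s = lab1 s" if "is_pole w s" "s \<noteq> 0" for s
    proof -
      have "is_pole g0 s" unfolding g0_def by (rule pole_divide_psi(1)[OF w1_meromorphic nz(1) that(2)]) (use w_pole_w1 that in blast)
      then have 1: "contour_winding G s = L s" using g0_winding that(2) by blast
      have m: "(\<lambda>s. w s / psi p x0 s) meromorphic_on -{0}"
        by (rule meromorphic_divide_psi[OF w_meromorphic nz(1)])
      have pl: "is_pole (\<lambda>s. w s / psi p x0 s / psi p v0 s) s"
        by (rule pole_divide_psi(1)[OF m nz(2) that(2) pole_divide_psi(1)[OF w_meromorphic nz(1) that(2,1)]])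
      have ev: "eventually (\<lambda>s. w s / psi p x0 s / psi p v0 s = \<Delta> s * (x0 * v0)) (at s)"
      proof -
        have "\<forall>\<^sup>*s. w s / psi p x0 s / psi p v0 s = \<Delta> s * (x0 * v0)"
          using egamma2_pair(1)[OF nz(1)] egamma2_pair(1)[OF nz(2)]
          by eventually_elim (use nz in \<open>simp add: \<Delta>_def as_def Delta_append w_def\<close>)
        then show ?thesis using that(2) by (simp add: cosparse_punctured)
      qed
      have "is_pole (\<lambda>s. \<Delta> s * (x0 * v0)) s" by (rule iffD1[OF is_pole_cong[OF ev refl] pl])
      then have "is_pole \<Delta> s"
        unfolding \<Delta>_def by (rule product_pole[OF meromorphic_Delta[OF as] _ that(2), rotated]) (auto intro!: holomorphic_intros)
      then show ?thesis
        using 1 lab_inner[of "[x0, p / x0, v0, p / v0]" Cs s] con that nz p by (auto simp: as_def[symmetric] \<Delta>_def L_def)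
    qed
    have evx: "eventually (\<lambda>x. generic x \<and> psi p x v \<noteq> 0) (at x0)"
    proof -
      have "isCont (\<lambda>x. psi p x v) x0"
        using psi_analytic1[OF v] nz(1) by (intro analytic_at_imp_isCont) (rule analytic_on_subset, auto)
      moreover have "psi p x0 v \<noteq> 0" using psi_antisym[of v x0] psiv v nz by simp
      ultimately have "eventually (\<lambda>x. psi p x v \<noteq> 0) (at x0)"
        unfolding isCont_def by (rule tendsto_imp_eventually_ne)
      then show ?thesis using eventually_generic[OF nz(1)] by eventually_elim simp
    qed
    have G': "good w1 lab1 x (G' x) \<and> good w1 lab1 v (G' x)" if x: "generic x \<and> psi p x v \<noteq> 0" for x
    proof -
      obtain Gx Gv where GG: "good w1 lab1 x Gx" "good w1 lab1 v Gv" "x \<noteq> 0" using x gv by (auto simp: generic_def)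
      obtain J where "good w1 lab1 x J" "good w1 lab1 v J"
        by (rule joint_good_exists[OF w1_meromorphic GG(3) v conjunct2[OF x] GG(1,2) lab1_values]) blast
      then have "good w1 lab1 x J \<and> good w1 lab1 v J" by blast
      then show ?thesis unfolding G'_def by (rule someI)
    qed
    have "(H' m \<longlongrightarrow> cyc_int G (ker (gv m) x0)) (at x0)" for m
    proof (rule ker_cycle_tendsto[OF gvm nz(1) Gc, where lab = "contour_winding G"])
      show "s \<notin> contour_image G \<and> contour_winding G s \<in> {0, 1}" if "s \<noteq> 0" "is_pole (ker (gv m) x0) s" for s
        using fam_winding[of s] g0_winding[OF pole_g0[OF pole_g]] that L01[of s] by (cases "s \<in> fam v") auto
      have inx: "x0 * p powi i \<in> fam x0" "p powi i / x0 \<in> fam x0" for i using fam_iff[OF nz(1)] by blast+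
      have x0: "x0 \<in> set as" "p / x0 \<in> set as" by (auto simp: as_def)
      show "contour_winding G (x0 * p powi i) = of_bool (i \<ge> 0)" if "is_pole (ker (gv m) x0) (x0 * p powi i)" for i
        using famx[OF that inx(1)] contour_fam(1)[OF as con x0] by (simp add: \<Delta>_def)
      show "contour_winding G (p powi i / x0) = of_bool (i \<ge> 1)" if "is_pole (ker (gv m) x0) (p powi i / x0)" for i
        using famx[OF that inx(2)] contour_fam(2)[OF as con x0] by (simp add: \<Delta>_def)
      show "\<forall>\<^sub>F x in at x0. \<exists>J. good (gv m) (contour_winding G) x J \<and> H' m x = cyc_int J (ker (gv m) x)"
        using evx
      proof (rule eventually_mono)
        fix x assume x: "generic x \<and> psi p x v \<noteq> 0"
        note J = G'[OF x]
        have cJ: "cycle (G' x)" using J by (simp add: good_def)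
        have an: "gv m analytic_on {s}" if s: "s \<in> contour_image (G' x)" for s
        proof -
          have s0: "s \<noteq> 0" using contour_image_nonzero[OF cJ] s by auto
          have "w1 analytic_on {s}" "psi p v s \<noteq> 0" using J s s0 by (auto simp: good_def fam_def)
          then show ?thesis
            unfolding gv_def using analytic_punctured[OF psi_analytic[OF v] s0]
              analytic_punctured[OF h[unfolded analytic_punctured_iff] s0] by (intro analytic_intros) auto
        qed
        have pl: "contour_winding (G' x) s = contour_winding G s" if s: "s \<noteq> 0" "is_pole (gv m) s" for s
        proof (cases "s \<in> fam v")
          case True
          then obtain i where "s = v * p powi i \<or> s = p powi i / v" using fam_iff[OF v] by blast
          then show ?thesis using J G by (auto simp: good_def)
        next
          case False
          have "is_pole (\<lambda>s. w1 s * h m s) s"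
            using pole_divide_psi(2)[OF mw v s(1)] s(2) False unfolding gv_def by blast
          then have ws: "is_pole w s" unfolding h_def by (rule w1A_pole[OF holomorphic_\<phi> s(1)])
          then show ?thesis using w_winding[OF ws s(1)] w_pole_w1[OF s(1) ws] J s(1) by (auto simp: good_def)
        qed
        have "good (gv m) (contour_winding G) x (G' x)" using J an pl by (auto simp: good_def)
        then show "\<exists>J. good (gv m) (contour_winding G) x J \<and> H' m x = cyc_int J (ker (gv m) x)"
          unfolding H'_def by blast
      qed
    qed simp
    then have limH: "(H' m \<longlongrightarrow> H m v) (at x0)" for m unfolding H_def G_def[symmetric] ker_eq .
    have "isCont (psi p v) x0"
      using psi_analytic[OF v] nz(1) by (intro analytic_at_imp_isCont) (rule analytic_on_subset, auto)
    then have "((\<lambda>x. psi p v x * hdet (Suc n) (\<lambda>m. K * H' m x)) \<longlongrightarrow>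
        psi p v x0 * hdet (Suc n) (\<lambda>m. K * H m v)) (at x0)"
      unfolding isCont_def by (intro tendsto_intros det_hankel_tendsto limH)
    moreover have "psi p v x0 * hdet (Suc n) (\<lambda>m. K * H m v) = \<Psi> v"
    proof -
      have "hdet (Suc n) (\<lambda>m. K * (1 / (x0 * v0) * H m v)) = hdet (Suc n) (\<lambda>m. 1 / (x0 * v0) * (K * H m v))"
        by (simp add: mult_ac)
      then show ?thesis unfolding \<Psi>_def det_hankel_scale[of "Suc n" "1 / (x0 * v0)"] using nz
        by (simp add: power_divide power_mult_distrib)
    qed
    moreover have "eventually (\<lambda>x. psi p v x * hdet (Suc n) (\<lambda>m. K * H' m x) = RR x v) (at x0)"
      using evx
    proof (rule eventually_mono)
      fix x assume x: "generic x \<and> psi p x v \<noteq> 0"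
      note J = G'[OF x]
      have "H' m x = cyc_int (G' x) (ker (\<lambda>s. w s / psi p x s * \<phi> (2 * n) m s) v)" for m
        unfolding H'_def
      proof (rule cyc_int_spike)
        show "\<forall>\<^sup>*s. ker (gv m) x s = ker (\<lambda>s. w s / psi p x s * \<phi> (2 * n) m s) v s"
          using w1_A
        proof eventually_elim
          case (elim s)
          show ?case unfolding ker_def gv_def h_def elim[symmetric] by (simp add: mult_ac)
        qed
      qed (use J in \<open>simp add: good_def\<close>)
      then show "psi p v x * hdet (Suc n) (\<lambda>m. K * H' m x) = RR x v"
        using Fplus_generic[of x "G' x" v] J x gv by simp
    qed
    ultimately show ?thesis by (simp only: Lim_transform_eventually)
  qed
  show ?thesis
  proof (rule that[OF lim1])
    have "eventually (\<lambda>v. psi p v x0 \<noteq> 0) (at v0)"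
    proof -
      have "(\<lambda>v. psi p v x0) holomorphic_on -{0}" using psi_analytic1[OF nz(1)] by (simp add: analytic_punctured_iff)
      moreover obtain e where "e \<noteq> 0" "psi p x0 e \<noteq> 0" by (rule ex_psi_nonzero[OF nz(1)]) blast
      moreover have "psi p e x0 \<noteq> 0" using psi_antisym[of x0 e] calculation nz by simp
      ultimately show ?thesis using analytic_cosparse_nonzero nz(2) by (simp add: cosparse_punctured)
    qed
    then show "eventually (\<lambda>v. ((\<lambda>x. RR x v) \<longlongrightarrow> \<Psi> v) (at x0)) (at v0)"
      using evg eventually_generic[OF nz(2)] by eventually_elim (rule lim2)
  qed
qed

end

text \<open>Two approximations are combined: of the extended value by values on \<open>S\<close>,
  and of these by generic values \<open>g\<close>. \<open>Q\<close> restricts to admissible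
  arguments near \<open>a\<close>; \<open>R\<close> can keep the sequences off the limit point, as
  convergence along \<open>at v0\<close> requires.\<close>

lemma extend_sequence:
  fixes a :: "complex \<times> complex"
  assumes ext: "Defs.extend S f a = Some y" and Q: "eventually Q (nhds a)"
    and near: "\<And>b e. b \<in> S \<Longrightarrow> Q b \<Longrightarrow> e > 0 \<Longrightarrow> \<exists>z. dist z b < e \<and> R z \<and> dist (g z) (f b) < e"
  obtains X V where "X \<longlonglongrightarrow> fst a" "V \<longlonglongrightarrow> snd a" "\<And>k. R (X k, V k)" "(\<lambda>k. g (X k, V k)) \<longlonglongrightarrow> y"
proof -
  obtain \<delta> where \<delta>: "\<delta> > 0" "\<And>b. dist b a < \<delta> \<Longrightarrow> Q b" using Q unfolding eventually_nhds_metric by blast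
  have "\<exists>z. dist z a < e \<and> R z \<and> dist (g z) y < e" if e: "e > 0" for e
  proof -
    have "min (e / 2) \<delta> > 0" using e \<delta>(1) by simp
    then obtain b where b: "b \<in> S" "dist b a < min (e / 2) \<delta>" "dist (f b) y < min (e / 2) \<delta>"
      by (rule extend_approx[OF ext])
    obtain z where z: "dist z b < e / 2" "R z" "dist (g z) (f b) < e / 2"
      using near[OF b(1) \<delta>(2) half_gt_zero[OF e]] b(2) by (metis min_less_iff_conj)
    have "dist z a < e" "dist (g z) y < e"
      using b z dist_triangle[of z a b] dist_triangle[of "g z" y "f b"] by simp_all
    then show ?thesis using z(2) by blast
  qed
  then have "\<forall>k. \<exists>z. dist z a < inverse (real (Suc k)) \<and> R z \<and> dist (g z) y < inverse (real (Suc k))" by simp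
  then obtain Z where Z: "\<And>k. dist (Z k) a < inverse (real (Suc k))" "\<And>k. R (Z k)" "\<And>k. dist (g (Z k)) y < inverse (real (Suc k))"
    by metis
  have "Z \<longlonglongrightarrow> a" "(\<lambda>k. g (Z k)) \<longlonglongrightarrow> y"
    by (rule metric_tendsto_imp_tendsto[OF LIMSEQ_inverse_real_of_nat]; use Z in \<open>auto intro!: always_eventually less_imp_le\<close>)+
  then show ?thesis using that[of "fst \<circ> Z" "snd \<circ> Z"] Z(2) tendsto_fst[of Z a] tendsto_snd[of Z a] by (simp add: comp_def)
qed

lemma is_pole_inverse_tendsto: "is_pole f z \<Longrightarrow> ((\<lambda>x. inverse (f x)) \<longlongrightarrow> (0::complex)) (at z)"
  unfolding is_pole_def by (rule filterlim_compose[OF tendsto_inverse_0])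

text \<open>Either the pair converges, or one component has a pole and dominates, so that (f : g)
  still has a limit on the projective line.\<close>

lemma meromorphic_pair:
  fixes f g :: "complex \<Rightarrow> complex"
  assumes f: "f meromorphic_on {z}" and g: "g meromorphic_on {z}"
  obtains a b where "f \<midarrow>z\<rightarrow> a" "g \<midarrow>z\<rightarrow> b"
  | c where "is_pole f z" "(\<lambda>x. g x / f x) \<midarrow>z\<rightarrow> c"
  | c where "is_pole g z" "(\<lambda>x. f x / g x) \<midarrow>z\<rightarrow> c"
proof -
  have gf: "(\<lambda>x. g x / f x) meromorphic_on {z}" by (rule meromorphic_on_divide[OF g f])
  consider "is_pole f z" "\<not> is_pole (\<lambda>x. g x / f x) z" | "is_pole f z" "is_pole (\<lambda>x. g x / f x) z" 
    | "\<not> is_pole f z" "is_pole g z" | "\<not> is_pole f z" "\<not> is_pole g z" by blast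
  then show ?thesis
  proof cases
    case 1
    then show ?thesis using not_pole_limit[OF gf] that(2) by blast
  next
    case 2
    have "is_pole g z"
    proof (rule ccontr)
      assume "\<not> is_pole g z"
      then obtain b where "g \<midarrow>z\<rightarrow> b" using not_pole_limit[OF g] by blast
      then have "(\<lambda>x. g x * inverse (f x)) \<midarrow>z\<rightarrow> b * 0" using is_pole_inverse_tendsto[OF 2(1)] by (rule tendsto_mult)
      then have "\<not> is_pole (\<lambda>x. g x * inverse (f x)) z" by (rule limit_not_pole)
      then show False using 2(2) by (simp add: divide_inverse)
    qed
    moreover have "(\<lambda>x. f x / g x) \<midarrow>z\<rightarrow> 0" using is_pole_inverse_tendsto[OF 2(2)] by simp
    ultimately show ?thesis using that(3) by blast
  next
    case 3
    obtain a where "f \<midarrow>z\<rightarrow> a" using not_pole_limit[OF f 3(1)] by blast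
    then have "(\<lambda>x. f x * inverse (g x)) \<midarrow>z\<rightarrow> a * 0" using is_pole_inverse_tendsto[OF 3(2)] by (rule tendsto_mult)
    then show ?thesis using that(3) 3(2) by (simp add: divide_inverse)
  next
    case 4
    then show ?thesis using not_pole_limit[OF f] not_pole_limit[OF g] that(1) by blast
  qed
qed

text \<open>Dividing a convergent combination by the unbounded f leaves 0, so the coefficient of the
  dominating direction vanishes in the limit.\<close>

lemma pole_ratio:
  fixes f g :: "complex \<Rightarrow> complex"
  assumes f: "is_pole f z" and c: "(\<lambda>x. g x / f x) \<midarrow>z\<rightarrow> c" and V: "filterlim V (at z) sequentially"
    and ab: "\<alpha> \<longlonglongrightarrow> \<alpha>0" "\<beta> \<longlonglongrightarrow> \<beta>0" and E: "E \<noteq> 0"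
    and y: "(\<lambda>k. E * (\<alpha> k * g (V k) - \<beta> k * f (V k))) \<longlonglongrightarrow> y"
  shows "\<alpha>0 * c = \<beta>0"
proof -
  have inv: "(\<lambda>k. inverse (f (V k))) \<longlonglongrightarrow> 0" by (rule filterlim_compose[OF is_pole_inverse_tendsto[OF f] V])
  have "(\<lambda>k. E * (\<alpha> k * (g (V k) / f (V k)) - \<beta> k)) \<longlonglongrightarrow> E * (\<alpha>0 * c - \<beta>0)"
    by (intro tendsto_intros ab filterlim_compose[OF c V])
  moreover have "eventually (\<lambda>k. f (V k) \<noteq> 0) sequentially"
  proof -
    have "eventually (\<lambda>x. f x \<noteq> 0) (at z)"
      using f unfolding is_pole_def by (rule filterlim_at_infinity_imp_eventually_ne)
    then show ?thesis by (rule eventually_compose_filterlim[OF _ V])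
  qed
  then have "eventually (\<lambda>k. E * (\<alpha> k * (g (V k) / f (V k)) - \<beta> k) = E * (\<alpha> k * g (V k) - \<beta> k * f (V k)) * inverse (f (V k))) sequentially"
    by eventually_elim (simp add: field_simps)
  ultimately have "(\<lambda>k. E * (\<alpha> k * g (V k) - \<beta> k * f (V k)) * inverse (f (V k))) \<longlonglongrightarrow> E * (\<alpha>0 * c - \<beta>0)"
    by (rule Lim_transform_eventually)
  moreover have "(\<lambda>k. E * (\<alpha> k * g (V k) - \<beta> k * f (V k)) * inverse (f (V k))) \<longlonglongrightarrow> y * 0"
    by (intro tendsto_mult y inv)
  ultimately have "E * (\<alpha>0 * c - \<beta>0) = y * 0" by (rule LIMSEQ_unique)
  then show ?thesis using E by simp
qed

lemma eventually_at_witness: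
  fixes a b :: complex
  assumes "eventually P (at a)" "e > 0"
  obtains x where "P x" "dist x a < e" "x \<noteq> b"
proof -
  have "eventually (\<lambda>x. dist x a < e) (at a)" using assms(2) unfolding eventually_at by blast
  with assms(1) eventually_neq_at_within[of b a UNIV] have "eventually (\<lambda>x. P x \<and> dist x a < e \<and> x \<noteq> b) (at a)"
    by eventually_elim simp
  then show ?thesis using that eventually_happens[of _ "at a"] by auto
qed

context weighted
begin

lemma A_near:
  assumes "x0 \<noteq> 0" "A x0 \<noteq> 0"
  shows "eventually (\<lambda>x. x \<noteq> 0 \<and> A x \<noteq> 0) (nhds x0)"
proof -
  have "isCont A x0" using holomorphic_isCont[OF holomorphic_A] assms(1) by (auto simp: open_delete)
  then have "eventually (\<lambda>x. A x \<noteq> 0) (nhds x0)"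
    using assms(2) by (intro tendsto_imp_eventually_ne[of A "A x0"]) (auto simp: isCont_def tendsto_at_iff_tendsto_nhds)
  moreover have "eventually (\<lambda>x. x \<in> -{0}) (nhds x0)" using assms(1) by (intro eventually_nhds_in_open) auto
  ultimately show ?thesis by eventually_elim simp
qed

lemma A_near_fst:
  assumes "x0 \<noteq> 0" "A x0 \<noteq> 0"
  shows "eventually (\<lambda>b. fst b \<noteq> 0 \<and> A (fst b) \<noteq> 0) (nhds (x0, v0))"
  using tendsto_fst[OF filterlim_ident, of "(x0, v0)"]
  by (intro eventually_compose_filterlim[OF A_near[OF assms]]) simp

lemma A_near_snd:
  assumes "v0 \<noteq> 0" "A v0 \<noteq> 0"
  shows "eventually (\<lambda>b. A (snd b) \<noteq> 0) (nhds (x0, v0))"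
  using tendsto_snd[OF filterlim_ident, of "(x0, v0)"]
  by (intro eventually_compose_filterlim[OF eventually_mono[OF A_near[OF assms]]]) simp_all

lemma F_sequence:
  assumes F: "F_fun p q n us x0 v0 = Some y" and nz: "x0 \<noteq> 0" "A x0 \<noteq> 0"
  obtains X V where "X \<longlonglongrightarrow> x0" "filterlim V (at v0) sequentially" "(\<lambda>k. PR (X k) (V k)) \<longlonglongrightarrow> y"
proof -
  have ext: "Defs.extend F_set F_value (x0, v0) = Some y" using F by (simp add: F_fun_def F_set_def F_value_def)
  have near: "\<exists>z. dist z b < e \<and> snd z \<noteq> v0 \<and> dist (PR (fst z) (snd z)) (F_value b) < e"
    if b: "b \<in> F_set" "fst b \<noteq> 0 \<and> A (fst b) \<noteq> 0" and e: "e > 0" for b e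
  proof -
    obtain x v where xv: "b = (x, v)" by (cases b)
    have "eventually (\<lambda>v'. dist (PR x v') (F_value b) < e) (at v)"
      using tendstoD[OF F_value_tendsto[of x v] e] b by (simp add: xv)
    then obtain v' where "dist (PR x v') (F_value b) < e" "dist v' v < e" "v' \<noteq> v0"
      using e by (rule eventually_at_witness)
    then show ?thesis by (intro exI[of _ "(x, v')"]) (simp add: xv dist_Pair_Pair)
  qed
  obtain X V where "X \<longlonglongrightarrow> fst (x0, v0)" "V \<longlonglongrightarrow> snd (x0, v0)" "\<And>k. snd (X k, V k) \<noteq> v0"
      "(\<lambda>k. PR (fst (X k, V k)) (snd (X k, V k))) \<longlonglongrightarrow> y"
    by (rule extend_sequence[OF ext A_near_fst[OF nz] near]) (assumption | rule that)+
  then show ?thesis using that[of X V] by (simp add: filterlim_at)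
qed

lemma Fplus_sequence:
  assumes F: "Fplus p q n us x0 v0 = Some y"
  obtains X V where "filterlim X (at x0) sequentially" "filterlim V (at v0) sequentially" "(\<lambda>k. RR (X k) (V k)) \<longlonglongrightarrow> y"
proof -
  have ext: "Defs.extend Fplus_set Fplus_value (x0, v0) = Some y"
    using F by (simp add: Fplus_def Fplus_set_def Fplus_value_def)
  have near: "\<exists>z. dist z b < e \<and> (fst z \<noteq> x0 \<and> snd z \<noteq> v0) \<and> dist (RR (fst z) (snd z)) (Fplus_value b) < e"
    if b: "b \<in> Fplus_set" True and e: "e > 0" for b e
  proof -
    obtain x v where xv: "b = (x, v)" by (cases b)
    have e2: "e / 2 > 0" using e by simp
    obtain \<Psi> where \<Psi>: "(\<Psi> \<longlongrightarrow> Fplus_value (x, v)) (at v)" "eventually (\<lambda>v. ((\<lambda>x. RR x v) \<longlongrightarrow> \<Psi> v) (at x)) (at v)"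
      by (rule Fplus_value_tendsto[OF b(1)[unfolded xv]]) blast
    obtain v' where v': "((\<lambda>x. RR x v') \<longlongrightarrow> \<Psi> v') (at x) \<and> dist (\<Psi> v') (Fplus_value (x, v)) < e / 2" "dist v' v < e / 2" "v' \<noteq> v0"
      by (rule eventually_at_witness[OF eventually_conj[OF \<Psi>(2) tendstoD[OF \<Psi>(1) e2]] e2])
    obtain x' where x': "dist (RR x' v') (\<Psi> v') < e / 2" "dist x' x < e / 2" "x' \<noteq> x0"
      by (rule eventually_at_witness[OF tendstoD[OF conjunct1[OF v'(1)] e2] e2])
    have "dist (x', v') (x, v) < e"
      using dist_triangle[of "(x', v')" "(x, v)" "(x, v')"] x'(2) v'(2) by (simp add: dist_Pair_Pair)
    moreover have "dist (RR x' v') (Fplus_value (x, v)) < e"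
      using dist_triangle[of "RR x' v'" "Fplus_value (x, v)" "\<Psi> v'"] x'(1) v'(1) by simp
    ultimately show ?thesis using v'(3) x'(3) by (intro exI[of _ "(x', v')"]) (simp add: xv)
  qed
  obtain X V where "X \<longlonglongrightarrow> fst (x0, v0)" "V \<longlonglongrightarrow> snd (x0, v0)" "\<And>k. fst (X k, V k) \<noteq> x0 \<and> snd (X k, V k) \<noteq> v0"
      "(\<lambda>k. RR (fst (X k, V k)) (snd (X k, V k))) \<longlonglongrightarrow> y"
    by (rule extend_sequence[OF ext always_eventually[OF allI[OF TrueI]] near]) (assumption | rule that)+
  then show ?thesis using that[of X V] by (simp add: filterlim_at)
qed

definition Fminus_set :: "(complex \<times> complex) set" where
  "Fminus_set = {(x, v). x \<noteq> 0 \<and> v \<noteq> 0 \<and> contour_exists p q (us @ [q * x, p * q / x, q * v, p * q / v])}"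

definition Fminus_value :: "complex \<times> complex \<Rightarrow> complex" where
  "Fminus_value = (\<lambda>(x, v). psi p x v * x powi (1 - int n) * v powi (1 - int n) *
     II p q (int n - 1) (us @ [q * x, p * q / x, q * v, p * q / v]))"

text \<open>No kernel is involved, so the value is exact and not a limit; the contour is exchanged
  for \<open>Cs0\<close>, which has the same sides at all actual poles.\<close>

lemma Fminus_value_eq:
  assumes S: "(x, v) \<in> Fminus_set" and nzA: "A x \<noteq> 0" "A v \<noteq> 0"
  shows "Fminus_value (x, v) = PP x v"
proof (cases n)
  case 0
  \<comment> \<open>For n = 0 both sides vanish: \<open>II\<close> is 0 for a negative number of
    variables, and \<open>P2\<close> is 0.\<close>
  show ?thesis unfolding Fminus_value_def II_def P1_def P2_def H.gen1_def H.gen2_def using 0 by simp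
next
  case (Suc n')
  define as where "as = us @ [q * x, p * q / x, q * v, p * q / v]"
  have nz: "x \<noteq> 0" "v \<noteq> 0" and ex: "contour_exists p q as" using S by (auto simp: Fminus_set_def as_def)
  have as: "0 \<notin> set as" using us nz p q by (auto simp: as_def)
  define Cs where "Cs = (SOME Cs. is_contour_for p q as Cs)"
  have con: "is_contour_for p q as Cs" unfolding Cs_def by (rule some_contour[OF ex])
  note cf = contour_facts[OF as con]
  define h where "h m s = psi p x s * psi p v s * \<phi> (2 * n' - 2) m s" for m s
  have h: "h m holomorphic_on -{0}" for m
    unfolding h_def using psi_holomorphic2 nz by (intro holomorphic_intros) auto
  have \<Delta>: "\<forall>\<^sup>*s. Delta p q s as = x * v * (w s * (psi p x s * psi p v s))"
    using egamma2_pair(2)[OF nz(1)] egamma2_pair(2)[OF nz(2)]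
    by eventually_elim (simp add: as_def Delta_append w_def)
  have "cyc_int Cs (\<lambda>s. Delta p q s as * \<phi> (2 * n' - 2) m s / s) = x * v * cyc_int Cs0 (\<lambda>s. w s * h m s / s)" for m
  proof -
    have lab: "s \<notin> contour_image Cs \<and> contour_winding Cs s = lab s" if s: "s \<noteq> 0" "is_pole (\<lambda>s. w s * h m s) s" for s
    proof -
      have ws: "is_pole w s" by (rule product_pole[OF w_meromorphic h s])
      have ev: "eventually (\<lambda>s. w s * h m s = Delta p q s as * (\<phi> (2 * n' - 2) m s / (x * v))) (at s)"
      proof -
        have "\<forall>\<^sup>*s. w s * h m s = Delta p q s as * (\<phi> (2 * n' - 2) m s / (x * v))"
          using \<Delta> by eventually_elim (use nz in \<open>simp add: h_def\<close>)
        then show ?thesis using s(1) by (simp add: cosparse_punctured)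
      qed
      have "is_pole (\<lambda>s. Delta p q s as * (\<phi> (2 * n' - 2) m s / (x * v))) s"
        by (rule iffD1[OF is_pole_cong[OF ev refl] s(2)])
      then have pl: "is_pole (\<lambda>s. Delta p q s as) s"
        by (rule product_pole[OF meromorphic_Delta[OF as] _ s(1), rotated]) (use nz in \<open>auto intro!: holomorphic_intros\<close>)
      then show ?thesis
        using lab_inner[of "[q * x, p * q / x, q * v, p * q / v]" Cs s] con ws s(1) nz p q cf(4)
        by (auto simp: as_def[symmetric] lab1_def)
    qed
    have "cyc_int Cs (\<lambda>s. Delta p q s as * \<phi> (2 * n' - 2) m s / s) = cyc_int Cs (\<lambda>s. x * v * (w s * h m s / s))"
      by (rule cyc_int_spike[OF cf(1)]) (use \<Delta> in \<open>eventually_elim; simp add: h_def\<close>)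
    also have "\<dots> = x * v * cyc_int Cs (\<lambda>s. w s * h m s / s)"
      using lab by (intro cyc_int_lmul weight_integrable[OF cf(1) w_meromorphic h]) auto
    finally show ?thesis using base_independent[OF h cf(1,2) lab] by simp
  qed
  then have "II p q (int n') as = hdet n' (\<lambda>m. x * v * (K * cyc_int Cs0 (\<lambda>s. w s * h m s / s)))"
    unfolding II_hankel[OF as ex] Cs_def[symmetric] by (simp add: mult_ac)
  then have "Fminus_value (x, v) = psi p x v * hdet n' (\<lambda>m. K * cyc_int Cs0 (\<lambda>s. w s * h m s / s))"
    unfolding Fminus_value_def prod.case as_def[symmetric] det_hankel_scale[of n' "x * v"]
    using nz Suc by (simp add: power_int_minus power_mult_distrib field_simps)
  then show ?thesis using Fminus_generic[OF nz(1) nzA(1) nz(2) nzA(2) Suc] by (simp add: h_def)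
qed

lemma Fminus_eq:
  assumes F: "Fminus p q n us x0 v0 = Some y" and nz: "x0 \<noteq> 0" "A x0 \<noteq> 0" "v0 \<noteq> 0" "A v0 \<noteq> 0"
  shows "y = PP x0 v0"
proof -
  have ext: "Defs.extend Fminus_set Fminus_value (x0, v0) = Some y"
    using F by (simp add: Fminus_def Fminus_set_def Fminus_value_def)
  have near: "\<exists>z. dist z b < e \<and> True \<and> dist (PP (fst z) (snd z)) (Fminus_value b) < e"
    if "b \<in> Fminus_set" "(fst b \<noteq> 0 \<and> A (fst b) \<noteq> 0) \<and> A (snd b) \<noteq> 0" "e > 0" for b e
    using that Fminus_value_eq[of "fst b" "snd b"] by (intro exI[of _ b]) simp
  obtain X V where XV: "X \<longlonglongrightarrow> fst (x0, v0)" "V \<longlonglongrightarrow> snd (x0, v0)" "\<And>k. True"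
      "(\<lambda>k. PP (fst (X k, V k)) (snd (X k, V k))) \<longlonglongrightarrow> y"
    by (rule extend_sequence[OF ext eventually_conj[OF A_near_fst[OF nz(1,2)] A_near_snd[OF nz(3,4)]] near]) (assumption | rule that)+
  have "(\<lambda>k. PP (X k) (V k)) \<longlonglongrightarrow> PP x0 v0"
    using P_isCont[OF nz(1,2)] P_isCont[OF nz(3,4)] XV(1,2)
    by (auto intro!: tendsto_intros isCont_tendsto_compose[of x0 _ X] isCont_tendsto_compose[of v0 _ V])
  then show ?thesis using LIMSEQ_unique XV(4) by simp
qed

text \<open>If \<open>R1\<close> or \<open>R2\<close> had a pole at \<open>v0\<close>, finite values
  of F(z; v0) and of F+(z, v0) would force (P1, P2) and (R1, R2) at \<open>z\<close> to be parallel
  to the limiting direction of (R1, R2) at \<open>v0\<close>. But their determinant at the generic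
  point \<open>z\<close> is 1.\<close>

lemma R_limit:
  assumes v0: "v0 \<noteq> 0" and F: "\<forall>\<^sup>*z. F_fun p q n us z v0 \<noteq> None \<and> Fplus p q n us z v0 \<noteq> None"
  obtains \<rho>1 \<rho>2 where "R1 \<midarrow>v0\<rightarrow> \<rho>1" "R2 \<midarrow>v0\<rightarrow> \<rho>2"
proof -
  have gen: "\<forall>\<^sup>*z. generic z" using eventually_generic by (simp add: cosparse_punctured)
  have nb: "cosparse (-{0::complex}) \<noteq> bot" using cosparse_eq_bot_iff'[of "-{0::complex}"] by (metis ComplI empty_iff singletonD zero_neq_one)
  have "\<forall>\<^sup>*z. z \<noteq> 0 \<and> generic z \<and> R1 analytic_on {z} \<and> R2 analytic_on {z} \<and>
      F_fun p q n us z v0 \<noteq> None \<and> Fplus p q n us z v0 \<noteq> None"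
    using cosparse_nz gen F meromorphic_on_imp_analytic_cosparse[OF R_meromorphic(1)]
      meromorphic_on_imp_analytic_cosparse[OF R_meromorphic(2)] by eventually_elim simp
  then obtain z where z: "z \<noteq> 0" "generic z" "R1 analytic_on {z}" "R2 analytic_on {z}"
      "F_fun p q n us z v0 \<noteq> None" "Fplus p q n us z v0 \<noteq> None"
    using eventually_happens'[OF nb] by blast
  obtain y y' where y: "F_fun p q n us z v0 = Some y" "Fplus p q n us z v0 = Some y'" using z(5,6) by auto
  have Az: "A z \<noteq> 0" using z(2) by (simp add: generic_def)
  note det = det_PR_diag[OF z(2)]
  obtain X V where XV: "X \<longlonglongrightarrow> z" "filterlim V (at v0) sequentially"
    "(\<lambda>k. PR (X k) (V k)) \<longlonglongrightarrow> y" by (rule F_sequence[OF y(1) z(1) Az]) blast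
  obtain X' V' where XV': "filterlim X' (at z) sequentially" "filterlim V' (at v0) sequentially"
    "(\<lambda>k. RR (X' k) (V' k)) \<longlonglongrightarrow> y'" by (rule Fplus_sequence[OF y(2)]) blast
  have P: "(\<lambda>k. P1 (X k)) \<longlonglongrightarrow> P1 z" "(\<lambda>k. P2 (X k)) \<longlonglongrightarrow> P2 z"
    using P_isCont[OF z(1) Az] by (auto intro: isCont_tendsto_compose XV(1))
  have R: "(\<lambda>k. R1 (X' k)) \<longlonglongrightarrow> R1 z" "(\<lambda>k. R2 (X' k)) \<longlonglongrightarrow> R2 z"
    using analytic_at_tendsto[OF z(3)] analytic_at_tendsto[OF z(4)] XV'(1) by (auto intro: filterlim_compose)
  have m: "R1 meromorphic_on {v0}" "R2 meromorphic_on {v0}"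
    using v0 by (auto intro: meromorphic_on_subset[OF R_meromorphic(1)] meromorphic_on_subset[OF R_meromorphic(2)])
  show ?thesis
  proof (rule meromorphic_pair[OF m])
    fix a b assume "R1 \<midarrow>v0\<rightarrow> a" "R2 \<midarrow>v0\<rightarrow> b"
    then show ?thesis by (rule that)
  next
    fix c assume c: "is_pole R1 v0" "(\<lambda>x. R2 x / R1 x) \<midarrow>v0\<rightarrow> c"
    have "P1 z * c = P2 z" by (rule pole_ratio[OF c XV(2) P D_nonzero XV(3)])
    moreover have "R1 z * c = R2 z" by (rule pole_ratio[OF c XV'(2) R D_nonzero XV'(3)])
    ultimately show ?thesis using det by (metis cancel_comm_monoid_add_class.diff_cancel mult.assoc mult.commute zero_neq_one)
  next
    fix c assume c: "is_pole R2 v0" "(\<lambda>x. R1 x / R2 x) \<midarrow>v0\<rightarrow> c"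
    have D': "- D \<noteq> 0" using D_nonzero by simp
    have 1: "- D * (b * r1 - a * r2) = D * (a * r2 - b * r1)" for a b r1 r2 by (simp add: algebra_simps)
    have "P2 z * c = P1 z" by (rule pole_ratio[OF c XV(2) P(2,1) D', unfolded 1, OF XV(3)])
    moreover have "R2 z * c = R1 z" by (rule pole_ratio[OF c XV'(2) R(2,1) D', unfolded 1, OF XV'(3)])
    ultimately show ?thesis using det by (metis cancel_comm_monoid_add_class.diff_cancel mult.assoc mult.commute zero_neq_one)
  qed
qed

text \<open>The plane vector attached to a point of the disjoint union: the limit of (R1, R2) at a
  plain point, the value of (P1, P2) at a hatted one. With it all cases of F, F+ and F- become one
  determinant.\<close>

definition represents :: "point2 \<Rightarrow> complex \<Rightarrow> complex \<Rightarrow> bool" where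
  "represents s a b \<longleftrightarrow> (case s of
     Inl v \<Rightarrow> v \<noteq> 0 \<and> R1 \<midarrow>v\<rightarrow> a \<and> R2 \<midarrow>v\<rightarrow> b
   | Inr v \<Rightarrow> v \<noteq> 0 \<and> A v \<noteq> 0 \<and> a = P1 v \<and> b = P2 v)"

lemma F_fun_eq:
  assumes "F_fun p q n us x v = Some y" "x \<noteq> 0" "A x \<noteq> 0" "R1 \<midarrow>v\<rightarrow> a" "R2 \<midarrow>v\<rightarrow> b"
  shows "y = D * (P1 x * b - P2 x * a)"
proof -
  obtain X V where XV: "X \<longlonglongrightarrow> x" "filterlim V (at v) sequentially"
    "(\<lambda>k. PR (X k) (V k)) \<longlonglongrightarrow> y" by (rule F_sequence[OF assms(1-3)]) blast
  have "(\<lambda>k. PR (X k) (V k)) \<longlonglongrightarrow> D * (P1 x * b - P2 x * a)"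
    using P_isCont[OF assms(2,3)]
    by (intro tendsto_intros isCont_tendsto_compose[OF _ XV(1)] filterlim_compose[OF assms(4) XV(2)] filterlim_compose[OF assms(5) XV(2)])
  then show ?thesis using LIMSEQ_unique XV(3) by blast
qed

lemma Fplus_ext_eq:
  assumes "represents s a b" "represents s' a' b'" "Fplus_ext p q n us s s' = Some y"
  shows "y = D * (a * b' - b * a')"
proof (cases s; cases s')
  fix x v assume s: "s = Inl x" "s' = Inl v"
  then have F: "Fplus p q n us x v = Some y" using assms(3) by simp
  have L: "R1 \<midarrow>x\<rightarrow> a" "R2 \<midarrow>x\<rightarrow> b" "R1 \<midarrow>v\<rightarrow> a'" "R2 \<midarrow>v\<rightarrow> b'" using assms(1,2) s by (auto simp: represents_def)
  obtain X V where XV: "filterlim X (at x) sequentially" "filterlim V (at v) sequentially"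
    "(\<lambda>k. RR (X k) (V k)) \<longlonglongrightarrow> y" by (rule Fplus_sequence[OF F]) blast
  have "(\<lambda>k. RR (X k) (V k)) \<longlonglongrightarrow> D * (a * b' - b * a')"
    by (intro tendsto_intros filterlim_compose[OF L(1) XV(1)] filterlim_compose[OF L(2) XV(1)]
      filterlim_compose[OF L(3) XV(2)] filterlim_compose[OF L(4) XV(2)])
  then show ?thesis using LIMSEQ_unique XV(3) by blast
next
  fix x v assume s: "s = Inl x" "s' = Inr v"
  then obtain y' where F: "F_fun p q n us v x = Some y'" "y = - y'" using assms(3) by auto
  have "y' = D * (P1 v * b - P2 v * a)" by (rule F_fun_eq[OF F(1)]) (use assms(1,2) s in \<open>auto simp: represents_def\<close>)
  then show ?thesis using F(2) assms(2) s by (simp add: represents_def algebra_simps)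
next
  fix x v assume s: "s = Inr x" "s' = Inl v"
  then have "F_fun p q n us x v = Some y" using assms(3) by simp
  then have "y = D * (P1 x * b' - P2 x * a')" by (rule F_fun_eq) (use assms(1,2) s in \<open>auto simp: represents_def\<close>)
  then show ?thesis using assms(1) s by (simp add: represents_def)
next
  fix x v assume s: "s = Inr x" "s' = Inr v"
  then have "Fminus p q n us x v = Some y" using assms(3) by simp
  then have "y = PP x v" by (rule Fminus_eq) (use assms(1,2) s in \<open>auto simp: represents_def\<close>)
  then show ?thesis using assms(1,2) s by (simp add: represents_def)
qed

lemma F_ext_Fplus_ext: "F_ext p q n us z s = Fplus_ext p q n us (Inr z) s"
  by (cases s) auto

end

section \<open>Quasi-periodicity of the connection coefficient\<close>

lemma cosparse_scale:
  assumes "\<forall>\<^sup>*z. P z" "c \<noteq> 0"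
  shows "\<forall>\<^sup>*z. P (c * z)"
  unfolding cosparse_punctured
proof (intro allI impI)
  fix z :: complex assume z: "z \<noteq> 0"
  have "eventually (\<lambda>w. w \<noteq> z) (at z)" by (rule eventually_neq_at_within)
  then have "eventually (\<lambda>w. c * w \<noteq> c * z) (at z)" by eventually_elim (use assms(2) in simp)
  then have "filterlim (\<lambda>w. c * w) (at (c * z)) (at z)" by (intro filterlim_atI tendsto_intros)
  moreover have "eventually P (at (c * z))" using assms z by (simp add: cosparse_punctured)
  ultimately show "eventually (\<lambda>w. P (c * w)) (at z)" using eventually_compose_filterlim by blast
qed

lemma cosparse_inverse:
  assumes "\<forall>\<^sup>*z. P z"
  shows "\<forall>\<^sup>*z. P (1 / z)"
  unfolding cosparse_punctured
proof (intro allI impI)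
  fix z :: complex assume z: "z \<noteq> 0"
  have "eventually (\<lambda>w. w \<noteq> z) (at z)" by (rule eventually_neq_at_within)
  then have "eventually (\<lambda>w. 1 / w \<noteq> 1 / z) (at z)" by eventually_elim simp
  then have "filterlim (\<lambda>w. 1 / w) (at (1 / z)) (at z)" by (intro filterlim_atI tendsto_intros z)
  moreover have "eventually P (at (1 / z))" using assms z by (simp add: cosparse_punctured)
  ultimately show "eventually (\<lambda>w. P (1 / w)) (at z)" using eventually_compose_filterlim by blast
qed

lemma powi_add_eq: "x \<noteq> (0::complex) \<Longrightarrow> a + b = c \<Longrightarrow> x powi a * x powi b = x powi c"
  using power_int_add[of x a b] by simp

lemma prod_list_upt: "(\<Prod>r\<leftarrow>[0..<N]. f r :: complex) = (\<Prod>r<N. f r)"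
  by (induction N) auto

lemma prod_powi: "x \<noteq> (0::complex) \<Longrightarrow> (\<Prod>i\<in>S. x powi f i) = x powi (\<Sum>i\<in>S. f i)"
  by (induction S rule: infinite_finite_induct) (auto simp: power_int_add)

lemma powi_prod: "(\<Prod>i\<in>S. (f i :: complex) powi k) = (\<Prod>i\<in>S. f i) powi k"
  by (induction S rule: infinite_finite_induct) (auto simp: power_int_mult_distrib)

lemma (in nome) theta_cosparse: "c \<noteq> 0 \<Longrightarrow> k > 0 \<Longrightarrow> \<forall>\<^sup>*z. theta p (c * z ^ k) \<noteq> 0"
  using eventually_theta_nonzero by (simp add: cosparse_punctured)

text \<open>Writing the nome as h^2 avoids halving the exponent j (j - 1), and half-integral shifts
  are powers of h anyway.\<close>

lemma theta_powi:
  assumes "norm (h\<^sup>2) < 1" "h \<noteq> 0" "x \<noteq> 0"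
  shows "theta (h\<^sup>2) ((h\<^sup>2) powi j * x) = (-1) powi j * h powi (- j * (j - 1)) * x powi (- j) * theta (h\<^sup>2) x"
proof -
  have step: "theta (h\<^sup>2) (h\<^sup>2 * y) = - theta (h\<^sup>2) y / y" if "y \<noteq> 0" for y
    using theta_pmult[of "h\<^sup>2" y] assms that by simp
  have h2: "(h\<^sup>2) powi j = h powi (2 * j)" for j using assms(2) by (simp add: power_int_mult)
  show ?thesis
  proof (induction j rule: int_induct[where k = 0])
    case (step1 i)
    have y: "(h\<^sup>2) powi i * x \<noteq> 0" using assms by simp
    have "theta (h\<^sup>2) ((h\<^sup>2) powi (i + 1) * x) = - theta (h\<^sup>2) ((h\<^sup>2) powi i * x) / ((h\<^sup>2) powi i * x)"
      using step[OF y] assms by (simp add: power_int_add mult_ac)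
    also have "\<dots> = (-1) powi (i + 1) * (h powi (- i * (i - 1)) * h powi (- (2 * i))) * (x powi (- i) * x powi (- 1)) * theta (h\<^sup>2) x"
      unfolding step1.IH unfolding h2 using assms by (simp add: power_int_add power_int_minus field_simps)
    also have "h powi (- i * (i - 1)) * h powi (- (2 * i)) = h powi (- (i + 1) * (i + 1 - 1))"
      by (rule powi_add_eq[OF assms(2)]) (simp add: algebra_simps)
    also have "x powi (- i) * x powi (- 1) = x powi (- (i + 1))" by (rule powi_add_eq[OF assms(3)]) simp
    finally show ?case .
  next
    case (step2 i)
    define y where "y = (h\<^sup>2) powi (i - 1) * x"
    have y: "y \<noteq> 0" using assms by (simp add: y_def)
    have hy: "h\<^sup>2 * y = (h\<^sup>2) powi i * x" using assms by (simp add: y_def power_int_diff)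
    have "theta (h\<^sup>2) y = - (y * theta (h\<^sup>2) ((h\<^sup>2) powi i * x))" using step[OF y] y by (simp add: hy)
    also have "\<dots> = (-1) powi (i - 1) * (h powi (- i * (i - 1)) * h powi (2 * (i - 1))) * (x powi (- i) * x powi 1) * theta (h\<^sup>2) x"
      unfolding step2.IH y_def unfolding h2 using assms by (simp add: power_int_diff right_diff_distrib mult_ac)
    also have "h powi (- i * (i - 1)) * h powi (2 * (i - 1)) = h powi (- (i - 1) * (i - 1 - 1))"
      by (rule powi_add_eq[OF assms(2)]) (simp add: algebra_simps)
    also have "x powi (- i) * x powi 1 = x powi (- (i - 1))" by (rule powi_add_eq[OF assms(3)]) simp
    finally show ?case by (simp add: y_def)
  qed simp
qed

context elliptic
begin

definition cfun :: "complex list \<Rightarrow> complex \<Rightarrow> complex" where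
  "cfun us z = inverse z * theta p (z\<^sup>2) / Delta p q z us"

text \<open>The multiplier of \<open>cfun\<close> under the shift by p; through it alone the
  connection matrix depends on the parameters u.\<close>

definition efun :: "complex list \<Rightarrow> complex \<Rightarrow> complex" where
  "efun us z = cfun us (p * z) / cfun us z"

lemma cfun_inverse:
  assumes "z \<noteq> 0"
  shows "cfun us (1 / z) = - cfun us z"
proof -
  have 1: "theta p ((1 / z)\<^sup>2) = - theta p (z\<^sup>2) / z\<^sup>2"
    using theta_inverse[OF p(1), of "z\<^sup>2"] assms by (simp add: power_divide)
  show ?thesis unfolding cfun_def Delta_inverse 1 using assms by (simp add: power2_eq_square divide_inverse)
qed

lemma egamma_p_shift:
  assumes "y \<noteq> 0" "dpoch p q y \<noteq> 0" "dpoch p q (p * q / y) \<noteq> 0"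
  shows "egamma p q (p * y) = theta q y * egamma p q y" "egamma p q y \<noteq> 0" "theta q y \<noteq> 0 \<Longrightarrow> egamma p q (p * y) \<noteq> 0"
proof -
  have "dpoch p q y = poch_inf q y * dpoch p q (p * y)" "dpoch p q (q / y) = poch_inf q (q / y) * dpoch p q (p * q / y)"
    using dpoch_p[OF p(1) q(1), of y] dpoch_p[OF p(1) q(1), of "q / y"] by (simp_all add: mult_ac)
  then show *: "egamma p q (p * y) = theta q y * egamma p q y" "egamma p q y \<noteq> 0"
    using assms p q by (auto simp: egamma_eq theta_eq divide_simps)
  then show "theta q y \<noteq> 0 \<Longrightarrow> egamma p q (p * y) \<noteq> 0" by simp
qed

lemma theta_q_cosparse: "c \<noteq> 0 \<Longrightarrow> k > 0 \<Longrightarrow> \<forall>\<^sup>*z. theta q (c * z ^ k) \<noteq> 0"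
  by (rule nome.theta_cosparse) (unfold_locales, use q in auto)

lemma theta_q_cosparse1:
  assumes "c \<noteq> 0"
  shows "\<forall>\<^sup>*z. theta q (c * z) \<noteq> 0" "\<forall>\<^sup>*z. theta q (c / z) \<noteq> 0"
proof -
  show "\<forall>\<^sup>*z. theta q (c * z) \<noteq> 0" using theta_q_cosparse[of c 1] assms by simp
  from cosparse_inverse[OF this] show "\<forall>\<^sup>*z. theta q (c / z) \<noteq> 0" by simp
qed

lemma egamma2_cosparse:
  assumes "a \<noteq> 0"
  shows "\<forall>\<^sup>*z. egamma2 p q a z \<noteq> 0 \<and> egamma2 p q a z = theta q (a / (p * z)) / theta q (a * z) * egamma2 p q a (p * z)"
  using cosparse_nz dpoch_cosparse1[of a] dpoch_cosparse1[of "p * q / a"] dpoch_cosparse1[of "a / p"] dpoch_cosparse1[of "p * q * p / a"]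
    theta_q_cosparse1(1)[OF assms]
proof eventually_elim
  case (elim z)
  have y: "a / (p * z) \<noteq> 0" "dpoch p q (a / (p * z)) \<noteq> 0" "dpoch p q (p * q / (a / (p * z))) \<noteq> 0"
    "dpoch p q (p * q / (a * z)) \<noteq> 0" "dpoch p q (p * q / (a / z)) \<noteq> 0"
    using elim assms p by (auto simp: mult.assoc)
  have 1: "egamma p q (p * (a * z)) = theta q (a * z) * egamma p q (a * z)" "egamma p q (a * z) \<noteq> 0"
    using egamma_p_shift[of "a * z"] elim assms y by auto
  have "egamma p q (p * (a / (p * z))) = theta q (a / (p * z)) * egamma p q (a / (p * z))"
    using egamma_p_shift(1)[of "a / (p * z)"] y by auto
  then have 2: "egamma p q (a / z) = theta q (a / (p * z)) * egamma p q (a / (p * z))" using p by simp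
  have 3: "egamma p q (a / z) \<noteq> 0" using egamma_p_shift(2)[of "a / z"] elim assms y by auto
  have 4: "a * (p * z) = p * (a * z)" by simp
  show ?case unfolding egamma2_def 4 1(1) using 1(2) 2 3 elim by (simp add: field_simps)
qed

text \<open>The factor \<theta>_p(z^2) found here cancels the one in \<open>cfun\<close>.\<close>

lemma egamma2_one: "\<forall>\<^sup>*z. 1 / egamma2 p q 1 (z\<^sup>2) = - theta q (z\<^sup>2) * theta p (z\<^sup>2) / z\<^sup>2"
  using cosparse_nz inverse_egamma2_one
proof eventually_elim
  case (elim z)
  note elim(2)
  also have "poch_inf q (1 / z\<^sup>2) = (1 - 1 / z\<^sup>2) * poch_inf q (q / z\<^sup>2)"
    using poch_inf_rec[OF q(1), of "1 / z\<^sup>2"] by simp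
  also have "poch_inf q (z\<^sup>2) * poch_inf p (p * z\<^sup>2) * ((1 - 1 / z\<^sup>2) * poch_inf q (q / z\<^sup>2) * poch_inf p (p / z\<^sup>2)) =
      - (poch_inf q (q / z\<^sup>2) * poch_inf q (z\<^sup>2)) * (poch_inf p (p / z\<^sup>2) * ((1 - z\<^sup>2) * poch_inf p (p * z\<^sup>2))) / z\<^sup>2"
    using elim(1) by (simp add: field_simps)
  also have "\<dots> = - theta q (z\<^sup>2) * theta p (z\<^sup>2) / z\<^sup>2"
    using poch_inf_rec[OF p(1), of "z\<^sup>2"] by (simp add: theta_eq[OF p(1)] theta_eq[OF q(1)])
  finally show ?case .
qed

lemma cfun_eq:
  assumes "0 \<notin> set us"
  shows "\<forall>\<^sup>*z. cfun us z = - z / (theta q (z\<^sup>2) * (\<Prod>a\<leftarrow>us. egamma2 p q a z)) \<and> cfun us z \<noteq> 0"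
proof -
  have "\<forall>\<^sup>*z. (\<Prod>a\<leftarrow>us. egamma2 p q a z) \<noteq> 0"
    using assms
  proof (induction us)
    case (Cons a us)
    have "\<forall>\<^sup>*z. (\<Prod>a\<leftarrow>us. egamma2 p q a z) \<noteq> 0" using Cons by simp
    moreover have "a \<noteq> 0" using Cons(2) by auto
    ultimately show ?case using egamma2_cosparse[of a] by (auto intro: eventually_elim2)
  qed simp
  then show ?thesis
    using cosparse_nz egamma2_one theta_q_cosparse[OF one_neq_zero zero_less_numeral, of "num.Bit0 num.One"]
      theta_cosparse[OF one_neq_zero zero_less_numeral, of "num.Bit0 num.One"]
  proof eventually_elim
    case (elim z)
    have "Delta p q z us = (\<Prod>a\<leftarrow>us. egamma2 p q a z) * (1 / egamma2 p q 1 (z\<^sup>2))" by (simp add: Delta_def)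
    then have "cfun us z = inverse z * theta p (z\<^sup>2) / ((\<Prod>a\<leftarrow>us. egamma2 p q a z) * (- theta q (z\<^sup>2) * theta p (z\<^sup>2) / z\<^sup>2))"
      by (simp only: cfun_def elim)
    then have "cfun us z = - z / (theta q (z\<^sup>2) * (\<Prod>a\<leftarrow>us. egamma2 p q a z))"
      using elim by (simp add: field_simps power2_eq_square)
    then show ?case using elim by simp
  qed
qed

text \<open>By \<Gamma>(p y) = \<theta>_q(y) \<Gamma>(y) all Gamma functions drop out of the
  multiplier, and shifts by powers of q act through the quasi-periodicity of \<theta>_q.\<close>

lemma efun_eq:
  assumes "0 \<notin> set us"
  shows "\<forall>\<^sup>*z. efun us z = p * theta q (z\<^sup>2) / theta q (p\<^sup>2 * z\<^sup>2) * (\<Prod>a\<leftarrow>us. theta q (a / (p * z)) / theta q (a * z))"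
proof -
  have "\<forall>\<^sup>*z. (\<Prod>a\<leftarrow>us. egamma2 p q a z) = (\<Prod>a\<leftarrow>us. theta q (a / (p * z)) / theta q (a * z)) * (\<Prod>a\<leftarrow>us. egamma2 p q a (p * z))"
    using assms
  proof (induction us)
    case (Cons a us)
    then have a: "a \<noteq> 0" and IH: "\<forall>\<^sup>*z. (\<Prod>a\<leftarrow>us. egamma2 p q a z) =
      (\<Prod>a\<leftarrow>us. theta q (a / (p * z)) / theta q (a * z)) * (\<Prod>a\<leftarrow>us. egamma2 p q a (p * z))" by auto
    from IH egamma2_cosparse[OF a] show ?case
    proof eventually_elim
      case (elim z)
      then have "egamma2 p q a z = theta q (a / (p * z)) / theta q (a * z) * egamma2 p q a (p * z)" by blast
      then show ?case unfolding list.map prod_list.Cons elim(1) by simp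
    qed
  qed simp
  then show ?thesis
    using cosparse_nz cfun_eq[OF assms] cosparse_scale[OF cfun_eq[OF assms] p(2)]
      theta_q_cosparse[OF one_neq_zero zero_less_numeral, of "num.Bit0 num.One"]
  proof eventually_elim
    case (elim z)
    have "(\<Prod>a\<leftarrow>us. egamma2 p q a (p * z)) \<noteq> 0" using elim(4) by auto
    then show ?case using elim p by (simp add: efun_def power_mult_distrib field_simps)
  qed
qed

text \<open>Covers all shifts at once: \<Lambda> is 2 l, and \<Lambda> + 2 J_r is 2 k_r. Numerator
  and denominator of the r-th theta quotient are shifted by q^(J_r) and q^(J_r + \<Lambda>),
  integral powers although l and k_r may be half-integers; this is why k_r - l has to be an integer.
  The remaining powers combine by the condition on the sum and by balancing.\<close>

lemma efun_shift:
  fixes u :: "nat \<Rightarrow> complex" and \<Lambda> \<nu> n :: int and J :: "nat \<Rightarrow> int"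
  assumes h: "h\<^sup>2 = q" and u: "\<And>r. r < 2 * m + 6 \<Longrightarrow> u r \<noteq> 0"
    and bal: "q powi (2 * n - 2) * (\<Prod>r<2 * m + 6. u r) = (p * q) ^ (m + 1)"
    and J: "(\<Sum>r<2 * m + 6. \<Lambda> + 2 * J r) = - 4 * \<nu>"
    and u': "\<And>r. r < 2 * m + 6 \<Longrightarrow> u' r = h powi (\<Lambda> + 2 * J r) * u r"
  shows "\<forall>\<^sup>*z. efun (params m u') (h powi \<Lambda> * z) =
    (p * z\<^sup>2) powi (- 2 * \<nu>) * (h powi \<Lambda>) powi (- 4 * (n + \<nu>)) * efun (params m u) z"
proof -
  define N where "N = 2 * m + 6"
  define H where "H = h powi \<Lambda>"
  have h0: "h \<noteq> 0" using h q by auto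
  have H0: "H \<noteq> 0" using h0 by (simp add: H_def)
  have H2: "H\<^sup>2 = q powi \<Lambda>" unfolding H_def h[symmetric] by (simp add: power_int_power power_int_power' mult.commute)
  have list: "(\<Prod>a\<leftarrow>params m g. f a) = (\<Prod>r<N. f (g r))" for f g :: "_ \<Rightarrow> complex"
    by (simp add: params_def N_def comp_def prod_list_upt del: upt_Suc)
  have us0: "0 \<notin> set (params m u)" using u by (auto simp: params_def)
  have us0': "0 \<notin> set (params m u')" using u u' h0 by (auto simp: params_def)
  have T: "theta q (q powi j * x) = (-1) powi j * h powi (- j * (j - 1)) * x powi (- j) * theta q x" if "x \<noteq> 0" for j x
    using theta_powi[of h x j] that h0 q by (simp add: h)
  have sJ: "(\<Sum>r<N. J r) = - 2 * \<nu> - \<Lambda> * (int m + 3)"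
  proof -
    have "(\<Sum>r<N. \<Lambda> + 2 * J r) = int N * \<Lambda> + 2 * (\<Sum>r<N. J r)" by (simp add: sum.distrib sum_distrib_left)
    then show ?thesis using J by (simp add: N_def algebra_simps)
  qed
  \<comment> \<open>The balancing condition, solved for the product of the parameters; it determines
    how the powers u_r^\<Lambda> contribute.\<close>
  have prod_u: "(\<Prod>r<N. u r) = p powi (int m + 1) * h powi (2 * (int m + 3 - 2 * n))"
  proof -
    have "(p * q) ^ (m + 1) = p powi (int m + 1) * h powi (2 * (int m + 1))"
    proof -
      have "q ^ (m + 1) = h powi (2 * (int m + 1))"
        unfolding h[symmetric] power_mult[symmetric] by (simp add: power_int_def nat_mult_distrib nat_add_distrib)
      moreover have "p ^ (m + 1) = p powi (int m + 1)" by (simp add: power_int_def nat_add_distrib)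
      ultimately show ?thesis by (simp only: power_mult_distrib)
    qed
    moreover have "q powi (2 * n - 2) = h powi (2 * (2 * n - 2))"
      unfolding h[symmetric] by (simp only: power_int_mult power_int_numeral)
    ultimately have "(\<Prod>r<N. u r) = p powi (int m + 1) * (h powi (2 * (int m + 1)) * h powi (- (2 * (2 * n - 2))))"
      using bal h0 unfolding N_def[symmetric] power_int_minus by (simp add: divide_simps mult_ac)
    also have "h powi (2 * (int m + 1)) * h powi (- (2 * (2 * n - 2))) = h powi (2 * (int m + 3 - 2 * n))"
      by (rule powi_add_eq[OF h0]) simp
    finally show ?thesis .
  qed
  have main: "efun (params m u') (H * z) = (p * z\<^sup>2) powi (- 2 * \<nu>) * H powi (- 4 * (n + \<nu>)) * efun (params m u) z"
    if z: "z \<noteq> 0"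
      and e: "efun (params m u) z = p * theta q (z\<^sup>2) / theta q (p\<^sup>2 * z\<^sup>2) * (\<Prod>a\<leftarrow>params m u. theta q (a / (p * z)) / theta q (a * z))"
      and e': "efun (params m u') (H * z) = p * theta q ((H * z)\<^sup>2) / theta q (p\<^sup>2 * (H * z)\<^sup>2) *
         (\<Prod>a\<leftarrow>params m u'. theta q (a / (p * (H * z))) / theta q (a * (H * z)))" for z
  proof -
    have 1: "theta q ((H * z)\<^sup>2) / theta q (p\<^sup>2 * (H * z)\<^sup>2) = p powi (2 * \<Lambda>) * (theta q (z\<^sup>2) / theta q (p\<^sup>2 * z\<^sup>2))"
    proof -
      have e1: "(H * z)\<^sup>2 = q powi \<Lambda> * z\<^sup>2" and e2: "p\<^sup>2 * (H * z)\<^sup>2 = q powi \<Lambda> * (p\<^sup>2 * z\<^sup>2)"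
        by (simp_all add: power_mult_distrib H2)
      have "theta q ((H * z)\<^sup>2) / theta q (p\<^sup>2 * (H * z)\<^sup>2) =
         (z\<^sup>2) powi (- \<Lambda>) / (p\<^sup>2 * z\<^sup>2) powi (- \<Lambda>) * (theta q (z\<^sup>2) / theta q (p\<^sup>2 * z\<^sup>2))"
        unfolding e2 unfolding e1 using T[of "z\<^sup>2" \<Lambda>] T[of "p\<^sup>2 * z\<^sup>2" \<Lambda>] z p h0 by simp
      also have "(z\<^sup>2) powi (- \<Lambda>) / (p\<^sup>2 * z\<^sup>2) powi (- \<Lambda>) = p powi (2 * \<Lambda>)"
      proof -
        have "p powi (2 * \<Lambda>) = (p\<^sup>2) powi \<Lambda>" by (simp add: power_int_mult)
        then show ?thesis using z p by (simp add: power_int_mult_distrib power_int_minus field_simps)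
      qed
      finally show ?thesis .
    qed
    have 2: "theta q (u' r / (p * (H * z))) / theta q (u' r * (H * z)) =
        ((-1) powi \<Lambda> * h powi (\<Lambda> * (\<Lambda> + 2 * J r - 1)) * p powi J r * z powi (\<Lambda> + 2 * J r) * u r powi \<Lambda>) *
        (theta q (u r / (p * z)) / theta q (u r * z))" if r: "r < N" for r
    proof -
      define j where "j = J r"
      have ur: "u r \<noteq> 0" using u r by (simp add: N_def)
      have q_h: "q powi i = h powi (2 * i)" for i unfolding h[symmetric] by (simp add: power_int_mult)
      have a: "u' r / (p * (H * z)) = q powi j * (u r / (p * z))"
      proof -
        have "h powi (\<Lambda> + 2 * j) = H * q powi j" unfolding H_def q_h using h0 by (simp add: power_int_add)
        then show ?thesis using u'[of r] r H0 by (simp add: N_def j_def)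
      qed
      have b: "u' r * (H * z) = q powi (j + \<Lambda>) * (u r * z)"
      proof -
        have "h powi (\<Lambda> + 2 * j) * H = q powi (j + \<Lambda>)" unfolding H_def q_h using h0
          by (simp add: algebra_simps flip: power_int_add)
        then show ?thesis using u'[of r] r by (simp add: N_def j_def mult_ac)
      qed
      have nz: "u r / (p * z) \<noteq> 0" "u r * z \<noteq> 0" using ur z p by auto
      have s: "(-1) powi j / (-1) powi (j + \<Lambda>) = ((-1) powi \<Lambda> :: complex)"
        by (simp add: power_int_add power_int_minus_left)
      have hh: "h powi (- j * (j - 1)) / h powi (- (j + \<Lambda>) * (j + \<Lambda> - 1)) = h powi (\<Lambda> * (\<Lambda> + 2 * j - 1))"
      proof -
        have "h powi (- j * (j - 1)) / h powi (- (j + \<Lambda>) * (j + \<Lambda> - 1)) = h powi (- j * (j - 1) - (- (j + \<Lambda>) * (j + \<Lambda> - 1)))"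
          using h0 by (simp only: power_int_diff simp_thms)
        also have "- j * (j - 1) - (- (j + \<Lambda>) * (j + \<Lambda> - 1)) = \<Lambda> * (\<Lambda> + 2 * j - 1)" by (simp add: algebra_simps)
        finally show ?thesis .
      qed
      have y: "(u r / (p * z)) powi (- j) / (u r * z) powi (- (j + \<Lambda>)) = p powi j * z powi (\<Lambda> + 2 * j) * u r powi \<Lambda>"
      proof -
        have "(u r / (p * z)) powi (- j) = u r powi (- j) * (p powi j * z powi j)"
          by (simp add: power_int_divide_distrib power_int_mult_distrib power_int_minus field_simps)
        moreover have "1 / (u r * z) powi (- (j + \<Lambda>)) = u r powi (j + \<Lambda>) * z powi (j + \<Lambda>)"
          unfolding power_int_minus by (simp add: power_int_mult_distrib divide_inverse)
        moreover have "z powi j * z powi (j + \<Lambda>) = z powi (\<Lambda> + 2 * j)" by (rule powi_add_eq[OF z]) simp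
        moreover have "u r powi (- j) * u r powi (j + \<Lambda>) = u r powi \<Lambda>" by (rule powi_add_eq[OF ur]) simp
        moreover have "x / y = x * (1 / y)" for x y :: complex by simp
        ultimately show ?thesis by (metis (no_types, lifting) mult.assoc mult.commute)
      qed
      have e3: "theta q (u' r / (p * (H * z))) / theta q (u' r * (H * z)) =
         ((-1) powi j / (-1) powi (j + \<Lambda>)) * (h powi (- j * (j - 1)) / h powi (- (j + \<Lambda>) * (j + \<Lambda> - 1))) *
         ((u r / (p * z)) powi (- j) / (u r * z) powi (- (j + \<Lambda>))) * (theta q (u r / (p * z)) / theta q (u r * z))"
        unfolding a b T[OF nz(1)] T[OF nz(2)] by simp
      show ?thesis unfolding e3[unfolded s hh y] unfolding j_def by (simp add: mult_ac)
    qed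
    have 3: "(\<Prod>r<N. theta q (u' r / (p * (H * z))) / theta q (u' r * (H * z))) =
        (p powi (- 2 * \<nu> - 2 * \<Lambda>) * z powi (- 4 * \<nu>) * H powi (- 4 * (n + \<nu>))) * (\<Prod>r<N. theta q (u r / (p * z)) / theta q (u r * z))"
    proof -
      have sK: "(\<Sum>r<N. \<Lambda> + 2 * J r) = - 4 * \<nu>" using J by (simp add: N_def)
      have N: "int N = 2 * int m + 6" by (simp add: N_def)
      have sh: "(\<Sum>r<N. \<Lambda> * (\<Lambda> + 2 * J r - 1)) = \<Lambda> * (- 4 * \<nu> - (2 * int m + 6))"
        unfolding sum_distrib_left[symmetric] sum_subtractf sK by (simp add: N)
      have "(\<Prod>r<N. theta q (u' r / (p * (H * z))) / theta q (u' r * (H * z))) =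
         ((-1) powi (\<Sum>r<N. \<Lambda>) * h powi (\<Sum>r<N. \<Lambda> * (\<Lambda> + 2 * J r - 1)) * p powi (\<Sum>r<N. J r) *
          z powi (\<Sum>r<N. \<Lambda> + 2 * J r) * (\<Prod>r<N. u r) powi \<Lambda>) * (\<Prod>r<N. theta q (u r / (p * z)) / theta q (u r * z))"
      proof -
        have m1: "(- 1 :: complex) \<noteq> 0" by simp
        have "(\<Prod>r<N. theta q (u' r / (p * (H * z))) / theta q (u' r * (H * z))) =
          (\<Prod>r<N. ((-1) powi \<Lambda> * h powi (\<Lambda> * (\<Lambda> + 2 * J r - 1)) * p powi J r * z powi (\<Lambda> + 2 * J r) * u r powi \<Lambda>) *
            (theta q (u r / (p * z)) / theta q (u r * z)))" by (rule prod.cong) (use 2 in auto)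
        then show ?thesis
          unfolding prod.distrib powi_prod[of u] prod_powi[OF h0] prod_powi[OF p(2)] prod_powi[OF z]
            prod_powi[OF m1] .
      qed
      \<comment> \<open>There are 2 m + 6 factors, an even number, so the signs cancel.\<close>
      also have "(-1) powi (\<Sum>r<N. \<Lambda>) = (1 :: complex)"
        by (simp add: N power_int_minus_left even_mult_iff)
      also have "1 * h powi (\<Sum>r<N. \<Lambda> * (\<Lambda> + 2 * J r - 1)) * p powi (\<Sum>r<N. J r) * z powi (\<Sum>r<N. \<Lambda> + 2 * J r) * (\<Prod>r<N. u r) powi \<Lambda> =
         (p powi (- 2 * \<nu> - \<Lambda> * (int m + 3)) * p powi ((int m + 1) * \<Lambda>)) * z powi (- 4 * \<nu>) *
         (h powi (\<Lambda> * (- 4 * \<nu> - (2 * int m + 6))) * h powi (2 * (int m + 3 - 2 * n) * \<Lambda>))"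
        unfolding sK sh sJ prod_u power_int_mult_distrib by (simp only: power_int_mult[symmetric] mult_ac mult_1)
      also have "p powi (- 2 * \<nu> - \<Lambda> * (int m + 3)) * p powi ((int m + 1) * \<Lambda>) = p powi (- 2 * \<nu> - 2 * \<Lambda>)"
        by (rule powi_add_eq[OF p(2)]) (simp add: algebra_simps)
      also have "h powi (\<Lambda> * (- 4 * \<nu> - (2 * int m + 6))) * h powi (2 * (int m + 3 - 2 * n) * \<Lambda>) = h powi (\<Lambda> * (- 4 * (n + \<nu>)))"
        by (rule powi_add_eq[OF h0]) (simp add: algebra_simps)
      also have "h powi (\<Lambda> * (- 4 * (n + \<nu>))) = H powi (- 4 * (n + \<nu>))" unfolding H_def by (simp only: power_int_mult)
      finally show ?thesis .
    qed
    have 4: "p powi (2 * \<Lambda>) * p powi (- 2 * \<nu> - 2 * \<Lambda>) * z powi (- 4 * \<nu>) = (p * z\<^sup>2) powi (- 2 * \<nu>)"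
    proof -
      have "p powi (2 * \<Lambda>) * p powi (- 2 * \<nu> - 2 * \<Lambda>) = p powi (- 2 * \<nu>)" using p by (simp flip: power_int_add)
      moreover have "(z\<^sup>2) powi (- 2 * \<nu>) = z powi (- 4 * \<nu>)"
        using power_int_mult[of z 2 "- 2 * \<nu>"] by simp
      ultimately show ?thesis by (simp add: power_int_mult_distrib)
    qed
    show ?thesis
      unfolding e' list 3 e 4[symmetric] times_divide_eq_right[symmetric] 1 by (simp add: mult_ac)
  qed
  show ?thesis
    using cosparse_nz efun_eq[OF us0] cosparse_scale[OF efun_eq[OF us0'] H0] unfolding H_def[symmetric]
    by eventually_elim (rule main)
qed

end

section \<open>Connection matrices\<close>

hide_const (open) Matrix.mat Determinant.det Matrix.vec Matrix.row Matrix.col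
no_notation Matrix.vec_index (infixl "$" 100)
no_notation fps_nth (infixl "$" 75)

section \<open>Two by two matrices of meromorphic functions\<close>

definition smul :: "complex \<Rightarrow> complex^2^2 \<Rightarrow> complex^2^2" where
  "smul a X = (\<chi> i j. a * X $ i $ j)"

lemma mat2_eq_iff: "X = Y \<longleftrightarrow> X $ 1 $ 1 = Y $ 1 $ 1 \<and> X $ 1 $ 2 = Y $ 1 $ 2 \<and> X $ 2 $ 1 = Y $ 2 $ 1 \<and> X $ 2 $ 2 = Y $ 2 $ 2"
  for X Y :: "complex^2^2"
  unfolding Finite_Cartesian_Product.vec_eq_iff[of X Y] Finite_Cartesian_Product.vec_eq_iff[of "X $ _" "Y $ _"] forall_2 by blast

lemma mult2: "(X ** Y) $ i $ j = X $ i $ 1 * Y $ 1 $ j + X $ i $ 2 * Y $ 2 $ j" for X Y :: "complex^2^2"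
  unfolding matrix_matrix_mult_def by (simp add: sum_2)

lemma smul_mult: "smul a X ** Y = smul a (X ** Y)" "X ** smul a Y = smul a (X ** Y)"
  by (simp_all add: mat2_eq_iff mult2 smul_def algebra_simps)

lemma matrix_inv_props:
  fixes X :: "complex^2^2"
  assumes "det X \<noteq> 0"
  shows "X ** matrix_inv X = mat 1" "matrix_inv X ** X = mat 1"
proof -
  have "\<exists>Y. X ** Y = mat 1 \<and> Y ** X = mat 1" using assms by (simp add: invertible_det_nz[symmetric] invertible_def)
  from someI_ex[OF this] show "X ** matrix_inv X = mat 1" "matrix_inv X ** X = mat 1"
    by (simp_all add: matrix_inv_def)
qed

lemma matrix_inv_unique: "X ** Y = mat 1 \<Longrightarrow> matrix_inv X = Y" for X :: "complex^2^2"
proof -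
  assume XY: "X ** Y = mat 1"
  then have "det X * det Y = 1" using det_mul[of X Y] by simp
  then have "det X \<noteq> 0" by auto
  then have "matrix_inv X = matrix_inv X ** (X ** Y)" "matrix_inv X ** X = mat 1"
    using XY matrix_inv_props by (simp_all add: matrix_mul_rid)
  then show "matrix_inv X = Y" by (simp add: matrix_mul_assoc matrix_mul_lid)
qed

lemma matrix_inv_mult:
  fixes X Y :: "complex^2^2"
  assumes "det X \<noteq> 0" "det Y \<noteq> 0"
  shows "matrix_inv (X ** Y) = matrix_inv Y ** matrix_inv X"
proof (rule matrix_inv_unique)
  have "X ** Y ** (matrix_inv Y ** matrix_inv X) = X ** (Y ** matrix_inv Y) ** matrix_inv X"
    by (simp add: matrix_mul_assoc)
  then show "X ** Y ** (matrix_inv Y ** matrix_inv X) = mat 1"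
    using assms by (simp add: matrix_inv_props matrix_mul_rid)
qed

lemma matrix_inv_2:
  fixes X :: "complex^2^2"
  assumes "det X \<noteq> 0"
  shows "matrix_inv X = smul (1 / det X) (vector [vector [X $ 2 $ 2, - X $ 1 $ 2], vector [- X $ 2 $ 1, X $ 1 $ 1]])"
proof (rule matrix_inv_unique)
  show "X ** smul (1 / det X) (vector [vector [X $ 2 $ 2, - X $ 1 $ 2], vector [- X $ 2 $ 1, X $ 1 $ 1]]) = mat 1"
    using assms unfolding smul_mult by (simp add: mat2_eq_iff mult2 smul_def det_2 Finite_Cartesian_Product.mat_def field_simps)
qed

lemma cosparse_nontrivial: "\<not> (\<forall>\<^sup>*z. False)"
  by (auto simp: cosparse_punctured intro: exI[of _ 1])

lemma det_meromorphic:
  assumes "\<And>i j. (\<lambda>z. M z $ i $ j) meromorphic_on S"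
  shows "(\<lambda>z. det (M z :: complex^2^2)) meromorphic_on S"
  unfolding det_2 by (intro meromorphic_intros assms)

text \<open>On the connected punctured plane a meromorphic determinant either vanishes identically
  or is nonzero off a discrete set; so the negated condition can be used pointwise.\<close>

lemma nonsingular_iff:
  "nonsingular_meromorphic (M :: complex \<Rightarrow> complex^2^2) \<longleftrightarrow>
     (\<forall>i j. (\<lambda>z. M z $ i $ j) meromorphic_on -{0}) \<and> (\<forall>\<^sup>*z. det (M z) \<noteq> 0)"
proof -
  have "(\<forall>\<^sup>*z. det (M z) \<noteq> 0) \<longleftrightarrow> \<not> (\<forall>\<^sup>*z. det (M z) = 0)"
    if "\<forall>i j. (\<lambda>z. M z $ i $ j) meromorphic_on -{0}"
  proof
    assume a: "\<forall>\<^sup>*z. det (M z) \<noteq> 0"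
    show "\<not> (\<forall>\<^sup>*z. det (M z) = 0)"
    proof
      assume "\<forall>\<^sup>*z. det (M z) = 0"
      with a have "\<forall>\<^sup>*z. False" by eventually_elim simp
      then show False using cosparse_nontrivial by blast
    qed
  next
    assume "\<not> (\<forall>\<^sup>*z. det (M z) = 0)"
    moreover have "(\<lambda>z. det (M z)) meromorphic_on -{0}" using that by (intro det_meromorphic) auto
    ultimately show "\<forall>\<^sup>*z. det (M z) \<noteq> 0"
      using meromorphic_imp_constant_or_avoid[of "\<lambda>z. det (M z)" "-{0}" 0] connected_punctured_universe[of "0::complex"]
      by (auto simp: open_delete)
  qed
  then show ?thesis unfolding nonsingular_meromorphic_def by blast
qed

lemma nonsingular_cong:
  assumes "nonsingular_meromorphic M" "\<forall>\<^sup>*z. M' z = (M z :: complex^2^2)"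
  shows "nonsingular_meromorphic M'"
proof -
  have "(\<lambda>z. M' z $ i $ j) meromorphic_on -{0}" for i j
  proof -
    have "\<forall>\<^sup>*z. M' z $ i $ j = M z $ i $ j" using assms(2) by eventually_elim simp
    from meromorphic_on_cong'[OF this refl] show ?thesis using assms(1) by (simp add: nonsingular_iff)
  qed
  moreover have "\<forall>\<^sup>*z. det (M z) \<noteq> 0" using assms(1) by (simp add: nonsingular_iff)
  with assms(2) have "\<forall>\<^sup>*z. det (M' z) \<noteq> 0" by eventually_elim simp
  ultimately show ?thesis by (simp add: nonsingular_iff)
qed

lemma nonsingular_mult:
  assumes "nonsingular_meromorphic M" "nonsingular_meromorphic L"
  shows "nonsingular_meromorphic (\<lambda>z. M z ** (L z :: complex^2^2))"
proof -
  have "(\<lambda>z. (M z ** L z) $ i $ j) meromorphic_on -{0}" for i j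
    unfolding mult2 using assms by (intro meromorphic_intros) (auto simp: nonsingular_iff)
  moreover have "\<forall>\<^sup>*z. det (M z) \<noteq> 0" "\<forall>\<^sup>*z. det (L z) \<noteq> 0" using assms by (simp_all add: nonsingular_iff)
  then have "\<forall>\<^sup>*z. det (M z ** L z) \<noteq> 0" by eventually_elim (simp add: det_mul)
  ultimately show ?thesis by (simp add: nonsingular_iff)
qed

lemma nonsingular_inv:
  assumes "nonsingular_meromorphic M"
  shows "nonsingular_meromorphic (\<lambda>z. matrix_inv (M z :: complex^2^2))"
proof -
  define L where "L z = smul (1 / det (M z)) (vector [vector [M z $ 2 $ 2, - M z $ 1 $ 2], vector [- M z $ 2 $ 1, M z $ 1 $ 1]])" for z
  have m: "(\<lambda>z. M z $ i $ j) meromorphic_on -{0}" for i j using assms by (simp add: nonsingular_iff)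
  have d: "\<forall>\<^sup>*z. det (M z) \<noteq> 0" using assms by (simp add: nonsingular_iff)
  have eq: "\<forall>\<^sup>*z. matrix_inv (M z) = L z" using d by eventually_elim (simp add: L_def matrix_inv_2)
  have "\<forall>i j. (\<lambda>z. L z $ i $ j) meromorphic_on -{0}"
    unfolding L_def smul_def forall_2 by (auto intro!: meromorphic_intros m det_meromorphic)
  moreover from d eq have "\<forall>\<^sup>*z. det (L z) \<noteq> 0"
  proof eventually_elim
    case (elim z)
    have "det (M z) * det (L z) = 1" using det_mul[of "M z" "L z"] matrix_inv_props(1)[OF elim(1)] by (simp flip: elim(2))
    then show ?case by auto
  qed
  ultimately have "nonsingular_meromorphic L" by (simp add: nonsingular_iff)
  then show ?thesis using eq by (rule nonsingular_cong)
qed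

lemma nonsingular_scale:
  assumes "nonsingular_meromorphic M" "c \<noteq> 0"
  shows "nonsingular_meromorphic (\<lambda>z. M (c * z) :: complex^2^2)"
proof -
  have "(\<lambda>z. M (c * z) $ i $ j) meromorphic_on -{0}" for i j
  proof -
    have "(\<lambda>z. M z $ i $ j) meromorphic_on -{0}" using assms by (simp add: nonsingular_iff)
    then show ?thesis by (rule meromorphic_on_compose[where f = "\<lambda>z. c * z"]) (use assms(2) in \<open>auto intro!: analytic_intros\<close>)
  qed
  moreover have "\<forall>\<^sup>*z. det (M z) \<noteq> 0" using assms by (simp add: nonsingular_iff)
  from cosparse_scale[OF this assms(2)] have "\<forall>\<^sup>*z. det (M (c * z)) \<noteq> 0" .
  ultimately show ?thesis by (simp add: nonsingular_iff)
qed

section \<open>Isomonodromy read off from the connection matrix\<close>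

definition shift_matrix :: "complex \<Rightarrow> (complex \<Rightarrow> complex^2^2) \<Rightarrow> complex \<Rightarrow> complex^2^2" where
  "shift_matrix q M z = M (q * z) ** matrix_inv (M z)"

text \<open>\<open>U\<close> is M(z)^-1 M(p z), and its transpose is the monodromy matrix of
  \<open>M\<close>. Its behaviour under the shift by q decides the multiplier of the
  equation.\<close>

definition has_connection ::
  "complex \<Rightarrow> complex \<Rightarrow> complex \<Rightarrow> (complex \<Rightarrow> complex^2^2) \<Rightarrow> (complex \<Rightarrow> complex^2^2) \<Rightarrow> bool" where
  "has_connection p q \<rho> M U \<longleftrightarrow> nonsingular_meromorphic M \<and> (\<forall>\<^sup>*z. M (p * z) = M z ** U z) \<and>
     \<rho> \<noteq> 0 \<and> (\<forall>\<^sup>*z. U (q * z) = smul \<rho> (U z))"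

lemma connection_scale:
  assumes "has_connection p q \<rho> M U" "c \<noteq> 0"
  shows "has_connection p q \<rho> (\<lambda>z. M (c * z)) (\<lambda>z. U (c * z))"
  using assms nonsingular_scale[of M c] cosparse_scale[of "\<lambda>z. M (p * z) = M z ** U z" c]
    cosparse_scale[of "\<lambda>z. U (q * z) = smul \<rho> (U z)" c]
  unfolding has_connection_def by (simp add: mult.left_commute)

lemma det_cosparse: "nonsingular_meromorphic M \<Longrightarrow> \<forall>\<^sup>*z. det (M z :: complex^2^2) \<noteq> 0"
  by (simp add: nonsingular_iff)

context elliptic
begin

lemma shift_nonsingular: "nonsingular_meromorphic M \<Longrightarrow> nonsingular_meromorphic (shift_matrix q M)"
  unfolding shift_matrix_def[abs_def] using q by (intro nonsingular_mult nonsingular_scale nonsingular_inv) auto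

lemma shift_fundamental:
  assumes "nonsingular_meromorphic M"
  shows "fundamental_matrix q (shift_matrix q M) M"
proof -
  have "\<forall>\<^sup>*z. M (q * z) = shift_matrix q M z ** M z"
    using det_cosparse[OF assms]
    by eventually_elim (simp add: shift_matrix_def matrix_mul_assoc[symmetric] matrix_inv_props matrix_mul_rid)
  then show ?thesis using assms by (simp add: fundamental_matrix_def)
qed

text \<open>A(p z) is M(q z) U(q z) U(z)^-1 M(z)^-1, and the two factors U combine to the scalar
  \<rho>; hence the exponent 0 of z.\<close>

lemma shift_multiplier:
  assumes "has_connection p q \<rho> M U"
  shows "theta_multiplier p (shift_matrix q M) \<rho> 0"
proof -
  have M: "nonsingular_meromorphic M" and eq: "\<forall>\<^sup>*z. M (p * z) = M z ** U z" and \<rho>: "\<rho> \<noteq> 0"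
    and U: "\<forall>\<^sup>*z. U (q * z) = smul \<rho> (U z)" using assms by (auto simp: has_connection_def)
  have "\<forall>\<^sup>*z. shift_matrix q M (p * z) = smul \<rho> (shift_matrix q M z)"
    using eq cosparse_scale[OF eq q(2)] U det_cosparse[OF M] cosparse_scale[OF det_cosparse[OF M] p(2)]
  proof eventually_elim
    case (elim z)
    have dU: "det (U z) \<noteq> 0" using elim(1,5) by (auto simp: det_mul)
    have "M (q * (p * z)) = M (q * z) ** smul \<rho> (U z)" using elim(2,3) by (simp add: mult.left_commute)
    then have "shift_matrix q M (p * z) = M (q * z) ** smul \<rho> (U z) ** (matrix_inv (U z) ** matrix_inv (M z))"
      using elim(1,4) dU by (simp add: shift_matrix_def matrix_inv_mult)
    also have "\<dots> = smul \<rho> (M (q * z) ** (U z ** matrix_inv (U z)) ** matrix_inv (M z))"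
      by (simp add: smul_mult matrix_mul_assoc)
    also have "\<dots> = smul \<rho> (shift_matrix q M z)" using dU by (simp add: matrix_inv_props matrix_mul_rid shift_matrix_def)
    finally show ?case .
  qed
  then show ?thesis using \<rho> by (simp add: theta_multiplier_def smul_def)
qed

lemma shift_equation: "has_connection p q \<rho> M U \<Longrightarrow> theta_equation p (shift_matrix q M)"
  using shift_multiplier[of \<rho> M U] shift_nonsingular[of M] unfolding theta_equation_def has_connection_def by blast

text \<open>An arbitrary fundamental matrix of the first equation is M E with E invariant under the
  shift by q. Then M' E is fundamental for the second one and has the same monodromy matrix, which
  involves only E and U.\<close>

lemma weak_monodromy_mono:
  assumes M: "nonsingular_meromorphic M" "\<forall>\<^sup>*z. M (p * z) = M z ** U z"
    and M': "nonsingular_meromorphic M'" "\<forall>\<^sup>*z. M' (p * z) = M' z ** U' z"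
    and U: "\<forall>\<^sup>*z. U' z = U z"
  shows "weak_monodromy p q (shift_matrix q M) \<subseteq> weak_monodromy p q (shift_matrix q M')"
proof
  fix C assume "C \<in> weak_monodromy p q (shift_matrix q M)"
  then obtain L D where C: "theta_equation q C" and L: "nonsingular_meromorphic L" "\<forall>\<^sup>*z. L (q * z) = shift_matrix q M z ** L z"
    and D: "nonsingular_meromorphic D" "\<forall>\<^sup>*z. D (q * z) = D z"
      "\<forall>\<^sup>*z. C z ** D z = D (p * z) ** monodromy_matrix p L z"
    by (auto simp: weak_monodromy_def fundamental_matrix_def monodromy_equiv_def)
  define E where "E z = matrix_inv (M z) ** L z" for z
  define L' where "L' z = M' z ** E z" for z
  have E: "nonsingular_meromorphic E" unfolding E_def[abs_def] by (intro nonsingular_mult nonsingular_inv M L)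
  have L': "nonsingular_meromorphic L'" unfolding L'_def[abs_def] by (intro nonsingular_mult M' E)
  note dM = det_cosparse[OF M(1)] and dM' = det_cosparse[OF M'(1)] and dE = det_cosparse[OF E]
  have LE: "\<forall>\<^sup>*z. L z = M z ** E z"
    using dM by eventually_elim (simp add: E_def matrix_mul_assoc matrix_inv_props matrix_mul_lid)
  have Eq: "\<forall>\<^sup>*z. E (q * z) = E z"
    using L(2) dM cosparse_scale[OF dM q(2)]
  proof eventually_elim
    case (elim z)
    have "E (q * z) = (matrix_inv (M (q * z)) ** M (q * z)) ** (matrix_inv (M z) ** L z)"
      by (simp only: E_def elim(1) shift_matrix_def matrix_mul_assoc)
    then show ?case using elim by (simp add: E_def matrix_inv_props matrix_mul_lid)
  qed
  have fund: "fundamental_matrix q (shift_matrix q M') L'"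
  proof -
    have "\<forall>\<^sup>*z. L' (q * z) = shift_matrix q M' z ** L' z"
      using Eq dM'
    proof eventually_elim
      case (elim z)
      have "shift_matrix q M' z ** L' z = M' (q * z) ** (matrix_inv (M' z) ** M' z) ** E z"
        by (simp add: shift_matrix_def L'_def matrix_mul_assoc)
      then show ?case using elim by (simp add: L'_def matrix_inv_props matrix_mul_rid)
    qed
    then show ?thesis using L' by (simp add: fundamental_matrix_def)
  qed
  have mono: "monodromy_matrix p X z = transpose (E (p * z)) ** (transpose (U z) ** matrix_inv (transpose (E z)))"
    if "X z = Y z ** E z" "X (p * z) = Y z ** U z ** E (p * z)" "det (Y z) \<noteq> 0" "det (E z) \<noteq> 0"
    for X Y :: "complex \<Rightarrow> complex^2^2" and z
  proof -
    have "monodromy_matrix p X z = transpose (E (p * z)) ** (transpose (U z) ** transpose (Y z)) **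
        (matrix_inv (transpose (Y z)) ** matrix_inv (transpose (E z)))"
      using that by (simp add: monodromy_matrix_def matrix_transpose_mul matrix_inv_mult Determinants.det_transpose)
    also have "\<dots> = transpose (E (p * z)) ** transpose (U z) ** (transpose (Y z) ** matrix_inv (transpose (Y z))) ** matrix_inv (transpose (E z))"
      by (simp add: matrix_mul_assoc)
    finally show ?thesis using that by (simp add: matrix_inv_props Determinants.det_transpose matrix_mul_rid matrix_mul_assoc)
  qed
  have "\<forall>\<^sup>*z. monodromy_matrix p L' z = monodromy_matrix p L z"
    using LE cosparse_scale[OF LE p(2)] dM dM' dE M(2) M'(2) U
  proof eventually_elim
    case (elim z)
    have "monodromy_matrix p L z = transpose (E (p * z)) ** (transpose (U z) ** matrix_inv (transpose (E z)))"
      by (rule mono[of L z M]) (use elim in auto)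
    moreover have "monodromy_matrix p L' z = transpose (E (p * z)) ** (transpose (U z) ** matrix_inv (transpose (E z)))"
      by (rule mono[of L' z M']) (use elim in \<open>auto simp: L'_def\<close>)
    ultimately show ?case by simp
  qed
  with D(3) have "\<forall>\<^sup>*z. C z ** D z = D (p * z) ** monodromy_matrix p L' z" by eventually_elim simp
  then show "C \<in> weak_monodromy p q (shift_matrix q M')"
    using C D(1,2) fund by (auto simp: weak_monodromy_def monodromy_equiv_def)
qed

lemma connection_isomonodromic:
  assumes M: "has_connection p q \<rho> M U" and M': "has_connection p q \<rho>' M' U'" and U: "\<forall>\<^sup>*z. U' z = U z"
  shows "isomonodromic p q (shift_matrix q M) (shift_matrix q M')"
proof -
  have U': "\<forall>\<^sup>*z. U z = U' z" using U by eventually_elim simp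
  have "weak_monodromy p q (shift_matrix q M) = weak_monodromy p q (shift_matrix q M')"
    using weak_monodromy_mono[of M U M' U'] weak_monodromy_mono[of M' U' M U] M M' U U'
    unfolding has_connection_def by blast
  then show ?thesis using shift_equation M M' by (auto simp: isomonodromic_def)
qed

text \<open>The gauge transformation is M' M^-1; in its shift by p the factors U cancel up to the
  monomial.\<close>

lemma connection_theta_isomonodromic:
  assumes M: "has_connection p q \<rho> M U" and M': "has_connection p q \<rho>' M' U'" and a: "a \<noteq> 0"
    and U: "\<forall>\<^sup>*z. U' z = smul (a * z powi k) (U z)"
  shows "theta_isomonodromic p q (shift_matrix q M) (shift_matrix q M')"
proof -
  define B where "B z = M' z ** matrix_inv (M z)" for z
  have nM: "nonsingular_meromorphic M" "nonsingular_meromorphic M'"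
    and eqs: "\<forall>\<^sup>*z. M (p * z) = M z ** U z" "\<forall>\<^sup>*z. M' (p * z) = M' z ** U' z"
    using M M' by (auto simp: has_connection_def)
  note dM = det_cosparse[OF nM(1)] and dM' = det_cosparse[OF nM(2)]
  have B: "nonsingular_meromorphic B" unfolding B_def[abs_def] by (intro nonsingular_mult nonsingular_inv nM)
  have "\<forall>\<^sup>*z. B (p * z) = smul (a * z powi k) (B z)"
    using eqs U dM cosparse_scale[OF dM p(2)]
  proof eventually_elim
    case (elim z)
    have dU: "det (U z) \<noteq> 0" using elim(1,5) by (auto simp: det_mul)
    have "B (p * z) = M' z ** smul (a * z powi k) (U z) ** (matrix_inv (U z) ** matrix_inv (M z))"
      using elim dU by (simp add: B_def matrix_inv_mult)
    also have "\<dots> = smul (a * z powi k) (M' z ** (U z ** matrix_inv (U z)) ** matrix_inv (M z))"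
      by (simp add: smul_mult matrix_mul_assoc)
    finally show ?case using dU by (simp add: matrix_inv_props matrix_mul_rid B_def)
  qed
  then have "theta_multiplier p B a k" using a by (simp add: theta_multiplier_def smul_def)
  moreover have "\<forall>\<^sup>*z. shift_matrix q M' z ** B z = B (q * z) ** shift_matrix q M z"
    using dM dM' cosparse_scale[OF dM q(2)]
  proof eventually_elim
    case (elim z)
    have "shift_matrix q M' z ** B z = M' (q * z) ** (matrix_inv (M' z) ** M' z) ** matrix_inv (M z)"
      by (simp add: shift_matrix_def B_def matrix_mul_assoc)
    moreover have "B (q * z) ** shift_matrix q M z = M' (q * z) ** (matrix_inv (M (q * z)) ** M (q * z)) ** matrix_inv (M z)"
      by (simp add: shift_matrix_def B_def matrix_mul_assoc)
    ultimately show ?case using elim by (simp add: matrix_inv_props matrix_mul_rid)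
  qed
  ultimately show ?thesis using B shift_equation M M' by (auto simp: theta_isomonodromic_def)
qed

text \<open>S is constant, so it cancels between M(1 / z) = M(z) S and M(1 / (q z)) = M(q z) S; the
  shift matrix at 1 / (q z) is M(z) M(q z)^-1.\<close>

lemma shift_symmetry:
  assumes M: "nonsingular_meromorphic M" and S: "det S \<noteq> 0" "\<forall>\<^sup>*z. M (1 / z) = M z ** S"
  shows "\<forall>\<^sup>*z. shift_matrix q M (1 / (q * z)) ** shift_matrix q M z = mat 1"
  using S(2) cosparse_scale[OF S(2) q(2)] det_cosparse[OF M] cosparse_scale[OF det_cosparse[OF M] q(2)]
proof eventually_elim
  case (elim z)
  have "shift_matrix q M (1 / (q * z)) = M z ** S ** (matrix_inv S ** matrix_inv (M (q * z)))"
    using elim S(1) q by (simp add: shift_matrix_def matrix_inv_mult)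
  also have "\<dots> = M z ** (S ** matrix_inv S) ** matrix_inv (M (q * z))" by (simp add: matrix_mul_assoc)
  also have "\<dots> = M z ** matrix_inv (M (q * z))" using S(1) by (simp add: matrix_inv_props matrix_mul_rid)
  finally have "shift_matrix q M (1 / (q * z)) ** shift_matrix q M z =
      M z ** (matrix_inv (M (q * z)) ** M (q * z)) ** matrix_inv (M z)"
    by (simp add: shift_matrix_def matrix_mul_assoc)
  then show ?case using elim by (simp add: matrix_inv_props matrix_mul_rid)
qed

end

section \<open>The fundamental matrix\<close>

lemma countable_avoid:
  assumes "countable (S :: complex set)"
  obtains x where "x \<notin> S"
proof -
  have "S \<noteq> UNIV" using assms uncountable_UNIV_complex by auto
  then show ?thesis using that by blast
qed

context elliptic
begin

text \<open>The constant \<open>\<omega>\<close>, restated without reference to the basis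
  functions.\<close>

definition \<kappa>0 :: complex where
  "\<kappa>0 = poch_inf p p * poch_inf q q * egamma p q q / (poch_inf p p)\<^sup>2"

text \<open>The matrix U of the overview. On the diagonal are the multipliers of the columns P and c
  R: the power (p z^2)^n occurs inversely in the first, and together with the multiplier of c in the
  second. The upper right entry is the multiple of P that R acquires.\<close>

definition connection :: "complex list \<Rightarrow> nat \<Rightarrow> complex \<Rightarrow> complex^2^2" where
  "connection us n z = vector [vector [1 / (p * z\<^sup>2) ^ n, - \<kappa>0 * ((p * z\<^sup>2) ^ n * efun us z)],
     vector [0, (p * z\<^sup>2) ^ n * efun us z]]"

definition inversion_matrix :: "complex^2^2" where
  "inversion_matrix = vector [vector [1, \<kappa>0], vector [0, - 1]]"

text \<open>Each condition excludes for \<open>c\<close> the family of one point, and countably many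
  points are in question; countable sets do not exhaust the plane.\<close>

lemma ex_basis:
  assumes us: "0 \<notin> set us" and X: "finite X"
  obtains c d where "c \<noteq> 0" "d \<noteq> 0" "psi p c d \<noteq> 0"
    "\<And>s. s \<in> fam c \<Longrightarrow> \<not> is_pole (\<lambda>z. Delta p q z us) s" "\<And>x. x \<in> X \<Longrightarrow> x \<noteq> 0 \<Longrightarrow> psi p c x \<noteq> 0"
proof -
  define T where "T = {s. s \<noteq> 0 \<and> (s \<in> inner_points us \<or> 1 / s \<in> inner_points us \<or> s \<in> X)}"
  have ci: "countable (inner_points us)"
  proof -
    have "inner_points us = (\<lambda>(i, j, a). p ^ i * q ^ j * a) ` (UNIV \<times> UNIV \<times> set us)"
      by (force simp: inner_points_def image_iff)
    then show ?thesis by (auto intro!: countable_image countable_SIGMA simp: countable_finite)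
  qed
  have "T \<subseteq> inner_points us \<union> (\<lambda>s. 1 / s) ` inner_points us \<union> X"
    by (force simp: T_def image_iff)
  then have cT: "countable T"
    by (rule countable_subset) (use ci X in \<open>auto intro: countable_finite\<close>)
  have cf: "countable (fam v)" if "v \<noteq> 0" for v
  proof -
    have "fam v \<subseteq> range (\<lambda>i::int. v * p powi i) \<union> range (\<lambda>i::int. p powi i / v)"
      using fam_iff[OF that] by blast
    then show ?thesis by (rule countable_subset) auto
  qed
  have "countable ((\<Union>s\<in>T. fam s) \<union> {0})" using cT cf by (intro countable_Un countable_UN) (auto simp: T_def)
  then obtain c where c: "c \<notin> (\<Union>s\<in>T. fam s) \<union> {0}" by (rule countable_avoid) blast
  then have c0: "c \<noteq> 0" by simp
  have nz: "psi p c s \<noteq> 0" if "s \<in> T" for s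
  proof
    assume "psi p c s = 0"
    moreover have s0: "s \<noteq> 0" using that by (simp add: T_def)
    ultimately have "psi p s c = 0" using psi_antisym[of c s] c0 by simp
    then have "c \<in> fam s" using c0 by (simp add: fam_def)
    then show False using c that by blast
  qed
  obtain d where d: "d \<noteq> 0" "psi p c d \<noteq> 0" by (rule ex_psi_nonzero[OF c0]) blast
  show ?thesis
  proof (rule that[OF c0 d])
    show "\<not> is_pole (\<lambda>z. Delta p q z us) s" if "s \<in> fam c" for s
      using nz[of s] Delta_pole[OF us, of s] that by (auto simp: fam_def T_def)
    show "psi p c x \<noteq> 0" if "x \<in> X" "x \<noteq> 0" for x using nz[of x] that by (simp add: T_def)
  qed
qed

end

context weighted
begin

lemma c2_cfun: "c2 = cfun us" by (auto simp: c2_def cfun_def w_def)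

lemma \<omega>_\<kappa>0: "\<omega> = \<kappa>0" by (simp add: \<omega>_def \<kappa>0_def \<kappa>_def)

definition Q :: "complex \<Rightarrow> complex^2^2" where
  "Q z = vector [vector [D * P1 z, D * c2 z * R1 z], vector [D * P2 z, D * c2 z * R2 z]]"

lemma generic_cosparse: "\<forall>\<^sup>*z. generic z" using eventually_generic by (simp add: cosparse_punctured)

lemma c2_nonzero: "\<forall>\<^sup>*z. c2 z \<noteq> 0"
  using cfun_eq[OF us] unfolding c2_cfun by eventually_elim blast

lemma Q_nonsingular: "nonsingular_meromorphic Q"
proof -
  have "c2 meromorphic_on -{0}"
  proof -
    have "(\<lambda>z. theta p (z\<^sup>2)) holomorphic_on -{0}" using p by (intro holomorphic_theta holomorphic_intros) auto
    then have "(\<lambda>z. theta p (z\<^sup>2)) meromorphic_on -{0}"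
      by (intro analytic_on_imp_meromorphic_on) (simp add: analytic_punctured_iff)
    then show ?thesis unfolding c2_def[abs_def] by (intro meromorphic_intros w_meromorphic)
  qed
  then have "\<forall>i j. (\<lambda>z. Q z $ i $ j) meromorphic_on -{0}"
    unfolding Q_def forall_2 by (auto intro!: meromorphic_intros P_meromorphic R_meromorphic)
  moreover have "\<forall>\<^sup>*z. det (Q z) \<noteq> 0"
    using generic_cosparse c2_nonzero
  proof eventually_elim
    case (elim z)
    have "det (Q z) = D\<^sup>2 * c2 z * (P1 z * R2 z - P2 z * R1 z)"
      by (simp add: det_2 Q_def power2_eq_square algebra_simps)
    then show ?case using det_PR_diag[OF elim(1)] elim(2) D_nonzero by simp
  qed
  ultimately show ?thesis by (simp add: nonsingular_iff)
qed

lemma R_inverse_cosparse: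
  "\<forall>\<^sup>*z. R1 (1 / z) = R1 z - \<kappa>0 / c2 z * P1 z \<and> R2 (1 / z) = R2 z - \<kappa>0 / c2 z * P2 z"
proof -
  have an: "\<forall>\<^sup>*z. w1 analytic_on {z}" by (rule meromorphic_on_imp_analytic_cosparse[OF w1_meromorphic])
  have "\<forall>\<^sup>*z. theta p (z\<^sup>2) \<noteq> 0"
    using theta_cosparse[OF one_neq_zero zero_less_numeral, of "num.Bit0 num.One"] by simp
  with generic_cosparse cosparse_inverse[OF generic_cosparse] an cosparse_inverse[OF an] show ?thesis
    by eventually_elim (simp add: R_inverse \<omega>_\<kappa>0)
qed

text \<open>P is invariant and c is odd under inversion; multiplied by c, the jump of R by a
  multiple of P / c becomes a constant entry.\<close>

lemma Q_inverse: "\<forall>\<^sup>*z. Q (1 / z) = Q z ** inversion_matrix"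
  using cosparse_nz R_inverse_cosparse c2_nonzero
proof eventually_elim
  case (elim z)
  have c: "c2 (1 / z) = - c2 z" using cfun_inverse[OF elim(1)] by (simp add: c2_cfun)
  have R: "R1 (1 / z) = R1 z - \<kappa>0 / c2 z * P1 z" "R2 (1 / z) = R2 z - \<kappa>0 / c2 z * P2 z" using elim(2) by auto
  show ?case
    unfolding mat2_eq_iff mult2 Q_def inversion_matrix_def P_inverse[OF elim(1)] c R using elim(3)
    by (simp add: right_diff_distrib)
qed

text \<open>p z is the reflection p / v at v = 1 / z. The reflection only rescales R, so the
  multiple of P enters through the inversion alone.\<close>

lemma Q_shift: "\<forall>\<^sup>*z. Q (p * z) = Q z ** connection us n z"
  using cosparse_nz R_inverse_cosparse c2_nonzero cosparse_inverse[OF generic_cosparse]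
proof eventually_elim
  case (elim z)
  have R: "R1 (p * z) = R1 (1 / z) * (p * z\<^sup>2) ^ n" "R2 (p * z) = R2 (1 / z) * (p * z\<^sup>2) ^ n"
    using R_reflect[OF elim(4)] elim(1) p by (simp_all add: power_divide power_mult_distrib)
  have c: "c2 (p * z) = efun us z * c2 z" using elim(3) by (simp add: efun_def c2_cfun)
  show ?case
    unfolding mat2_eq_iff mult2 Q_def connection_def using elim(1-3)
    by (simp add: P_shift R c) (simp add: field_simps)
qed

lemma represents_exists:
  assumes s: "s \<in> cstar2" "\<forall>\<^sup>*z. F_ext p q n us z s \<noteq> None \<and> Fplus_ext p q n us (Inl z) s \<noteq> None"
    and A: "\<And>v. s = Inr v \<Longrightarrow> A v \<noteq> 0"
  obtains a b where "represents s a b"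
proof (cases s)
  case (Inl v)
  have v: "v \<noteq> 0" using s(1) Inl by (auto simp: cstar2_def)
  have "\<forall>\<^sup>*z. F_fun p q n us z v \<noteq> None \<and> Fplus p q n us z v \<noteq> None" using s(2) by (simp add: Inl)
  then obtain a b where "R1 \<midarrow>v\<rightarrow> a" "R2 \<midarrow>v\<rightarrow> b" by (rule R_limit[OF v]) blast
  then show ?thesis using that v Inl by (simp add: represents_def)
next
  case (Inr v)
  then have "represents s (P1 v) (P2 v)" using s(1) A by (auto simp: represents_def cstar2_def)
  then show ?thesis by (rule that)
qed

lemma F_ext_cosparse:
  assumes s: "represents s a b" "\<forall>\<^sup>*z. F_ext p q n us z s \<noteq> None \<and> Fplus_ext p q n us (Inl z) s \<noteq> None"
  shows "\<forall>\<^sup>*z. the (F_ext p q n us z s) = D * (P1 z * b - P2 z * a) \<and>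
    the (Fplus_ext p q n us (Inl z) s) = D * (R1 z * b - R2 z * a)"
  using cosparse_nz A_cosparse s(2) meromorphic_on_imp_analytic_cosparse[OF R_meromorphic(1)]
      meromorphic_on_imp_analytic_cosparse[OF R_meromorphic(2)]
proof eventually_elim
  case (elim z)
  have r: "represents (Inr z) (P1 z) (P2 z)" "represents (Inl z) (R1 z) (R2 z)"
    using elim by (auto simp: represents_def analytic_at_tendsto)
  obtain y y' where y: "F_ext p q n us z s = Some y" "Fplus_ext p q n us (Inl z) s = Some y'" using elim(3) by auto
  then show ?case
    using Fplus_ext_eq[OF r(1) s(1) y(1)[unfolded F_ext_Fplus_ext]] Fplus_ext_eq[OF r(2) s(1) y(2)] by simp
qed

end

context elliptic
begin

text \<open>The constant left factor has the rows (b, -a) and (b', -a'), made from the vectors that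
  represent \<open>v\<close> and \<open>w\<close>. Its determinant times D is F+(v, w), hence
  nonzero. The basis is adapted to \<open>v\<close> and \<open>w\<close>: \<open>A\<close> must not
  vanish at hatted arguments.\<close>

lemma M_mat_factorization:
  assumes eq: "equation_defined p q m n v w u"
  obtains N Q where "det N \<noteq> 0" "nonsingular_meromorphic Q" "\<forall>\<^sup>*z. M_mat p q m n v w u z = N ** Q z"
    "\<forall>\<^sup>*z. Q (1 / z) = Q z ** inversion_matrix"
    "\<forall>\<^sup>*z. Q (p * z) = Q z ** connection (params m u) n z"
proof -
  define us where "us = params m u"
  define pt :: "point2 \<Rightarrow> complex" where "pt s = (case s of Inl x \<Rightarrow> x | Inr x \<Rightarrow> x)" for s
  have us: "0 \<notin> set us" using eq by (auto simp: us_def params_def equation_defined_def)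
  obtain c d where cd: "c \<noteq> 0" "d \<noteq> 0" "psi p c d \<noteq> 0" "\<And>s. s \<in> fam c \<Longrightarrow> \<not> is_pole (\<lambda>z. Delta p q z us) s"
    "\<And>x. x \<in> {pt v, pt w} \<Longrightarrow> x \<noteq> 0 \<Longrightarrow> psi p c x \<noteq> 0"
    by (rule ex_basis[OF us, of "{pt v, pt w}"]) (auto intro: that)
  obtain y where y: "Fplus_ext p q n us v w = Some y" "II p q (int n) us * y \<noteq> 0"
    using eq by (auto simp: us_def equation_defined_def)
  have ex: "contour_exists p q us" using eq by (auto simp: us_def equation_defined_def)
  interpret W: weighted p q c d us n
    using cd us ex y(2) by unfold_locales auto
  have adm: "\<forall>\<^sup>*z. F_ext p q n us z s \<noteq> None \<and> Fplus_ext p q n us (Inl z) s \<noteq> None" "s \<in> cstar2" if "s \<in> {v, w}" for s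
    using eq that by (auto simp: us_def equation_defined_def)
  have A: "W.A x \<noteq> 0" if "s = Inr x" "s \<in> {v, w}" for s x
  proof -
    have "x \<noteq> 0" using adm(2)[OF that(2)] that(1) by (auto simp: cstar2_def)
    moreover have "x \<in> {pt v, pt w}" using that by (auto simp: pt_def)
    ultimately show ?thesis using cd(5) by (simp add: W.A_def)
  qed
  have vw: "v \<in> {v, w}" "w \<in> {v, w}" by auto
  obtain a b where ab: "W.represents v a b"
    by (rule W.represents_exists[OF adm(2)[OF vw(1)] adm(1)[OF vw(1)] A[OF _ vw(1)]])
  obtain a' b' where ab': "W.represents w a' b'"
    by (rule W.represents_exists[OF adm(2)[OF vw(2)] adm(1)[OF vw(2)] A[OF _ vw(2)]])
  define N :: "complex^2^2" where "N = vector [vector [b, - a], vector [b', - a']]"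
  have "y = W.D * (a * b' - b * a')" by (rule W.Fplus_ext_eq[OF ab ab' y(1)])
  moreover have "det N = a * b' - b * a'" by (simp add: N_def det_2)
  ultimately have "det N \<noteq> 0" using y(2) by auto
  moreover have "\<forall>\<^sup>*z. M_mat p q m n v w u z = N ** W.Q z"
    using W.F_ext_cosparse[OF ab adm(1)[OF vw(1)]] W.F_ext_cosparse[OF ab' adm(1)[OF vw(2)]]
  proof eventually_elim
    case (elim z)
    have F: "the (F_ext p q n us z v) = W.D * (W.P1 z * b - W.P2 z * a)"
      "the (Fplus_ext p q n us (Inl z) v) = W.D * (W.R1 z * b - W.R2 z * a)"
      "the (F_ext p q n us z w) = W.D * (W.P1 z * b' - W.P2 z * a')"
      "the (Fplus_ext p q n us (Inl z) w) = W.D * (W.R1 z * b' - W.R2 z * a')" using elim by auto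
    have c: "inverse z * theta p (z\<^sup>2) * x / Delta p q z us = W.c2 z * x" for x by (simp add: W.c2_def W.w_def)
    show ?case
      unfolding mat2_eq_iff mult2 M_mat_def Let_def us_def[symmetric] F c vector_2 W.Q_def N_def
      by (simp add: algebra_simps)
  qed
  ultimately show ?thesis
    using that[of N W.Q] W.Q_nonsingular W.Q_inverse W.Q_shift by (simp add: us_def)
qed

text \<open>Shifting z by q with all parameters kept is the case \<Lambda> = 2, J_r = -1, \<nu> = 0
  of the general shift.\<close>

lemma connection_multiplier:
  assumes h: "h\<^sup>2 = q" and u: "\<And>r. r < 2 * m + 6 \<Longrightarrow> u r \<noteq> 0"
    and bal: "q powi (2 * int n - 2) * (\<Prod>r<2 * m + 6. u r) = (p * q) ^ (m + 1)"
  shows "\<forall>\<^sup>*z. connection (params m u) n (q * z) = smul (q powi (- 2 * int n)) (connection (params m u) n z)"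
proof -
  have e: "\<forall>\<^sup>*z. efun (params m u) (h powi 2 * z) =
    (p * z\<^sup>2) powi (- 2 * 0) * (h powi 2) powi (- 4 * (int n + 0)) * efun (params m u) z"
    by (rule efun_shift[OF h u bal, where J = "\<lambda>_. -1"]) auto
  have "h powi 2 = q" using h by simp
  with e have e': "\<forall>\<^sup>*z. efun (params m u) (q * z) = q powi (- 4 * int n) * efun (params m u) z" by simp
  have q2: "q powi (- 2 * int n) = inverse (q ^ n * q ^ n)" and q4: "q powi (- 4 * int n) = inverse (q ^ n * q ^ n * (q ^ n * q ^ n))"
  proof -
    have "q powi (- 2 * int n) = inverse (q powi int (n + n))" using q by (simp flip: power_int_minus)
    then show "q powi (- 2 * int n) = inverse (q ^ n * q ^ n)" by (simp only: power_int_of_nat power_add)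
    have "q powi (- 4 * int n) = inverse (q powi int (n + n + (n + n)))" using q by (simp flip: power_int_minus)
    then show "q powi (- 4 * int n) = inverse (q ^ n * q ^ n * (q ^ n * q ^ n))" by (simp only: power_int_of_nat power_add)
  qed
  from e' cosparse_nz show ?thesis
  proof eventually_elim
    case (elim z)
    have "(p * (q * z)\<^sup>2) ^ n = q ^ n * q ^ n * (p * z\<^sup>2) ^ n"
      by (simp add: power_mult_distrib power2_eq_square mult_ac)
    then show ?case
      unfolding mat2_eq_iff connection_def smul_def elim(1) q2 q4 using q elim(2) p by (simp add: field_simps)
  qed
qed

lemma equation_connection:
  assumes h: "h\<^sup>2 = q" and eq: "equation_defined p q m n v w u"
  shows "has_connection p q (q powi (- 2 * int n)) (M_mat p q m n v w u) (connection (params m u) n)"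
    and "\<forall>\<^sup>*z. M_mat p q m n v w u (1 / z) = M_mat p q m n v w u z ** inversion_matrix"
proof -
  obtain N Q where N: "det N \<noteq> 0" and Q: "nonsingular_meromorphic Q"
    and M: "\<forall>\<^sup>*z. M_mat p q m n v w u z = N ** Q z"
    and QS: "\<forall>\<^sup>*z. Q (1 / z) = Q z ** inversion_matrix"
    and QU: "\<forall>\<^sup>*z. Q (p * z) = Q z ** connection (params m u) n z" by (rule M_mat_factorization[OF eq]) blast
  have "nonsingular_meromorphic (\<lambda>_. N)" using N by (auto simp: nonsingular_iff intro!: meromorphic_intros)
  then have "nonsingular_meromorphic (M_mat p q m n v w u)"
    by (rule nonsingular_cong[OF nonsingular_mult[OF _ Q] M])
  moreover have "\<forall>\<^sup>*z. M_mat p q m n v w u (p * z) = M_mat p q m n v w u z ** connection (params m u) n z"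
    using M cosparse_scale[OF M p(2)] QU by eventually_elim (simp add: matrix_mul_assoc)
  moreover have "\<forall>\<^sup>*z. connection (params m u) n (q * z) = smul (q powi (- 2 * int n)) (connection (params m u) n z)"
    by (rule connection_multiplier[OF h]) (use eq in \<open>auto simp: equation_defined_def\<close>)
  ultimately show "has_connection p q (q powi (- 2 * int n)) (M_mat p q m n v w u) (connection (params m u) n)"
    using q by (simp add: has_connection_def)
  show "\<forall>\<^sup>*z. M_mat p q m n v w u (1 / z) = M_mat p q m n v w u z ** inversion_matrix"
    using M cosparse_inverse[OF M] QS by eventually_elim (simp add: matrix_mul_assoc)
qed

lemma A_mat_shift: "A_mat p q m n v w u = shift_matrix q (M_mat p q m n v w u)"
  by (auto simp: A_mat_def shift_matrix_def)

lemma A_mat_scale: "(\<lambda>z. A_mat p q m n v w u (c * z)) = shift_matrix q (\<lambda>z. M_mat p q m n v w u (c * z))"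
  by (auto simp: A_mat_def shift_matrix_def mult.left_commute)

lemma connection_cong:
  assumes "\<forall>\<^sup>*z. efun us' z = efun us z"
  shows "\<forall>\<^sup>*z. connection us' n z = connection us n z"
  using assms by eventually_elim (simp add: connection_def)

lemma connection_permute:
  assumes "\<pi> permutes {..<2 * m + 6}"
  shows "connection (params m (\<lambda>r. u (\<pi> r))) n = connection (params m u) n"
proof -
  have D: "Delta p q z (params m f) = (\<Prod>r<2 * m + 6. egamma2 p q (f r) z) / egamma2 p q 1 (z\<^sup>2)" for z f
    by (simp add: Delta_def params_def comp_def prod_list_upt del: upt_Suc)
  have "Delta p q z (params m (\<lambda>r. u (\<pi> r))) = Delta p q z (params m u)" for z
    unfolding D using prod.permute[OF assms, of "\<lambda>r. egamma2 p q (u r) z"] by (simp add: comp_def)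
  then show ?thesis by (auto simp: connection_def efun_def cfun_def)
qed

text \<open>\<open>Delta\<close> involves the parameters only through products and quotients with z;
  c changes sign, and its multiplier does not.\<close>

lemma connection_negate: "connection (params m (\<lambda>r. - u r)) n (- 1 * z) = connection (params m u) n z"
proof -
  have D: "Delta p q z (params m f) = (\<Prod>r<2 * m + 6. egamma2 p q (f r) z) / egamma2 p q 1 (z\<^sup>2)" for z f
    by (simp add: Delta_def params_def comp_def prod_list_upt del: upt_Suc)
  have "Delta p q (- z) (params m (\<lambda>r. - u r)) = Delta p q z (params m u)" for z
    unfolding D by (simp add: egamma2_def)
  then have "cfun (params m (\<lambda>r. - u r)) (- z) = - cfun (params m u) z" for z
    by (simp add: cfun_def)
  from this[of z] this[of "p * z"] show ?thesis by (simp add: connection_def efun_def)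
qed

text \<open>With H the shift of z, the entry (p z^2)^(-n) acquires the factor (p z^2)^(-\<nu>) H^(-2
  n'), and \<open>efun\<close> acquires exactly its square. So both diagonal entries, and with them
  the whole matrix, change by the same scalar.\<close>

lemma connection_half_shift:
  fixes \<Lambda> \<nu> :: int and J :: "nat \<Rightarrow> int" and n n' :: nat
  assumes h: "h\<^sup>2 = q" and u: "\<And>r. r < 2 * m + 6 \<Longrightarrow> u r \<noteq> 0"
    and bal: "q powi (2 * int n - 2) * (\<Prod>r<2 * m + 6. u r) = (p * q) ^ (m + 1)"
    and J: "(\<Sum>r<2 * m + 6. \<Lambda> + 2 * J r) = - 4 * \<nu>"
    and u': "\<And>r. r < 2 * m + 6 \<Longrightarrow> u' r = h powi (\<Lambda> + 2 * J r) * u r" and n': "int n' = int n + \<nu>"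
  shows "\<forall>\<^sup>*z. connection (params m u') n' (h powi \<Lambda> * z) =
    smul (p powi (- \<nu>) * (h powi \<Lambda>) powi (- 2 * int n') * z powi (- 2 * \<nu>)) (connection (params m u) n z)"
proof -
  have "\<forall>\<^sup>*z. efun (params m u') (h powi \<Lambda> * z) =
    (p * z\<^sup>2) powi (- 2 * \<nu>) * (h powi \<Lambda>) powi (- 4 * (int n + \<nu>)) * efun (params m u) z"
    by (rule efun_shift[OF h u bal J u'])
  then show ?thesis
    using cosparse_nz
  proof eventually_elim
  case (elim z)
  define H where "H = h powi \<Lambda>"
  have H0: "H \<noteq> 0" using h q by (auto simp: H_def)
  define X where "X = p * z\<^sup>2"
  have X0: "X \<noteq> 0" using elim p by (simp add: X_def)
  have H2: "(p * (H * z)\<^sup>2) ^ n' = H powi (2 * int n') * X powi int n'"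
  proof -
    have "(p * (H * z)\<^sup>2) ^ n' = (H\<^sup>2) ^ n' * X ^ n'" by (simp add: X_def power_mult_distrib mult_ac)
    then show ?thesis by (simp add: power_int_mult)
  qed
  have s: "p powi (- \<nu>) * H powi (- 2 * int n') * z powi (- 2 * \<nu>) = X powi (- \<nu>) * H powi (- 2 * int n')"
  proof -
    have "z powi (- 2 * \<nu>) = (z\<^sup>2) powi (- \<nu>)" using power_int_mult[of z 2 "- \<nu>"] by simp
    then show ?thesis by (simp add: X_def power_int_mult_distrib)
  qed
  have Xn: "X ^ n = X powi int n" by simp
  have e: "efun (params m u') (H * z) = X powi (- 2 * \<nu>) * H powi (- 4 * int n') * efun (params m u) z"
    using elim(1) by (simp add: H_def X_def n')
  have 1: "1 / (H powi (2 * int n') * X powi int n') = X powi (- \<nu>) * H powi (- 2 * int n') * (1 / X powi int n)"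
  proof -
    have "X powi int n = X powi int n' * X powi (- \<nu>)" using powi_add_eq[OF X0, of "int n'" "- \<nu>" "int n"] n' by simp
    moreover have "H powi (- 2 * int n') = inverse (H powi (2 * int n'))" by (simp flip: power_int_minus)
    ultimately show ?thesis using X0 H0 by (simp add: divide_simps)
  qed
  have 2: "H powi (2 * int n') * X powi int n' * (X powi (- 2 * \<nu>) * H powi (- 4 * int n') * f) =
      X powi (- \<nu>) * H powi (- 2 * int n') * (X powi int n * f)" for f
  proof -
    have a: "H powi (2 * int n') * H powi (- 4 * int n') = H powi (- 2 * int n')" by (rule powi_add_eq[OF H0]) simp
    have b: "X powi int n' * X powi (- 2 * \<nu>) = X powi (- \<nu>) * X powi int n"
      unfolding powi_add_eq[OF X0 refl] by (simp add: n')
    have "H powi (2 * int n') * X powi int n' * (X powi (- 2 * \<nu>) * H powi (- 4 * int n') * f) =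
      (H powi (2 * int n') * H powi (- 4 * int n')) * (X powi int n' * X powi (- 2 * \<nu>)) * f" by (simp only: mult_ac)
    then show ?thesis unfolding a b by (simp only: mult_ac)
  qed
  show ?case
    unfolding H_def[symmetric] mat2_eq_iff connection_def smul_def s X_def[symmetric] H2 Xn e
    using 1 2[of "efun (params m u) z"] by simp
  qed
qed

end

theorem theorem3p9:
  fixes p q h :: complex and m n :: nat and u :: "nat \<Rightarrow> complex" and v w :: point2
  assumes "p \<noteq> 0" "q \<noteq> 0" "norm p < 1" "norm q < 1"
    and "range (\<lambda>i::int. p powi i) \<inter> range (\<lambda>j::int. q powi j) = {1}"
    and "h\<^sup>2 = q"
    and "equation_defined p q m n v w u"
  shows "nonsingular_meromorphic (A_mat p q m n v w u)
     \<and> theta_multiplier p (A_mat p q m n v w u) (q powi (-2 * int n)) 0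
     \<and> fundamental_matrix q (A_mat p q m n v w u) (M_mat p q m n v w u)
     \<and> (\<forall>v' w'. equation_defined p q m n v' w' u \<longrightarrow>
          isomonodromic p q (A_mat p q m n v w u) (A_mat p q m n v' w' u))
     \<and> (\<forall>\<pi> v' w'. \<pi> permutes {..<2 * m + 6} \<longrightarrow>
          equation_defined p q m n v' w' (\<lambda>r. u (\<pi> r)) \<longrightarrow>
          isomonodromic p q (A_mat p q m n v w u) (A_mat p q m n v' w' (\<lambda>r. u (\<pi> r))))
     \<and> (\<forall>(k :: nat \<Rightarrow> int) v' w'. (\<Sum>r<2 * m + 6. k r) = 0 \<longrightarrow>
          equation_defined p q m n v' w' (\<lambda>r. q powi k r * u r) \<longrightarrow>
          isomonodromic p q (A_mat p q m n v w u)
            (A_mat p q m n v' w' (\<lambda>r. q powi k r * u r)))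
     \<and> (\<forall>v' w'. equation_defined p q m n v' w' (\<lambda>r. - u r) \<longrightarrow>
          isomonodromic p q (A_mat p q m n v w u)
            (\<lambda>z. A_mat p q m n v' w' (\<lambda>r. - u r) (- z)))
     \<and> (\<forall>(l :: real) (k :: nat \<Rightarrow> real) (\<nu> :: int) v' w'.
          2 * l \<in> \<int> \<longrightarrow> (\<forall>r<2 * m + 6. k r - l \<in> \<int>) \<longrightarrow>
          2 * real_of_int \<nu> + (\<Sum>r<2 * m + 6. k r) = 0 \<longrightarrow> int n + \<nu> \<ge> 0 \<longrightarrow>
          equation_defined p q m (nat (int n + \<nu>)) v' w' (\<lambda>r. half_powi h (k r) * u r) \<longrightarrow>
          theta_isomonodromic p q (A_mat p q m n v w u)
            (\<lambda>z. A_mat p q m (nat (int n + \<nu>)) v' w'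
                   (\<lambda>r. half_powi h (k r) * u r) (half_powi h l * z)))
     \<and> (\<forall>\<^sub>\<approx>z\<in>-{0}. A_mat p q m n v w u (1 / (q * z)) ** A_mat p q m n v w u z = mat 1)"
proof -
  interpret elliptic p q using assms by unfold_locales auto
  note h = assms(6) and eq = assms(7)
  define M where "M = M_mat p q m n v w u"
  have u: "u r \<noteq> 0" if "r < 2 * m + 6" for r using eq that by (auto simp: equation_defined_def)
  have bal: "q powi (2 * int n - 2) * (\<Prod>r<2 * m + 6. u r) = (p * q) ^ (m + 1)"
    using eq by (auto simp: equation_defined_def)
  note hc = equation_connection(1)[OF h eq, folded M_def] and inv = equation_connection(2)[OF h eq, folded M_def]
  have M: "nonsingular_meromorphic M" using hc by (simp add: has_connection_def)
  have A: "A_mat p q m n v w u = shift_matrix q M" by (simp add: A_mat_shift M_def)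
  have h0: "h \<noteq> 0" using h q by auto
  have iso: "isomonodromic p q (shift_matrix q M) (A_mat p q m n v' w' u')"
    if "equation_defined p q m n v' w' u'" "\<forall>\<^sup>*z. connection (params m u') n z = connection (params m u) n z" for v' w' u'
    unfolding A_mat_shift by (rule connection_isomonodromic[OF hc equation_connection(1)[OF h that(1)] that(2)])
  have int_shift: "isomonodromic p q (shift_matrix q M) (A_mat p q m n v' w' (\<lambda>r. q powi k r * u r))"
    if k: "(\<Sum>r<2 * m + 6. k r) = 0" and eq': "equation_defined p q m n v' w' (\<lambda>r. q powi k r * u r)" for k v' w'
  \<comment> \<open>The shift with \<Lambda> = 0, \<nu> = 0 and J_r = k_r: z and n stay, and
    \<open>efun\<close> does not change.\<close>
  proof (rule iso[OF eq' connection_cong])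
    have "\<forall>\<^sup>*z. efun (params m (\<lambda>r. q powi k r * u r)) (h powi 0 * z) =
      (p * z\<^sup>2) powi (- 2 * 0) * (h powi 0) powi (- 4 * (int n + 0)) * efun (params m u) z"
    proof (rule efun_shift[OF h u bal])
      show "(\<Sum>r<2 * m + 6. 0 + 2 * k r) = - 4 * 0" using k by (simp flip: sum_distrib_left)
      show "q powi k r * u r = h powi (0 + 2 * k r) * u r" for r
        unfolding h[symmetric] by (simp add: power_int_mult)
    qed
    then show "\<forall>\<^sup>*z. efun (params m (\<lambda>r. q powi k r * u r)) z = efun (params m u) z" by simp
  qed
  have negation: "isomonodromic p q (shift_matrix q M) (\<lambda>z. A_mat p q m n v' w' (\<lambda>r. - u r) (- z))"
    if eq': "equation_defined p q m n v' w' (\<lambda>r. - u r)" for v' w'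
  proof -
    have "has_connection p q (q powi (- 2 * int n)) (\<lambda>z. M_mat p q m n v' w' (\<lambda>r. - u r) (- 1 * z))
        (\<lambda>z. connection (params m (\<lambda>r. - u r)) n (- 1 * z))"
      by (rule connection_scale[OF equation_connection(1)[OF h eq']]) simp
    then have "isomonodromic p q (shift_matrix q M) (shift_matrix q (\<lambda>z. M_mat p q m n v' w' (\<lambda>r. - u r) (- 1 * z)))"
      by (rule connection_isomonodromic[OF hc]) (rule always_eventually, simp only: connection_negate simp_thms)
    then show ?thesis using A_mat_scale[of m n v' w' "\<lambda>r. - u r" "- 1"] by simp
  qed
  have half_shift: "theta_isomonodromic p q (shift_matrix q M)
      (\<lambda>z. A_mat p q m (nat (int n + \<nu>)) v' w' (\<lambda>r. half_powi h (k r) * u r) (half_powi h l * z))"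
    if l: "2 * l \<in> \<int>" and k: "\<forall>r<2 * m + 6. k r - l \<in> \<int>" and \<nu>: "2 * real_of_int \<nu> + (\<Sum>r<2 * m + 6. k r) = 0" "int n + \<nu> \<ge> 0"
      and eq': "equation_defined p q m (nat (int n + \<nu>)) v' w' (\<lambda>r. half_powi h (k r) * u r)" for l k \<nu> v' w'
  proof -
    define n' where "n' = nat (int n + \<nu>)"
    define u' where "u' r = half_powi h (k r) * u r" for r
    \<comment> \<open>2 l, k_r - l and hence 2 k_r are integers, so the floors, also those in
      \<open>half_powi\<close>, lose nothing.\<close>
    define \<Lambda> where "\<Lambda> = \<lfloor>2 * l\<rfloor>"
    define J where "J r = \<lfloor>k r - l\<rfloor>" for r
    have \<Lambda>: "of_int \<Lambda> = 2 * l" using l by (auto simp: \<Lambda>_def elim: Ints_cases)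
    have J: "of_int (J r) = k r - l" if "r < 2 * m + 6" for r
    proof -
      have "k r - l \<in> \<int>" using k that by blast
      then show ?thesis by (auto simp: J_def elim!: Ints_cases)
    qed
    have kJ: "2 * k r = of_int (\<Lambda> + 2 * J r)" if "r < 2 * m + 6" for r using \<Lambda> J[OF that] by simp
    have sum: "(\<Sum>r<2 * m + 6. \<Lambda> + 2 * J r) = - 4 * \<nu>"
    proof -
      have "real_of_int (\<Sum>r<2 * m + 6. \<Lambda> + 2 * J r) = (\<Sum>r<2 * m + 6. 2 * k r)"
        unfolding of_int_sum by (intro sum.cong) (use kJ in auto)
      also have "\<dots> = real_of_int (- 4 * \<nu>)" using \<nu>(1) by (simp flip: sum_distrib_left)
      finally show ?thesis by (simp only: of_int_eq_iff)
    qed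
    have u': "u' r = h powi (\<Lambda> + 2 * J r) * u r" if "r < 2 * m + 6" for r
    proof -
      have "\<lfloor>2 * k r\<rfloor> = \<Lambda> + 2 * J r" unfolding kJ[OF that] by (rule floor_of_int)
      then show ?thesis by (simp add: u'_def half_powi_def)
    qed
    have H: "half_powi h l = h powi \<Lambda>" by (simp add: half_powi_def \<Lambda>_def)
    have "has_connection p q (q powi (- 2 * int n')) (\<lambda>z. M_mat p q m n' v' w' u' (h powi \<Lambda> * z))
        (\<lambda>z. connection (params m u') n' (h powi \<Lambda> * z))"
      by (rule connection_scale[OF equation_connection(1)[OF h]])
        (use eq' h0 in \<open>simp_all add: n'_def u'_def[abs_def]\<close>)
    then have "theta_isomonodromic p q (shift_matrix q M) (shift_matrix q (\<lambda>z. M_mat p q m n' v' w' u' (h powi \<Lambda> * z)))"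
    proof (rule connection_theta_isomonodromic[OF hc])
      show "\<forall>\<^sup>*z. connection (params m u') n' (h powi \<Lambda> * z) =
        smul (p powi (- \<nu>) * (h powi \<Lambda>) powi (- 2 * int n') * z powi (- 2 * \<nu>)) (connection (params m u) n z)"
        by (rule connection_half_shift[OF h u bal sum u']) (use \<nu>(2) in \<open>auto simp: n'_def\<close>)
      show "p powi (- \<nu>) * (h powi \<Lambda>) powi (- 2 * int n') \<noteq> 0" using p h0 by simp
    qed
    then show ?thesis unfolding A_mat_scale H n'_def u'_def[abs_def] .
  qed
  have "det inversion_matrix \<noteq> 0" by (simp add: inversion_matrix_def det_2)
  then have "\<forall>\<^sup>*z. shift_matrix q M (1 / (q * z)) ** shift_matrix q M z = mat 1"
    by (rule shift_symmetry[OF M _ inv])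
  moreover have "isomonodromic p q (shift_matrix q M) (A_mat p q m n v' w' (\<lambda>r. u (\<pi> r)))"
    if "\<pi> permutes {..<2 * m + 6}" "equation_defined p q m n v' w' (\<lambda>r. u (\<pi> r))" for \<pi> v' w'
    by (rule iso[OF that(2)]) (rule always_eventually, simp add: connection_permute[OF that(1)])
  moreover have "isomonodromic p q (shift_matrix q M) (A_mat p q m n v' w' u)" if "equation_defined p q m n v' w' u" for v' w'
    by (rule iso[OF that]) (rule always_eventually, simp)
  ultimately show ?thesis
    unfolding A M_def[symmetric]
    using shift_nonsingular[OF M] shift_multiplier[OF hc] shift_fundamental[OF M] int_shift negation half_shift
    by blast
qed

end
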